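(* Let $n\ge 2$, $\lambda\ge 1$, $\Lambda>0$, $M_1>0$, and let $g(x)=\{g_{ij}(x)\}_{i,j=1}^n$, $x\in\mathbb{R}^n$, be a real symmetric matrix-valued function such that $$\lambda^{-1}|\xi|_n^2\le g_{ij}(x)\xi_i\xi_j\le \lambda|\xi|_n^2\quad\text{for all }x,\xi\in\mathbb{R}^n,\qquad \sum_{i,j=1}^n|g_{ij}(x)-g_{ij}(y)|\le\Lambda|x-y|_n\quad\text{for all }x,y\in\mathbb{R}^n .$$ Let $b\in L^\infty(B_1,\mathbb{R}^n)$ and $a\in L^\infty(B_1,\mathbb{R})$ satisfy $\|b\|_{L^\infty(B_1,\mathbb{R}^n)}\le M_1$ and $\|a\|_{L^\infty(B_1,\mathbb{R})}\le M_1$. Let $r_0,\rho$ satisfy $0<r_0<\rho<1$, and let $u\in H^2_{loc}(B_1)$ be a solution to $$\Delta_gu=\langle b,\nabla_gu\rangle+au\quad\text{in }B_1 .$$ Then $$\|u\|_{L^2(B_\rho)}\le C\,\|u\|_{L^2(B_{r_0})}^{\theta}\,\|u\|_{L^2(B_1)}^{1-\theta},$$ where $C$ and $\theta$, $\theta\in(0,1)$, depend on $\lambda,\Lambda,m,M$ and $r_0$ only.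
   Context: Summation over repeated indices is used. $|\cdot|_n$ is the Euclidean norm on $\mathbb{R}^n$, and $B_r$ is the ball of $\mathbb{R}^n$ of radius $r$ centered at $0$. $\{g^{ij}(x)\}$ is the inverse matrix of $g(x)=\{g_{ij}(x)\}$; $\langle\xi,\eta\rangle=g_{ij}(x)\xi_i\eta_j$ and $|\xi|^2=\langle\xi,\xi\rangle$; $\nabla_gu=g^{-1}\nabla u$ (so $\langle b,\nabla_gu\rangle=b_i\partial_iu$); $\Delta_gu=\operatorname{div}(\nabla_gu)=\partial_i(g^{ij}\partial_ju)$. Functions $u$ are real-valued. The quantities $m$ and $M$ refer to the weight function used in the Carleman estimate behind the inequality: $m=\min_{\overline{\Omega}}|\nabla\phi|$ and $M=\|\phi\|_{C^2(\overline{\Omega})}$, with $\Omega=B_1\setminus\overline{B}_{r_0/8}$ and $\phi(x)=e^{-\mu_0|x|^2}$, where $\mu_0>0$ is a fixed parameter for which there are constants $\overline{C}_1,\tau_0>0$ such that $\int_{\Omega}(\tau^3w^2+\tau|\nabla_gw|^2)e^{2\tau\phi}\le\overline{C}_1\int_{\Omega}|\Delta_gw|^2e^{2\tau\phi}$ for every $w\in C_0^\infty(\Omega)$ and every $\tau\ge\tau_0$.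
   Formalization: The constants are allowed further dependence: θ may also depend on n and ρ, and C also on n, ρ and M_1. Independence of ρ fails for the harmonic functions r^k cos(kφ), and independence of M_1 fails for positive u equal to ε on B_{r_0} with a = Δu/u. *)

theory Defs
  imports "HOL-Analysis.Analysis"
begin

section \<open>Classical derivatives, test functions\<close>

definition pderiv_at :: "'n \<Rightarrow> (real^'n \<Rightarrow> real) \<Rightarrow> real^'n \<Rightarrow> real" where
  "pderiv_at i f x = frechet_derivative f (at x) (axis i 1)"

definition grad :: "(real^'n \<Rightarrow> real) \<Rightarrow> real^'n \<Rightarrow> real^'n" where
  "grad f x = (\<chi> i. pderiv_at i f x)"

definition smooth :: "(real^'n \<Rightarrow> real) \<Rightarrow> bool" where
  "smooth f \<longleftrightarrow> (\<forall>is x. foldr pderiv_at is f differentiable (at x))"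

text \<open>The space of smooth functions with compact support in \<open>S\<close>, extended by zero to the whole
  space.\<close>

definition test_functions :: "(real^'n) set \<Rightarrow> (real^'n \<Rightarrow> real) set" where
  "test_functions S = {w. smooth w \<and> compact (closure {x. w x \<noteq> 0}) \<and> closure {x. w x \<noteq> 0} \<subseteq> S}"

definition C2_norm :: "(real^'n) set \<Rightarrow> (real^'n \<Rightarrow> real) \<Rightarrow> real" where
  "C2_norm S f =
     (SUP x\<in>S. \<bar>f x\<bar>)
     + (\<Sum>i\<in>UNIV. SUP x\<in>S. \<bar>pderiv_at i f x\<bar>)
     + (\<Sum>i\<in>UNIV. \<Sum>j\<in>UNIV. SUP x\<in>S. \<bar>pderiv_at j (pderiv_at i f) x\<bar>)"


section \<open>Weak derivatives and Sobolev regularity\<close>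

text \<open>Functions on a set \<open>S\<close> are represented by functions on the whole space, only the values on
  \<open>S\<close> being relevant; they are not identified modulo null sets.\<close>

definition L1_loc :: "(real^'n) set \<Rightarrow> (real^'n \<Rightarrow> real) set" where
  "L1_loc S = {f. \<forall>K. compact K \<and> K \<subseteq> S \<longrightarrow> integrable (lebesgue_on K) f}"

definition L2_loc :: "(real^'n) set \<Rightarrow> (real^'n \<Rightarrow> real) set" where
  "L2_loc S = {f. \<forall>K. compact K \<and> K \<subseteq> S \<longrightarrow>
     f \<in> borel_measurable (lebesgue_on K) \<and> integrable (lebesgue_on K) (\<lambda>x. (f x)\<^sup>2)}"

definition weak_pderiv ::
  "(real^'n) set \<Rightarrow> 'n \<Rightarrow> (real^'n \<Rightarrow> real) \<Rightarrow> (real^'n \<Rightarrow> real) \<Rightarrow> bool" where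
  "weak_pderiv S i u v \<longleftrightarrow> u \<in> L1_loc S \<and> v \<in> L1_loc S \<and>
     (\<forall>\<eta>\<in>test_functions S.
        integral\<^sup>L (lebesgue_on S) (\<lambda>x. u x * pderiv_at i \<eta> x)
          = - integral\<^sup>L (lebesgue_on S) (\<lambda>x. v x * \<eta> x))"

definition weak_grad ::
  "(real^'n) set \<Rightarrow> (real^'n \<Rightarrow> real) \<Rightarrow> (real^'n \<Rightarrow> real^'n) \<Rightarrow> bool" where
  "weak_grad S u G \<longleftrightarrow> (\<forall>i. weak_pderiv S i u (\<lambda>x. G x $ i))"

definition weak_div ::
  "(real^'n) set \<Rightarrow> (real^'n \<Rightarrow> real^'n) \<Rightarrow> (real^'n \<Rightarrow> real) \<Rightarrow> bool" where
  "weak_div S X f \<longleftrightarrow> (\<forall>i. (\<lambda>x. X x $ i) \<in> L1_loc S) \<and> f \<in> L1_loc S \<and>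
     (\<forall>\<eta>\<in>test_functions S.
        integral\<^sup>L (lebesgue_on S) (\<lambda>x. X x \<bullet> grad \<eta> x)
          = - integral\<^sup>L (lebesgue_on S) (\<lambda>x. f x * \<eta> x))"

definition H2_loc :: "(real^'n) set \<Rightarrow> (real^'n \<Rightarrow> real) set" where
  "H2_loc S = {u. u \<in> L2_loc S \<and>
     (\<exists>D D2. (\<forall>i. D i \<in> L2_loc S \<and> weak_pderiv S i u (D i)) \<and>
             (\<forall>i j. D2 i j \<in> L2_loc S \<and> weak_pderiv S j (D i) (D2 i j)))}"


section \<open>Norms\<close>

text \<open>Only meant for exponents \<open>t > 0\<close>.\<close>

definition ennreal_powr :: "ennreal \<Rightarrow> real \<Rightarrow> ennreal" where
  "ennreal_powr x t = (if x = top then top else ennreal (enn2real x powr t))"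

text \<open>The value is \<open>\<infinity>\<close> if \<open>u\<close> is not square integrable on \<open>S\<close>.\<close>

definition L2_norm :: "(real^'n) set \<Rightarrow> (real^'n \<Rightarrow> real) \<Rightarrow> ennreal" where
  "L2_norm S u = ennreal_powr (\<integral>\<^sup>+x. ennreal ((u x)\<^sup>2) \<partial>lebesgue_on S) (1/2)"

definition Linf_bounded :: "(real^'n) set \<Rightarrow> (real^'n \<Rightarrow> 'b::euclidean_space) \<Rightarrow> real \<Rightarrow> bool" where
  "Linf_bounded S f K \<longleftrightarrow>
     f \<in> borel_measurable (lebesgue_on S) \<and> (AE x in lebesgue_on S. norm (f x) \<le> K)"


section \<open>The metric and the Laplace-Beltrami type operator\<close>

definition metric_class :: "real \<Rightarrow> real \<Rightarrow> (real^'n \<Rightarrow> real^'n^'n) set" where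
  "metric_class lam Lam = {g.
     (\<forall>x. transpose (g x) = g x) \<and>
     (\<forall>x \<xi>. inverse lam * (norm \<xi>)\<^sup>2 \<le> \<xi> \<bullet> (g x *v \<xi>) \<and> \<xi> \<bullet> (g x *v \<xi>) \<le> lam * (norm \<xi>)\<^sup>2) \<and>
     (\<forall>x y. (\<Sum>i\<in>UNIV. \<Sum>j\<in>UNIV. \<bar>g x $ i $ j - g y $ i $ j\<bar>) \<le> Lam * norm (x - y))}"

definition metric_inner :: "(real^'n \<Rightarrow> real^'n^'n) \<Rightarrow> real^'n \<Rightarrow> real^'n \<Rightarrow> real^'n \<Rightarrow> real" where
  "metric_inner g x \<xi> \<eta> = (\<Sum>i\<in>UNIV. \<Sum>j\<in>UNIV. g x $ i $ j * \<xi> $ i * \<eta> $ j)"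

text \<open>The gradient \<open>\<nabla>\<^sub>g u\<close> for a function \<open>u\<close> whose (weak or classical) Euclidean gradient is
  \<open>G\<close>.\<close>

definition metric_grad ::
  "(real^'n \<Rightarrow> real^'n^'n) \<Rightarrow> (real^'n \<Rightarrow> real^'n) \<Rightarrow> real^'n \<Rightarrow> real^'n" where
  "metric_grad g G x = matrix_inv (g x) *v G x"

text \<open>The equation \<open>\<Delta>\<^sub>g u = \<langle>b, \<nabla>\<^sub>g u\<rangle> + a u\<close> in \<open>S\<close>. The weak gradient is unique up to null
  sets, so the existential quantifier is only a way to name it. For \<open>u\<close> in \<open>H2_loc S\<close> and Lipschitz
  \<open>g\<close>, the components of \<open>\<nabla>\<^sub>g u\<close> are weakly differentiable, so that this is the same as
  the equation almost everywhere.\<close>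

definition solves ::
  "(real^'n) set \<Rightarrow> (real^'n \<Rightarrow> real^'n^'n) \<Rightarrow> (real^'n \<Rightarrow> real^'n) \<Rightarrow> (real^'n \<Rightarrow> real) \<Rightarrow>
   (real^'n \<Rightarrow> real) \<Rightarrow> bool" where
  "solves S g b a u \<longleftrightarrow>
     (\<exists>G. weak_grad S u G \<and>
          weak_div S (metric_grad g G) (\<lambda>x. metric_inner g x (b x) (metric_grad g G x) + a x * u x))"


section \<open>The Carleman weight\<close>

definition annulus :: "real \<Rightarrow> (real^'n) set" where
  "annulus r0 = ball 0 1 - cball 0 (r0 / 8)"

definition weight :: "real \<Rightarrow> real^'n \<Rightarrow> real" where
  "weight \<mu> x = exp (- \<mu> * (norm x)\<^sup>2)"

text \<open>The function \<open>F\<close> below is \<open>\<Delta>\<^sub>g w\<close>. As \<open>g\<close> is only Lipschitz, it is a bounded function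
  determined almost everywhere.\<close>

definition carleman_estimate ::
  "(real^'n) set \<Rightarrow> (real^'n \<Rightarrow> real^'n^'n) \<Rightarrow> (real^'n \<Rightarrow> real) \<Rightarrow> real \<Rightarrow> real \<Rightarrow> bool" where
  "carleman_estimate S g \<phi> C1 \<tau>0 \<longleftrightarrow>
     (\<forall>w\<in>test_functions S. \<forall>F \<tau>. weak_div S (metric_grad g (grad w)) F \<and> \<tau> \<ge> \<tau>0 \<longrightarrow>
        integral\<^sup>L (lebesgue_on S)
          (\<lambda>x. (\<tau>^3 * (w x)\<^sup>2
                + \<tau> * metric_inner g x (metric_grad g (grad w) x) (metric_grad g (grad w) x))
               * exp (2 * \<tau> * \<phi> x))
        \<le> C1 * integral\<^sup>L (lebesgue_on S) (\<lambda>x. (F x)\<^sup>2 * exp (2 * \<tau> * \<phi> x)))"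

end

theory Submission
  imports Defs
begin

text \<open>The inequality rests on a Carleman estimate for the weight \<open>exp (\<tau> * exp (- \<mu> * \<bar>x\<bar>\<^sup>2))\<close>. The
  constants of the final inequality are the same for all metrics of the class, so the Carleman
  estimate has to be uniform over the class as well. For this \<open>\<mu>\<close> is chosen large in terms of
  \<open>lam\<close>, \<open>Lam\<close>, \<open>r0\<close> and the dimension; the Hessian of \<open>exp (- \<mu> * \<bar>x\<bar>\<^sup>2)\<close> then has in the radial
  direction a positive part of order \<open>\<mu>\<^sup>2\<close>, which dominates everything of order \<open>\<mu>\<close>, in
  particular all terms in which a derivative falls on the coefficients (\<open>radial_positivity\<close>,
  \<open>carleman_pointwise\<close>, \<open>carleman_uniform\<close>).

  The coefficients \<open>A = g\<^sup>-\<^sup>1\<close> are only Lipschitz. They are never differentiated: if \<open>a\<close> is Lipschitz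
  with constant \<open>L\<close> and \<open>F\<close> is of class \<open>C\<^sup>1\<close> with compact support, then the integral of \<open>a \<partial>\<^sub>i F\<close>
  is at most \<open>L\<close> times the integral of \<open>\<bar>F\<bar>\<close> (\<open>lipschitz_ibp\<close>). Such terms
  are dominated for large \<open>\<mu>\<close> and \<open>\<tau>\<close>, and the a priori estimates can be proved for the operator
  \<open>A\<^sub>i\<^sub>j \<partial>\<^sub>i \<partial>\<^sub>j\<close>, which differs from the one in divergence form by terms of first order.

  For a function \<open>u\<close> of class \<open>C\<^sup>2\<close> with \<open>\<bar>A\<^sub>i\<^sub>j \<partial>\<^sub>i \<partial>\<^sub>j u\<bar>\<^sup>2 \<le> K (u\<^sup>2 + \<bar>\<nabla>u\<bar>\<^sup>2)\<close>, the Carleman estimate is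
  applied to \<open>u\<close> times a cut-off function of a shell. The first order terms are absorbed for large
  \<open>\<tau>\<close>, the commutator with the cut-off lives near the two boundary spheres, and there
  \<open>caccioppoli\<close> replaces \<open>\<nabla>u\<close> by \<open>u\<close>. Since the weight decreases with \<open>\<bar>x\<bar>\<close>, this gives
  \<open>I(\<rho>) \<le> C (exp (2 \<tau> \<alpha>) I(r) + exp (- 2 \<tau> \<beta>) I(R))\<close>, where \<open>I(s)\<close> is the integral of \<open>u\<^sup>2\<close>
  over the ball of radius \<open>s\<close>, for all \<open>\<tau> \<ge> \<tau>1\<close>
  (\<open>three_ball_classical\<close>), and optimising in \<open>\<tau>\<close> yields the interpolation with
  \<open>\<theta> = \<beta> / (\<alpha> + \<beta>)\<close> (\<open>exponential_interpolation\<close>). The numbers \<open>\<alpha>\<close> and \<open>\<beta>\<close> are differences of values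
  of the weight; the bound \<open>M1\<close> of the lower order terms enters only into \<open>\<tau>1\<close> and \<open>C\<close>. This is why
  \<open>\<theta>\<close> can be chosen before \<open>M1\<close>.

  A weak solution is mollified. By the equation and the Lipschitz continuity of \<open>A\<close> (Friedrichs'
  commutator argument), the mollified function satisfies the differential inequality up to an error
  that is bounded by the mean oscillations of \<open>u\<close> and \<open>\<nabla>u\<close> on small balls
  (\<open>mollified_solution\<close>). These tend to \<open>0\<close> in \<open>L\<^sup>2\<close> because translations are continuous in \<open>L\<^sup>2\<close>
  (\<open>osc_L2\<close>). For this reason \<open>three_ball_classical\<close> is stated with an error term, the \<open>excess\<close>,
  and the inequality for weak solutions follows by letting the mollification parameter tend to \<open>0\<close>
  for each fixed \<open>\<tau>\<close> (\<open>weak_three_ball\<close>). The large ball has radius \<open>(1 + \<rho>) / 2 < 1\<close>, where \<open>u\<close> is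
  square integrable, so that solutions of infinite norm on the unit ball are covered.\<close>

section \<open>Integration by parts against Lipschitz coefficients\<close>

text \<open>Only derivatives along the coordinate lines are used, so that the product and chain rules are
  those of one real variable. The derivative is an argument: identities between integrands can be
  stated with explicit formulas for all derivatives.\<close>

definition has_partial :: "'n \<Rightarrow> (real^'n \<Rightarrow> real) \<Rightarrow> (real^'n \<Rightarrow> real) \<Rightarrow> bool" where
  "has_partial i F F' \<longleftrightarrow> (\<forall>x. ((\<lambda>t. F (x + t *\<^sub>R axis i 1)) has_real_derivative F' x) (at 0))"

lemma has_partial_line:
  assumes "has_partial i F F'"
  shows "((\<lambda>t. F (x + t *\<^sub>R axis i 1)) has_real_derivative F' (x + s *\<^sub>R axis i 1)) (at s)"
proof -
  have "((\<lambda>t. F ((x + s *\<^sub>R axis i 1) + t *\<^sub>R axis i 1)) has_real_derivative F' (x + s *\<^sub>R axis i 1)) (at 0)"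
    using assms by (simp add: has_partial_def)
  then have "((\<lambda>t. F ((x + s *\<^sub>R axis i 1) + (t - s) *\<^sub>R axis i 1)) has_real_derivative F' (x + s *\<^sub>R axis i 1)) (at (0 + s))"
    using DERIV_at_within_shift[of "\<lambda>t. F ((x + s *\<^sub>R axis i 1) + (t - s) *\<^sub>R axis i 1)" _ s 0 UNIV]
    by (simp add: add.commute)
  then show ?thesis by (simp add: algebra_simps)
qed

lemma has_partial_mult:
  assumes "has_partial i F F'" "has_partial i G G'"
  shows "has_partial i (\<lambda>x. F x * G x) (\<lambda>x. F' x * G x + F x * G' x)"
  unfolding has_partial_def
proof
  fix x
  show "((\<lambda>t. F (x + t *\<^sub>R axis i 1) * G (x + t *\<^sub>R axis i 1)) has_real_derivative F' x * G x + F x * G' x) (at 0)"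
    using DERIV_mult[OF assms[unfolded has_partial_def, rule_format, of x]] by (simp add: algebra_simps)
qed

lemma has_partial_add:
  assumes "has_partial i F F'" "has_partial i G G'"
  shows "has_partial i (\<lambda>x. F x + G x) (\<lambda>x. F' x + G' x)"
  using assms unfolding has_partial_def by (auto intro!: DERIV_add)

lemma has_partial_const: "has_partial i (\<lambda>x. c) (\<lambda>x. 0)"
  unfolding has_partial_def by auto

lemma has_partial_coord: "has_partial i (\<lambda>x. x $ j) (\<lambda>x. if i = j then 1 else 0)"
  unfolding has_partial_def by (auto simp: axis_def intro!: derivative_eq_intros)

lemma has_partial_chain:
  assumes "has_partial i F F'" "\<And>t. (g has_real_derivative g' t) (at t)"
  shows "has_partial i (\<lambda>x. g (F x)) (\<lambda>x. g' (F x) * F' x)"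
  unfolding has_partial_def
proof
  fix x
  show "((\<lambda>t. g (F (x + t *\<^sub>R axis i 1))) has_real_derivative g' (F x) * F' x) (at 0)"
    by (rule DERIV_chain2[where f = g]) (use assms in \<open>auto simp: has_partial_def\<close>)
qed

lemma has_partial_norm2:
  fixes i :: "'n::finite"
  shows "has_partial i (\<lambda>x. (norm x)\<^sup>2) (\<lambda>x. 2 * x $ i)"
proof -
  have "(norm (x + t *\<^sub>R axis i 1))\<^sup>2 = (norm x)\<^sup>2 + 2 * t * x $ i + t\<^sup>2" for x :: "real^'n" and t :: real
    unfolding power2_norm_eq_inner
    by (simp add: inner_add_left inner_add_right inner_axis inner_axis' power2_eq_square algebra_simps)
  then show ?thesis
    unfolding has_partial_def by (auto intro!: derivative_eq_intros)
qed

lemma integrable_compactly_supported: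
  fixes f :: "real^'n \<Rightarrow> real"
  assumes "continuous_on UNIV f" "\<And>x. x \<notin> cball 0 R \<Longrightarrow> f x = 0"
  shows "integrable lborel f"
proof -
  have "integrable lborel (\<lambda>x. indicator (cball 0 R) x *\<^sub>R f x)"
    by (intro borel_integrable_compact continuous_on_subset[OF assms(1)]) auto
  also have "(\<lambda>x. indicator (cball 0 R) x *\<^sub>R f x) = f"
    using assms(2) by (auto simp: indicator_def fun_eq_iff)
  finally show ?thesis .
qed

lemma continuous_of_lipschitz:
  fixes a :: "real^'n \<Rightarrow> real"
  assumes "\<And>x y. \<bar>a x - a y\<bar> \<le> L * norm (x - y)"
  shows "continuous_on UNIV a"
proof -
  have "L * norm (x - y) \<le> \<bar>L\<bar> * norm (x - y)" for x y :: "real^'n"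
    by (intro mult_right_mono) auto
  then have "\<bar>L\<bar>-lipschitz_on UNIV a"
    using assms order_trans by (intro lipschitz_onI) (auto simp: dist_norm, blast)
  then show ?thesis by (rule lipschitz_on_continuous_on)
qed

lemma has_partial_zero_on_open:
  assumes pd: "has_partial i F F'" and "open U" and z: "\<And>x. x \<in> U \<Longrightarrow> F x = 0" and "x \<in> U"
  shows "F' x = 0"
proof -
  have "open ((\<lambda>t::real. x + t *\<^sub>R axis i 1) -` U)"
    by (intro open_vimage continuous_intros \<open>open U\<close>)
  moreover have "0 \<in> ((\<lambda>t::real. x + t *\<^sub>R axis i 1) -` U)" using \<open>x \<in> U\<close> by simp
  ultimately have ev: "eventually (\<lambda>t. t \<in> ((\<lambda>t::real. x + t *\<^sub>R axis i 1) -` U)) (nhds 0)"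
    using eventually_nhds by blast
  have "((\<lambda>t. F (x + t *\<^sub>R axis i 1)) has_real_derivative 0) (at 0)"
  proof (subst DERIV_cong_ev)
    show "eventually (\<lambda>t. F (x + t *\<^sub>R axis i 1) = 0) (nhds 0)"
      using ev by eventually_elim (use z in auto)
  qed auto
  then show ?thesis using pd DERIV_unique unfolding has_partial_def by blast
qed

text \<open>The derivative of \<open>F\<close> is the limit of the difference quotients of \<open>F\<close>, and by translation
  invariance the difference operator can be moved to \<open>a\<close>, whose difference quotients are bounded
  by \<open>L\<close>. No derivative of \<open>a\<close> has to exist.\<close>

lemma lipschitz_ibp:
  fixes a F F' :: "real^'n \<Rightarrow> real"
  assumes L: "\<And>x y. \<bar>a x - a y\<bar> \<le> L * norm (x - y)"
    and pd: "has_partial i F F'"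
    and cF: "continuous_on UNIV F" and cF': "continuous_on UNIV F'"
    and z: "\<And>x. x \<notin> cball 0 R \<Longrightarrow> F x = 0"
  shows "\<bar>\<integral>x. a x * F' x \<partial>lborel\<bar> \<le> L * (\<integral>x. \<bar>F x\<bar> \<partial>lborel)"
proof -
  define e :: "real^'n" where "e = axis i 1"
  have ne: "norm e = 1" by (simp add: e_def)
  have z': "F' x = 0" if "x \<notin> cball 0 R" for x by (rule has_partial_zero_on_open[OF pd, of "- cball 0 R"]) (use z that in auto)
  have ca: "continuous_on UNIV a" using continuous_of_lipschitz[OF L] .
  define h where "h n = 1 / real (Suc n)" for n
  have h0: "h n > 0" "h n \<le> 1" for n by (auto simp: h_def)
  have hlim: "h \<longlonglongrightarrow> 0" unfolding h_def using LIMSEQ_inverse_real_of_nat by (simp add: inverse_eq_divide)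
  define D where "D n x = (F (x + h n *\<^sub>R e) - F x) / h n" for n x
  obtain B where B: "\<And>x. \<bar>F' x\<bar> \<le> B"
  proof -
    have "compact (F' ` cball 0 R)" by (intro compact_continuous_image continuous_on_subset[OF cF']) auto
    then have "bounded (F' ` cball 0 R)" by (rule compact_imp_bounded)
    then obtain B where "\<forall>y\<in>F' ` cball 0 R. norm y \<le> B" by (auto simp: bounded_iff)
    then have "\<bar>F' x\<bar> \<le> max B 0" for x using z'[of x] by (cases "x \<in> cball 0 R") (force simp: le_max_iff_disj)+
    then show ?thesis using that by blast
  qed
  have Dlim: "(\<lambda>n. D n x) \<longlonglongrightarrow> F' x" for x
  proof -
    have "((\<lambda>t. (F (x + t *\<^sub>R e) - F x) / t) \<longlongrightarrow> F' x) (at 0)"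
      using pd[unfolded has_partial_def, rule_format, of x] by (simp add: DERIV_def e_def)
    moreover have "filterlim h (at 0) sequentially"
      using hlim h0 by (auto simp: filterlim_at intro!: always_eventually) (metis less_irrefl)
    ultimately show ?thesis unfolding D_def by (rule filterlim_compose)
  qed
  have Dbd: "\<bar>D n x\<bar> \<le> B" for n x
  proof -
    have "\<exists>s. s > 0 \<and> s < h n \<and> F (x + h n *\<^sub>R e) - F (x + 0 *\<^sub>R e) = (h n - 0) * F' (x + s *\<^sub>R e)"
      using MVT2[of 0 "h n" "\<lambda>t. F (x + t *\<^sub>R e)" "\<lambda>s. F' (x + s *\<^sub>R e)"] h0[of n]
      has_partial_line[OF pd, of x] unfolding e_def by auto
    then obtain s where "F (x + h n *\<^sub>R e) - F x = h n * F' (x + s *\<^sub>R e)" by auto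
    then have "D n x = F' (x + s *\<^sub>R e)" using h0[of n] by (simp add: D_def)
    then show ?thesis using B by simp
  qed
  have Dz: "D n x = 0" if "x \<notin> cball 0 (R + 1)" for n x
  proof -
    have "norm x \<le> norm (x + h n *\<^sub>R e) + norm (h n *\<^sub>R e)"
      by (metis add_diff_cancel norm_triangle_ineq4)
    then have "norm (x + h n *\<^sub>R e) > R" using that h0[of n] ne by auto
    moreover have "norm x > R" using that by auto
    ultimately show ?thesis using z by (simp add: D_def)
  qed
  have cD: "continuous_on UNIV (D n)" for n
    unfolding D_def using h0[of n]
    by (intro continuous_intros continuous_on_compose2[OF cF]) auto
  have lim: "(\<lambda>n. \<integral>x. a x * D n x \<partial>lborel) \<longlonglongrightarrow> (\<integral>x. a x * F' x \<partial>lborel)"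
  proof (rule integral_dominated_convergence)
    show "integrable lborel (\<lambda>x. indicator (cball 0 (R+1)) x *\<^sub>R (\<bar>a x\<bar> * B))"
      by (intro borel_integrable_compact continuous_intros continuous_on_subset[OF ca]) auto
    show "AE x in lborel. norm (a x * D n x) \<le> indicator (cball 0 (R+1)) x *\<^sub>R (\<bar>a x\<bar> * B)" for n
    proof (intro AE_I2)
      fix x
      show "norm (a x * D n x) \<le> indicator (cball 0 (R+1)) x *\<^sub>R (\<bar>a x\<bar> * B)"
        using Dbd[of n x] Dz[of x n] by (cases "x \<in> cball 0 (R+1)") (auto simp: abs_mult intro: mult_left_mono)
    qed
    show "AE x in lborel. (\<lambda>n. a x * D n x) \<longlonglongrightarrow> a x * F' x"
      by (intro AE_I2 tendsto_intros Dlim)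
    show "(\<lambda>x. a x * F' x) \<in> borel_measurable lborel"
      using borel_measurable_continuous_onI[OF continuous_on_mult[OF ca cF']] by simp
    show "(\<lambda>x. a x * D n x) \<in> borel_measurable lborel" for n
      using borel_measurable_continuous_onI[OF continuous_on_mult[OF ca cD]] by simp
  qed
  have iF: "integrable lborel (\<lambda>x. \<bar>F x\<bar>)"
    by (intro integrable_compactly_supported[where R=R] continuous_intros cF) (use z in auto)
  have bd: "\<bar>\<integral>x. a x * D n x \<partial>lborel\<bar> \<le> L * (\<integral>x. \<bar>F x\<bar> \<partial>lborel)" for n
  proof -
    define G where "G x = a (x - h n *\<^sub>R e) * F x" for x
    have cG: "continuous_on UNIV G" unfolding G_def
      by (intro continuous_intros continuous_on_compose2[OF ca] cF) auto
    have iG: "integrable lborel G" by (rule integrable_compactly_supported[OF cG, of R]) (use z in \<open>auto simp: G_def\<close>)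
    have iaF: "integrable lborel (\<lambda>x. a x * F x)"
      by (rule integrable_compactly_supported[of _ R]) (use z in \<open>auto intro!: continuous_intros ca cF\<close>)
    have iG': "integrable lborel (\<lambda>x. a x * F (x + h n *\<^sub>R e))"
    proof (rule integrable_compactly_supported[of _ "R+1"])
      show "continuous_on UNIV (\<lambda>x. a x * F (x + h n *\<^sub>R e))"
        by (intro continuous_intros continuous_on_compose2[OF cF] ca) auto
      fix x :: "real^'n" assume "x \<notin> cball 0 (R+1)"
      then have "F (x + h n *\<^sub>R e) = 0" using Dz[of x n] z[of x] h0[of n] by (auto simp: D_def)
      then show "a x * F (x + h n *\<^sub>R e) = 0" by simp
    qed
    have sh: "(\<integral>x. a x * F (x + h n *\<^sub>R e) \<partial>lborel) = (\<integral>x. G x \<partial>lborel)"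
    proof -
      have "(\<integral>x. G x \<partial>lborel) = (\<integral>x. G x \<partial>distr lborel borel ((+) (h n *\<^sub>R e)))"
        by (simp add: lborel_distr_plus)
      also have "\<dots> = (\<integral>x. G (h n *\<^sub>R e + x) \<partial>lborel)"
        by (subst integral_distr) (use borel_measurable_continuous_onI[OF cG] in auto)
      finally show ?thesis by (simp add: G_def add.commute)
    qed
    have "(\<integral>x. a x * D n x \<partial>lborel) = (\<integral>x. (a x * F (x + h n *\<^sub>R e) - a x * F x) / h n \<partial>lborel)"
      by (simp add: D_def right_diff_distrib)
    also have "\<dots> = ((\<integral>x. a x * F (x + h n *\<^sub>R e) \<partial>lborel) - (\<integral>x. a x * F x \<partial>lborel)) / h n"
      using iaF iG' by simp
    also have "\<dots> = (\<integral>x. (G x - a x * F x) / h n \<partial>lborel)"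
      unfolding sh using iaF iG by simp
    finally have eq: "(\<integral>x. a x * D n x \<partial>lborel) = (\<integral>x. (G x - a x * F x) / h n \<partial>lborel)" .
    have "\<bar>\<integral>x. (G x - a x * F x) / h n \<partial>lborel\<bar> \<le> (\<integral>x. \<bar>(G x - a x * F x) / h n\<bar> \<partial>lborel)"
      by (rule integral_abs_bound)
    also have "\<dots> \<le> (\<integral>x. L * \<bar>F x\<bar> \<partial>lborel)"
    proof (rule integral_mono)
      show "integrable lborel (\<lambda>x. \<bar>(G x - a x * F x) / h n\<bar>)" using iG iaF by auto
      show "integrable lborel (\<lambda>x. L * \<bar>F x\<bar>)" using iF by auto
      fix x
      have "\<bar>a (x - h n *\<^sub>R e) - a x\<bar> \<le> L * h n" using L[of "x - h n *\<^sub>R e" x] h0[of n] ne by simp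
      then have "\<bar>a (x - h n *\<^sub>R e) - a x\<bar> * \<bar>F x\<bar> \<le> L * h n * \<bar>F x\<bar>" by (intro mult_right_mono) auto
      moreover have "G x - a x * F x = (a (x - h n *\<^sub>R e) - a x) * F x" by (simp add: G_def algebra_simps)
      ultimately show "\<bar>(G x - a x * F x) / h n\<bar> \<le> L * \<bar>F x\<bar>"
        using h0[of n] by (simp add: abs_mult divide_simps) (simp add: mult_ac)
    qed
    finally show ?thesis using eq by simp
  qed
  have "(\<lambda>n. \<bar>\<integral>x. a x * D n x \<partial>lborel\<bar>) \<longlonglongrightarrow> \<bar>\<integral>x. a x * F' x \<partial>lborel\<bar>"
    by (intro tendsto_intros lim)
  then show ?thesis using bd by (intro LIMSEQ_le_const2) auto
qed

section \<open>The multiplier identity\<close>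

definition C2 :: "(real^'n \<Rightarrow> real) \<Rightarrow> ('n \<Rightarrow> real^'n \<Rightarrow> real) \<Rightarrow> ('n \<Rightarrow> 'n \<Rightarrow> real^'n \<Rightarrow> real) \<Rightarrow> bool" where
  "C2 f f1 f2 \<longleftrightarrow> continuous_on UNIV f \<and> (\<forall>i. continuous_on UNIV (f1 i) \<and> has_partial i f (f1 i)) \<and>
     (\<forall>i j. continuous_on UNIV (f2 i j) \<and> has_partial j (f1 i) (f2 i j) \<and> f2 i j = f2 j i)"

text \<open>The coefficients are written as a family of real functions. The lower bound on the quadratic form
  and the upper bound on the entries have the same constant because this is what the inverse of a
  metric with bounds \<open>1 / lam\<close> and \<open>lam\<close> satisfies.\<close>

definition elliptic_lipschitz :: "real \<Rightarrow> real \<Rightarrow> ('n::finite \<Rightarrow> 'n \<Rightarrow> real^'n \<Rightarrow> real) \<Rightarrow> bool" where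
  "elliptic_lipschitz lam L A \<longleftrightarrow> (\<forall>i j. A i j = A j i) \<and> (\<forall>i j x. \<bar>A i j x\<bar> \<le> lam) \<and>
     (\<forall>i j x y. \<bar>A i j x - A i j y\<bar> \<le> L * norm (x - y)) \<and>
     (\<forall>x \<xi>. (\<Sum>i\<in>UNIV. (\<xi> i)\<^sup>2) \<le> lam * (\<Sum>i\<in>UNIV. \<Sum>j\<in>UNIV. A i j x * (\<xi> i * \<xi> j)))"

text \<open>Contractions of \<open>f\<close> with one and with two copies of the coefficient matrix. Every term in the
  Carleman computation is of one of these two forms, so that it suffices to know their linearity and
  their symmetries.\<close>

definition quad2 :: "('n::finite \<Rightarrow> 'n \<Rightarrow> real) \<Rightarrow> ('n \<Rightarrow> 'n \<Rightarrow> real) \<Rightarrow> real" where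
  "quad2 B f = (\<Sum>i\<in>UNIV. \<Sum>j\<in>UNIV. B i j * f i j)"

definition quad4 :: "('n::finite \<Rightarrow> 'n \<Rightarrow> real) \<Rightarrow> ('n \<Rightarrow> 'n \<Rightarrow> 'n \<Rightarrow> 'n \<Rightarrow> real) \<Rightarrow> real" where
  "quad4 B f = (\<Sum>i\<in>UNIV. \<Sum>j\<in>UNIV. \<Sum>k\<in>UNIV. \<Sum>l\<in>UNIV. B i j * B k l * f i j k l)"

lemma quad2_mult: "quad2 B f * quad2 B g = quad4 B (\<lambda>i j k l. f i j * g k l)"
  unfolding quad2_def quad4_def sum_distrib_right unfolding sum_distrib_left
  by (simp add: mult_ac)

lemma quad4_add: "quad4 B (\<lambda>i j k l. f i j k l + g i j k l) = quad4 B f + quad4 B g"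
  unfolding quad4_def by (simp add: distrib_left sum.distrib)

lemma quad4_diff: "quad4 B (\<lambda>i j k l. f i j k l - g i j k l) = quad4 B f - quad4 B g"
  unfolding quad4_def by (simp add: right_diff_distrib sum_subtractf)

lemma quad4_cmult: "quad4 B (\<lambda>i j k l. c * f i j k l) = c * quad4 B f"
  unfolding quad4_def sum_distrib_left by (simp add: mult_ac)

lemma quad2_add: "quad2 B (\<lambda>i j. f i j + g i j) = quad2 B f + quad2 B g"
  unfolding quad2_def by (simp add: distrib_left sum.distrib)

lemma quad2_diff: "quad2 B (\<lambda>i j. f i j - g i j) = quad2 B f - quad2 B g"
  unfolding quad2_def by (simp add: right_diff_distrib sum_subtractf)

lemma quad2_cmult: "quad2 B (\<lambda>i j. c * f i j) = c * quad2 B f"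
  unfolding quad2_def sum_distrib_left by (simp add: mult_ac)

lemma quad4_swap12:
  assumes "\<And>i j. B i j = B j i"
  shows "quad4 B (\<lambda>i j k l. f j i k l) = quad4 B f"
proof -
  have "quad4 B (\<lambda>i j k l. f j i k l) = (\<Sum>i\<in>UNIV. \<Sum>j\<in>UNIV. \<Sum>k\<in>UNIV. \<Sum>l\<in>UNIV. B j i * B k l * f j i k l)"
    unfolding quad4_def by (intro sum.cong refl arg_cong2[where f="(*)"] assms)
  also have "\<dots> = quad4 B f" unfolding quad4_def by (rule sum.swap)
  finally show ?thesis .
qed

lemma quad4_swap34:
  assumes "\<And>i j. B i j = B j i"
  shows "quad4 B (\<lambda>i j k l. f i j l k) = quad4 B f"
proof -
  have "quad4 B (\<lambda>i j k l. f i j l k) = (\<Sum>i\<in>UNIV. \<Sum>j\<in>UNIV. \<Sum>k\<in>UNIV. \<Sum>l\<in>UNIV. B i j * B l k * f i j l k)"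
    unfolding quad4_def by (intro sum.cong refl arg_cong2[where f="(*)"] assms)
  also have "\<dots> = quad4 B f" unfolding quad4_def by (intro sum.cong refl sum.swap)
  finally show ?thesis .
qed

text \<open>For \<open>v = exp (\<tau> * \<phi>) * w\<close> the conjugated operator is split into
  \<open>S v = A\<^sub>i\<^sub>j v\<^sub>i\<^sub>j + \<tau>\<^sup>2 \<langle>A\<nabla>\<phi>, \<nabla>\<phi>\<rangle> v\<close> and \<open>T v = - 2 \<tau> \<langle>A\<nabla>\<phi>, \<nabla>v\<rangle> - \<tau> A\<^sub>k\<^sub>l h\<^sub>k\<^sub>l v\<close>, where \<open>h\<close> is a free
  parameter. The product \<open>S v * T v\<close> is rewritten at a point, with \<open>p1, p2\<close> and \<open>v1, v2\<close> for the
  first and second derivatives of \<open>\<phi>\<close> and \<open>v\<close> and \<open>h1\<close> for those of \<open>h\<close>: the first two lines of the result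
  carry the sign, the third one is of lower order, and the last four are products \<open>A\<^sub>i\<^sub>j A\<^sub>k\<^sub>l\<close> times the
  partial derivative with index \<open>i\<close> or \<open>l\<close> of \<open>p1\<^sub>k v1\<^sub>l v1\<^sub>j\<close>, \<open>p1\<^sub>k v1\<^sub>i v1\<^sub>j\<close>, \<open>p1\<^sub>i p1\<^sub>j p1\<^sub>k v\<^sup>2\<close> and
  \<open>h\<^sub>k\<^sub>l v v1\<^sub>j\<close>. To the latter \<open>lipschitz_ibp\<close> applies. Only the symmetries of \<open>A\<close> and of the Hessians are
  used.\<close>

lemma multiplier_identity:
  fixes B :: "'n::finite \<Rightarrow> 'n \<Rightarrow> real" and p1 v1 :: "'n \<Rightarrow> real" and p2 v2 h :: "'n \<Rightarrow> 'n \<Rightarrow> real"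
    and h1 :: "'n \<Rightarrow> 'n \<Rightarrow> 'n \<Rightarrow> real"
  assumes B: "\<And>i j. B i j = B j i" and v2: "\<And>i j. v2 i j = v2 j i"  and p2: "\<And>i j. p2 i j = p2 j i"
  shows "(quad2 B v2 + \<tau>^2 * quad2 B (\<lambda>i j. p1 i * p1 j) * v)
      * (- 2 * \<tau> * quad2 B (\<lambda>k l. p1 k * v1 l) - \<tau> * quad2 B h * v) =
     \<tau> * (2 * quad4 B (\<lambda>i j k l. p2 k i * v1 l * v1 j)
          + quad2 B (\<lambda>k l. h k l - p2 k l) * quad2 B (\<lambda>i j. v1 i * v1 j))
   + \<tau>^3 * (2 * quad4 B (\<lambda>i j k l. p2 k i * p1 l * p1 j)
          - quad2 B (\<lambda>i j. p1 i * p1 j) * quad2 B (\<lambda>k l. h k l - p2 k l)) * v^2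
   + \<tau> * quad4 B (\<lambda>i j k l. h1 i k l * v * v1 j)
   + quad4 B (\<lambda>i j k l. - 2 * \<tau> * (p2 k i * v1 l * v1 j + p1 k * v2 l i * v1 j + p1 k * v1 l * v2 j i))
   + quad4 B (\<lambda>i j k l. \<tau> * (p2 k l * v1 i * v1 j + p1 k * v2 i l * v1 j + p1 k * v1 i * v2 j l))
   + quad4 B (\<lambda>i j k l. - (\<tau>^3) * ((p2 i l * p1 j * p1 k + p1 i * p2 j l * p1 k + p1 i * p1 j * p2 k l) * v^2
                                 + p1 i * p1 j * p1 k * (2 * v * v1 l)))
   + quad4 B (\<lambda>i j k l. - \<tau> * (h1 i k l * v * v1 j + h k l * v1 i * v1 j + h k l * v * v2 j i))"
  (is "?L = ?R")
proof -
  define X1 where "X1 = quad4 B (\<lambda>i j k l. p1 k * v2 l i * v1 j)"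
  define X2 where "X2 = quad4 B (\<lambda>i j k l. p1 k * v1 l * v2 j i)"
  define X3 where "X3 = quad4 B (\<lambda>i j k l. p1 k * v2 i l * v1 j)"
  define X4 where "X4 = quad4 B (\<lambda>i j k l. p1 k * v1 i * v2 j l)"
  define Y1 where "Y1 = quad4 B (\<lambda>i j k l. p2 k i * v1 l * v1 j)"
  define Y2 where "Y2 = quad4 B (\<lambda>i j k l. p2 k l * v1 i * v1 j)"
  define Y3 where "Y3 = quad4 B (\<lambda>i j k l. h k l * v1 i * v1 j)"
  define Z1 where "Z1 = quad4 B (\<lambda>i j k l. p2 i l * p1 j * p1 k)"
  define Z2 where "Z2 = quad4 B (\<lambda>i j k l. p1 i * p2 j l * p1 k)"
  define Z3 where "Z3 = quad4 B (\<lambda>i j k l. p1 i * p1 j * p2 k l)"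
  define Z4 where "Z4 = quad4 B (\<lambda>i j k l. p1 i * p1 j * h k l)"
  define Z5 where "Z5 = quad4 B (\<lambda>i j k l. p1 i * p1 j * p1 k * v1 l)"
  define W1 where "W1 = quad4 B (\<lambda>i j k l. h1 i k l * v1 j)"
  define W2 where "W2 = quad4 B (\<lambda>i j k l. h k l * v2 j i)"
  have e1: "X1 = X3" unfolding X1_def X3_def by (subst v2) (rule refl)
  have e2: "X4 = X3"
    unfolding X3_def X4_def
    using quad4_swap12[OF B, where f = "\<lambda>i j k l. p1 k * v2 i l * v1 j"] by (simp add: mult_ac)
  have e3: "Z2 = Z1"
    unfolding Z1_def Z2_def
    using quad4_swap12[OF B, where f = "\<lambda>i j k l. p2 i l * p1 j * p1 k"] by (simp add: mult_ac)
  have e4: "quad4 B (\<lambda>i j k l. p2 k i * p1 l * p1 j) = Z1"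
    unfolding Z1_def
    using quad4_swap34[OF B, where f = "\<lambda>i j k l. p2 i l * p1 j * p1 k"] p2 by (simp add: mult_ac)
  have m1: "quad2 B v2 * quad2 B (\<lambda>k l. p1 k * v1 l) = X2"
    unfolding X2_def quad2_mult using v2 by (simp add: mult_ac)
  have m2: "quad2 B v2 * quad2 B h = W2"
    unfolding W2_def quad2_mult using v2 by (simp add: mult_ac)
  have m3: "quad2 B (\<lambda>i j. p1 i * p1 j) * quad2 B (\<lambda>k l. p1 k * v1 l) = Z5"
    unfolding Z5_def quad2_mult by (simp add: mult_ac)
  have m4: "quad2 B (\<lambda>i j. p1 i * p1 j) * quad2 B h = Z4"
    unfolding Z4_def quad2_mult by (simp add: mult_ac)
  have m5: "quad2 B (\<lambda>i j. p1 i * p1 j) * quad2 B p2 = Z3"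
    unfolding Z3_def quad2_mult by (simp add: mult_ac)
  have m6: "quad2 B p2 * quad2 B (\<lambda>i j. v1 i * v1 j) = Y2"
    unfolding Y2_def by (subst mult.commute, subst quad2_mult) (simp add: mult_ac)
  have m7: "quad2 B h * quad2 B (\<lambda>i j. v1 i * v1 j) = Y3"
    unfolding Y3_def by (subst mult.commute, subst quad2_mult) (simp add: mult_ac)
  have q1: "quad4 B (\<lambda>i j k l. - 2 * \<tau> * (p2 k i * v1 l * v1 j + p1 k * v2 l i * v1 j + p1 k * v1 l * v2 j i))
     = - 2 * \<tau> * (Y1 + X1 + X2)"
    unfolding quad4_cmult quad4_add Y1_def X1_def X2_def by simp
  have q2: "quad4 B (\<lambda>i j k l. \<tau> * (p2 k l * v1 i * v1 j + p1 k * v2 i l * v1 j + p1 k * v1 i * v2 j l))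
     = \<tau> * (Y2 + X3 + X4)"
    unfolding quad4_cmult quad4_add Y2_def X3_def X4_def by simp
  have "quad4 B (\<lambda>i j k l. - (\<tau>^3) * ((p2 i l * p1 j * p1 k + p1 i * p2 j l * p1 k + p1 i * p1 j * p2 k l) * v^2
                                 + p1 i * p1 j * p1 k * (2 * v * v1 l)))
     = quad4 B (\<lambda>i j k l. - (\<tau>^3) * (v^2 * (p2 i l * p1 j * p1 k + p1 i * p2 j l * p1 k + p1 i * p1 j * p2 k l)
                                 + (2 * v) * (p1 i * p1 j * p1 k * v1 l)))"
    by (simp add: mult_ac)
  also have "\<dots> = - (\<tau>^3) * (v^2 * (Z1 + Z2 + Z3) + 2 * v * Z5)"
    unfolding quad4_cmult quad4_add Z1_def Z2_def Z3_def Z5_def by simp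
  finally have q3: "quad4 B (\<lambda>i j k l. - (\<tau>^3) * ((p2 i l * p1 j * p1 k + p1 i * p2 j l * p1 k + p1 i * p1 j * p2 k l) * v^2
                                 + p1 i * p1 j * p1 k * (2 * v * v1 l))) = - (\<tau>^3) * (v^2 * (Z1 + Z2 + Z3) + 2 * v * Z5)" .
  have "quad4 B (\<lambda>i j k l. - \<tau> * (h1 i k l * v * v1 j + h k l * v1 i * v1 j + h k l * v * v2 j i))
    = quad4 B (\<lambda>i j k l. - \<tau> * (v * (h1 i k l * v1 j) + h k l * v1 i * v1 j + v * (h k l * v2 j i)))"
    by (simp add: mult_ac)
  also have "\<dots> = - \<tau> * (v * W1 + Y3 + v * W2)"
    unfolding quad4_cmult quad4_add Y3_def W1_def W2_def by simp
  finally have q4: "quad4 B (\<lambda>i j k l. - \<tau> * (h1 i k l * v * v1 j + h k l * v1 i * v1 j + h k l * v * v2 j i))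
    = - \<tau> * (v * W1 + Y3 + v * W2)" .
  have "quad4 B (\<lambda>i j k l. h1 i k l * v * v1 j) = quad4 B (\<lambda>i j k l. v * (h1 i k l * v1 j))"
    by (simp add: mult_ac)
  then have q5: "quad4 B (\<lambda>i j k l. h1 i k l * v * v1 j) = v * W1"
    unfolding quad4_cmult W1_def .
  have "?R = \<tau> * (2 * Y1 + (Y3 - Y2)) + \<tau>^3 * (2 * Z1 - (Z4 - Z3)) * v^2 + \<tau> * (v * W1)
      - 2 * \<tau> * (Y1 + X3 + X2) + \<tau> * (Y2 + X3 + X3) - \<tau>^3 * (v^2 * (Z1 + Z1 + Z3) + 2 * v * Z5)
      - \<tau> * (v * W1 + Y3 + v * W2)"
    unfolding q1 q2 q3 q4 q5 e4 e1 e2 e3 quad2_diff left_diff_distrib right_diff_distrib m4 m5 m6 m7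
    unfolding Y1_def by (simp add: algebra_simps)
  also have "\<dots> = - 2 * \<tau> * X2 - \<tau> * v * W2 - 2 * \<tau>^3 * v * Z5 - \<tau>^3 * Z4 * v^2"
    by (simp add: algebra_simps)
  also have "\<dots> = ?L"
    unfolding m1[symmetric] m2[symmetric] m3[symmetric] m4[symmetric]
    by (simp add: algebra_simps power2_eq_square power3_eq_cube)
  finally show ?thesis by simp
qed

lemma lipschitz_ibp_sum:
  fixes a F F' :: "'p::finite \<Rightarrow> real^'n \<Rightarrow> real" and i :: "'p \<Rightarrow> 'n"
  assumes L: "\<And>p x y. \<bar>a p x - a p y\<bar> \<le> L * norm (x - y)"
    and pd: "\<And>p. has_partial (i p) (F p) (F' p)"
    and cF: "\<And>p. continuous_on UNIV (F p)" and cF': "\<And>p. continuous_on UNIV (F' p)"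
    and z: "\<And>p x. x \<notin> cball 0 R \<Longrightarrow> F p x = 0"
  shows "\<bar>\<integral>x. (\<Sum>p\<in>UNIV. a p x * F' p x) \<partial>lborel\<bar> \<le> L * (\<integral>x. (\<Sum>p\<in>UNIV. \<bar>F p x\<bar>) \<partial>lborel)"
    "integrable lborel (\<lambda>x. \<Sum>p\<in>UNIV. a p x * F' p x)"
    "integrable lborel (\<lambda>x. \<Sum>p\<in>UNIV. \<bar>F p x\<bar>)"
proof -
  have i1: "integrable lborel (\<lambda>x. \<bar>F p x\<bar>)" for p
    by (rule integrable_compactly_supported[where R=R]) (auto intro!: continuous_intros cF z)
  have i2: "integrable lborel (\<lambda>x. a p x * F' p x)" for p
  proof (rule integrable_compactly_supported[where R=R])
    show "continuous_on UNIV (\<lambda>x. a p x * F' p x)"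
      by (intro continuous_intros cF' continuous_of_lipschitz[OF L])
    fix x :: "real^'n" assume "x \<notin> cball 0 R"
    then have "F' p x = 0" by (intro has_partial_zero_on_open[OF pd, of "- cball 0 R"]) (use z in auto)
    then show "a p x * F' p x = 0" by simp
  qed
  show "integrable lborel (\<lambda>x. \<Sum>p\<in>UNIV. a p x * F' p x)" "integrable lborel (\<lambda>x. \<Sum>p\<in>UNIV. \<bar>F p x\<bar>)"
    using i1 i2 by auto
  have "\<bar>\<integral>x. (\<Sum>p\<in>UNIV. a p x * F' p x) \<partial>lborel\<bar> = \<bar>\<Sum>p\<in>UNIV. \<integral>x. a p x * F' p x \<partial>lborel\<bar>"
    using i2 by simp
  also have "\<dots> \<le> (\<Sum>p\<in>UNIV. \<bar>\<integral>x. a p x * F' p x \<partial>lborel\<bar>)" by (rule sum_abs)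
  also have "\<dots> \<le> (\<Sum>p\<in>UNIV. L * (\<integral>x. \<bar>F p x\<bar> \<partial>lborel))"
    by (intro sum_mono lipschitz_ibp[OF L pd cF cF' z])
  also have "\<dots> = L * (\<integral>x. (\<Sum>p\<in>UNIV. \<bar>F p x\<bar>) \<partial>lborel)"
    using i1 by (simp add: sum_distrib_left)
  finally show "\<bar>\<integral>x. (\<Sum>p\<in>UNIV. a p x * F' p x) \<partial>lborel\<bar> \<le> L * (\<integral>x. (\<Sum>p\<in>UNIV. \<bar>F p x\<bar>) \<partial>lborel)" .
qed

section \<open>Convexity of the radial weight\<close>

definition sum4 :: "('n::finite \<Rightarrow> 'n \<Rightarrow> 'n \<Rightarrow> 'n \<Rightarrow> real) \<Rightarrow> real" where
  "sum4 f = (\<Sum>i\<in>UNIV. \<Sum>j\<in>UNIV. \<Sum>k\<in>UNIV. \<Sum>l\<in>UNIV. f i j k l)"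

lemma sum4_prod: "(\<Sum>p\<in>UNIV. f p) = sum4 (\<lambda>i j k l. f (i, j, k, l))"
  unfolding sum4_def by (simp add: sum.cartesian_product UNIV_Times_UNIV[symmetric] del: UNIV_Times_UNIV)

lemma sum4_mono: "(\<And>i j k l. f i j k l \<le> g i j k l) \<Longrightarrow> sum4 f \<le> sum4 g"
  unfolding sum4_def by (intro sum_mono)

lemma sum4_const: "sum4 (\<lambda>i j k l::'n::finite. c) = real CARD('n) ^ 4 * c"
  unfolding sum4_def by (simp add: power4_eq_xxxx)

lemma quad4_abs:
  assumes "\<And>i j. \<bar>B i j\<bar> \<le> lam"
  shows "\<bar>quad4 B f\<bar> \<le> lam\<^sup>2 * sum4 (\<lambda>i j k l. \<bar>f i j k l\<bar>)"
proof -
  have "\<bar>quad4 B f\<bar> \<le> sum4 (\<lambda>i j k l. \<bar>B i j * B k l * f i j k l\<bar>)"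
    unfolding quad4_def sum4_def by (intro order_trans[OF sum_abs] sum_mono order_refl)
  also have "\<dots> \<le> sum4 (\<lambda>i j k l. lam\<^sup>2 * \<bar>f i j k l\<bar>)"
    unfolding abs_mult power2_eq_square
    by (intro sum4_mono mult_right_mono mult_mono assms order_trans[OF abs_ge_zero assms]) auto
  also have "\<dots> = lam\<^sup>2 * sum4 (\<lambda>i j k l. \<bar>f i j k l\<bar>)" by (simp add: sum4_def sum_distrib_left)
  finally show ?thesis .
qed

text \<open>The Hessian of \<open>exp (- \<mu> * \<bar>x\<bar>\<^sup>2)\<close> is the weight times \<open>4 \<mu>\<^sup>2 x\<^sub>k x\<^sub>i - 2 \<mu> \<delta>\<^sub>k\<^sub>i\<close>: a rank one part, which
  contributes a square of order \<open>\<mu>\<^sup>2\<close>, and a negative part of order \<open>\<mu>\<close>.\<close>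

lemma quad4_radial:
  fixes x w :: "'n::finite \<Rightarrow> real"
  shows "quad4 B (\<lambda>i j k l. (\<phi> * (4 * \<mu>\<^sup>2 * (x k * x i) - 2 * \<mu> * (if k = i then 1 else 0))) * w l * w j)
     = \<phi> * (4 * \<mu>\<^sup>2 * (quad2 B (\<lambda>i j. x i * w j))\<^sup>2 - 2 * \<mu> * (\<Sum>i\<in>UNIV. (\<Sum>j\<in>UNIV. B i j * w j)\<^sup>2))"
proof -
  have d: "quad4 B (\<lambda>i j k l. (if k = i then 1 else 0) * w l * w j) = (\<Sum>i\<in>UNIV. (\<Sum>j\<in>UNIV. B i j * w j)\<^sup>2)"
  proof -
    have "(\<Sum>k\<in>UNIV. \<Sum>l\<in>UNIV. B i j * B k l * ((if k = i then 1 else 0) * w l * w j))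
        = (\<Sum>l\<in>UNIV. B i j * B i l * (w l * w j))" for i j
    proof -
      have "(\<Sum>k\<in>UNIV. \<Sum>l\<in>UNIV. B i j * B k l * ((if k = i then 1 else 0) * w l * w j))
        = (\<Sum>k\<in>UNIV. if k = i then (\<Sum>l\<in>UNIV. B i j * B k l * (w l * w j)) else 0)"
        by (intro sum.cong refl) auto
      then show ?thesis by simp
    qed
    then show ?thesis unfolding quad4_def
      by (simp add: power2_eq_square sum_product mult_ac)
  qed
  have "(\<lambda>i j k l. (\<phi> * (4 * \<mu>\<^sup>2 * (x k * x i) - 2 * \<mu> * (if k = i then 1 else 0))) * w l * w j)
     = (\<lambda>i j k l. \<phi> * (4 * \<mu>\<^sup>2 * ((x i * w j) * (x k * w l)) - 2 * \<mu> * ((if k = i then 1 else 0) * w l * w j)))"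
    by (intro ext) (simp add: algebra_simps)
  then show ?thesis
    by (simp only: quad4_cmult quad4_diff d quad2_mult[symmetric] power2_eq_square)
qed

lemma sum_square_matrix_vector_le:
  fixes w :: "'n::finite \<Rightarrow> real" and B :: "'n \<Rightarrow> 'n \<Rightarrow> real"
  assumes B: "\<And>i j. \<bar>B i j\<bar> \<le> lam"
  shows "(\<Sum>i\<in>UNIV. (\<Sum>j\<in>UNIV. B i j * w j)\<^sup>2) \<le> (real CARD('n))\<^sup>2 * lam\<^sup>2 * (\<Sum>i\<in>UNIV. (w i)\<^sup>2)"
proof -
  have *: "(\<Sum>j\<in>UNIV. B i j * w j)\<^sup>2 \<le> real CARD('n) * lam\<^sup>2 * (\<Sum>i\<in>UNIV. (w i)\<^sup>2)" for i
  proof -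
    have "(\<Sum>j\<in>UNIV. B i j * w j)\<^sup>2 \<le> (\<Sum>j\<in>UNIV. (B i j)\<^sup>2) * (\<Sum>j\<in>UNIV. (w j)\<^sup>2)"
      by (rule Cauchy_Schwarz_ineq_sum)
    also have "\<dots> \<le> (\<Sum>j\<in>(UNIV::'n set). lam\<^sup>2) * (\<Sum>j\<in>UNIV. (w j)\<^sup>2)"
      using B by (intro mult_right_mono sum_mono sum_nonneg) (auto intro: power2_le_imp_le simp: abs_le_square_iff[symmetric] intro: order_trans[OF _ abs_ge_self])
    finally show ?thesis by simp
  qed
  have "(\<Sum>i\<in>UNIV. (\<Sum>j\<in>UNIV. B i j * w j)\<^sup>2) \<le> (\<Sum>i\<in>(UNIV::'n set). real CARD('n) * lam\<^sup>2 * (\<Sum>i\<in>UNIV. (w i)\<^sup>2))"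
    by (intro sum_mono *)
  then show ?thesis by (simp add: power2_eq_square mult_ac)
qed

text \<open>The convexification step. The rank one part of the Hessian has the right sign for the term without
  derivatives of \<open>v\<close>, but it says nothing about derivatives of \<open>v\<close> tangential to the spheres. Adding
  \<open>4 \<mu>\<^sup>2 \<phi> x\<^sub>k x\<^sub>l\<close> to the Hessian in the choice of \<open>h\<close> takes half of the positivity away from the former term
  and gives it to all derivatives, so that both coefficients are positive once \<open>\<mu>\<close> is large. The lower bound
  \<open>r\<close> on \<open>\<bar>x\<bar>\<close> is needed because the gradient of the weight vanishes at the origin.\<close>

lemma radial_positivity:
  fixes x :: "'n::finite \<Rightarrow> real"
  assumes B: "\<And>i j. \<bar>B i j\<bar> \<le> lam"
    and ell: "\<And>\<xi>. (\<Sum>i\<in>UNIV. (\<xi> i)\<^sup>2) \<le> lam * quad2 B (\<lambda>i j. \<xi> i * \<xi> j)"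
    and lam: "lam > 0" and r: "r > 0" "r\<^sup>2 \<le> (\<Sum>i\<in>UNIV. (x i)\<^sup>2)" "(\<Sum>i\<in>UNIV. (x i)\<^sup>2) \<le> 1"
    and \<phi>: "\<phi> > 0" and \<mu>: "\<mu> > 0"
    and p1: "p1 = (\<lambda>i. - 2 * \<mu> * x i * \<phi>)"
    and p2: "p2 = (\<lambda>i j. \<phi> * (4 * \<mu>\<^sup>2 * (x i * x j) - 2 * \<mu> * (if i = j then 1 else 0)))"
    and h: "h = (\<lambda>i j. p2 i j + 4 * \<mu>\<^sup>2 * \<phi> * (x i * x j))"
  defines "K2 \<equiv> (real CARD('n))\<^sup>2 * lam\<^sup>2"
  shows "\<phi> * \<mu> * (4 * \<mu> * r\<^sup>2 / lam\<^sup>2 - 4 * K2) * (\<Sum>i\<in>UNIV. (w i)\<^sup>2)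
      \<le> 2 * quad4 B (\<lambda>i j k l. p2 k i * w l * w j)
        + quad2 B (\<lambda>k l. h k l - p2 k l) * quad2 B (\<lambda>i j. w i * w j)" (is ?A)
    and "\<phi>^3 * \<mu>^3 * (16 * \<mu> * r^4 / lam\<^sup>2 - 16 * K2)
      \<le> 2 * quad4 B (\<lambda>i j k l. p2 k i * p1 l * p1 j)
        - quad2 B (\<lambda>i j. p1 i * p1 j) * quad2 B (\<lambda>k l. h k l - p2 k l)" (is ?B)
proof -
  define s where "s = quad2 B (\<lambda>i j. x i * x j)"
  have s: "s \<ge> r\<^sup>2 / lam" using ell[of x] r lam by (simp add: s_def divide_simps mult_ac)
  have s0: "s > 0" using s r lam by (smt (verit) divide_pos_pos zero_less_power)
  have d: "quad2 B (\<lambda>k l. h k l - p2 k l) = 4 * \<mu>\<^sup>2 * \<phi> * s"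
    unfolding h s_def by (simp add: quad2_cmult)
  have q4: "quad4 B (\<lambda>i j k l. p2 k i * w l * w j)
     = \<phi> * (4 * \<mu>\<^sup>2 * (quad2 B (\<lambda>i j. x i * w j))\<^sup>2 - 2 * \<mu> * (\<Sum>i\<in>UNIV. (\<Sum>j\<in>UNIV. B i j * w j)\<^sup>2))" for w
    unfolding p2 by (rule quad4_radial)
  show ?A
  proof -
    define V where "V = (\<Sum>i\<in>UNIV. (w i)\<^sup>2)"
    have V: "V \<ge> 0" unfolding V_def by (auto intro: sum_nonneg)
    have v: "quad2 B (\<lambda>i j. w i * w j) \<ge> V / lam" using ell[of w] lam by (simp add: V_def divide_simps mult_ac)
    have "(r\<^sup>2 / lam) * (V / lam) \<le> s * quad2 B (\<lambda>i j. w i * w j)"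
      by (intro mult_mono s v) (use s0 V lam in auto)
    then have "4 * \<mu>\<^sup>2 * \<phi> * ((r\<^sup>2 / lam) * (V / lam)) \<le> 4 * \<mu>\<^sup>2 * \<phi> * (s * quad2 B (\<lambda>i j. w i * w j))"
      using \<phi> by (intro mult_left_mono) auto
    moreover have "\<phi> * (- 2 * \<mu> * (K2 * V)) \<le> \<phi> * (4 * \<mu>\<^sup>2 * (quad2 B (\<lambda>i j. x i * w j))\<^sup>2 - 2 * \<mu> * (\<Sum>i\<in>UNIV. (\<Sum>j\<in>UNIV. B i j * w j)\<^sup>2))"
    proof (intro mult_left_mono)
      have "2 * \<mu> * (\<Sum>i\<in>UNIV. (\<Sum>j\<in>UNIV. B i j * w j)\<^sup>2) \<le> 2 * \<mu> * (K2 * V)"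
        unfolding K2_def V_def using \<mu> by (intro mult_left_mono sum_square_matrix_vector_le[OF B]) auto
      then show "- 2 * \<mu> * (K2 * V) \<le> 4 * \<mu>\<^sup>2 * (quad2 B (\<lambda>i j. x i * w j))\<^sup>2 - 2 * \<mu> * (\<Sum>i\<in>UNIV. (\<Sum>j\<in>UNIV. B i j * w j)\<^sup>2)"
        using zero_le_power2[of "\<mu> * quad2 B (\<lambda>i j. x i * w j)"] unfolding power_mult_distrib by linarith
    qed (use \<phi> in auto)
    moreover have "\<phi> * \<mu> * (4 * \<mu> * r\<^sup>2 / lam\<^sup>2 - 4 * K2) * V
        = 4 * \<mu>\<^sup>2 * \<phi> * ((r\<^sup>2 / lam) * (V / lam)) + 2 * (\<phi> * (- 2 * \<mu> * (K2 * V)))"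
      using lam by (simp add: power2_eq_square field_simps)
    ultimately show ?A unfolding q4 d V_def[symmetric] mult.assoc[of _ s] by linarith
  qed
  show ?B
  proof -
    have x1: "quad2 B (\<lambda>i j. x i * p1 j) = - 2 * \<mu> * \<phi> * s"
    proof -
      have "(\<lambda>i j. x i * p1 j) = (\<lambda>i j. (- 2 * \<mu> * \<phi>) * (x i * x j))" unfolding p1 by (intro ext) (simp add: mult_ac)
      then show ?thesis by (simp only: quad2_cmult s_def)
    qed
    have x2: "quad2 B (\<lambda>i j. p1 i * p1 j) = 4 * \<mu>\<^sup>2 * \<phi>\<^sup>2 * s"
    proof -
      have "(\<lambda>i j. p1 i * p1 j) = (\<lambda>i j. (4 * \<mu>\<^sup>2 * \<phi>\<^sup>2) * (x i * x j))"
        unfolding p1 by (intro ext) (simp add: mult_ac power2_eq_square)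
      then show ?thesis by (simp only: quad2_cmult s_def)
    qed
    have "(\<Sum>i\<in>UNIV. (\<Sum>j\<in>UNIV. B i j * p1 j)\<^sup>2) \<le> K2 * (\<Sum>i\<in>UNIV. (p1 i)\<^sup>2)"
      unfolding K2_def by (rule sum_square_matrix_vector_le[OF B])
    also have "(\<Sum>i\<in>UNIV. (p1 i)\<^sup>2) = 4 * \<mu>\<^sup>2 * \<phi>\<^sup>2 * (\<Sum>i\<in>UNIV. (x i)\<^sup>2)"
      unfolding p1 by (simp add: power_mult_distrib sum_distrib_left mult_ac)
    also have "K2 * \<dots> \<le> K2 * (4 * \<mu>\<^sup>2 * \<phi>\<^sup>2 * 1)"
      using r by (intro mult_left_mono) (auto simp: K2_def)
    finally have mv: "(\<Sum>i\<in>UNIV. (\<Sum>j\<in>UNIV. B i j * p1 j)\<^sup>2) \<le> 4 * \<mu>\<^sup>2 * \<phi>\<^sup>2 * K2" by (simp add: mult_ac)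
    have "4 * \<mu> * \<phi> * (\<Sum>i\<in>UNIV. (\<Sum>j\<in>UNIV. B i j * p1 j)\<^sup>2) \<le> 4 * \<mu> * \<phi> * (4 * \<mu>\<^sup>2 * \<phi>\<^sup>2 * K2)"
      using \<mu> \<phi> by (intro mult_left_mono mv) auto
    moreover have "16 * \<mu>^4 * \<phi>^3 * (r\<^sup>2 / lam)\<^sup>2 \<le> 16 * \<mu>^4 * \<phi>^3 * s\<^sup>2"
      using s s0 r lam \<phi> \<mu> by (intro mult_left_mono power_mono) auto
    ultimately show ?B unfolding q4 d x1 x2
      by (simp add: power_divide power2_eq_square power3_eq_cube power4_eq_xxxx right_diff_distrib mult_ac)
  qed
qed

lemma abs_mult_le_half_sq:
  fixes a b :: real shows "\<bar>a\<bar> * \<bar>b\<bar> \<le> (a\<^sup>2 + b\<^sup>2) / 2"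
  using sum_squares_bound[of "\<bar>a\<bar>" "\<bar>b\<bar>"] by simp

text \<open>All the bounds at a point. The two conditions on \<open>\<mu>\<close> make the positive coefficients larger than the
  error \<open>L * sum4 _\<close> that \<open>lipschitz_ibp\<close> produces, in which every summand of highest order carries the
  same powers of \<open>\<mu>\<close>, \<open>\<phi>\<close> and \<open>\<tau>\<close> as the main terms except for one factor \<open>\<mu>\<close>. What remains is of
  order \<open>\<tau>\<^sup>2 v\<^sup>2 + \<bar>\<nabla>v\<bar>\<^sup>2\<close> and is absorbed by taking \<open>\<tau>\<close> large. The number \<open>P\<close> is the conjugated operator;
  it differs from \<open>S + T\<close> by the last summand, which compensates for the choice of \<open>h\<close>.\<close>

lemma carleman_pointwise:
  fixes x v1 :: "'n::finite \<Rightarrow> real" and lam L :: real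
  assumes B: "\<And>i j. B i j = B j i" "\<And>i j. \<bar>B i j\<bar> \<le> lam"
    and ell: "\<And>\<xi>. (\<Sum>i\<in>UNIV. (\<xi> i)\<^sup>2) \<le> lam * quad2 B (\<lambda>i j. \<xi> i * \<xi> j)"
    and lam: "lam > 0" and L: "L \<ge> 0" and r: "r > 0" "r\<^sup>2 \<le> (\<Sum>i\<in>UNIV. (x i)\<^sup>2)" "(\<Sum>i\<in>UNIV. (x i)\<^sup>2) \<le> 1"
    and \<phi>: "exp (- \<mu>) \<le> \<phi>" "\<phi> \<le> 1" and \<mu>: "\<mu> \<ge> 1"
    and p1: "p1 = (\<lambda>i. - 2 * \<mu> * x i * \<phi>)"
    and p2: "p2 = (\<lambda>i j. \<phi> * (4 * \<mu>\<^sup>2 * (x i * x j) - 2 * \<mu> * (if i = j then 1 else 0)))"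
    and h: "h = (\<lambda>i j. p2 i j + 4 * \<mu>\<^sup>2 * \<phi> * (x i * x j))"
    and H: "\<And>k l. \<bar>h k l\<bar> \<le> H" "\<And>i k l. \<bar>h1 i k l\<bar> \<le> H"
    and v2: "\<And>i j. v2 i j = v2 j i"
    and \<mu>1: "4 * \<mu> * r\<^sup>2 / lam\<^sup>2 - 4 * ((real CARD('n))\<^sup>2 * lam\<^sup>2) \<ge> 6 * L * real CARD('n)^4 + 1"
    and \<mu>2: "16 * \<mu> * r^4 / lam\<^sup>2 - 16 * ((real CARD('n))\<^sup>2 * lam\<^sup>2) \<ge> 8 * L * real CARD('n)^4 + 1"
    and \<tau>: "\<tau> \<ge> 1" "exp (- \<mu>) ^ 3 * \<tau> / 2 \<ge> real CARD('n)^4 * H * (L + lam\<^sup>2) + ((real CARD('n))\<^sup>2 * lam * (4 * \<mu>\<^sup>2))\<^sup>2"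
    and P: "P = quad2 B v2 + \<tau>^2 * quad2 B (\<lambda>i j. p1 i * p1 j) * v
              + (- 2 * \<tau> * quad2 B (\<lambda>k l. p1 k * v1 l) - \<tau> * quad2 B h * v)
              + \<tau> * quad2 B (\<lambda>k l. h k l - p2 k l) * v"
  shows "exp (- \<mu>)^3 / 2 * (\<tau> * (\<Sum>i\<in>UNIV. (v1 i)\<^sup>2) + \<tau>^3 * v\<^sup>2)
    + (quad4 B (\<lambda>i j k l. - 2 * \<tau> * (p2 k i * v1 l * v1 j + p1 k * v2 l i * v1 j + p1 k * v1 l * v2 j i))
   + quad4 B (\<lambda>i j k l. \<tau> * (p2 k l * v1 i * v1 j + p1 k * v2 i l * v1 j + p1 k * v1 i * v2 j l))
   + quad4 B (\<lambda>i j k l. - (\<tau>^3) * ((p2 i l * p1 j * p1 k + p1 i * p2 j l * p1 k + p1 i * p1 j * p2 k l) * v^2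
                                 + p1 i * p1 j * p1 k * (2 * v * v1 l)))
   + quad4 B (\<lambda>i j k l. - \<tau> * (h1 i k l * v * v1 j + h k l * v1 i * v1 j + h k l * v * v2 j i)))
   + L * sum4 (\<lambda>i j k l. 2 * \<tau> * \<bar>p1 k * v1 l * v1 j\<bar> + \<tau> * \<bar>p1 k * v1 i * v1 j\<bar>
        + \<tau>^3 * \<bar>p1 i * p1 j * p1 k * v\<^sup>2\<bar> + \<tau> * \<bar>h k l * v * v1 j\<bar>)
   \<le> P\<^sup>2 / 2"
  (is "?c0 / 2 * _ + ?G + L * ?E \<le> _")
proof -
  define V where "V = (\<Sum>i\<in>UNIV. (v1 i)\<^sup>2)"
  define N4 where "N4 = real CARD('n)^4"
  define S where "S = quad2 B v2 + \<tau>^2 * quad2 B (\<lambda>i j. p1 i * p1 j) * v"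
  define T where "T = - 2 * \<tau> * quad2 B (\<lambda>k l. p1 k * v1 l) - \<tau> * quad2 B h * v"
  define d where "d = quad2 B (\<lambda>k l. h k l - p2 k l)"
  define D where "D = (real CARD('n))\<^sup>2 * lam * (4 * \<mu>\<^sup>2)"
  define M1 where "M1 = 2 * quad4 B (\<lambda>i j k l. p2 k i * v1 l * v1 j)
          + quad2 B (\<lambda>k l. h k l - p2 k l) * quad2 B (\<lambda>i j. v1 i * v1 j)"
  define M2 where "M2 = 2 * quad4 B (\<lambda>i j k l. p2 k i * p1 l * p1 j)
          - quad2 B (\<lambda>i j. p1 i * p1 j) * quad2 B (\<lambda>k l. h k l - p2 k l)"
  define Q where "Q = quad4 B (\<lambda>i j k l. h1 i k l * v * v1 j)"
  have \<phi>0: "\<phi> > 0" using \<phi>(1) exp_gt_zero[of "-\<mu>"] by linarith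
  have \<mu>0: "\<mu> > 0" using \<mu> by simp
  have \<tau>0: "\<tau> > 0" using \<tau> by simp
  have N4: "N4 \<ge> 0" by (simp add: N4_def)
  have H0: "H \<ge> 0" using H(1)[of undefined undefined] by linarith
  have V0: "V \<ge> 0" unfolding V_def by (auto intro: sum_nonneg)
  have p2s: "p2 i j = p2 j i" for i j unfolding p2 by (simp add: mult_ac)
  have ST: "S * T = \<tau> * M1 + \<tau>^3 * M2 * v\<^sup>2 + \<tau> * Q + ?G"
    using multiplier_identity[of B v2 p2 \<tau> p1 v v1 h h1, OF B(1) v2 p2s]
    by (simp only: S_def T_def M1_def M2_def Q_def add.assoc)
  have x1: "\<bar>x i\<bar> \<le> 1" for i
  proof -
    have "(x i)\<^sup>2 \<le> (\<Sum>i\<in>UNIV. (x i)\<^sup>2)" by (rule member_le_sum) auto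
    then have "(x i)\<^sup>2 \<le> 1" using r by linarith
    then show ?thesis by (simp add: abs_square_le_1)
  qed
  have v1: "\<bar>v1 i\<bar> * \<bar>v1 j\<bar> \<le> V" for i j
  proof -
    have "(v1 i)\<^sup>2 \<le> V" "(v1 j)\<^sup>2 \<le> V" unfolding V_def by (auto intro: member_le_sum)
    then have "((v1 i)\<^sup>2 + (v1 j)\<^sup>2) / 2 \<le> V" by simp
    then show ?thesis by (rule order_trans[OF abs_mult_le_half_sq])
  qed
  have p1b: "\<bar>p1 i\<bar> \<le> 2 * \<mu> * \<phi>" for i
  proof -
    have "\<bar>p1 i\<bar> = (2 * \<mu> * \<phi>) * \<bar>x i\<bar>" unfolding p1 using \<mu>0 \<phi>0 by (simp add: abs_mult mult_ac)
    also have "\<dots> \<le> (2 * \<mu> * \<phi>) * 1" using x1 \<mu>0 \<phi>0 by (intro mult_left_mono) auto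
    finally show ?thesis by simp
  qed
  have vv: "\<tau> * (\<bar>v\<bar> * \<bar>v1 j\<bar>) \<le> (\<tau>\<^sup>2 * v\<^sup>2 + V) / 2" for j
  proof -
    have "(v1 j)\<^sup>2 \<le> V" unfolding V_def by (auto intro: member_le_sum)
    moreover have "\<bar>\<tau> * v\<bar> * \<bar>v1 j\<bar> \<le> ((\<tau> * v)\<^sup>2 + (v1 j)\<^sup>2) / 2" by (rule abs_mult_le_half_sq)
    ultimately show ?thesis using \<tau>0 by (simp add: abs_mult power_mult_distrib mult_ac)
  qed
  have hv: "\<tau> * \<bar>g * v * v1 j\<bar> \<le> H * ((\<tau>\<^sup>2 * v\<^sup>2 + V) / 2)" if "\<bar>g\<bar> \<le> H" for g j
  proof -
    have "\<bar>g\<bar> * (\<tau> * (\<bar>v\<bar> * \<bar>v1 j\<bar>)) \<le> H * ((\<tau>\<^sup>2 * v\<^sup>2 + V) / 2)"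
      using that H0 \<tau>0 by (intro mult_mono vv) auto
    then show ?thesis by (simp add: abs_mult mult_ac)
  qed
  have E: "?E \<le> N4 * (6 * \<tau> * \<mu> * \<phi> * V + 8 * \<tau>^3 * \<mu>^3 * \<phi>^3 * v\<^sup>2 + H * ((\<tau>\<^sup>2 * v\<^sup>2 + V) / 2))"
  proof -
    have "?E \<le> sum4 (\<lambda>i j k l::'n. 2 * \<tau> * (2 * \<mu> * \<phi> * V) + \<tau> * (2 * \<mu> * \<phi> * V)
       + \<tau>^3 * ((2 * \<mu> * \<phi>)^3 * v\<^sup>2) + H * ((\<tau>\<^sup>2 * v\<^sup>2 + V) / 2))"
    proof (intro sum4_mono add_mono)
      fix i j k l
      have a: "\<bar>p1 k * v1 l * v1 j\<bar> \<le> 2 * \<mu> * \<phi> * V" for k l j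
      proof -
        have "\<bar>p1 k\<bar> * (\<bar>v1 l\<bar> * \<bar>v1 j\<bar>) \<le> 2 * \<mu> * \<phi> * V"
          using \<mu>0 \<phi>0 by (intro mult_mono p1b v1) auto
        then show ?thesis by (simp add: abs_mult mult_ac)
      qed
      show "2 * \<tau> * \<bar>p1 k * v1 l * v1 j\<bar> \<le> 2 * \<tau> * (2 * \<mu> * \<phi> * V)" using a \<tau>0 by (intro mult_left_mono) auto
      show "\<tau> * \<bar>p1 k * v1 i * v1 j\<bar> \<le> \<tau> * (2 * \<mu> * \<phi> * V)" using a \<tau>0 by (intro mult_left_mono) auto
      have "\<bar>p1 i\<bar> * \<bar>p1 j\<bar> * \<bar>p1 k\<bar> \<le> (2 * \<mu> * \<phi>) * (2 * \<mu> * \<phi>) * (2 * \<mu> * \<phi>)"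
        using \<mu>0 \<phi>0 by (intro mult_mono p1b) auto
      then have "\<bar>p1 i\<bar> * \<bar>p1 j\<bar> * \<bar>p1 k\<bar> * v\<^sup>2 \<le> (2 * \<mu> * \<phi>)^3 * v\<^sup>2"
        by (intro mult_right_mono) (auto simp: power3_eq_cube)
      then show "\<tau>^3 * \<bar>p1 i * p1 j * p1 k * v\<^sup>2\<bar> \<le> \<tau>^3 * ((2 * \<mu> * \<phi>)^3 * v\<^sup>2)"
        using \<tau>0 by (intro mult_left_mono) (auto simp: abs_mult)
      show "\<tau> * \<bar>h k l * v * v1 j\<bar> \<le> H * ((\<tau>\<^sup>2 * v\<^sup>2 + V) / 2)" by (rule hv[OF H(1)])
    qed
    then show ?thesis unfolding sum4_const N4_def[symmetric] by (simp add: power_mult_distrib algebra_simps)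
  qed
  have Q: "\<tau> * \<bar>Q\<bar> \<le> N4 * lam\<^sup>2 * H * ((\<tau>\<^sup>2 * v\<^sup>2 + V) / 2)"
  proof -
    have "\<tau> * \<bar>Q\<bar> \<le> \<tau> * (lam\<^sup>2 * sum4 (\<lambda>i j k l. \<bar>h1 i k l * v * v1 j\<bar>))"
      unfolding Q_def using \<tau>0 by (intro mult_left_mono quad4_abs B) auto
    also have "\<dots> = lam\<^sup>2 * sum4 (\<lambda>i j k l. \<tau> * \<bar>h1 i k l * v * v1 j\<bar>)"
      by (simp add: sum4_def sum_distrib_left mult.left_commute)
    also have "\<dots> \<le> lam\<^sup>2 * sum4 (\<lambda>i j k l::'n. H * ((\<tau>\<^sup>2 * v\<^sup>2 + V) / 2))"
      by (intro mult_left_mono sum4_mono hv H) auto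
    finally show ?thesis unfolding sum4_const N4_def[symmetric] by (simp add: mult_ac)
  qed
  have db: "\<bar>d\<bar> \<le> D"
  proof -
    have "\<bar>d\<bar> \<le> (\<Sum>i\<in>UNIV. \<Sum>j\<in>UNIV. \<bar>B i j * (h i j - p2 i j)\<bar>)"
      unfolding d_def quad2_def by (intro order_trans[OF sum_abs] sum_mono order_refl)
    also have "\<dots> \<le> (\<Sum>i\<in>(UNIV::'n set). \<Sum>j\<in>(UNIV::'n set). lam * (4 * \<mu>\<^sup>2))"
    proof (intro sum_mono)
      fix i j
      have "\<phi> * (\<bar>x i\<bar> * \<bar>x j\<bar>) \<le> 1 * (1 * 1)" using \<phi> \<phi>0 by (intro mult_mono x1) auto
      then have "\<bar>h i j - p2 i j\<bar> \<le> 4 * \<mu>\<^sup>2" unfolding h using \<phi>0 by (simp add: abs_mult mult.assoc mult_left_le)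
      then show "\<bar>B i j * (h i j - p2 i j)\<bar> \<le> lam * (4 * \<mu>\<^sup>2)"
        unfolding abs_mult using B lam by (intro mult_mono) auto
    qed
    finally show ?thesis by (simp add: D_def power2_eq_square)
  qed
  have M1: "\<phi> * \<mu> * (6 * L * N4 + 1) * V \<le> M1"
  proof -
    have "\<phi> * \<mu> * (6 * L * N4 + 1) * V \<le> \<phi> * \<mu> * (4 * \<mu> * r\<^sup>2 / lam\<^sup>2 - 4 * ((real CARD('n))\<^sup>2 * lam\<^sup>2)) * V"
      using \<mu>1 \<phi>0 \<mu>0 V0 by (intro mult_right_mono mult_left_mono) (auto simp: N4_def)
    also have "\<dots> \<le> M1" unfolding V_def M1_def
      by (rule radial_positivity(1)[OF B(2) ell lam r \<phi>0 \<mu>0 p1 p2 h])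
    finally show ?thesis .
  qed
  have M2: "\<phi>^3 * \<mu>^3 * (8 * L * N4 + 1) \<le> M2"
  proof -
    have "\<phi>^3 * \<mu>^3 * (8 * L * N4 + 1) \<le> \<phi>^3 * \<mu>^3 * (16 * \<mu> * r^4 / lam\<^sup>2 - 16 * ((real CARD('n))\<^sup>2 * lam\<^sup>2))"
      using \<mu>2 \<phi>0 \<mu>0 V0 by (intro mult_left_mono) (auto simp: N4_def)
    also have "\<dots> \<le> M2" unfolding M2_def
      by (rule radial_positivity(2)[OF B(2) ell lam r \<phi>0 \<mu>0 p1 p2 h])
    finally show ?thesis .
  qed
  have c0: "?c0 \<le> \<phi>^3 * \<mu>^3" "?c0 \<le> \<phi> * \<mu>"
  proof -
    have a: "?c0 \<le> \<phi>^3" using \<phi> by (intro power_mono) auto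
    have "\<phi>^3 * 1 \<le> \<phi>^3 * \<mu>^3" using \<mu> \<phi>0 by (intro mult_left_mono one_le_power) auto
    then show "?c0 \<le> \<phi>^3 * \<mu>^3" using a by linarith
    have "\<phi>^3 \<le> \<phi>^1" using \<phi> \<phi>0 by (intro power_decreasing) auto
    moreover have "\<phi> * 1 \<le> \<phi> * \<mu>" using \<mu> \<phi>0 by (intro mult_left_mono) auto
    ultimately show "?c0 \<le> \<phi> * \<mu>" using a by simp
  qed
  define Y where "Y = \<tau>\<^sup>2 * v\<^sup>2 + V"
  have Y0: "Y \<ge> 0" using V0 by (simp add: Y_def)
  have a1: "\<tau> * M1 \<ge> 6 * L * N4 * \<tau> * \<mu> * \<phi> * V + ?c0 * (\<tau> * V)"
  proof -
    have "?c0 * (\<tau> * V) \<le> (\<phi> * \<mu>) * (\<tau> * V)" using c0 \<tau>0 V0 by (intro mult_right_mono) auto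
    moreover have "\<tau> * (\<phi> * \<mu> * (6 * L * N4 + 1) * V) \<le> \<tau> * M1" using M1 \<tau>0 by (intro mult_left_mono) auto
    ultimately show ?thesis by (simp add: algebra_simps)
  qed
  have a2: "\<tau>^3 * M2 * v\<^sup>2 \<ge> 8 * L * N4 * \<tau>^3 * \<mu>^3 * \<phi>^3 * v\<^sup>2 + ?c0 * (\<tau>^3 * v\<^sup>2)"
  proof -
    have "?c0 * (\<tau>^3 * v\<^sup>2) \<le> (\<phi>^3 * \<mu>^3) * (\<tau>^3 * v\<^sup>2)" using c0 \<tau>0 V0 by (intro mult_right_mono) auto
    moreover have "\<tau>^3 * (\<phi>^3 * \<mu>^3 * (8 * L * N4 + 1)) * v\<^sup>2 \<le> \<tau>^3 * M2 * v\<^sup>2"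
      using M2 \<tau>0 by (intro mult_left_mono mult_right_mono) auto
    ultimately show ?thesis by (simp add: algebra_simps)
  qed
  have a3: "L * ?E \<le> 6 * L * N4 * \<tau> * \<mu> * \<phi> * V + 8 * L * N4 * \<tau>^3 * \<mu>^3 * \<phi>^3 * v\<^sup>2 + N4 * H * L * (Y / 2)"
    using mult_left_mono[OF E L] by (simp add: Y_def algebra_simps)
  have a4: "\<tau> * Q \<ge> - (N4 * H * lam\<^sup>2 * (Y / 2))"
  proof -
    have "- (\<tau> * \<bar>Q\<bar>) \<le> \<tau> * Q" using \<tau>0 mult_left_mono[of "- \<bar>Q\<bar>" Q \<tau>] by simp
    then show ?thesis using Q by (simp add: Y_def mult_ac)
  qed
  have a5: "S * T \<le> P\<^sup>2 / 2 + D\<^sup>2 * Y / 2"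
  proof -
    have P': "S + T = P - \<tau> * d * v" unfolding P S_def T_def d_def by simp
    have "4 * (S * T) \<le> (S + T)\<^sup>2" using zero_le_power2[of "S - T"] by (simp add: power2_eq_square algebra_simps)
    also have "\<dots> \<le> 2 * P\<^sup>2 + 2 * (\<tau> * d * v)\<^sup>2"
      unfolding P' using zero_le_power2[of "P + \<tau> * d * v"] by (simp add: power2_eq_square algebra_simps)
    also have "(\<tau> * d * v)\<^sup>2 = d\<^sup>2 * (\<tau>\<^sup>2 * v\<^sup>2)" by (simp add: power_mult_distrib)
    also have "d\<^sup>2 * (\<tau>\<^sup>2 * v\<^sup>2) \<le> D\<^sup>2 * Y"
      using db V0 by (intro mult_mono) (auto simp: Y_def abs_le_square_iff[symmetric])
    finally show ?thesis by simp
  qed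
  have a6: "(N4 * H * (L + lam\<^sup>2) + D\<^sup>2) * Y \<le> ?c0 / 2 * (\<tau> * V + \<tau>^3 * v\<^sup>2)"
  proof -
    have "(N4 * H * (L + lam\<^sup>2) + D\<^sup>2) * Y \<le> (?c0 * \<tau> / 2) * Y"
      using \<tau>(2) Y0 unfolding N4_def D_def by (intro mult_right_mono) auto
    then show ?thesis by (simp add: Y_def algebra_simps power2_eq_square power3_eq_cube)
  qed
  have a7: "N4 * H * L * (Y / 2) + N4 * H * lam\<^sup>2 * (Y / 2) + D\<^sup>2 * Y / 2 \<le> (N4 * H * (L + lam\<^sup>2) + D\<^sup>2) * Y"
  proof -
    have "(N4 * H * (L + lam\<^sup>2) + D\<^sup>2) * Y \<ge> 0" using N4 H0 L Y0 by simp
    then show ?thesis by (simp add: algebra_simps)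
  qed
  have a6': "(N4 * H * (L + lam\<^sup>2) + D\<^sup>2) * Y \<le> (?c0 * (\<tau> * V) + ?c0 * (\<tau>^3 * v\<^sup>2)) / 2"
    using a6 by (simp add: algebra_simps)
  have b: "?c0 / 2 * (\<tau> * V + \<tau>^3 * v\<^sup>2) = (?c0 * (\<tau> * V) + ?c0 * (\<tau>^3 * v\<^sup>2)) / 2"
    by (simp add: algebra_simps)
  have "y / 2 + G + LE \<le> p"
    if "st = m1 + m2 + q + G" "m1 \<ge> e1 + c1" "m2 \<ge> e2 + c2" "LE \<le> e1 + e2 + u1" "q \<ge> - u2"
      "st \<le> p + u3" "u1 + u2 + u3 \<le> u4" "u4 \<le> y / 2" "y = c1 + c2"
    for y G LE p st m1 m2 q e1 e2 c1 c2 u1 u2 u3 u4 :: real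
    using that by linarith
  from this[OF ST a1 a2 a3 a4 a5 a7 a6' refl] show ?thesis
    unfolding V_def[symmetric] b .
qed

section \<open>The Carleman estimate with uniform constants\<close>

lemma C2D:
  assumes "C2 f f1 f2"
  shows "continuous_on UNIV f" "continuous_on UNIV (f1 i)" "continuous_on UNIV (f2 i j)"
    "has_partial i f (f1 i)" "has_partial j (f1 i) (f2 i j)" "f2 i j = f2 j i"
  using assms by (auto simp: C2_def)

lemma C2_mult:
  assumes f: "C2 f f1 f2" and g: "C2 g g1 g2"
  shows "C2 (\<lambda>x. f x * g x) (\<lambda>i x. f1 i x * g x + f x * g1 i x)
     (\<lambda>i j x. f2 i j x * g x + f1 i x * g1 j x + (f1 j x * g1 i x + f x * g2 i j x))"
  unfolding C2_def
proof (intro conjI allI)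
  note c = C2D(1-3)[OF f] C2D(1-3)[OF g]
  show "continuous_on UNIV (\<lambda>x. f x * g x)" by (intro continuous_intros c)
  fix i j
  show "continuous_on UNIV (\<lambda>x. f1 i x * g x + f x * g1 i x)" by (intro continuous_intros c)
  show "has_partial i (\<lambda>x. f x * g x) (\<lambda>x. f1 i x * g x + f x * g1 i x)"
    by (intro has_partial_mult C2D(4)[OF f] C2D(4)[OF g])
  show "continuous_on UNIV (\<lambda>x. f2 i j x * g x + f1 i x * g1 j x + (f1 j x * g1 i x + f x * g2 i j x))"
    by (intro continuous_intros c)
  show "has_partial j (\<lambda>x. f1 i x * g x + f x * g1 i x) (\<lambda>x. f2 i j x * g x + f1 i x * g1 j x + (f1 j x * g1 i x + f x * g2 i j x))"
    by (intro has_partial_add has_partial_mult C2D(4,5)[OF f] C2D(4,5)[OF g])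
  show "(\<lambda>x. f2 i j x * g x + f1 i x * g1 j x + (f1 j x * g1 i x + f x * g2 i j x))
      = (\<lambda>x. f2 j i x * g x + f1 j x * g1 i x + (f1 i x * g1 j x + f x * g2 j i x))"
    using C2D(6)[OF f, of i j] C2D(6)[OF g, of i j] by (simp add: algebra_simps)
qed

lemma C2_chain:
  assumes f: "C2 f f1 f2"
    and g: "\<And>t. (g has_real_derivative g' t) (at t)" "\<And>t. (g' has_real_derivative g'' t) (at t)"
    and cont: "continuous_on UNIV g''"
  shows "C2 (\<lambda>x. g (f x)) (\<lambda>i x. g' (f x) * f1 i x)
     (\<lambda>i j x. (g'' (f x) * f1 j x) * f1 i x + g' (f x) * f2 i j x)"
proof -
  have cg: "continuous_on UNIV g" "continuous_on UNIV g'"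
    using g by (auto intro!: DERIV_continuous_on intro: has_field_derivative_at_within)
  have c: "continuous_on UNIV (\<lambda>x. g (f x))" "continuous_on UNIV (\<lambda>x. g' (f x))" "continuous_on UNIV (\<lambda>x. g'' (f x))"
    by (rule continuous_on_compose2[OF cg(1) C2D(1)[OF f]] continuous_on_compose2[OF cg(2) C2D(1)[OF f]]
        continuous_on_compose2[OF cont C2D(1)[OF f]]; simp)+
  show ?thesis
    unfolding C2_def
  proof (intro conjI allI)
    note c = c C2D(1-3)[OF f]
    show "continuous_on UNIV (\<lambda>x. g (f x))" by (rule c)
    fix i j
    show "continuous_on UNIV (\<lambda>x. g' (f x) * f1 i x)"
      "continuous_on UNIV (\<lambda>x. g'' (f x) * f1 j x * f1 i x + g' (f x) * f2 i j x)"
      by (intro continuous_intros c)+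
    show "has_partial i (\<lambda>x. g (f x)) (\<lambda>x. g' (f x) * f1 i x)"
      by (intro has_partial_chain C2D(4)[OF f] g)
    show "has_partial j (\<lambda>x. g' (f x) * f1 i x) (\<lambda>x. g'' (f x) * f1 j x * f1 i x + g' (f x) * f2 i j x)"
      by (intro has_partial_chain has_partial_mult C2D(4,5)[OF f] g)
    show "(\<lambda>x. g'' (f x) * f1 j x * f1 i x + g' (f x) * f2 i j x) = (\<lambda>x. g'' (f x) * f1 i x * f1 j x + g' (f x) * f2 j i x)"
      using C2D(6)[OF f, of i j] by (simp add: mult_ac)
  qed
qed

lemma C2_norm2: "C2 (\<lambda>x::real^'n. (norm x)\<^sup>2) (\<lambda>i x. 2 * x $ i) (\<lambda>i j x. 2 * (if i = j then 1 else 0))"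
proof -
  have "has_partial j (\<lambda>x. 2 * x $ i) (\<lambda>x. 2 * (if i = j then 1 else 0))" for i j :: 'n
    using has_partial_mult[OF has_partial_const[of j 2] has_partial_coord[of j i]] by (simp add: eq_commute)
  then show ?thesis unfolding C2_def by (auto intro!: continuous_intros has_partial_norm2)
qed

lemma C2_weight:
  "C2 (weight \<mu>) (\<lambda>i x::real^'n. - 2 * \<mu> * x $ i * weight \<mu> x)
     (\<lambda>i j x. weight \<mu> x * (4 * \<mu>\<^sup>2 * (x $ i * x $ j) - 2 * \<mu> * (if i = j then 1 else 0)))"
proof -
  have "C2 (\<lambda>x::real^'n. exp (- \<mu> * (norm x)\<^sup>2)) (\<lambda>i x. (- \<mu> * exp (- \<mu> * (norm x)\<^sup>2)) * (2 * x $ i))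
    (\<lambda>i j x. ((\<mu>\<^sup>2 * exp (- \<mu> * (norm x)\<^sup>2)) * (2 * x $ j)) * (2 * x $ i)
       + (- \<mu> * exp (- \<mu> * (norm x)\<^sup>2)) * (2 * (if i = j then 1 else 0)))"
    by (rule C2_chain[OF C2_norm2, where g = "\<lambda>t. exp (- \<mu> * t)" and g' = "\<lambda>t. - \<mu> * exp (- \<mu> * t)"
          and g'' = "\<lambda>t. \<mu>\<^sup>2 * exp (- \<mu> * t)"])
      (auto intro!: derivative_eq_intros continuous_intros simp: power2_eq_square)
  then show ?thesis
    unfolding weight_def by (rule back_subst[where P = "\<lambda>f. C2 _ _ f", OF back_subst[where P = "\<lambda>f. C2 _ f _"]])
      (auto simp: fun_eq_iff algebra_simps power2_eq_square)
qed

lemma C2_exp_weight: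
  assumes f: "C2 f f1 f2"
  shows "C2 (\<lambda>x. exp (\<tau> * f x)) (\<lambda>i x. \<tau> * exp (\<tau> * f x) * f1 i x)
    (\<lambda>i j x. (\<tau>\<^sup>2 * exp (\<tau> * f x) * f1 j x) * f1 i x + \<tau> * exp (\<tau> * f x) * f2 i j x)"
  by (rule C2_chain[OF f, where g = "\<lambda>t. exp (\<tau> * t)" and g' = "\<lambda>t. \<tau> * exp (\<tau> * t)" and g'' = "\<lambda>t. \<tau>\<^sup>2 * exp (\<tau> * t)"])
    (auto intro!: derivative_eq_intros continuous_intros simp: power2_eq_square)

lemma C2_zero_on_open:
  assumes "C2 f f1 f2" "open U" "\<And>x. x \<in> U \<Longrightarrow> f x = 0" "x \<in> U"
  shows "f1 i x = 0" "f2 i j x = 0"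
proof -
  have a: "f1 i x = 0" if "x \<in> U" for x i
    by (rule has_partial_zero_on_open[OF C2D(4)[OF assms(1)] assms(2) assms(3) that])
  show "f1 i x = 0" using a assms(4) .
  show "f2 i j x = 0" by (rule has_partial_zero_on_open[OF C2D(5)[OF assms(1)] assms(2) a assms(4)])
qed

text \<open>The conjugation that \<open>multiplier_identity\<close> presupposes: with \<open>E = exp (\<tau> * \<phi>)\<close>, the formulas for
  \<open>v1\<close> and \<open>v2\<close> are the derivatives of \<open>E * w\<close>.\<close>

lemma conjugation_identity:
  fixes B :: "'n::finite \<Rightarrow> 'n \<Rightarrow> real"
  assumes B: "\<And>i j. B i j = B j i"
    and v1_def: "v1 = (\<lambda>i. (\<tau> * E * p1 i) * w + E * w1 i)"
    and v2_def: "v2 = (\<lambda>i j. ((\<tau>\<^sup>2 * E * p1 j) * p1 i + \<tau> * E * p2 i j) * w + (\<tau> * E * p1 i) * w1 j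
                + ((\<tau> * E * p1 j) * w1 i + E * w2 i j))"
  shows "E * quad2 B w2 = quad2 B v2 + \<tau>^2 * quad2 B (\<lambda>i j. p1 i * p1 j) * (E * w)
              + (- 2 * \<tau> * quad2 B (\<lambda>k l. p1 k * v1 l) - \<tau> * quad2 B h * (E * w))
              + \<tau> * quad2 B (\<lambda>k l. h k l - p2 k l) * (E * w)"
proof -
  define a where "a = quad2 B (\<lambda>i j. p1 i * p1 j)"
  define b where "b = quad2 B (\<lambda>i j. p1 i * w1 j)"
  have b': "quad2 B (\<lambda>i j. p1 j * w1 i) = b"
    unfolding b_def quad2_def by (subst sum.swap) (simp add: B[of i j for i j])
  have "quad2 B v2 = quad2 B (\<lambda>i j. (\<tau>\<^sup>2 * E * w) * (p1 i * p1 j) + (\<tau> * E * w) * p2 i j + (\<tau> * E) * (p1 i * w1 j)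
     + ((\<tau> * E) * (p1 j * w1 i) + E * w2 i j))"
    unfolding v2_def by (intro arg_cong[where f = "quad2 B"] ext) (simp add: algebra_simps)
  then have 1: "quad2 B v2 = (\<tau>\<^sup>2 * E * w) * a + (\<tau> * E * w) * quad2 B p2 + (\<tau> * E) * b + ((\<tau> * E) * b + E * quad2 B w2)"
    by (simp only: quad2_add quad2_cmult a_def b_def b'[unfolded b_def])
  have "quad2 B (\<lambda>k l. p1 k * v1 l) = quad2 B (\<lambda>k l. (\<tau> * E * w) * (p1 k * p1 l) + E * (p1 k * w1 l))"
    unfolding v1_def by (intro arg_cong[where f = "quad2 B"] ext) (simp add: algebra_simps)
  then have 2: "quad2 B (\<lambda>k l. p1 k * v1 l) = (\<tau> * E * w) * a + E * b"
    by (simp only: quad2_add quad2_cmult a_def b_def)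
  show ?thesis unfolding 1 2 quad2_diff a_def[symmetric] by (simp add: algebra_simps power2_eq_square)
qed

lemma lipschitz_product:
  fixes a b :: "real^'n \<Rightarrow> real"
  assumes "\<And>x. \<bar>a x\<bar> \<le> K" "\<And>x. \<bar>b x\<bar> \<le> K" "\<And>x y. \<bar>a x - a y\<bar> \<le> L * norm (x - y)"
    "\<And>x y. \<bar>b x - b y\<bar> \<le> L * norm (x - y)"
  shows "\<bar>a x * b x - a y * b y\<bar> \<le> (2 * K * L) * norm (x - y)"
proof -
  have "a x * b x - a y * b y = a x * (b x - b y) + (a x - a y) * b y" by (simp add: algebra_simps)
  then have "\<bar>a x * b x - a y * b y\<bar> \<le> \<bar>a x\<bar> * \<bar>b x - b y\<bar> + \<bar>a x - a y\<bar> * \<bar>b y\<bar>"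
    by (metis abs_mult abs_triangle_ineq)
  also have "\<dots> \<le> K * (L * norm (x - y)) + (L * norm (x - y)) * K"
    using assms order_trans[OF abs_ge_zero assms(1)] order_trans[OF abs_ge_zero assms(3)]
    by (intro add_mono mult_mono) auto
  finally show ?thesis by (simp add: algebra_simps)
qed

lemma elliptic_lipschitzD:
  assumes "elliptic_lipschitz lam L A"
  shows "A i j = A j i" "\<bar>A i j x\<bar> \<le> lam" "\<bar>A i j x - A i j y\<bar> \<le> L * norm (x - y)"
    "(\<Sum>i\<in>UNIV. (\<xi> i)\<^sup>2) \<le> lam * quad2 (\<lambda>i j. A i j x) (\<lambda>i j. \<xi> i * \<xi> j)"
    "continuous_on UNIV (A i j)"
proof -
  show "A i j = A j i" "\<bar>A i j x\<bar> \<le> lam" "\<bar>A i j x - A i j y\<bar> \<le> L * norm (x - y)"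
    "(\<Sum>i\<in>UNIV. (\<xi> i)\<^sup>2) \<le> lam * quad2 (\<lambda>i j. A i j x) (\<lambda>i j. \<xi> i * \<xi> j)"
    using assms unfolding elliptic_lipschitz_def quad2_def by blast+
  show "continuous_on UNIV (A i j)"
    using assms unfolding elliptic_lipschitz_def by (intro continuous_of_lipschitz) blast
qed

lemma sum4_add: "sum4 (\<lambda>i j k l. f i j k l + g i j k l) = sum4 f + sum4 g"
  unfolding sum4_def by (simp add: sum.distrib)

lemma norm_vec_sq: "(norm (x::real^'n))\<^sup>2 = (\<Sum>i\<in>UNIV. (x $ i)\<^sup>2)"
  unfolding power2_norm_eq_inner inner_vec_def by (simp add: power2_eq_square)

abbreviation second_order ::
  "('n::finite \<Rightarrow> 'n \<Rightarrow> real^'n \<Rightarrow> real) \<Rightarrow> ('n \<Rightarrow> 'n \<Rightarrow> real^'n \<Rightarrow> real) \<Rightarrow> real^'n \<Rightarrow> real" where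
  "second_order A w2 x \<equiv> quad2 (\<lambda>i j. A i j x) (\<lambda>i j. w2 i j x)"

lemma continuous_on_second_order:
  "(\<And>i j. continuous_on S (A i j)) \<Longrightarrow> (\<And>i j. continuous_on S (f i j)) \<Longrightarrow>
    continuous_on S (\<lambda>x. quad2 (\<lambda>i j. A i j x) (\<lambda>i j. f i j x))"
  unfolding quad2_def by (intro continuous_intros)

text \<open>The parameters are fixed before \<open>A\<close>, hence depend on the class of coefficients only. The proof
  integrates \<open>carleman_pointwise\<close> and uses \<open>lipschitz_ibp_sum\<close>, with the Lipschitz functions
  \<open>A\<^sub>i\<^sub>j A\<^sub>k\<^sub>l\<close>, to discard the terms in divergence form together with the error term.\<close>

theorem carleman_uniform:
  fixes lam L r :: real
  assumes lam: "lam > 0" and L: "L \<ge> 0" and r: "0 < r"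
  obtains \<mu> C \<tau>0 where "\<mu> \<ge> 1" "C > 0" "\<tau>0 \<ge> 1"
    "\<And>A (w :: real^'n \<Rightarrow> real) w1 w2 \<tau>. elliptic_lipschitz lam L A \<Longrightarrow> C2 w w1 w2 \<Longrightarrow>
       (\<And>x. norm x < r \<or> norm x > 1 \<Longrightarrow> w x = 0) \<Longrightarrow> \<tau> \<ge> \<tau>0 \<Longrightarrow>
       (\<integral>x. exp (2 * \<tau> * weight \<mu> x) * (\<tau> * (\<Sum>i\<in>UNIV. (w1 i x)\<^sup>2) + \<tau>^3 * (w x)\<^sup>2) \<partial>lborel)
       \<le> C * (\<integral>x. exp (2 * \<tau> * weight \<mu> x) * (second_order A w2 x)\<^sup>2 \<partial>lborel)"
proof -
  define N where "N = real CARD('n)"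
  define L2 where "L2 = 2 * lam * L"
  \<comment> \<open>the two conditions on \<open>\<mu>\<close> in \<open>carleman_pointwise\<close>, solved for \<open>\<mu>\<close>\<close>
  define \<mu>a where "\<mu>a = (4 * (N\<^sup>2 * lam\<^sup>2) + 6 * L2 * N^4 + 1) / (4 * r\<^sup>2 / lam\<^sup>2)"
  define \<mu>b where "\<mu>b = (16 * (N\<^sup>2 * lam\<^sup>2) + 8 * L2 * N^4 + 1) / (16 * r^4 / lam\<^sup>2)"
  define \<mu> where "\<mu> = max 1 (max \<mu>a \<mu>b)"
  define H where "H = (2 * \<mu> + 1) * (8 * \<mu>\<^sup>2 + 2 * \<mu>) + 16 * \<mu>\<^sup>2"
  define c0 where "c0 = exp (- \<mu>) ^ 3"
  define \<tau>0 where "\<tau>0 = max 1 ((N^4 * H * (L2 + lam\<^sup>2) + (N\<^sup>2 * lam * (4 * \<mu>\<^sup>2))\<^sup>2) / (c0 / 2))"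
  have \<mu>: "\<mu> \<ge> 1" "\<mu> > 0" unfolding \<mu>_def by auto
  have c0: "c0 > 0" unfolding c0_def by simp
  have L2: "L2 \<ge> 0" using lam L by (simp add: L2_def)
  have \<mu>1: "4 * \<mu> * r\<^sup>2 / lam\<^sup>2 - 4 * (N\<^sup>2 * lam\<^sup>2) \<ge> 6 * L2 * N^4 + 1"
  proof -
    have "\<mu>a \<le> \<mu>" by (simp add: \<mu>_def)
    then show ?thesis using r lam by (simp add: \<mu>a_def field_simps)
  qed
  have \<mu>2: "16 * \<mu> * r^4 / lam\<^sup>2 - 16 * (N\<^sup>2 * lam\<^sup>2) \<ge> 8 * L2 * N^4 + 1"
  proof -
    have "\<mu>b \<le> \<mu>" by (simp add: \<mu>_def)
    then show ?thesis using r lam by (simp add: \<mu>b_def field_simps)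
  qed
  show ?thesis
  proof (rule that[of \<mu> "(8 * \<mu>\<^sup>2 + 2) / c0" \<tau>0])
    show "\<mu> \<ge> 1" by fact
    show "(8 * \<mu>\<^sup>2 + 2) / c0 > 0" using c0 by (intro divide_pos_pos add_nonneg_pos) auto
    show "\<tau>0 \<ge> 1" by (simp add: \<tau>0_def)
    fix A :: "'n \<Rightarrow> 'n \<Rightarrow> real^'n \<Rightarrow> real" and w :: "real^'n \<Rightarrow> real" and w1 w2 \<tau>
    assume A: "elliptic_lipschitz lam L A" and w: "C2 w w1 w2"
      and z: "\<And>x. norm x < r \<or> norm x > 1 \<Longrightarrow> w x = 0" and "\<tau> \<ge> \<tau>0"
    have \<tau>: "\<tau> \<ge> 1" "c0 * \<tau> / 2 \<ge> N^4 * H * (L2 + lam\<^sup>2) + (N\<^sup>2 * lam * (4 * \<mu>\<^sup>2))\<^sup>2"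
      using \<open>\<tau> \<ge> \<tau>0\<close> c0 by (simp_all add: \<tau>0_def field_simps)
    define \<phi> where "\<phi> = (weight \<mu> :: real^'n \<Rightarrow> real)"
    define p1 where "p1 = (\<lambda>i (x::real^'n). - 2 * \<mu> * x $ i * \<phi> x)"
    define p2 where "p2 = (\<lambda>i j (x::real^'n). \<phi> x * (4 * \<mu>\<^sup>2 * (x $ i * x $ j) - 2 * \<mu> * (if i = j then 1 else 0)))"
    define h where "h = (\<lambda>i j (x::real^'n). p2 i j x + 4 * \<mu>\<^sup>2 * \<phi> x * (x $ i * x $ j))"
    define h1 where "h1 = (\<lambda>i k l (x::real^'n). p1 i x * (8 * \<mu>\<^sup>2 * (x $ k * x $ l) - 2 * \<mu> * (if k = l then 1 else 0))
       + \<phi> x * (8 * \<mu>\<^sup>2 * ((if i = k then 1 else 0) * x $ l + x $ k * (if i = l then 1 else 0))))"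
    define E where "E = (\<lambda>x. exp (\<tau> * \<phi> x))"
    define v where "v = (\<lambda>x. E x * w x)"
    define v1 where "v1 = (\<lambda>i x. (\<tau> * E x * p1 i x) * w x + E x * w1 i x)"
    define v2 where "v2 = (\<lambda>i j x. ((\<tau>\<^sup>2 * E x * p1 j x) * p1 i x + \<tau> * E x * p2 i j x) * w x
            + (\<tau> * E x * p1 i x) * w1 j x + ((\<tau> * E x * p1 j x) * w1 i x + E x * w2 i j x))"
    have p: "C2 \<phi> p1 p2" unfolding p1_def p2_def \<phi>_def by (rule C2_weight)
    have v: "C2 v v1 v2"
      unfolding v_def v1_def v2_def E_def by (intro C2_mult C2_exp_weight p w)
    have hh: "h = (\<lambda>k l x. \<phi> x * (8 * \<mu>\<^sup>2 * (x $ k * x $ l) - 2 * \<mu> * (if k = l then 1 else 0)))"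
      unfolding h_def p2_def by (intro ext) (simp add: algebra_simps)
    have ch: "continuous_on UNIV (h k l)" for k l
      unfolding hh by (intro continuous_intros C2D(1)[OF p])
    have ch1: "continuous_on UNIV (h1 i k l)" for i k l
      unfolding h1_def by (intro continuous_intros C2D(1,2)[OF p])
    have hpd: "has_partial i (h k l) (h1 i k l)" for i k l
    proof -
      have "has_partial i (\<lambda>x. \<phi> x * ((8 * \<mu>\<^sup>2) * (x $ k * x $ l) + (- 2 * \<mu> * (if k = l then 1 else 0))))
        (\<lambda>x. p1 i x * ((8 * \<mu>\<^sup>2) * (x $ k * x $ l) + (- 2 * \<mu> * (if k = l then 1 else 0)))
         + \<phi> x * (0 * (x $ k * x $ l) + (8 * \<mu>\<^sup>2) * ((if i = k then 1 else 0) * x $ l + x $ k * (if i = l then 1 else 0)) + 0))"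
        by (intro has_partial_mult has_partial_add C2D(4)[OF p] has_partial_const has_partial_coord)
      then show ?thesis unfolding hh h1_def by simp
    qed
    have \<phi>1: "0 < \<phi> x" "\<phi> x \<le> 1" for x unfolding \<phi>_def weight_def using \<mu> by auto
    have x1: "\<bar>x $ i\<bar> \<le> 1" if "norm x \<le> 1" for x :: "real^'n" and i
      using component_le_norm_cart[of x i] that by simp
    have hx: "\<bar>8 * \<mu>\<^sup>2 * (x $ k * x $ l) - 2 * \<mu> * (if k = l then 1 else 0)\<bar> \<le> 8 * \<mu>\<^sup>2 + 2 * \<mu>"
      if "norm x \<le> 1" for x :: "real^'n" and k l
    proof -
      have "\<bar>x $ k\<bar> * \<bar>x $ l\<bar> \<le> 1 * 1" by (intro mult_mono x1[OF that]) auto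
      then have "8 * \<mu>\<^sup>2 * \<bar>x $ k * x $ l\<bar> \<le> 8 * \<mu>\<^sup>2 * 1" unfolding abs_mult by (intro mult_left_mono) auto
      moreover have "\<bar>8 * \<mu>\<^sup>2 * (x $ k * x $ l)\<bar> = 8 * \<mu>\<^sup>2 * \<bar>x $ k * x $ l\<bar>" by (simp add: abs_mult)
      moreover have "\<bar>2 * \<mu> * (if k = l then 1 else 0)\<bar> \<le> 2 * \<mu>" using \<mu> by simp
      ultimately show ?thesis
        using abs_triangle_ineq4[of "8 * \<mu>\<^sup>2 * (x $ k * x $ l)" "2 * \<mu> * (if k = l then 1 else 0)"] by linarith
    qed
    have Hh: "\<bar>h k l x\<bar> \<le> H" if "norm x \<le> 1" for k l x
    proof -
      have "\<bar>h k l x\<bar> \<le> 1 * (8 * \<mu>\<^sup>2 + 2 * \<mu>)"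
        unfolding hh abs_mult[of "\<phi> x"] using \<phi>1[of x] by (intro mult_mono hx[OF that]) auto
      also have "\<dots> \<le> H" unfolding H_def using \<mu> by (simp add: algebra_simps)
      finally show ?thesis .
    qed
    have Hh1: "\<bar>h1 i k l x\<bar> \<le> H" if "norm x \<le> 1" for i k l x
    proof -
      have "\<bar>x $ i\<bar> * \<phi> x \<le> 1 * 1" using \<phi>1[of x] by (intro mult_mono x1[OF that]) auto
      then have "2 * \<mu> * (\<bar>x $ i\<bar> * \<phi> x) \<le> 2 * \<mu> * 1" using \<mu> by (intro mult_left_mono) auto
      moreover have "\<bar>p1 i x\<bar> = 2 * \<mu> * (\<bar>x $ i\<bar> * \<phi> x)" unfolding p1_def using \<mu> \<phi>1[of x] by (simp add: abs_mult)
      ultimately have a: "\<bar>p1 i x\<bar> \<le> 2 * \<mu>" by linarith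
      have b: "\<bar>p1 i x * (8 * \<mu>\<^sup>2 * (x $ k * x $ l) - 2 * \<mu> * (if k = l then 1 else 0))\<bar> \<le> 2 * \<mu> * (8 * \<mu>\<^sup>2 + 2 * \<mu>)"
        unfolding abs_mult[of "p1 i x"] by (intro mult_mono a hx[OF that]) (use \<mu> in auto)
      have "\<bar>(if i = k then 1 else 0) * x $ l + x $ k * (if i = l then 1 else 0)\<bar> \<le> 2"
        using x1[OF that, of l] x1[OF that, of k] by auto
      then have c2: "8 * \<mu>\<^sup>2 * \<bar>(if i = k then 1 else 0) * x $ l + x $ k * (if i = l then 1 else 0)\<bar> \<le> 8 * \<mu>\<^sup>2 * 2"
        by (rule mult_left_mono) simp
      have c': "\<phi> x * (8 * \<mu>\<^sup>2 * \<bar>(if i = k then 1 else 0) * x $ l + x $ k * (if i = l then 1 else 0)\<bar>) \<le> 1 * (8 * \<mu>\<^sup>2 * 2)"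
        using \<phi>1[of x] by (intro mult_mono c2) auto
      have c: "\<bar>\<phi> x * (8 * \<mu>\<^sup>2 * ((if i = k then 1 else 0) * x $ l + x $ k * (if i = l then 1 else 0)))\<bar> \<le> 16 * \<mu>\<^sup>2"
      proof -
        have "\<bar>\<phi> x * (8 * \<mu>\<^sup>2 * Z)\<bar> = \<phi> x * (8 * \<mu>\<^sup>2 * \<bar>Z\<bar>)" for Z
          using \<phi>1[of x] by (simp add: abs_mult)
        then show ?thesis using c' by simp
      qed
      have "2 * \<mu> * (8 * \<mu>\<^sup>2 + 2 * \<mu>) + 16 * \<mu>\<^sup>2 \<le> H" unfolding H_def using \<mu> by (simp add: algebra_simps)
      then show ?thesis using b c unfolding h1_def by (smt (verit))
    qed
    define a where "a = (\<lambda>(i::'n, j::'n, k::'n, l::'n) x. A i j x * A k l x)"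
    have aL: "\<bar>a p x - a p y\<bar> \<le> L2 * norm (x - y)" for p x y
      unfolding a_def L2_def by (cases p) (auto intro!: lipschitz_product elliptic_lipschitzD[OF A])
    have vz: "v x = 0" if "norm x < r \<or> norm x > 1" for x using z[OF that] by (simp add: v_def)
    have oU: "open {x :: real^'n. norm x < r \<or> norm x > 1}"
      by (intro open_Collect_disj open_Collect_less continuous_intros)
    have v1z: "v1 i x = 0" and v2z: "v2 i j x = 0" if "norm x < r \<or> norm x > 1" for x i j
      using C2_zero_on_open[OF v oU, of x] vz that by auto
    have w1z: "w1 i x = 0" and w2z: "w2 i j x = 0" if "norm x < r \<or> norm x > 1" for x i j
      using C2_zero_on_open[OF w oU, of x] z that by auto
    note cc = C2D(1-3)[OF p] C2D(1-3)[OF v] ch ch1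
    note pd = C2D(4,5)[OF p] C2D(4,5)[OF v] hpd
    \<comment> \<open>the four fields that are differentiated in \<open>multiplier_identity\<close>, the first and the last one with respect to the index \<open>i\<close>, the other two with respect to \<open>l\<close>; the summands with factor \<open>0\<close> make the derivatives literally those of the product rule\<close>
    define F1 where "F1 = (\<lambda>(i::'n, j::'n, k::'n, l::'n) x. - 2 * \<tau> * ((p1 k x * v1 l x) * v1 j x))"
    define F1' where "F1' = (\<lambda>(i::'n, j::'n, k::'n, l::'n) x. 0 * ((p1 k x * v1 l x) * v1 j x) + - 2 * \<tau> * ((p2 k i x * v1 l x + p1 k x * v2 l i x) * v1 j x + (p1 k x * v1 l x) * v2 j i x))"
    define F2 where "F2 = (\<lambda>(i::'n, j::'n, k::'n, l::'n) x. \<tau> * ((p1 k x * v1 i x) * v1 j x))"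
    define F2' where "F2' = (\<lambda>(i::'n, j::'n, k::'n, l::'n) x. 0 * ((p1 k x * v1 i x) * v1 j x) + \<tau> * ((p2 k l x * v1 i x + p1 k x * v2 i l x) * v1 j x + (p1 k x * v1 i x) * v2 j l x))"
    define F3 where "F3 = (\<lambda>(i::'n, j::'n, k::'n, l::'n) x. - (\<tau>^3) * (((p1 i x * p1 j x) * p1 k x) * (v x * v x)))"
    define F3' where "F3' = (\<lambda>(i::'n, j::'n, k::'n, l::'n) x. 0 * (((p1 i x * p1 j x) * p1 k x) * (v x * v x)) + - (\<tau>^3) * (((p2 i l x * p1 j x + p1 i x * p2 j l x) * p1 k x + (p1 i x * p1 j x) * p2 k l x) * (v x * v x)
        + ((p1 i x * p1 j x) * p1 k x) * (v1 l x * v x + v x * v1 l x)))"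
    define F4 where "F4 = (\<lambda>(i::'n, j::'n, k::'n, l::'n) x. - \<tau> * ((h k l x * v x) * v1 j x))"
    define F4' where "F4' = (\<lambda>(i::'n, j::'n, k::'n, l::'n) x. 0 * ((h k l x * v x) * v1 j x) + - \<tau> * ((h1 i k l x * v x + h k l x * v1 i x) * v1 j x + (h k l x * v x) * v2 j i x))"
    define di where "di = (\<lambda>(i::'n, j::'n, k::'n, l::'n). i)"
    define dl where "dl = (\<lambda>(i::'n, j::'n, k::'n, l::'n). l)"
    have k1a: "has_partial (di p) (F1 p) (F1' p)" for p
      unfolding F1_def F1'_def di_def
      by (cases p rule: prod_cases4) (hypsubst, simp only: prod.case, intro has_partial_mult has_partial_add has_partial_const pd)
    have k1b: "continuous_on UNIV (F1 p)" "continuous_on UNIV (F1' p)" for p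
      unfolding F1_def F1'_def
      by (cases p rule: prod_cases4; hypsubst, simp only: prod.case, intro continuous_intros cc)+
    have k1c: "F1 p x = 0" if "x \<notin> cball 0 1" for p x
      using v1z[of x] that by (auto simp: F1_def split: prod.split)
    note ib1 = lipschitz_ibp_sum[of a L2 di F1 F1' 1, OF aL k1a k1b k1c]
    have k2a: "has_partial (dl p) (F2 p) (F2' p)" for p
      unfolding F2_def F2'_def dl_def
      by (cases p rule: prod_cases4) (hypsubst, simp only: prod.case, intro has_partial_mult has_partial_add has_partial_const pd)
    have k2b: "continuous_on UNIV (F2 p)" "continuous_on UNIV (F2' p)" for p
      unfolding F2_def F2'_def
      by (cases p rule: prod_cases4; hypsubst, simp only: prod.case, intro continuous_intros cc)+
    have k2c: "F2 p x = 0" if "x \<notin> cball 0 1" for p x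
      using v1z[of x] that by (auto simp: F2_def split: prod.split)
    note ib2 = lipschitz_ibp_sum[of a L2 dl F2 F2' 1, OF aL k2a k2b k2c]
    have k3a: "has_partial (dl p) (F3 p) (F3' p)" for p
      unfolding F3_def F3'_def dl_def
      by (cases p rule: prod_cases4) (hypsubst, simp only: prod.case, intro has_partial_mult has_partial_add has_partial_const pd)
    have k3b: "continuous_on UNIV (F3 p)" "continuous_on UNIV (F3' p)" for p
      unfolding F3_def F3'_def
      by (cases p rule: prod_cases4; hypsubst, simp only: prod.case, intro continuous_intros cc)+
    have k3c: "F3 p x = 0" if "x \<notin> cball 0 1" for p x
      using vz[of x] that by (auto simp: F3_def split: prod.split)
    note ib3 = lipschitz_ibp_sum[of a L2 dl F3 F3' 1, OF aL k3a k3b k3c]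
    have k4a: "has_partial (di p) (F4 p) (F4' p)" for p
      unfolding F4_def F4'_def di_def
      by (cases p rule: prod_cases4) (hypsubst, simp only: prod.case, intro has_partial_mult has_partial_add has_partial_const pd)
    have k4b: "continuous_on UNIV (F4 p)" "continuous_on UNIV (F4' p)" for p
      unfolding F4_def F4'_def
      by (cases p rule: prod_cases4; hypsubst, simp only: prod.case, intro continuous_intros cc)+
    have k4c: "F4 p x = 0" if "x \<notin> cball 0 1" for p x
      using vz[of x] that by (auto simp: F4_def split: prod.split)
    note ib4 = lipschitz_ibp_sum[of a L2 di F4 F4' 1, OF aL k4a k4b k4c]
    define G where "G x = (\<Sum>p\<in>UNIV. a p x * F1' p x) + (\<Sum>p\<in>UNIV. a p x * F2' p x) + (\<Sum>p\<in>UNIV. a p x * F3' p x) + (\<Sum>p\<in>UNIV. a p x * F4' p x)" for x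
    define EE where "EE x = (\<Sum>p\<in>UNIV. \<bar>F1 p x\<bar>) + (\<Sum>p\<in>UNIV. \<bar>F2 p x\<bar>) + (\<Sum>p\<in>UNIV. \<bar>F3 p x\<bar>) + (\<Sum>p\<in>UNIV. \<bar>F4 p x\<bar>)" for x
    have iG: "integrable lborel G" unfolding G_def using ib1(2) ib2(2) ib3(2) ib4(2) by auto
    have iE: "integrable lborel EE" unfolding EE_def using ib1(3) ib2(3) ib3(3) ib4(3) by auto
    have IG: "(\<integral>x. G x \<partial>lborel) + L2 * (\<integral>x. EE x \<partial>lborel) \<ge> 0"
    proof -
      have "(\<integral>x. G x \<partial>lborel) = (\<integral>x. (\<Sum>p\<in>UNIV. a p x * F1' p x) \<partial>lborel) + (\<integral>x. (\<Sum>p\<in>UNIV. a p x * F2' p x) \<partial>lborel)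
          + (\<integral>x. (\<Sum>p\<in>UNIV. a p x * F3' p x) \<partial>lborel) + (\<integral>x. (\<Sum>p\<in>UNIV. a p x * F4' p x) \<partial>lborel)"
        unfolding G_def using ib1(2) ib2(2) ib3(2) ib4(2)
        by (simp del: Bochner_Integration.integral_sum)
      moreover have "L2 * (\<integral>x. EE x \<partial>lborel) = L2 * (\<integral>x. (\<Sum>p\<in>UNIV. \<bar>F1 p x\<bar>) \<partial>lborel) + L2 * (\<integral>x. (\<Sum>p\<in>UNIV. \<bar>F2 p x\<bar>) \<partial>lborel)
          + L2 * (\<integral>x. (\<Sum>p\<in>UNIV. \<bar>F3 p x\<bar>) \<partial>lborel) + L2 * (\<integral>x. (\<Sum>p\<in>UNIV. \<bar>F4 p x\<bar>) \<partial>lborel)"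
        unfolding EE_def using ib1(3) ib2(3) ib3(3) ib4(3)
        by (simp add: distrib_left del: Bochner_Integration.integral_sum)
      ultimately show ?thesis using ib1(1) ib2(1) ib3(1) ib4(1) by linarith
    qed
    define P where "P x = E x * second_order A w2 x" for x
    define V where "V x = \<tau> * (\<Sum>i\<in>UNIV. (v1 i x)\<^sup>2) + \<tau>^3 * (v x)\<^sup>2" for x
    have pt: "c0 / 2 * V x + G x + L2 * EE x \<le> (P x)\<^sup>2 / 2" for x
    proof (cases "norm x < r \<or> norm x > 1")
      case True
      then show ?thesis
        unfolding V_def G_def EE_def F1'_def F2'_def F3'_def F4'_def F1_def F2_def F3_def F4_def
        using vz v1z v2z by (simp add: case_prod_beta)
    next
      case False
      then have nx: "r \<le> norm x" "norm x \<le> 1" by auto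
      have nx2: "r\<^sup>2 \<le> (\<Sum>i\<in>UNIV. (x $ i)\<^sup>2)" "(\<Sum>i\<in>UNIV. (x $ i)\<^sup>2) \<le> 1"
        using nx r unfolding norm_vec_sq[symmetric] by (auto intro: power_mono simp: power_le_one)
      have ephi: "exp (- \<mu>) \<le> \<phi> x"
      proof -
        have "\<mu> * (norm x)\<^sup>2 \<le> \<mu> * 1" using nx \<mu> by (intro mult_left_mono) (auto simp: power_le_one)
        then show ?thesis by (simp add: \<phi>_def weight_def)
      qed
      have PP: "P x = quad2 (\<lambda>i j. A i j x) (\<lambda>i j. v2 i j x) + \<tau>^2 * quad2 (\<lambda>i j. A i j x) (\<lambda>i j. p1 i x * p1 j x) * v x
              + (- 2 * \<tau> * quad2 (\<lambda>i j. A i j x) (\<lambda>k l. p1 k x * v1 l x) - \<tau> * quad2 (\<lambda>i j. A i j x) (\<lambda>k l. h k l x) * v x)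
              + \<tau> * quad2 (\<lambda>i j. A i j x) (\<lambda>k l. h k l x - p2 k l x) * v x"
        unfolding P_def v2_def v1_def v_def
        by (rule conjugation_identity[OF _ refl refl]) (simp add: elliptic_lipschitzD(1)[OF A, of i j for i j])
      have Asym: "A i j x = A j i x" for i j using elliptic_lipschitzD(1)[OF A, of i j] by simp
      have v2sym: "v2 i j x = v2 j i x" for i j using C2D(6)[OF v, of i j] by simp
      note CP = carleman_pointwise[where B = "\<lambda>i j. A i j x" and lam = lam and L = L2 and r = r and x = "\<lambda>i. x $ i"
          and \<phi> = "\<phi> x" and \<mu> = \<mu> and ?p1.0 = "\<lambda>i. p1 i x" and ?p2.0 = "\<lambda>i j. p2 i j x" and h = "\<lambda>i j. h i j x"
          and ?h1.0 = "\<lambda>i k l. h1 i k l x" and H = H and v = "v x" and ?v1.0 = "\<lambda>i. v1 i x" and ?v2.0 = "\<lambda>i j. v2 i j x"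
          and \<tau> = \<tau> and P = "P x"]
      have GG: "G x = quad4 (\<lambda>i j. A i j x) (\<lambda>i j k l. - 2 * \<tau> * (p2 k i x * v1 l x * v1 j x + p1 k x * v2 l i x * v1 j x + p1 k x * v1 l x * v2 j i x))
   + quad4 (\<lambda>i j. A i j x) (\<lambda>i j k l. \<tau> * (p2 k l x * v1 i x * v1 j x + p1 k x * v2 i l x * v1 j x + p1 k x * v1 i x * v2 j l x))
   + quad4 (\<lambda>i j. A i j x) (\<lambda>i j k l. - (\<tau>^3) * ((p2 i l x * p1 j x * p1 k x + p1 i x * p2 j l x * p1 k x + p1 i x * p1 j x * p2 k l x) * (v x)^2
                                 + p1 i x * p1 j x * p1 k x * (2 * v x * v1 l x)))
   + quad4 (\<lambda>i j. A i j x) (\<lambda>i j k l. - \<tau> * (h1 i k l x * v x * v1 j x + h k l x * v1 i x * v1 j x + h k l x * v x * v2 j i x))"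
        unfolding G_def sum4_prod unfolding quad4_def sum4_def a_def F1'_def F2'_def F3'_def F4'_def prod.case
        by (intro arg_cong2[where f = "(+)"] sum.cong refl) (simp_all add: algebra_simps power2_eq_square)
      have EEx: "EE x = sum4 (\<lambda>i j k l. 2 * \<tau> * \<bar>p1 k x * v1 l x * v1 j x\<bar> + \<tau> * \<bar>p1 k x * v1 i x * v1 j x\<bar>
        + \<tau>^3 * \<bar>p1 i x * p1 j x * p1 k x * (v x)\<^sup>2\<bar> + \<tau> * \<bar>h k l x * v x * v1 j x\<bar>)"
        unfolding EE_def sum4_prod F1_def F2_def F3_def F4_def prod.case sum4_add[symmetric]
        using \<tau> by (intro arg_cong[where f = sum4] ext) (simp add: abs_mult power2_eq_square)
      have "c0 / 2 * V x + G x + L2 * EE x \<le> (P x)\<^sup>2 / 2"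
        unfolding c0_def V_def GG EEx
      proof (rule CP)
        show "\<And>i j. A i j x = A j i x" by (rule Asym)
        show "\<And>i j. v2 i j x = v2 j i x" by (rule v2sym)
        show "\<And>i j. \<bar>A i j x\<bar> \<le> lam" by (rule elliptic_lipschitzD(2)[OF A])
        show "\<And>\<xi>. (\<Sum>i\<in>UNIV. (\<xi> i)\<^sup>2) \<le> lam * quad2 (\<lambda>i j. A i j x) (\<lambda>i j. \<xi> i * \<xi> j)"
          by (rule elliptic_lipschitzD(4)[OF A])
        show "\<And>k l. \<bar>h k l x\<bar> \<le> H" "\<And>i k l. \<bar>h1 i k l x\<bar> \<le> H" using nx by (auto intro: Hh Hh1)
        show "6 * L2 * real CARD('n) ^ 4 + 1 \<le> 4 * \<mu> * r\<^sup>2 / lam\<^sup>2 - 4 * ((real CARD('n))\<^sup>2 * lam\<^sup>2)"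
          using \<mu>1 unfolding N_def .
        show "8 * L2 * real CARD('n) ^ 4 + 1 \<le> 16 * \<mu> * r ^ 4 / lam\<^sup>2 - 16 * ((real CARD('n))\<^sup>2 * lam\<^sup>2)"
          using \<mu>2 unfolding N_def .
        show "real CARD('n) ^ 4 * H * (L2 + lam\<^sup>2) + ((real CARD('n))\<^sup>2 * lam * (4 * \<mu>\<^sup>2))\<^sup>2 \<le> exp (- \<mu>) ^ 3 * \<tau> / 2"
          using \<tau>(2) unfolding N_def c0_def .
      qed (use lam L2 r nx2 ephi \<phi>1 \<mu> \<tau> PP in \<open>simp_all add: p1_def p2_def h_def\<close>)
      then show ?thesis .
    qed
    have cA: "continuous_on UNIV (A i j)" for i j by (rule elliptic_lipschitzD(5)[OF A])
    have cP: "continuous_on UNIV P" unfolding P_def E_def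
      by (intro continuous_intros continuous_on_second_order cA C2D[OF w] C2D(1)[OF p])
    have iP: "integrable lborel (\<lambda>x. (P x)\<^sup>2)"
    proof (rule integrable_compactly_supported[where R=1])
      show "continuous_on UNIV (\<lambda>x. (P x)\<^sup>2)" by (intro continuous_intros cP)
      show "\<And>x. x \<notin> cball 0 1 \<Longrightarrow> (P x)\<^sup>2 = 0" using w2z by (simp add: P_def quad2_def)
    qed
    have iV: "integrable lborel V"
    proof (rule integrable_compactly_supported[where R=1])
      show "continuous_on UNIV V" unfolding V_def by (intro continuous_intros cc)
      show "\<And>x. x \<notin> cball 0 1 \<Longrightarrow> V x = 0" using vz v1z by (simp add: V_def)
    qed
    have "(\<integral>x. c0 / 2 * V x + G x + L2 * EE x \<partial>lborel) \<le> (\<integral>x. (P x)\<^sup>2 / 2 \<partial>lborel)"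
      using pt iV iG iE iP by (intro integral_mono) auto
    then have main: "c0 * (\<integral>x. V x \<partial>lborel) \<le> (\<integral>x. (P x)\<^sup>2 \<partial>lborel)"
      using IG iV iG iE iP by simp
    have P2: "(P x)\<^sup>2 = exp (2 * \<tau> * weight \<mu> x) * (second_order A w2 x)\<^sup>2" for x
    proof -
      have "exp (2 * \<tau> * weight \<mu> x) = (E x)\<^sup>2" unfolding E_def \<phi>_def by (simp add: exp_double[symmetric] mult.assoc)
      then show ?thesis by (simp add: P_def power_mult_distrib)
    qed
    define W where "W x = exp (2 * \<tau> * weight \<mu> x) * (\<tau> * (\<Sum>i\<in>UNIV. (w1 i x)\<^sup>2) + \<tau>^3 * (w x)\<^sup>2)" for x
    have iW: "integrable lborel W"
    proof (rule integrable_compactly_supported[where R=1])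
      show "continuous_on UNIV W" unfolding W_def by (intro continuous_intros C2D[OF w] C2D(1)[OF C2_weight])
      show "\<And>x. x \<notin> cball 0 1 \<Longrightarrow> W x = 0" using z w1z by (simp add: W_def)
    qed
    \<comment> \<open>the gradient of \<open>w\<close> is recovered from \<open>v\<close> and \<open>v1\<close>; the derivative of the weight, at most \<open>2 \<mu>\<close>, produces the factor\<close>
    have WV: "W x \<le> (8 * \<mu>\<^sup>2 + 2) * V x" for x
    proof (cases "norm x \<le> 1")
      case False
      then show ?thesis using z w1z vz v1z by (simp add: W_def V_def)
    next
      case True
      have p1s: "(\<Sum>i\<in>UNIV. (p1 i x)\<^sup>2) \<le> 4 * \<mu>\<^sup>2"
      proof -
        have "(\<Sum>i\<in>UNIV. (p1 i x)\<^sup>2) = 4 * \<mu>\<^sup>2 * ((\<phi> x)\<^sup>2 * (norm x)\<^sup>2)"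
          unfolding p1_def norm_vec_sq by (simp add: power_mult_distrib sum_distrib_left mult_ac)
        also have "\<dots> \<le> 4 * \<mu>\<^sup>2 * (1 * 1)"
          using \<phi>1[of x] True by (intro mult_left_mono mult_mono power_le_one) auto
        finally show ?thesis by simp
      qed
      have e: "E x * w1 i x = v1 i x - \<tau> * p1 i x * v x" for i unfolding v1_def v_def by (simp add: algebra_simps)
      have "(E x * w1 i x)\<^sup>2 \<le> 2 * (v1 i x)\<^sup>2 + 2 * (\<tau>\<^sup>2 * (v x)\<^sup>2) * (p1 i x)\<^sup>2" for i
        unfolding e using zero_le_power2[of "v1 i x + \<tau> * p1 i x * v x"] by (simp add: power2_eq_square algebra_simps)
      then have "(\<Sum>i\<in>UNIV. (E x * w1 i x)\<^sup>2) \<le> (\<Sum>i\<in>UNIV. 2 * (v1 i x)\<^sup>2 + 2 * (\<tau>\<^sup>2 * (v x)\<^sup>2) * (p1 i x)\<^sup>2)"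
        by (intro sum_mono)
      also have "\<dots> = 2 * (\<Sum>i\<in>UNIV. (v1 i x)\<^sup>2) + 2 * (\<tau>\<^sup>2 * (v x)\<^sup>2) * (\<Sum>i\<in>UNIV. (p1 i x)\<^sup>2)"
        by (simp add: sum.distrib sum_distrib_left)
      also have "\<dots> \<le> 2 * (\<Sum>i\<in>UNIV. (v1 i x)\<^sup>2) + 2 * (\<tau>\<^sup>2 * (v x)\<^sup>2) * (4 * \<mu>\<^sup>2)"
        using p1s by (intro add_left_mono mult_left_mono) auto
      finally have a: "(\<Sum>i\<in>UNIV. (E x * w1 i x)\<^sup>2) \<le> 2 * (\<Sum>i\<in>UNIV. (v1 i x)\<^sup>2) + 8 * \<mu>\<^sup>2 * (\<tau>\<^sup>2 * (v x)\<^sup>2)"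
        by (simp add: mult_ac)
      have ee: "exp (2 * \<tau> * weight \<mu> x) = (E x)\<^sup>2" unfolding E_def \<phi>_def by (simp add: exp_double[symmetric] mult.assoc)
      have "W x = \<tau> * (\<Sum>i\<in>UNIV. (E x * w1 i x)\<^sup>2) + \<tau>^3 * (v x)\<^sup>2"
        unfolding W_def ee v_def by (simp add: power_mult_distrib sum_distrib_left algebra_simps)
      also have "\<dots> \<le> \<tau> * (2 * (\<Sum>i\<in>UNIV. (v1 i x)\<^sup>2) + 8 * \<mu>\<^sup>2 * (\<tau>\<^sup>2 * (v x)\<^sup>2)) + \<tau>^3 * (v x)\<^sup>2"
        using a \<tau> by (intro add_right_mono mult_left_mono) auto
      also have "\<dots> = 2 * (\<tau> * (\<Sum>i\<in>UNIV. (v1 i x)\<^sup>2)) + (8 * \<mu>\<^sup>2 + 1) * (\<tau>^3 * (v x)\<^sup>2)"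
        by (simp add: algebra_simps power2_eq_square power3_eq_cube)
      also have "\<dots> \<le> (8 * \<mu>\<^sup>2 + 2) * (\<tau> * (\<Sum>i\<in>UNIV. (v1 i x)\<^sup>2)) + (8 * \<mu>\<^sup>2 + 2) * (\<tau>^3 * (v x)\<^sup>2)"
        using \<tau>(1) by (intro add_mono mult_right_mono) (auto intro!: sum_nonneg mult_nonneg_nonneg)
      finally show ?thesis by (simp add: V_def algebra_simps)
    qed
    have "(\<integral>x. W x \<partial>lborel) \<le> (\<integral>x. (8 * \<mu>\<^sup>2 + 2) * V x \<partial>lborel)"
      using WV iW iV by (intro integral_mono) auto
    also have "\<dots> = (8 * \<mu>\<^sup>2 + 2) * (\<integral>x. V x \<partial>lborel)" by simp
    also have "\<dots> \<le> (8 * \<mu>\<^sup>2 + 2) * ((\<integral>x. (P x)\<^sup>2 \<partial>lborel) / c0)"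
      using main c0 by (intro mult_left_mono) (auto simp: field_simps)
    finally show "(\<integral>x. exp (2 * \<tau> * weight \<mu> x) * (\<tau> * (\<Sum>i\<in>UNIV. (w1 i x)\<^sup>2) + \<tau>^3 * (w x)\<^sup>2) \<partial>lborel)
       \<le> (8 * \<mu>\<^sup>2 + 2) / c0 * (\<integral>x. exp (2 * \<tau> * weight \<mu> x) * (second_order A w2 x)\<^sup>2 \<partial>lborel)"
      unfolding P2 W_def by simp
  qed
qed

section \<open>The Caccioppoli inequality\<close>

definition cball_integral :: "real \<Rightarrow> (real^'n \<Rightarrow> real) \<Rightarrow> real" where
  "cball_integral R f = (\<integral>x. indicat_real (cball 0 R) x * f x \<partial>lborel)"

lemma integrable_cball:
  fixes f :: "real^'n \<Rightarrow> real"
  assumes "continuous_on UNIV f"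
  shows "integrable lborel (\<lambda>x. indicat_real (cball 0 R) x * f x)"
  using borel_integrable_compact[of "cball 0 R" f] continuous_on_subset[OF assms] by simp

lemma cball_integral_mono_radius:
  assumes "continuous_on UNIV f" "\<And>x. f x \<ge> 0" "s \<le> t"
  shows "cball_integral s f \<le> cball_integral t f"
  unfolding cball_integral_def
  by (intro integral_mono integrable_cball assms) (use assms in \<open>auto simp: indicator_def\<close>)

lemma cball_integral_nonneg: "(\<And>x. f x \<ge> 0) \<Longrightarrow> cball_integral s f \<ge> 0"
  unfolding cball_integral_def by (intro Bochner_Integration.integral_nonneg) auto

lemma cball_integral_add:
  assumes "continuous_on UNIV f" "continuous_on UNIV g"
  shows "cball_integral s (\<lambda>x. f x + g x) = cball_integral s f + cball_integral s g"
  unfolding cball_integral_def distrib_left using integrable_cball[OF assms(1)] integrable_cball[OF assms(2)] by simp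

lemma cball_integral_cmult: "cball_integral s (\<lambda>x. c * f x) = c * cball_integral s f"
  unfolding cball_integral_def by (simp add: mult.left_commute)

lemma DERIV_max_power:
  assumes "k \<ge> 1"
  shows "((\<lambda>y::real. max 0 y ^ Suc k) has_real_derivative real (Suc k) * max 0 y ^ k) (at y)"
proof -
  consider "y > 0" | "y < 0" | "y = 0" by linarith
  then show ?thesis
  proof cases
    case 1
    have "eventually (\<lambda>x. max 0 x ^ Suc k = x ^ Suc k) (nhds y)"
      using eventually_nhds_in_open[of "{0<..}" y] 1 by (auto elim: eventually_mono)
    then show ?thesis using 1
      using DERIV_pow[of "Suc k" y UNIV] by (subst DERIV_cong_ev[OF refl]) (auto simp: max_def)
  next
    case 2
    have "eventually (\<lambda>x. max 0 x ^ Suc k = 0) (nhds y)"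
      using eventually_nhds_in_open[of "{..<0}" y] 2 by (auto elim!: eventually_mono simp: max_def)
    from DERIV_cong_ev[OF refl this refl, of 0]
    have "((\<lambda>y::real. max 0 y ^ Suc k) has_real_derivative 0) (at y)" by (simp only: DERIV_const)
    moreover have "real (Suc k) * max 0 y ^ k = 0" using 2 assms by (simp add: max_def)
    ultimately show ?thesis by (simp only:)
  next
    case 3
    have b: "norm (max 0 h ^ Suc k / h) \<le> \<bar>h\<bar> ^ k" for h :: real
      by (cases "h > 0") (auto simp: max_def)
    have "((\<lambda>h::real. \<bar>h\<bar> ^ k) \<longlongrightarrow> \<bar>0\<bar> ^ k) (at 0)" by (intro tendsto_intros)
    moreover have "\<bar>0::real\<bar> ^ k = 0" using assms by (simp add: power_0_left)
    ultimately have "((\<lambda>h::real. \<bar>h\<bar> ^ k) \<longlongrightarrow> 0) (at 0)" by (simp only:)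
    then have "((\<lambda>h::real. max 0 h ^ Suc k / h) \<longlongrightarrow> 0) (at 0)"
      by (rule Lim_null_comparison[rotated]) (use b in auto)
    then show ?thesis using 3 assms by (simp add: DERIV_def power_0_left)
  qed
qed

text \<open>The amount by which \<open>u\<close> fails to satisfy the squared differential inequality
  \<open>\<bar>A\<^sub>i\<^sub>j \<partial>\<^sub>i \<partial>\<^sub>j u\<bar>\<^sup>2 \<le> K (u\<^sup>2 + \<bar>\<nabla>u\<bar>\<^sup>2)\<close>. It is carried through the estimates because mollified solutions
  satisfy the inequality only approximately.\<close>

definition excess :: "real \<Rightarrow> ('n::finite \<Rightarrow> 'n \<Rightarrow> real^'n \<Rightarrow> real) \<Rightarrow> (real^'n \<Rightarrow> real) \<Rightarrow>
    ('n \<Rightarrow> real^'n \<Rightarrow> real) \<Rightarrow> ('n \<Rightarrow> 'n \<Rightarrow> real^'n \<Rightarrow> real) \<Rightarrow> real^'n \<Rightarrow> real" where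
  "excess K A u u1 u2 x = max 0 ((second_order A u2 x)\<^sup>2
      - K * ((u x)\<^sup>2 + (\<Sum>i\<in>UNIV. (u1 i x)\<^sup>2)))"

lemma excess_bound: "(second_order A u2 x)\<^sup>2
     \<le> K * ((u x)\<^sup>2 + (\<Sum>i\<in>UNIV. (u1 i x)\<^sup>2)) + excess K A u u1 u2 x"
  "excess K A u u1 u2 x \<ge> 0"
  unfolding excess_def by auto

lemma continuous_excess:
  assumes "elliptic_lipschitz lam L A" "C2 u u1 u2"
  shows "continuous_on UNIV (excess K A u u1 u2)"
  unfolding excess_def
  by (intro continuous_intros continuous_on_second_order elliptic_lipschitzD(5)[OF assms(1)] C2D[OF assms(2)])

lemma quad2_abs_le:
  assumes "\<And>i j. \<bar>B i j\<bar> \<le> lam"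
  shows "\<bar>quad2 B f\<bar> \<le> lam * (\<Sum>i\<in>UNIV. \<Sum>j\<in>UNIV. \<bar>f i j\<bar>)"
proof -
  have "\<bar>quad2 B f\<bar> \<le> (\<Sum>i\<in>UNIV. \<Sum>j\<in>UNIV. \<bar>B i j * f i j\<bar>)"
    unfolding quad2_def by (intro order_trans[OF sum_abs] sum_mono order_refl)
  also have "\<dots> \<le> (\<Sum>i\<in>UNIV. \<Sum>j\<in>UNIV. lam * \<bar>f i j\<bar>)"
    unfolding abs_mult by (intro sum_mono mult_right_mono assms) auto
  finally show ?thesis by (simp add: sum_distrib_left)
qed

text \<open>The equation is multiplied by \<open>p\<^sup>2 u\<close> with \<open>p = max 0 (t\<^sup>2 - \<bar>x\<bar>\<^sup>2)\<close>. As the operator is not in divergence form,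
  the field \<open>p\<^sup>2 u \<nabla>u\<close> is integrated by parts against the Lipschitz coefficients; the error is of the same
  type as the term from the derivative of \<open>p\<^sup>2\<close>, and both are bounded by a multiple of \<open>p \<bar>\<nabla>u\<bar> \<bar>u\<bar>\<close>.\<close>

theorem caccioppoli:
  fixes lam L K s t :: real
  assumes lam: "lam \<ge> 1" and L: "L \<ge> 0" and K: "K \<ge> 1" and st: "0 < s" "s < t" "t \<le> 1"
  obtains C where "C > 0"
    "\<And>A (u :: real^'n \<Rightarrow> real) u1 u2. elliptic_lipschitz lam L A \<Longrightarrow> C2 u u1 u2 \<Longrightarrow>
       cball_integral s (\<lambda>x. \<Sum>i\<in>UNIV. (u1 i x)\<^sup>2) \<le> C * cball_integral t (\<lambda>x. (u x)\<^sup>2 + excess K A u u1 u2 x)"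
proof -
  define N where "N = real CARD('n)"
  \<comment> \<open>\<open>c\<close> collects the coefficients of \<open>p \<bar>u\<bar> \<bar>\<nabla>u\<bar>\<close>; \<open>C'\<close> is what Young's inequality with weights \<open>1 / (4 lam)\<close> and \<open>1 / (4 lam K)\<close> leaves in front of \<open>u\<^sup>2\<close>\<close>
  define c where "c = (4 * lam + L) * N"
  define C' where "C' = 1 + N * lam * c\<^sup>2 + 1 / (4 * lam) + 4 * lam * K"
  have N: "N \<ge> 1" by (simp add: N_def Suc_le_eq)
  have C': "C' \<ge> 1" unfolding C'_def using lam K N by simp
  have m: "(t\<^sup>2 - s\<^sup>2)\<^sup>2 > 0" using st by (simp add: power_strict_mono)
  define C where "C = 2 * lam * C' / (t\<^sup>2 - s\<^sup>2)\<^sup>2"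
  show ?thesis
  proof (rule that[of C])
    show "C > 0" using lam C' m by (simp add: C_def)
    fix A :: "'n \<Rightarrow> 'n \<Rightarrow> real^'n \<Rightarrow> real" and u :: "real^'n \<Rightarrow> real" and u1 u2
    assume A: "elliptic_lipschitz lam L A" and u: "C2 u u1 u2"
    define p where "p = (\<lambda>x::real^'n. max 0 (t\<^sup>2 - (norm x)\<^sup>2))"
    define D where "D = (\<lambda>x. \<Sum>i\<in>UNIV. (u1 i x)\<^sup>2)"
    define e where "e = excess K A u u1 u2"
    have p0: "p x \<ge> 0" for x by (simp add: p_def)
    have p1: "p x \<le> 1" for x
    proof -
      have "t\<^sup>2 \<le> 1" using st by (simp add: power_le_one)
      then show ?thesis unfolding p_def using zero_le_power2[of "norm x"] by (intro max.boundedI) linarith+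
    qed
    have pz: "p x = 0" if "x \<notin> cball 0 t" for x
    proof -
      have "t < norm x" using that by simp
      then have "t\<^sup>2 \<le> (norm x)\<^sup>2" using st by (intro power_mono) auto
      then show ?thesis by (simp add: p_def)
    qed
    have cp: "continuous_on UNIV p" unfolding p_def by (intro continuous_intros)
    have pdp: "has_partial i (\<lambda>x. (p x)\<^sup>2) (\<lambda>x. - 4 * p x * x $ i)" for i
    proof -
      have 1: "has_partial i (\<lambda>x. t\<^sup>2 + (- 1) * (norm x)\<^sup>2) (\<lambda>x. 0 + (0 * (norm x)\<^sup>2 + (- 1) * (2 * x $ i)))"
        by (intro has_partial_add has_partial_mult has_partial_const has_partial_norm2)
      have 2: "((\<lambda>y::real. (max 0 y)\<^sup>2) has_real_derivative 2 * max 0 y) (at y)" for y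
        using DERIV_max_power[of 1 y] by (simp add: numeral_2_eq_2)
      show ?thesis using has_partial_chain[OF 1 2] unfolding p_def by (simp add: mult_ac)
    qed
    define a where "a = (\<lambda>(i::'n, j::'n). A i j)"
    define F where "F = (\<lambda>(i::'n, j::'n) x. (p x)\<^sup>2 * (u x * u1 j x))"
    define F' where "F' = (\<lambda>(i::'n, j::'n) x. (- 4 * p x * x $ i) * (u x * u1 j x) + (p x)\<^sup>2 * (u1 i x * u1 j x + u x * u2 j i x))"
    define di where "di = (\<lambda>(i::'n, j::'n). i)"
    note cu = C2D(1-3)[OF u]
    have aL: "\<bar>a q x - a q y\<bar> \<le> L * norm (x - y)" for q x y
      unfolding a_def by (cases q) (simp add: elliptic_lipschitzD(3)[OF A])
    have k1: "has_partial (di q) (F q) (F' q)" for q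
      unfolding F_def F'_def di_def
      by (cases q) (hypsubst, simp only: prod.case, intro has_partial_mult pdp C2D(4,5)[OF u])
    have k2: "continuous_on UNIV (F q)" "continuous_on UNIV (F' q)" for q
      unfolding F_def F'_def by (cases q; hypsubst, simp only: prod.case, intro continuous_intros cp cu)+
    have k3: "F q x = 0" if "x \<notin> cball 0 t" for q x
      unfolding F_def by (cases q) (simp add: pz[OF that])
    note ib = lipschitz_ibp_sum[of a L di F F' t, OF aL k1 k2 k3]
    have ce: "continuous_on UNIV e" unfolding e_def by (rule continuous_excess[OF A u])
    have cD: "continuous_on UNIV D" unfolding D_def by (intro continuous_intros cu)
    have pt: "(p x)\<^sup>2 * D x / (2 * lam) \<le> (\<Sum>q\<in>UNIV. a q x * F' q x) - L * (\<Sum>q\<in>UNIV. \<bar>F q x\<bar>)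
       + indicat_real (cball 0 t) x * (C' * ((u x)\<^sup>2 + e x))" for x
    proof (cases "x \<in> cball 0 t")
      case False
      then show ?thesis by (simp add: F_def F'_def case_prod_beta pz)
    next
      case True
      have x1: "\<bar>x $ i\<bar> \<le> 1" for i
        using component_le_norm_cart[of x i] True st by simp
      define B where "B = (\<lambda>i j. A i j x)"
      define Q where "Q = quad2 B (\<lambda>i j. u1 i x * u1 j x)"
      define R where "R = quad2 B (\<lambda>i j. x $ i * u1 j x)"
      define S where "S = quad2 B (\<lambda>i j. u2 i j x)"
      define U where "U = (\<Sum>j\<in>UNIV. \<bar>u1 j x\<bar>)"
      have B: "\<bar>B i j\<bar> \<le> lam" for i j unfolding B_def by (rule elliptic_lipschitzD(2)[OF A])
      have U0: "U \<ge> 0" unfolding U_def by (auto intro: sum_nonneg)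
      have s1: "(\<Sum>q\<in>UNIV. a q x * F' q x) = - 4 * p x * u x * R + (p x)\<^sup>2 * Q + (p x)\<^sup>2 * u x * S"
      proof -
        have "(\<Sum>q\<in>UNIV. a q x * F' q x) = quad2 B (\<lambda>i j. (- 4 * p x * u x) * (x $ i * u1 j x) + (p x)\<^sup>2 * (u1 i x * u1 j x)
             + (p x)\<^sup>2 * u x * u2 i j x)"
          unfolding quad2_def sum.cartesian_product UNIV_Times_UNIV a_def F'_def B_def
          using C2D(6)[OF u] by (intro sum.cong refl) (auto simp: algebra_simps)
        then show ?thesis by (simp only: quad2_add quad2_cmult Q_def R_def S_def)
      qed
      have s2: "(\<Sum>q\<in>UNIV. \<bar>F q x\<bar>) = N * ((p x)\<^sup>2 * \<bar>u x\<bar> * U)"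
      proof -
        have "(\<Sum>q\<in>UNIV. \<bar>F q x\<bar>) = (\<Sum>i\<in>(UNIV::'n set). \<Sum>j\<in>UNIV. (p x)\<^sup>2 * \<bar>u x\<bar> * \<bar>u1 j x\<bar>)"
          unfolding sum.cartesian_product UNIV_Times_UNIV F_def
          by (intro sum.cong refl) (auto simp: abs_mult)
        then show ?thesis by (simp add: N_def U_def sum_distrib_left mult_ac)
      qed
      have Q: "D x / lam \<le> Q"
        using elliptic_lipschitzD(4)[OF A, of "\<lambda>i. u1 i x" x] lam by (simp add: Q_def D_def B_def field_simps)
      have R: "\<bar>R\<bar> \<le> lam * N * U"
      proof -
        have "\<bar>R\<bar> \<le> lam * (\<Sum>i\<in>UNIV. \<Sum>j\<in>UNIV. \<bar>x $ i * u1 j x\<bar>)" unfolding R_def by (rule quad2_abs_le[OF B])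
        also have "\<dots> \<le> lam * (\<Sum>i\<in>(UNIV::'n set). \<Sum>j\<in>UNIV. 1 * \<bar>u1 j x\<bar>)"
          unfolding abs_mult using lam by (intro mult_left_mono sum_mono mult_right_mono x1) auto
        finally show ?thesis by (simp add: N_def U_def)
      qed
      have S: "S\<^sup>2 \<le> K * ((u x)\<^sup>2 + D x) + e x"
        unfolding S_def B_def e_def D_def by (rule excess_bound(1))
      have e0: "e x \<ge> 0" unfolding e_def by (rule excess_bound(2))
      have D0: "D x \<ge> 0" unfolding D_def by (auto intro: sum_nonneg)
      have t1: "c * (p x * \<bar>u x\<bar> * U) \<le> (p x)\<^sup>2 * D x / (4 * lam) + N * lam * c\<^sup>2 * (u x)\<^sup>2"
      proof -
        have "c * (p x * \<bar>u x\<bar> * \<bar>u1 j x\<bar>) \<le> (p x)\<^sup>2 * (u1 j x)\<^sup>2 / (4 * lam) + lam * c\<^sup>2 * (u x)\<^sup>2" for j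
        proof -
          have "0 \<le> (p x * \<bar>u1 j x\<bar> - 2 * lam * c * \<bar>u x\<bar>)\<^sup>2 / (4 * lam)" using lam by simp
          also have "\<dots> = (p x)\<^sup>2 * (u1 j x)\<^sup>2 / (4 * lam) + lam * c\<^sup>2 * (u x)\<^sup>2 - c * (p x * \<bar>u x\<bar> * \<bar>u1 j x\<bar>)"
            using lam by (simp add: power2_diff power_mult_distrib field_simps) (simp add: power2_eq_square mult_ac)?
          finally show ?thesis by simp
        qed
        then have "(\<Sum>j\<in>UNIV. c * (p x * \<bar>u x\<bar> * \<bar>u1 j x\<bar>)) \<le> (\<Sum>j\<in>UNIV. (p x)\<^sup>2 * (u1 j x)\<^sup>2 / (4 * lam) + lam * c\<^sup>2 * (u x)\<^sup>2)"
          by (intro sum_mono)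
        then show ?thesis
          by (simp add: U_def D_def N_def sum.distrib sum_distrib_left sum_divide_distrib mult_ac)
      qed
      have t2: "(p x)\<^sup>2 * \<bar>u x\<bar> * \<bar>S\<bar> \<le> (p x)\<^sup>2 * D x / (4 * lam) + (1 / (4 * lam) + 4 * lam * K) * (u x)\<^sup>2 + e x"
      proof -
        define \<delta> where "\<delta> = 1 / (4 * lam * K)"
        have \<delta>: "\<delta> > 0" "\<delta> \<le> 1" "\<delta> * K = 1 / (4 * lam)" "1 / \<delta> = 4 * lam * K"
        proof -
          have "lam * K \<ge> 1 * 1" using lam K by (intro mult_mono) auto
          then show "\<delta> \<le> 1" unfolding \<delta>_def by (intro divide_le_eq_1_pos[THEN iffD2]) linarith+
        qed (use lam K in \<open>auto simp: \<delta>_def\<close>)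
        have "0 \<le> (\<delta> * \<bar>S\<bar> - \<bar>u x\<bar>)\<^sup>2 / \<delta>" using \<delta> by simp
        also have "\<dots> = \<delta> * S\<^sup>2 - 2 * (\<bar>u x\<bar> * \<bar>S\<bar>) + (u x)\<^sup>2 * (1 / \<delta>)"
          using \<delta>(1) by (simp add: power2_diff power_mult_distrib field_simps) (simp add: power2_eq_square mult_ac)?
        finally have "\<bar>u x\<bar> * \<bar>S\<bar> \<le> \<delta> * S\<^sup>2 + (u x)\<^sup>2 * (1 / \<delta>)"
          using mult_nonneg_nonneg[of "\<bar>u x\<bar>" "\<bar>S\<bar>"] by linarith
        also have "\<dots> \<le> \<delta> * (K * ((u x)\<^sup>2 + D x) + e x) + (u x)\<^sup>2 * (1 / \<delta>)"
          using S \<delta> by (intro add_right_mono mult_left_mono) auto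
        also have "\<dots> = (\<delta> * K) * ((u x)\<^sup>2 + D x) + \<delta> * e x + (u x)\<^sup>2 * (1 / \<delta>)" by (simp add: algebra_simps)
        also have "\<delta> * e x \<le> 1 * e x" using \<delta> e0 by (intro mult_right_mono) auto
        finally have "\<bar>u x\<bar> * \<bar>S\<bar> \<le> D x / (4 * lam) + (1 / (4 * lam) + 4 * lam * K) * (u x)\<^sup>2 + e x"
          unfolding \<delta>(3,4) by (simp add: algebra_simps add_divide_distrib)
        then have "(p x)\<^sup>2 * (\<bar>u x\<bar> * \<bar>S\<bar>) \<le> (p x)\<^sup>2 * (D x / (4 * lam) + (1 / (4 * lam) + 4 * lam * K) * (u x)\<^sup>2 + e x)"
          by (intro mult_left_mono) auto
        also have "\<dots> = (p x)\<^sup>2 * D x / (4 * lam) + (p x)\<^sup>2 * ((1 / (4 * lam) + 4 * lam * K) * (u x)\<^sup>2 + e x)"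
          by (simp add: algebra_simps)
        also have "(p x)\<^sup>2 * ((1 / (4 * lam) + 4 * lam * K) * (u x)\<^sup>2 + e x) \<le> 1 * ((1 / (4 * lam) + 4 * lam * K) * (u x)\<^sup>2 + e x)"
          using p0 p1 e0 lam K by (intro mult_right_mono power_le_one add_nonneg_nonneg mult_nonneg_nonneg) auto
        finally show ?thesis by (simp add: mult.assoc)
      qed
      have t3: "L * (N * ((p x)\<^sup>2 * \<bar>u x\<bar> * U)) + 4 * (p x * \<bar>u x\<bar> * \<bar>R\<bar>) \<le> c * (p x * \<bar>u x\<bar> * U)"
      proof -
        have "(p x)\<^sup>2 \<le> p x" unfolding power2_eq_square using p0 p1 by (simp add: mult_left_le)
        then have "L * N * ((p x)\<^sup>2 * (\<bar>u x\<bar> * U)) \<le> L * N * (p x * (\<bar>u x\<bar> * U))"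
          using L N U0 by (intro mult_left_mono mult_right_mono) auto
        moreover have "4 * (p x * \<bar>u x\<bar> * \<bar>R\<bar>) \<le> 4 * (p x * \<bar>u x\<bar> * (lam * N * U))"
          using R p0 by (intro mult_left_mono) auto
        ultimately show ?thesis by (simp add: c_def algebra_simps)
      qed
      have t4: "(p x)\<^sup>2 * (D x / lam) \<le> (p x)\<^sup>2 * Q" using Q by (intro mult_left_mono) auto
      have t5: "4 * p x * u x * R \<le> 4 * (p x * \<bar>u x\<bar> * \<bar>R\<bar>)"
      proof -
        have "4 * p x * u x * R \<le> \<bar>4 * p x * u x * R\<bar>" by simp
        then show ?thesis using p0[of x] by (simp add: abs_mult mult_ac)
      qed
      have t6: "- ((p x)\<^sup>2 * u x * S) \<le> (p x)\<^sup>2 * \<bar>u x\<bar> * \<bar>S\<bar>"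
      proof -
        have "- ((p x)\<^sup>2 * u x * S) \<le> \<bar>(p x)\<^sup>2 * u x * S\<bar>" by simp
        then show ?thesis by (simp add: abs_mult mult_ac)
      qed
      have t7: "(p x)\<^sup>2 * (D x / lam) = (p x)\<^sup>2 * D x / (2 * lam) + (p x)\<^sup>2 * D x / (4 * lam) + (p x)\<^sup>2 * D x / (4 * lam)"
        using lam by (simp add: field_simps)
      have t8: "N * lam * c\<^sup>2 * (u x)\<^sup>2 + (1 / (4 * lam) + 4 * lam * K) * (u x)\<^sup>2 + e x \<le> C' * ((u x)\<^sup>2 + e x)"
      proof -
        have "1 * e x \<le> C' * e x" using C' e0 by (intro mult_right_mono) auto
        then show ?thesis unfolding C'_def by (simp add: algebra_simps)
      qed
      have t9: "indicat_real (cball 0 t) x * (C' * ((u x)\<^sup>2 + e x)) = C' * ((u x)\<^sup>2 + e x)" using True by simp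
      have "y \<le> - 4 * p x * u x * R + q + us - l + k"
        if "cu \<le> d + n" "au \<le> d + m" "l + r \<le> cu" "dl \<le> q" "4 * p x * u x * R \<le> r" "- us \<le> au"
          "dl = y + d + d" "n + m \<le> k" for y q us l k cu d n au m r dl :: real
        using that by linarith
      from this[OF t1 t2[unfolded add.assoc] t3 t4 t5 t6 t7 t8[unfolded add.assoc]] show ?thesis
        unfolding s1 s2 t9 .
    qed
    have iD: "integrable lborel (\<lambda>x. (p x)\<^sup>2 * D x / (2 * lam))"
      by (rule integrable_compactly_supported[where R=t]) (use lam in \<open>auto intro!: continuous_intros cp cD simp: pz simp del: mem_cball\<close>)
    have iu: "integrable lborel (\<lambda>x. indicat_real (cball 0 t) x * (C' * ((u x)\<^sup>2 + e x)))"
      by (intro integrable_cball continuous_intros cu ce)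
    have "(\<integral>x. (p x)\<^sup>2 * D x / (2 * lam) \<partial>lborel) \<le> (\<integral>x. (\<Sum>q\<in>UNIV. a q x * F' q x) - L * (\<Sum>q\<in>UNIV. \<bar>F q x\<bar>)
       + indicat_real (cball 0 t) x * (C' * ((u x)\<^sup>2 + e x)) \<partial>lborel)"
      using pt iD iu ib(2,3) by (intro integral_mono) auto
    also have "\<dots> = (\<integral>x. (\<Sum>q\<in>UNIV. a q x * F' q x) \<partial>lborel) - L * (\<integral>x. (\<Sum>q\<in>UNIV. \<bar>F q x\<bar>) \<partial>lborel)
       + (\<integral>x. indicat_real (cball 0 t) x * (C' * ((u x)\<^sup>2 + e x)) \<partial>lborel)"
      using iu ib(2,3) by (simp del: Bochner_Integration.integral_sum)
    also have "\<dots> \<le> (\<integral>x. indicat_real (cball 0 t) x * (C' * ((u x)\<^sup>2 + e x)) \<partial>lborel)"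
      using ib(1) by linarith
    also have "\<dots> = C' * cball_integral t (\<lambda>x. (u x)\<^sup>2 + e x)" unfolding cball_integral_cmult[symmetric] by (simp add: cball_integral_def)
    finally have I: "(\<integral>x. (p x)\<^sup>2 * D x / (2 * lam) \<partial>lborel) \<le> C' * cball_integral t (\<lambda>x. (u x)\<^sup>2 + e x)" .
    have "(t\<^sup>2 - s\<^sup>2)\<^sup>2 / (2 * lam) * cball_integral s D = cball_integral s (\<lambda>x. (t\<^sup>2 - s\<^sup>2)\<^sup>2 / (2 * lam) * D x)"
      by (rule cball_integral_cmult[symmetric])
    also have "\<dots> \<le> (\<integral>x. (p x)\<^sup>2 * D x / (2 * lam) \<partial>lborel)"
      unfolding cball_integral_def
    proof (intro integral_mono iD integrable_cball continuous_intros cD)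
      fix x :: "real^'n"
      have D0: "D x \<ge> 0" unfolding D_def by (auto intro: sum_nonneg)
      show "indicat_real (cball 0 s) x * ((t\<^sup>2 - s\<^sup>2)\<^sup>2 / (2 * lam) * D x) \<le> (p x)\<^sup>2 * D x / (2 * lam)"
      proof (cases "x \<in> cball 0 s")
        case True
        then have "(norm x)\<^sup>2 \<le> s\<^sup>2" by (intro power_mono) auto
        then have "t\<^sup>2 - s\<^sup>2 \<le> p x" by (simp add: p_def)
        moreover have "t\<^sup>2 - s\<^sup>2 \<ge> 0" using st by (simp add: power_mono)
        ultimately have "(t\<^sup>2 - s\<^sup>2)\<^sup>2 \<le> (p x)\<^sup>2" by (intro power_mono) auto
        then have "(t\<^sup>2 - s\<^sup>2)\<^sup>2 * (D x / (2 * lam)) \<le> (p x)\<^sup>2 * (D x / (2 * lam))"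
          using D0 lam by (intro mult_right_mono) auto
        then show ?thesis using True by simp
      qed (use D0 lam in simp)
    qed
    also note I
    finally have "(t\<^sup>2 - s\<^sup>2)\<^sup>2 / (2 * lam) * cball_integral s D \<le> C' * cball_integral t (\<lambda>x. (u x)\<^sup>2 + e x)" .
    then have "cball_integral s D \<le> C * cball_integral t (\<lambda>x. (u x)\<^sup>2 + e x)"
      using m lam by (simp add: C_def field_simps)
    then show "cball_integral s (\<lambda>x. \<Sum>i\<in>UNIV. (u1 i x)\<^sup>2) \<le> C * cball_integral t (\<lambda>x. (u x)\<^sup>2 + excess K A u u1 u2 x)"
      unfolding D_def e_def .
  qed
qed

section \<open>Three balls for functions of class \<open>C\<^sup>2\<close>\<close>

definition cube_pos :: "real \<Rightarrow> real" where "cube_pos t = max 0 t ^ 3"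

text \<open>A transition from \<open>0\<close> to \<open>1\<close> of class \<open>C\<^sup>2\<close>: the cube of the positive part is of class \<open>C\<^sup>2\<close>, vanishes for
  \<open>t \<le> 0\<close> and is at least \<open>1\<close> for \<open>t \<ge> 1\<close>, and so the outer cube vanishes there.\<close>

definition step :: "real \<Rightarrow> real" where "step t = 1 - cube_pos (1 - cube_pos t)"

lemma step_values: "t \<le> 0 \<Longrightarrow> step t = 0" "t \<ge> 1 \<Longrightarrow> step t = 1" "0 \<le> step t" "step t \<le> 1"
proof -
  show "t \<le> 0 \<Longrightarrow> step t = 0" by (simp add: step_def cube_pos_def max_def)
  assume "t \<ge> 1"
  then have "1 \<le> t ^ 3" by (rule one_le_power)
  with \<open>t \<ge> 1\<close> show "step t = 1" by (simp add: step_def cube_pos_def max_def antisym)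
next
  show "0 \<le> step t" unfolding step_def cube_pos_def by (simp add: power_le_one)
  show "step t \<le> 1" unfolding step_def cube_pos_def by simp
qed

lemma C2_step:
  assumes f: "C2 f f1 f2"
  shows "\<exists>g1 g2. C2 (\<lambda>x. step (f x)) g1 g2"
proof -
  define h where "h t = 3 * (max 0 t)\<^sup>2" for t :: real
  define h' where "h' t = 6 * max 0 t" for t :: real
  have d1: "(cube_pos has_real_derivative h t) (at t)" for t
    using DERIV_max_power[of 2 t] unfolding cube_pos_def h_def by (simp add: numeral_3_eq_3)
  have d2: "(h has_real_derivative h' t) (at t)" for t
    using DERIV_cmult[OF DERIV_max_power[of 1 t], of 3] unfolding h'_def h_def by (simp add: numeral_2_eq_2)
  have ch': "continuous_on UNIV h'" unfolding h'_def by (intro continuous_intros)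
  have ch: "continuous_on UNIV h" unfolding h_def by (intro continuous_intros)
  have cc: "continuous_on UNIV cube_pos" unfolding cube_pos_def by (intro continuous_intros)
  have i: "((\<lambda>t. 1 - cube_pos t) has_real_derivative (0 - h t)) (at t)" for t
    by (rule DERIV_diff[OF DERIV_const d1])
  have e1: "(step has_real_derivative (h (1 - cube_pos t) * h t)) (at t)" for t
    using DERIV_diff[OF DERIV_const DERIV_chain2[OF d1 i], of 1 t] by (simp add: step_def[abs_def])
  have e2: "((\<lambda>t. h (1 - cube_pos t) * h t) has_real_derivative
       (h' (1 - cube_pos t) * (- h t)) * h t + h' t * h (1 - cube_pos t)) (at t)" for t
    using DERIV_mult[OF DERIV_chain2[OF d2 i] d2, of t] by simp
  have c: "continuous_on UNIV (\<lambda>t. (h' (1 - cube_pos t) * (- h t)) * h t + h' t * h (1 - cube_pos t))"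
    by (intro continuous_intros cc ch ch' continuous_on_compose2[OF ch] continuous_on_compose2[OF ch']) auto
  show ?thesis using C2_chain[OF f e1 e2 c] by blast
qed

lemma C2_affine:
  assumes "C2 f f1 f2"
  shows "C2 (\<lambda>x. a + b * f x) (\<lambda>i x. b * f1 i x) (\<lambda>i j x. b * f2 i j x)"
proof -
  have "C2 (\<lambda>x. a + b * f x) (\<lambda>i x. b * f1 i x) (\<lambda>i j x. (0 * f1 j x) * f1 i x + b * f2 i j x)"
    by (rule C2_chain[OF assms, where g = "\<lambda>t. a + b * t" and g' = "\<lambda>t. b" and g'' = "\<lambda>t. 0"])
      (auto intro!: derivative_eq_intros)
  then show ?thesis by simp
qed

lemma C2_const_on_open:
  assumes f: "C2 f f1 f2" and U: "open U" "\<And>x. x \<in> U \<Longrightarrow> f x = c" "x \<in> U"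
  shows "f1 i x = 0" "f2 i j x = 0"
proof -
  have "C2 (\<lambda>x. - c + 1 * f x) (\<lambda>i x. 1 * f1 i x) (\<lambda>i j x. 1 * f2 i j x)" by (rule C2_affine[OF f])
  from C2_zero_on_open[OF this U(1) _ U(3)] U(2) show "f1 i x = 0" "f2 i j x = 0" by auto
qed

lemma cutoff_shell:
  fixes a b R1 R2 :: real
  assumes ab: "0 < a" "a < b" "b < R1" "R1 < R2"
  obtains \<zeta> :: "real^'n \<Rightarrow> real" and \<zeta>1 \<zeta>2 B where "C2 \<zeta> \<zeta>1 \<zeta>2"
    "\<And>x. norm x \<le> a \<Longrightarrow> \<zeta> x = 0" "\<And>x. norm x \<ge> R2 \<Longrightarrow> \<zeta> x = 0" "\<And>x. b \<le> norm x \<Longrightarrow> norm x \<le> R1 \<Longrightarrow> \<zeta> x = 1"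
    "\<And>x. 0 \<le> \<zeta> x" "\<And>x. \<zeta> x \<le> 1" "B \<ge> 1" "\<And>x i. norm x \<le> R2 \<Longrightarrow> \<bar>\<zeta>1 i x\<bar> \<le> B" "\<And>x i j. norm x \<le> R2 \<Longrightarrow> \<bar>\<zeta>2 i j x\<bar> \<le> B"
proof -
  have d: "b\<^sup>2 - a\<^sup>2 > 0" "R2\<^sup>2 - R1\<^sup>2 > 0" using ab by (auto intro!: power_strict_mono)
  obtain s1 s2 where s: "C2 (\<lambda>x::real^'n. step (- a\<^sup>2 / (b\<^sup>2 - a\<^sup>2) + (1 / (b\<^sup>2 - a\<^sup>2)) * (norm x)\<^sup>2)) s1 s2"
    using C2_step[OF C2_affine[OF C2_norm2]] by blast
  obtain t1 t2 where t: "C2 (\<lambda>x::real^'n. step (R2\<^sup>2 / (R2\<^sup>2 - R1\<^sup>2) + (- 1 / (R2\<^sup>2 - R1\<^sup>2)) * (norm x)\<^sup>2)) t1 t2"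
    using C2_step[OF C2_affine[OF C2_norm2]] by blast
  define f where "f = (\<lambda>x::real^'n. step (- a\<^sup>2 / (b\<^sup>2 - a\<^sup>2) + (1 / (b\<^sup>2 - a\<^sup>2)) * (norm x)\<^sup>2))"
  define g where "g = (\<lambda>x::real^'n. step (R2\<^sup>2 / (R2\<^sup>2 - R1\<^sup>2) + (- 1 / (R2\<^sup>2 - R1\<^sup>2)) * (norm x)\<^sup>2))"
  have fe: "f x = step (((norm x)\<^sup>2 - a\<^sup>2) / (b\<^sup>2 - a\<^sup>2))" for x by (simp add: f_def diff_divide_distrib)
  have ge: "g x = step ((R2\<^sup>2 - (norm x)\<^sup>2) / (R2\<^sup>2 - R1\<^sup>2))" for x by (simp add: g_def diff_divide_distrib)
  obtain \<zeta>1 \<zeta>2 where C: "C2 (\<lambda>x. f x * g x) \<zeta>1 \<zeta>2" using C2_mult[OF s t] unfolding f_def g_def by blast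
  have bd: "\<exists>B. \<forall>x. norm x \<le> R2 \<longrightarrow> \<bar>F x\<bar> \<le> B" if "continuous_on UNIV F" for F :: "real^'n \<Rightarrow> real"
  proof -
    have "compact (F ` cball 0 R2)" by (intro compact_continuous_image continuous_on_subset[OF that]) auto
    then have "bounded (F ` cball 0 R2)" by (rule compact_imp_bounded)
    then obtain B where "\<forall>y\<in>F ` cball 0 R2. norm y \<le> B" unfolding bounded_iff by blast
    then show ?thesis by (intro exI[of _ B]) auto
  qed
  have "\<forall>i. \<exists>B. \<forall>x. norm x \<le> R2 \<longrightarrow> \<bar>\<zeta>1 i x\<bar> \<le> B" "\<forall>i j. \<exists>B. \<forall>x. norm x \<le> R2 \<longrightarrow> \<bar>\<zeta>2 i j x\<bar> \<le> B"
    using bd C2D(2,3)[OF C] by blast+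
  then obtain B1 B2 where B1: "\<And>i x. norm x \<le> R2 \<Longrightarrow> \<bar>\<zeta>1 i x\<bar> \<le> B1 i"
    and B2: "\<And>i j x. norm x \<le> R2 \<Longrightarrow> \<bar>\<zeta>2 i j x\<bar> \<le> B2 i j" by metis
  define B where "B = 1 + (\<Sum>i\<in>UNIV. \<bar>B1 i\<bar>) + (\<Sum>p\<in>UNIV. \<bar>B2 (fst p) (snd p)\<bar>)"
  have BB: "B1 i \<le> B" "B2 i j \<le> B" "B \<ge> 1" for i j
  proof -
    have "\<bar>B1 i\<bar> \<le> (\<Sum>i\<in>UNIV. \<bar>B1 i\<bar>)" by (rule member_le_sum) auto
    moreover have "\<bar>B2 (fst (i,j)) (snd (i,j))\<bar> \<le> (\<Sum>p\<in>UNIV. \<bar>B2 (fst p) (snd p)\<bar>)" by (rule member_le_sum) auto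
    moreover have "(\<Sum>i\<in>UNIV. \<bar>B1 i\<bar>) \<ge> 0" "(\<Sum>p\<in>UNIV. \<bar>B2 (fst p) (snd p)\<bar>) \<ge> 0" by (auto intro: sum_nonneg)
    ultimately show "B1 i \<le> B" "B2 i j \<le> B" "B \<ge> 1" unfolding B_def by auto
  qed
  show ?thesis
  proof (rule that[OF C _ _ _ _ _ BB(3)])
    fix x :: "real^'n"
    { assume "norm x \<le> a"
      then have "(norm x)\<^sup>2 \<le> a\<^sup>2" by (intro power_mono) auto
      then have "f x = 0" unfolding fe using d by (intro step_values) (simp add: divide_nonpos_pos)
      then show "f x * g x = 0" by simp }
    { assume "R2 \<le> norm x"
      then have "R2\<^sup>2 \<le> (norm x)\<^sup>2" using ab by (intro power_mono) auto
      then have "g x = 0" unfolding ge using d by (intro step_values) (simp add: divide_nonpos_pos)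
      then show "f x * g x = 0" by simp }
    { assume x: "b \<le> norm x" "norm x \<le> R1"
      then have "b\<^sup>2 \<le> (norm x)\<^sup>2" "(norm x)\<^sup>2 \<le> R1\<^sup>2" using ab by (auto intro!: power_mono)
      then have "f x = 1" "g x = 1" unfolding fe ge using d by (auto intro!: step_values)
      then show "f x * g x = 1" by simp }
    show "0 \<le> f x * g x" unfolding f_def g_def by (intro mult_nonneg_nonneg step_values)
    show "f x * g x \<le> 1" unfolding f_def g_def by (intro mult_le_one step_values)
  next
    fix x :: "real^'n" and i assume "norm x \<le> R2" then show "\<bar>\<zeta>1 i x\<bar> \<le> B" using B1 BB order_trans by blast
  next
    fix x :: "real^'n" and i j assume "norm x \<le> R2" then show "\<bar>\<zeta>2 i j x\<bar> \<le> B" using B2 BB order_trans by blast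
  qed
qed

lemma weight_antimono:
  fixes x :: "real^'n" shows "\<mu> \<ge> 0 \<Longrightarrow> 0 \<le> s \<Longrightarrow> s \<le> norm x \<Longrightarrow> weight \<mu> x \<le> exp (- \<mu> * s\<^sup>2)"
  and "\<mu> \<ge> 0 \<Longrightarrow> norm x \<le> s \<Longrightarrow> weight \<mu> x \<ge> exp (- \<mu> * s\<^sup>2)"
  unfolding weight_def by (auto intro!: mult_left_mono power_mono)

text \<open>The operator applied to \<open>\<zeta> * u\<close>. The commutator with the cut-off function contains only \<open>u\<close> and its first
  derivatives.\<close>

lemma product_operator_bound:
  fixes B :: "'n::finite \<Rightarrow> 'n \<Rightarrow> real"
  assumes B: "\<And>i j. B i j = B j i" "\<And>i j. \<bar>B i j\<bar> \<le> lam" and lam: "lam \<ge> 1" and K: "K \<ge> 0" and b: "b \<ge> 1"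
    and \<zeta>: "0 \<le> \<zeta>" "\<zeta> \<le> 1" "\<And>i. \<bar>\<zeta>1 i\<bar> \<le> b" "\<And>i j. \<bar>\<zeta>2 i j\<bar> \<le> b"
    and S: "(quad2 B u2)\<^sup>2 \<le> K * (u\<^sup>2 + (\<Sum>i\<in>UNIV. (u1 i)\<^sup>2)) + e" "e \<ge> 0"
  shows "(quad2 B (\<lambda>i j. \<zeta>2 i j * u + \<zeta>1 i * u1 j + (\<zeta>1 j * u1 i + \<zeta> * u2 i j)))\<^sup>2
     \<le> (3 * K + 12 * (lam * b * (real CARD('n))\<^sup>2)\<^sup>2) * (u\<^sup>2 + (\<Sum>i\<in>UNIV. (u1 i)\<^sup>2)) + 3 * e"
proof -
  define N where "N = real CARD('n)"
  define D where "D = (\<Sum>i\<in>UNIV. (u1 i)\<^sup>2)"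
  define q where "q = quad2 B (\<lambda>i j. \<zeta>1 i * u1 j)"
  define q2 where "q2 = quad2 B \<zeta>2"
  define m where "m = lam * b * N\<^sup>2"
  have N: "N \<ge> 1" by (simp add: N_def Suc_le_eq)
  have q': "quad2 B (\<lambda>i j. \<zeta>1 j * u1 i) = q"
    unfolding q_def quad2_def by (subst sum.swap) (simp add: B(1)[of i j for i j])
  have "quad2 B (\<lambda>i j. \<zeta>2 i j * u + \<zeta>1 i * u1 j + (\<zeta>1 j * u1 i + \<zeta> * u2 i j))
     = quad2 B (\<lambda>i j. u * \<zeta>2 i j + \<zeta>1 i * u1 j + (\<zeta>1 j * u1 i + \<zeta> * u2 i j))"
    by (simp add: mult.commute)
  also have "\<dots> = u * q2 + q + (q + \<zeta> * quad2 B u2)"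
    unfolding quad2_add quad2_cmult q' q2_def q_def ..
  finally have e: "quad2 B (\<lambda>i j. \<zeta>2 i j * u + \<zeta>1 i * u1 j + (\<zeta>1 j * u1 i + \<zeta> * u2 i j)) = \<zeta> * quad2 B u2 + q2 * u + 2 * q"
    by simp
  have q2b: "\<bar>q2\<bar> \<le> m"
  proof -
    have "\<bar>q2\<bar> \<le> lam * (\<Sum>i\<in>UNIV. \<Sum>j\<in>UNIV. \<bar>\<zeta>2 i j\<bar>)" unfolding q2_def by (rule quad2_abs_le[OF B(2)])
    also have "\<dots> \<le> lam * (\<Sum>i\<in>(UNIV::'n set). \<Sum>j\<in>(UNIV::'n set). b)"
      using lam by (intro mult_left_mono sum_mono \<zeta>) auto
    finally show ?thesis by (simp add: m_def N_def power2_eq_square mult_ac)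
  qed
  have qb: "q\<^sup>2 \<le> m\<^sup>2 * D"
  proof -
    have "\<bar>q\<bar> \<le> lam * (\<Sum>i\<in>UNIV. \<Sum>j\<in>UNIV. \<bar>\<zeta>1 i * u1 j\<bar>)" unfolding q_def by (rule quad2_abs_le[OF B(2)])
    also have "\<dots> \<le> lam * (\<Sum>i\<in>(UNIV::'n set). \<Sum>j\<in>UNIV. b * \<bar>u1 j\<bar>)"
      unfolding abs_mult using lam by (intro mult_left_mono sum_mono mult_right_mono \<zeta>) auto
    also have "\<dots> = lam * b * N * (\<Sum>j\<in>UNIV. \<bar>u1 j\<bar>)" by (simp add: N_def sum_distrib_left mult_ac)
    finally have "\<bar>q\<bar>\<^sup>2 \<le> (lam * b * N * (\<Sum>j\<in>UNIV. \<bar>u1 j\<bar>))\<^sup>2" by (intro power_mono) auto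
    also have "\<dots> = (lam * b * N)\<^sup>2 * (\<Sum>j\<in>UNIV. 1 * \<bar>u1 j\<bar>)\<^sup>2" by (simp add: power_mult_distrib)
    also have "\<dots> \<le> (lam * b * N)\<^sup>2 * ((\<Sum>j\<in>(UNIV::'n set). 1\<^sup>2) * (\<Sum>j\<in>UNIV. \<bar>u1 j\<bar>\<^sup>2))"
      by (intro mult_left_mono Cauchy_Schwarz_ineq_sum) auto
    also have "\<dots> = (lam * b * N)\<^sup>2 * (N * D)" by (simp add: N_def D_def)
    also have "\<dots> \<le> (lam * b * N)\<^sup>2 * (N\<^sup>2 * D)"
    proof -
      have "N * D \<le> N\<^sup>2 * D" using N unfolding D_def power2_eq_square by (intro mult_right_mono) (auto intro: sum_nonneg)
      then show ?thesis by (intro mult_left_mono) auto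
    qed
    finally show ?thesis by (simp add: m_def power_mult_distrib power2_eq_square mult_ac)
  qed
  have three: "(x + y + 2 * z)\<^sup>2 \<le> 3 * x\<^sup>2 + 3 * y\<^sup>2 + 12 * z\<^sup>2" for x y z :: real
  proof -
    have "0 \<le> (x - y)\<^sup>2 + (y - 2 * z)\<^sup>2 + (x - 2 * z)\<^sup>2" by simp
    then show ?thesis by (simp add: power2_eq_square algebra_simps)
  qed
  have "(\<zeta> * quad2 B u2)\<^sup>2 \<le> K * (u\<^sup>2 + D) + e"
  proof -
    have "\<zeta>\<^sup>2 * (quad2 B u2)\<^sup>2 \<le> 1 * (quad2 B u2)\<^sup>2" using \<zeta> by (intro mult_right_mono power_le_one) auto
    then show ?thesis using S by (simp add: power_mult_distrib D_def)
  qed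
  moreover have "(q2 * u)\<^sup>2 \<le> m\<^sup>2 * u\<^sup>2"
    using q2b unfolding power_mult_distrib by (intro mult_right_mono) (auto simp: abs_le_square_iff[symmetric])
  moreover have "12 * (m\<^sup>2 * u\<^sup>2) \<ge> 3 * (m\<^sup>2 * u\<^sup>2)" by simp
  ultimately have "(\<zeta> * quad2 B u2 + q2 * u + 2 * q)\<^sup>2 \<le> (3 * K + 12 * m\<^sup>2) * (u\<^sup>2 + D) + 3 * e"
    using three[of "\<zeta> * quad2 B u2" "q2 * u" q] qb
    unfolding distrib_left distrib_right by linarith
  then show ?thesis unfolding e D_def m_def N_def .
qed

text \<open>The exponents \<open>\<alpha>\<close> and \<open>\<beta>\<close> are the differences of the weight between \<open>r0 / 4\<close> and \<open>\<rho>\<close>, and between \<open>\<rho>\<close> and a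
  radius \<open>R1\<close> between \<open>\<rho>\<close> and \<open>R\<close>; in particular they do not depend on \<open>K\<close>.\<close>

theorem three_ball_classical:
  fixes lam L r0 \<rho> R :: real
  assumes lam: "lam \<ge> 1" and L: "L \<ge> 0" and r: "0 < r0" "r0 < \<rho>" "\<rho> < R" "R < 1"
  obtains \<alpha> \<beta> where "\<alpha> > 0" "\<beta> > 0"
    "\<And>K. K \<ge> 1 \<Longrightarrow> \<exists>C>0. \<exists>\<tau>1\<ge>1. \<forall>A (u :: real^'n \<Rightarrow> real) u1 u2 \<tau>. elliptic_lipschitz lam L A \<longrightarrow> C2 u u1 u2 \<longrightarrow> \<tau> \<ge> \<tau>1 \<longrightarrow>
       cball_integral \<rho> (\<lambda>x. (u x)\<^sup>2) \<le> C * (exp (2 * \<tau> * \<alpha>) * cball_integral r0 (\<lambda>x. (u x)\<^sup>2) + exp (- 2 * \<tau> * \<beta>) * cball_integral R (\<lambda>x. (u x)\<^sup>2)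
          + exp (2 * \<tau>) * cball_integral R (excess K A u u1 u2))"
proof -
  define a where "a = r0 / 4"
  define b where "b = r0 / 2"
  define R1 where "R1 = (2 * \<rho> + R) / 3"
  define R2 where "R2 = (\<rho> + 2 * R) / 3"
  have o: "0 < a" "a < b" "b < r0" "r0 < \<rho>" "\<rho> < R1" "R1 < R2" "R2 < R" "R < 1"
    using r by (auto simp: a_def b_def R1_def R2_def)
  have lam0: "lam > 0" using lam by simp
  obtain \<mu> C0 \<tau>0 where \<mu>: "\<mu> \<ge> 1" and C0: "C0 > 0" and \<tau>0: "\<tau>0 \<ge> 1"
    and carl: "\<And>A (w :: real^'n \<Rightarrow> real) w1 w2 \<tau>. elliptic_lipschitz lam L A \<Longrightarrow> C2 w w1 w2 \<Longrightarrow>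
       (\<And>x. norm x < a \<or> norm x > 1 \<Longrightarrow> w x = 0) \<Longrightarrow> \<tau> \<ge> \<tau>0 \<Longrightarrow>
       (\<integral>x. exp (2 * \<tau> * weight \<mu> x) * (\<tau> * (\<Sum>i\<in>UNIV. (w1 i x)\<^sup>2) + \<tau>^3 * (w x)\<^sup>2) \<partial>lborel)
       \<le> C0 * (\<integral>x. exp (2 * \<tau> * weight \<mu> x) * (second_order A w2 x)\<^sup>2 \<partial>lborel)"
  proof (rule carleman_uniform[where 'n = 'n, OF lam0 L o(1)], goal_cases)
    case (1 \<mu> C \<tau>0)
    from 1(2-5) show ?case by (rule 1(1))
  qed
  define ph where "ph s = exp (- \<mu> * s\<^sup>2)" for s :: real
  have ph_mono: "ph s < ph t" if "0 \<le> t" "t < s" for s t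
  proof -
    have "t\<^sup>2 < s\<^sup>2" using that by (intro power_strict_mono) auto
    then show ?thesis using \<mu> by (simp add: ph_def)
  qed
  have ph01: "0 < ph s" "ph s \<le> 1" for s using \<mu> by (auto simp: ph_def)
  define \<alpha> where "\<alpha> = ph a - ph \<rho>"
  define \<beta> where "\<beta> = ph \<rho> - ph R1"
  have bR1: "b < R1" using o by linarith
  obtain \<zeta> :: "real^'n \<Rightarrow> real" and \<zeta>1 \<zeta>2 B where chi: "C2 \<zeta> \<zeta>1 \<zeta>2"
    "\<And>x. norm x \<le> a \<Longrightarrow> \<zeta> x = 0" "\<And>x. norm x \<ge> R2 \<Longrightarrow> \<zeta> x = 0" "\<And>x. b \<le> norm x \<Longrightarrow> norm x \<le> R1 \<Longrightarrow> \<zeta> x = 1"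
    "\<And>x. 0 \<le> \<zeta> x" "\<And>x. \<zeta> x \<le> 1" "B \<ge> 1" "\<And>x i. norm x \<le> R2 \<Longrightarrow> \<bar>\<zeta>1 i x\<bar> \<le> B" "\<And>x i j. norm x \<le> R2 \<Longrightarrow> \<bar>\<zeta>2 i j x\<bar> \<le> B"
  proof (rule cutoff_shell[where 'n = 'n, OF o(1,2) bR1 o(6)], goal_cases)
    case (1 \<zeta> \<zeta>1 \<zeta>2 B)
    from 1(2-10) show ?case by (rule 1(1))
  qed
  show ?thesis
  proof (rule that[of \<alpha> \<beta>])
    show "\<alpha> > 0" "\<beta> > 0" unfolding \<alpha>_def \<beta>_def using ph_mono o by auto
    fix K :: real assume K: "K \<ge> 1"
    have b0: "0 < b" and r01: "r0 \<le> 1" and R20: "0 < R2" and R01: "R \<le> 1" using o by linarith+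
    obtain Ca where Ca: "Ca > 0"
      "\<And>A (u :: real^'n \<Rightarrow> real) u1 u2. elliptic_lipschitz lam L A \<Longrightarrow> C2 u u1 u2 \<Longrightarrow>
       cball_integral b (\<lambda>x. \<Sum>i\<in>UNIV. (u1 i x)\<^sup>2) \<le> Ca * cball_integral r0 (\<lambda>x. (u x)\<^sup>2 + excess K A u u1 u2 x)"
    proof (rule caccioppoli[where 'n = 'n, OF lam L K b0 o(3) r01], goal_cases)
      case (1 C)
      from 1(2-3) show ?case by (rule 1(1))
    qed
    obtain Cb where Cb: "Cb > 0"
      "\<And>A (u :: real^'n \<Rightarrow> real) u1 u2. elliptic_lipschitz lam L A \<Longrightarrow> C2 u u1 u2 \<Longrightarrow>
       cball_integral R2 (\<lambda>x. \<Sum>i\<in>UNIV. (u1 i x)\<^sup>2) \<le> Cb * cball_integral R (\<lambda>x. (u x)\<^sup>2 + excess K A u u1 u2 x)"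
    proof (rule caccioppoli[where 'n = 'n, OF lam L K R20 o(7) R01], goal_cases)
      case (1 C)
      from 1(2-3) show ?case by (rule 1(1))
    qed
    define Cs where "Cs = 3 * K + 12 * (lam * B * (real CARD('n))\<^sup>2)\<^sup>2"
    have Cs: "Cs \<ge> 1"
      unfolding Cs_def using K zero_le_power2[of "lam * B * (real CARD('n))\<^sup>2"] by linarith
    define \<tau>1 where "\<tau>1 = max \<tau>0 (C0 * K + 1)"
    define C where "C = 1 + C0 * (3 + Cs * (1 + Ca) + Cs * (1 + Cb))"
    have C: "C > 0" unfolding C_def using C0 Cs Ca(1) Cb(1) by (intro add_pos_nonneg mult_nonneg_nonneg add_nonneg_nonneg) auto
    show "\<exists>C>0. \<exists>\<tau>1\<ge>1. \<forall>A (u :: real^'n \<Rightarrow> real) u1 u2 \<tau>. elliptic_lipschitz lam L A \<longrightarrow> C2 u u1 u2 \<longrightarrow> \<tau> \<ge> \<tau>1 \<longrightarrow>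
       cball_integral \<rho> (\<lambda>x. (u x)\<^sup>2) \<le> C * (exp (2 * \<tau> * \<alpha>) * cball_integral r0 (\<lambda>x. (u x)\<^sup>2) + exp (- 2 * \<tau> * \<beta>) * cball_integral R (\<lambda>x. (u x)\<^sup>2)
          + exp (2 * \<tau>) * cball_integral R (excess K A u u1 u2))"
    proof (rule exI[of _ C], rule conjI[OF C], rule exI[of _ \<tau>1], intro conjI allI impI)
      show "\<tau>1 \<ge> 1" using \<tau>0 by (simp add: \<tau>1_def)
      fix A :: "'n \<Rightarrow> 'n \<Rightarrow> real^'n \<Rightarrow> real" and u :: "real^'n \<Rightarrow> real" and u1 u2 \<tau>
      assume A: "elliptic_lipschitz lam L A" and u: "C2 u u1 u2" and "\<tau> \<ge> \<tau>1"
      then have \<tau>: "\<tau> \<ge> \<tau>0" "\<tau> \<ge> C0 * K + 1" "\<tau> \<ge> 1" using \<tau>0 by (auto simp: \<tau>1_def)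
      define e where "e = excess K A u u1 u2"
      define D where "D = (\<lambda>x. (u x)\<^sup>2 + (\<Sum>i\<in>UNIV. (u1 i x)\<^sup>2))"
      define w where "w = (\<lambda>x. \<zeta> x * u x)"
      define w1 where "w1 = (\<lambda>i x. \<zeta>1 i x * u x + \<zeta> x * u1 i x)"
      define w2 where "w2 = (\<lambda>i j x. \<zeta>2 i j x * u x + \<zeta>1 i x * u1 j x + (\<zeta>1 j x * u1 i x + \<zeta> x * u2 i j x))"
      define E where "E x = exp (2 * \<tau> * weight \<mu> x)" for x :: "real^'n"
      define S where "S x = second_order A w2 x" for x
      define X where "X x = E x * ((w x)\<^sup>2 + (\<Sum>i\<in>UNIV. (w1 i x)\<^sup>2))" for x
      have w: "C2 w w1 w2" unfolding w_def w1_def w2_def by (rule C2_mult[OF chi(1) u])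
      have wz: "w x = 0" if "norm x < a \<or> norm x > R2" for x using chi(2,3)[of x] that by (auto simp: w_def)
      have oU: "open {x :: real^'n. norm x < a \<or> norm x > R2}"
        by (intro open_Collect_disj open_Collect_less continuous_intros)
      have w1z: "w1 i x = 0" and w2z: "w2 i j x = 0" if "norm x < a \<or> norm x > R2" for x i j
        using C2_zero_on_open[OF w oU, of x] wz that by auto
      have oM: "open {x :: real^'n. b < norm x \<and> norm x < R1}"
        by (intro open_Collect_conj open_Collect_less continuous_intros)
      have c1z: "\<zeta>1 i x = 0" and c2z: "\<zeta>2 i j x = 0" if "b < norm x \<and> norm x < R1" for x i j
        using C2_const_on_open[OF chi(1) oM, of 1 x] chi(4) that by auto
      have E0: "E x > 0" for x by (simp add: E_def)
      have e0: "e x \<ge> 0" for x unfolding e_def by (rule excess_bound)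
      have D0: "D x \<ge> 0" for x unfolding D_def by (intro add_nonneg_nonneg sum_nonneg) auto
      have X0: "X x \<ge> 0" for x unfolding X_def using E0[of x] by (intro mult_nonneg_nonneg add_nonneg_nonneg sum_nonneg) auto
      have ce: "continuous_on UNIV e" unfolding e_def by (rule continuous_excess[OF A u])
      have cD: "continuous_on UNIV D" unfolding D_def by (intro continuous_intros C2D[OF u])
      have cE: "continuous_on UNIV E" unfolding E_def by (intro continuous_intros C2D(1)[OF C2_weight])
      have cS: "continuous_on UNIV S" unfolding S_def
        by (intro continuous_on_second_order elliptic_lipschitzD(5)[OF A] C2D[OF w])
      have cX: "continuous_on UNIV X" unfolding X_def by (intro continuous_intros cE C2D[OF w])
      \<comment> \<open>a bound for the contributions of the error and of the inner and the outer shell, where the weight is at most its value at \<open>a\<close> and at \<open>R1\<close>\<close>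
      define U where "U x = 3 * exp (2 * \<tau>) * (indicat_real (cball 0 R2) x * e x)
           + Cs * exp (2 * \<tau> * ph a) * (indicat_real (cball 0 b) x * D x)
           + Cs * exp (2 * \<tau> * ph R1) * (indicat_real (cball 0 R2) x * D x)" for x
      have U0: "U x \<ge> 0" "3 * exp (2 * \<tau>) * (indicat_real (cball 0 R2) x * e x) \<ge> 0"
         "Cs * exp (2 * \<tau> * ph a) * (indicat_real (cball 0 b) x * D x) \<ge> 0"
         "Cs * exp (2 * \<tau> * ph R1) * (indicat_real (cball 0 R2) x * D x) \<ge> 0" for x
        unfolding U_def using e0[of x] D0[of x] Cs by auto
      have iU: "integrable lborel U" unfolding U_def
        using integrable_cball[OF ce, of R2] integrable_cball[OF cD, of b] integrable_cball[OF cD, of R2] by auto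
      have pt: "E x * (S x)\<^sup>2 \<le> K * X x + U x" for x
      proof -
        have E1: "E x \<le> exp (2 * \<tau>)"
        proof -
          have "\<tau> * weight \<mu> x \<le> \<tau> * 1" using \<tau> \<mu> by (intro mult_left_mono) (auto simp: weight_def)
          then show ?thesis by (simp add: E_def)
        qed
        have Eb: "E x \<le> exp (2 * \<tau> * ph s)" if "0 \<le> s" "s \<le> norm x" for s
          unfolding E_def ph_def using weight_antimono(1)[of \<mu> s x] that \<tau> \<mu> by (simp add: mult_left_mono)
        have ex: "(second_order A u2 x)\<^sup>2 \<le> K * D x + e x"
          unfolding D_def e_def by (rule excess_bound)
        have shell: "E x * (S x)\<^sup>2 \<le> exp (2 * \<tau> * ph s) * (Cs * D x) + 3 * (exp (2 * \<tau>) * e x)"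
          if s: "norm x \<le> R2" "0 \<le> s" "s \<le> norm x" for s
        proof -
          have "(S x)\<^sup>2 \<le> Cs * D x + 3 * e x" unfolding S_def w2_def Cs_def D_def
            by (rule product_operator_bound) (use elliptic_lipschitzD(1,2)[OF A] lam K chi s ex e0[of x] in \<open>simp_all add: D_def\<close>)
          then have "E x * (S x)\<^sup>2 \<le> E x * (Cs * D x + 3 * e x)" using E0[of x] by (intro mult_left_mono) auto
          also have "\<dots> = E x * (Cs * D x) + 3 * (E x * e x)" by (simp add: algebra_simps)
          also have "E x * (Cs * D x) \<le> exp (2 * \<tau> * ph s) * (Cs * D x)"
            using Eb s D0[of x] Cs by (intro mult_right_mono) auto
          also have "3 * (E x * e x) \<le> 3 * (exp (2 * \<tau>) * e x)"
            using E1 e0[of x] by (intro mult_left_mono mult_right_mono) auto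
          finally show ?thesis by simp
        qed
        consider "norm x < a \<or> norm x > R2" | "b < norm x \<and> norm x < R1"
          | "a \<le> norm x" "norm x \<le> b" | "R1 \<le> norm x" "norm x \<le> R2" by linarith
        then show ?thesis
        proof cases
          case 1
          then have "S x = 0" using w2z by (simp add: S_def quad2_def)
          then show ?thesis using X0[of x] U0(1)[of x] K by simp
        next
          case 2
          then have "S x = second_order A u2 x" "w x = u x" "\<And>i. w1 i x = u1 i x"
            using c1z c2z chi(4)[of x] by (auto simp: S_def w2_def w_def w1_def)
          then have a: "(S x)\<^sup>2 \<le> K * D x + e x" "X x = E x * D x" using ex by (auto simp: X_def D_def)
          have "E x * (S x)\<^sup>2 \<le> E x * (K * D x + e x)" using a E0[of x] by (intro mult_left_mono) auto
          also have "\<dots> = K * X x + E x * e x" by (simp add: a algebra_simps)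
          also have "E x * e x \<le> exp (2 * \<tau>) * e x" using E1 e0 by (intro mult_right_mono)
          also have "exp (2 * \<tau>) * e x \<le> 3 * exp (2 * \<tau>) * (indicat_real (cball 0 R2) x * e x)"
            using 2 o e0[of x] by (simp add: mult.assoc)
          also have "\<dots> \<le> U x" unfolding U_def using U0(3,4)[of x] by linarith
          finally show ?thesis by simp
        next
          case 3
          have "exp (2 * \<tau> * ph a) * (Cs * D x) + 3 * (exp (2 * \<tau>) * e x) \<le> U x"
            unfolding U_def using 3 o U0(4)[of x] by (simp add: mult_ac)
          then show ?thesis using shell[of a] 3 o X0[of x] K by (smt (verit) mult_nonneg_nonneg)
        next
          case 4
          have "exp (2 * \<tau> * ph R1) * (Cs * D x) + 3 * (exp (2 * \<tau>) * e x) \<le> U x"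
            unfolding U_def using 4 U0(3)[of x] by (simp add: mult_ac)
          then show ?thesis using shell[of R1] 4 o X0[of x] K by (smt (verit) mult_nonneg_nonneg)
        qed
      qed
      have iX: "integrable lborel X"
        by (rule integrable_compactly_supported[OF cX, of R2]) (simp add: X_def wz w1z)
      have iS: "integrable lborel (\<lambda>x. E x * (S x)\<^sup>2)"
        by (rule integrable_compactly_supported[where R = R2]) (intro continuous_intros cE cS, simp add: S_def quad2_def w2z)
      have iT: "integrable lborel (\<lambda>x. E x * (\<tau> * (\<Sum>i\<in>UNIV. (w1 i x)\<^sup>2) + \<tau>^3 * (w x)\<^sup>2))"
        by (rule integrable_compactly_supported[where R = R2]) (auto intro!: continuous_intros cE C2D[OF w] simp: wz w1z)
      have "\<tau> * (\<integral>x. X x \<partial>lborel) = (\<integral>x. \<tau> * X x \<partial>lborel)" by simp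
      also have "\<dots> \<le> (\<integral>x. E x * (\<tau> * (\<Sum>i\<in>UNIV. (w1 i x)\<^sup>2) + \<tau>^3 * (w x)\<^sup>2) \<partial>lborel)"
      proof (rule integral_mono[OF _ iT])
        fix x
        have "\<tau>^1 \<le> \<tau>^3" using \<tau>(3) by (intro power_increasing) auto
        then have "\<tau> * (w x)\<^sup>2 \<le> \<tau>^3 * (w x)\<^sup>2" by (intro mult_right_mono) auto
        then have "E x * (\<tau> * (\<Sum>i\<in>UNIV. (w1 i x)\<^sup>2) + \<tau> * (w x)\<^sup>2) \<le> E x * (\<tau> * (\<Sum>i\<in>UNIV. (w1 i x)\<^sup>2) + \<tau>^3 * (w x)\<^sup>2)"
          using E0[of x] by (intro mult_left_mono add_left_mono) auto
        then show "\<tau> * X x \<le> E x * (\<tau> * (\<Sum>i\<in>UNIV. (w1 i x)\<^sup>2) + \<tau>^3 * (w x)\<^sup>2)" by (simp add: X_def algebra_simps)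
      qed (use iX in auto)
      also have "\<dots> \<le> C0 * (\<integral>x. E x * (S x)\<^sup>2 \<partial>lborel)"
        unfolding E_def S_def by (rule carl[OF A w _ \<tau>(1)]) (use wz o in auto)
      also have "\<dots> \<le> C0 * (\<integral>x. K * X x + U x \<partial>lborel)"
        using C0 iX iU iS pt by (intro mult_left_mono integral_mono) auto
      also have "\<dots> = C0 * K * (\<integral>x. X x \<partial>lborel) + C0 * (\<integral>x. U x \<partial>lborel)"
        using iX iU by (simp add: algebra_simps)
      finally have m1: "\<tau> * (\<integral>x. X x \<partial>lborel) \<le> C0 * K * (\<integral>x. X x \<partial>lborel) + C0 * (\<integral>x. U x \<partial>lborel)" .
      have IX0: "(\<integral>x. X x \<partial>lborel) \<ge> 0" using X0 by simp
      \<comment> \<open>absorption of the first order terms: the coefficient \<open>\<tau> - C0 * K\<close> is at least \<open>1\<close>\<close>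
      have m2: "(\<integral>x. X x \<partial>lborel) \<le> C0 * (\<integral>x. U x \<partial>lborel)"
        using m1 mult_right_mono[OF \<tau>(2) IX0] by (simp add: algebra_simps)
      define I0 where "I0 = cball_integral r0 (\<lambda>x. (u x)\<^sup>2)"
      define IR where "IR = cball_integral R (\<lambda>x. (u x)\<^sup>2)"
      define Ie where "Ie = cball_integral R e"
      have cu2: "continuous_on UNIV (\<lambda>x. (u x)\<^sup>2)" by (intro continuous_intros C2D(1)[OF u])
      have cs: "continuous_on UNIV (\<lambda>x. \<Sum>i\<in>UNIV. (u1 i x)\<^sup>2)" by (intro continuous_intros C2D(2)[OF u])
      have pos: "I0 \<ge> 0" "IR \<ge> 0" "Ie \<ge> 0" unfolding I0_def IR_def Ie_def by (auto intro!: cball_integral_nonneg e0)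
      have Da: "cball_integral b D \<le> (1 + Ca) * (I0 + Ie)"
      proof -
        have "cball_integral b D = cball_integral b (\<lambda>x. (u x)\<^sup>2) + cball_integral b (\<lambda>x. \<Sum>i\<in>UNIV. (u1 i x)\<^sup>2)"
          unfolding D_def by (rule cball_integral_add[OF cu2 cs])
        also have "cball_integral b (\<lambda>x. (u x)\<^sup>2) \<le> I0" unfolding I0_def using o by (intro cball_integral_mono_radius cu2) auto
        also have "cball_integral b (\<lambda>x. \<Sum>i\<in>UNIV. (u1 i x)\<^sup>2) \<le> Ca * cball_integral r0 (\<lambda>x. (u x)\<^sup>2 + e x)"
          unfolding e_def by (rule Ca(2)[OF A u])
        also have "cball_integral r0 (\<lambda>x. (u x)\<^sup>2 + e x) = I0 + cball_integral r0 e" unfolding I0_def by (rule cball_integral_add[OF cu2 ce])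
        also have "cball_integral r0 e \<le> Ie" unfolding Ie_def using o by (intro cball_integral_mono_radius ce e0) auto
        finally show ?thesis using pos Ca(1) by (simp add: algebra_simps mult_left_mono)
      qed
      have Db: "cball_integral R2 D \<le> (1 + Cb) * (IR + Ie)"
      proof -
        have "cball_integral R2 D = cball_integral R2 (\<lambda>x. (u x)\<^sup>2) + cball_integral R2 (\<lambda>x. \<Sum>i\<in>UNIV. (u1 i x)\<^sup>2)"
          unfolding D_def by (rule cball_integral_add[OF cu2 cs])
        also have "cball_integral R2 (\<lambda>x. (u x)\<^sup>2) \<le> IR" unfolding IR_def using o by (intro cball_integral_mono_radius cu2) auto
        also have "cball_integral R2 (\<lambda>x. \<Sum>i\<in>UNIV. (u1 i x)\<^sup>2) \<le> Cb * cball_integral R (\<lambda>x. (u x)\<^sup>2 + e x)"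
          unfolding e_def by (rule Cb(2)[OF A u])
        also have "cball_integral R (\<lambda>x. (u x)\<^sup>2 + e x) = IR + Ie" unfolding IR_def Ie_def by (rule cball_integral_add[OF cu2 ce])
        finally show ?thesis using pos Cb(1) by (simp add: algebra_simps)
      qed
      have IU: "(\<integral>x. U x \<partial>lborel) = 3 * exp (2 * \<tau>) * cball_integral R2 e + Cs * exp (2 * \<tau> * ph a) * cball_integral b D + Cs * exp (2 * \<tau> * ph R1) * cball_integral R2 D"
        unfolding U_def cball_integral_def
        using integrable_cball[OF ce, of R2] integrable_cball[OF cD, of b] integrable_cball[OF cD, of R2] by simp
      have low: "exp (2 * \<tau> * ph \<rho>) * (cball_integral \<rho> (\<lambda>x. (u x)\<^sup>2) - cball_integral b (\<lambda>x. (u x)\<^sup>2)) \<le> (\<integral>x. X x \<partial>lborel)"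
      proof -
        have "exp (2 * \<tau> * ph \<rho>) * (cball_integral \<rho> (\<lambda>x. (u x)\<^sup>2) - cball_integral b (\<lambda>x. (u x)\<^sup>2))
          = (\<integral>x. exp (2 * \<tau> * ph \<rho>) * (indicat_real (cball 0 \<rho>) x * (u x)\<^sup>2 - indicat_real (cball 0 b) x * (u x)\<^sup>2) \<partial>lborel)"
          unfolding cball_integral_def using integrable_cball[OF cu2] by simp
        also have "\<dots> \<le> (\<integral>x. X x \<partial>lborel)"
        proof (rule integral_mono)
          show "integrable lborel (\<lambda>x. exp (2 * \<tau> * ph \<rho>) * (indicat_real (cball 0 \<rho>) x * (u x)\<^sup>2 - indicat_real (cball 0 b) x * (u x)\<^sup>2))"
            using integrable_cball[OF cu2] by auto
          fix x :: "real^'n"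
          show "exp (2 * \<tau> * ph \<rho>) * (indicat_real (cball 0 \<rho>) x * (u x)\<^sup>2 - indicat_real (cball 0 b) x * (u x)\<^sup>2) \<le> X x"
          proof (cases "b < norm x \<and> norm x \<le> \<rho>")
            case True
            then have wu: "w x = u x" using chi(4)[of x] o by (simp add: w_def)
            have "exp (2 * \<tau> * ph \<rho>) \<le> E x" unfolding E_def ph_def
              using weight_antimono(2)[of \<mu> x \<rho>] True \<tau> \<mu> by (simp add: mult_left_mono)
            then have "exp (2 * \<tau> * ph \<rho>) * (u x)\<^sup>2 \<le> E x * ((w x)\<^sup>2 + (\<Sum>i\<in>UNIV. (w1 i x)\<^sup>2))"
              unfolding wu using E0[of x] by (intro mult_mono) (auto intro: sum_nonneg)
            then show ?thesis using True by (simp add: X_def indicator_def)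
          next
            case False
            then have "indicat_real (cball 0 \<rho>) x * (u x)\<^sup>2 - indicat_real (cball 0 b) x * (u x)\<^sup>2 = 0"
              using o by (auto simp: indicator_def)
            then show ?thesis using X0[of x] by (simp only: mult_zero_right)
          qed
        qed (rule iX)
        finally show ?thesis .
      qed
      define P where "P = exp (2 * \<tau> * ph \<rho>)"
      have P0: "P > 0" by (simp add: P_def)
      have P1: "P \<ge> 1" using \<tau> ph01(1)[of \<rho>] by (simp add: P_def)
      have eqa: "exp (2 * \<tau> * ph a) = P * exp (2 * \<tau> * \<alpha>)" unfolding P_def \<alpha>_def exp_add[symmetric] by (simp add: algebra_simps)
      have eqb: "exp (2 * \<tau> * ph R1) = P * exp (- 2 * \<tau> * \<beta>)" unfolding P_def \<beta>_def exp_add[symmetric] by (simp add: algebra_simps)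
      define ea where "ea = exp (2 * \<tau> * \<alpha>)"
      define eb where "eb = exp (- 2 * \<tau> * \<beta>)"
      define et where "et = exp (2 * \<tau>)"
      have ea1: "1 \<le> ea" "ea \<le> et"
      proof -
        have "0 \<le> \<tau> * \<alpha>" using \<tau> ph_mono[of a \<rho>] o by (intro mult_nonneg_nonneg) (auto simp: \<alpha>_def)
        then show "1 \<le> ea" unfolding ea_def one_le_exp_iff by linarith
        have "\<tau> * \<alpha> \<le> \<tau> * 1" using \<tau> ph01(2)[of a] ph01(1)[of \<rho>] by (intro mult_left_mono) (auto simp: \<alpha>_def)
        then show "ea \<le> et" unfolding ea_def et_def exp_le_cancel_iff by linarith
      qed
      have eb1: "0 \<le> eb" "eb \<le> et"
      proof -
        have "0 \<le> \<tau> * \<beta>" using \<tau> ph_mono[of \<rho> R1] o by (intro mult_nonneg_nonneg) (auto simp: \<beta>_def)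
        moreover have "0 \<le> \<tau>" using \<tau> by simp
        ultimately show "eb \<le> et" unfolding eb_def et_def exp_le_cancel_iff by linarith
      qed (simp add: eb_def)
      have "cball_integral R2 e \<le> Ie" unfolding Ie_def using o by (intro cball_integral_mono_radius ce e0) auto
      have J: "cball_integral \<rho> (\<lambda>x. (u x)\<^sup>2) - cball_integral b (\<lambda>x. (u x)\<^sup>2) \<le> C0 * (3 * et * Ie + Cs * ea * ((1 + Ca) * (I0 + Ie)) + Cs * eb * ((1 + Cb) * (IR + Ie)))"
      proof -
        have "P * (cball_integral \<rho> (\<lambda>x. (u x)\<^sup>2) - cball_integral b (\<lambda>x. (u x)\<^sup>2)) \<le> C0 * (\<integral>x. U x \<partial>lborel)"
          using low m2 unfolding P_def by linarith
        also have "\<dots> \<le> C0 * (3 * et * (P * Ie) + Cs * (P * ea) * ((1 + Ca) * (I0 + Ie)) + Cs * (P * eb) * ((1 + Cb) * (IR + Ie)))"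
          unfolding IU ea_def eb_def et_def \<open>exp (2 * \<tau> * ph a) = P * exp (2 * \<tau> * \<alpha>)\<close> \<open>exp (2 * \<tau> * ph R1) = P * exp (- 2 * \<tau> * \<beta>)\<close>
        proof (intro mult_left_mono add_mono Da Db)
          have "1 * Ie \<le> P * Ie" using P1 pos by (intro mult_right_mono) auto
          then show "cball_integral R2 e \<le> P * Ie" using \<open>cball_integral R2 e \<le> Ie\<close> by simp
        qed (use C0 Cs P0 in auto)
        also have "\<dots> = P * (C0 * (3 * et * Ie + Cs * ea * ((1 + Ca) * (I0 + Ie)) + Cs * eb * ((1 + Cb) * (IR + Ie))))"
          by (simp add: algebra_simps)
        finally show ?thesis using P0 by simp
      qed
      have "cball_integral b (\<lambda>x. (u x)\<^sup>2) \<le> I0" unfolding I0_def using o by (intro cball_integral_mono_radius cu2) auto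
      also have "\<dots> \<le> ea * I0" using ea1 pos by (simp add: mult_le_cancel_right1)
      finally have J2: "cball_integral b (\<lambda>x. (u x)\<^sup>2) \<le> ea * I0" .
      define Y where "Y = ea * I0 + eb * IR + et * Ie"
      have Y: "ea * I0 \<le> Y" "et * Ie \<le> Y" "ea * (I0 + Ie) \<le> Y" "eb * (IR + Ie) \<le> Y" "Y \<ge> 0"
      proof -
        have "0 \<le> ea * I0" "0 \<le> eb * IR" "0 \<le> et * Ie" "ea * Ie \<le> et * Ie" "eb * Ie \<le> et * Ie"
          using pos ea1 eb1 by (auto intro!: mult_right_mono)
        then show "ea * I0 \<le> Y" "et * Ie \<le> Y" "ea * (I0 + Ie) \<le> Y" "eb * (IR + Ie) \<le> Y" "Y \<ge> 0"
          unfolding Y_def distrib_left by linarith+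
      qed
      have "C0 * (3 * et * Ie + Cs * ea * ((1 + Ca) * (I0 + Ie)) + Cs * eb * ((1 + Cb) * (IR + Ie)))
         = C0 * (3 * (et * Ie) + Cs * (1 + Ca) * (ea * (I0 + Ie)) + Cs * (1 + Cb) * (eb * (IR + Ie)))"
        by (simp add: mult_ac)
      also have "\<dots> \<le> C0 * (3 * Y + Cs * (1 + Ca) * Y + Cs * (1 + Cb) * Y)"
        using C0 Cs Ca(1) Cb(1) by (intro mult_left_mono add_mono Y) auto
      finally have "cball_integral \<rho> (\<lambda>x. (u x)\<^sup>2) \<le> C0 * (3 * Y + Cs * (1 + Ca) * Y + Cs * (1 + Cb) * Y) + Y"
        using J J2 Y(1) by linarith
      also have "\<dots> = C * Y" by (simp add: C_def algebra_simps)
      finally show "cball_integral \<rho> (\<lambda>x. (u x)\<^sup>2) \<le> C * (exp (2 * \<tau> * \<alpha>) * cball_integral r0 (\<lambda>x. (u x)\<^sup>2) + exp (- 2 * \<tau> * \<beta>) * cball_integral R (\<lambda>x. (u x)\<^sup>2)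
          + exp (2 * \<tau>) * cball_integral R (excess K A u u1 u2))"
        unfolding Y_def ea_def eb_def et_def I0_def IR_def Ie_def e_def .
    qed
  qed
qed

section \<open>Smooth mollifiers\<close>

text \<open>The functions \<open>t\<^sup>-\<^sup>k exp (- 1 / t)\<close>, extended by \<open>0\<close>. Their linear combinations are closed under
  differentiation, which makes their smoothness visible without computing higher derivatives.\<close>

definition flat :: "nat \<Rightarrow> real \<Rightarrow> real" where
  "flat k t = (if t > 0 then exp (- 1 / t) / t ^ k else 0)"

lemma power_div_fact_le_exp:
  fixes x :: real assumes "x \<ge> 0" shows "x ^ m / fact m \<le> exp x"
proof -
  have s: "(\<lambda>n. x ^ n /\<^sub>R fact n) sums exp x" by (rule exp_converges)
  have "sum (\<lambda>n. x ^ n /\<^sub>R fact n) {m} \<le> suminf (\<lambda>n. x ^ n /\<^sub>R fact n)"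
    using assms s by (intro sum_le_suminf) (auto simp: sums_iff)
  then show ?thesis using s by (simp add: sums_iff divide_inverse mult.commute)
qed

lemma flat_bound: "\<bar>flat k t\<bar> \<le> fact (k + 2) * t\<^sup>2"
proof (cases "t > 0")
  case True
  define F where "F = (fact (k + 2) :: real)"
  have F: "F > 0" by (simp add: F_def)
  have "(1 / t) ^ (k + 2) / F \<le> exp (1 / t)" unfolding F_def using True by (intro power_div_fact_le_exp) auto
  then have "exp (- (1 / t)) \<le> F * t ^ (k + 2)"
    using True F by (simp add: exp_minus field_simps)
  then have "exp (- (1 / t)) / t ^ k \<le> F * t ^ (k + 2) / t ^ k"
    using True by (intro divide_right_mono) auto
  then show ?thesis using True unfolding F_def[symmetric] by (simp add: flat_def power_add power2_eq_square)
qed (simp add: flat_def)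

lemma DERIV_flat: "(flat k has_real_derivative - real k * flat (Suc k) t + flat (Suc (Suc k)) t) (at t)"
proof -
  consider "t > 0" | "t < 0" | "t = 0" by linarith
  then show ?thesis
  proof cases
    case 1
    have ev: "eventually (\<lambda>s. flat k s = exp (- 1 / s) / s ^ k) (nhds t)"
      using eventually_nhds_in_open[of "{0<..}" t] 1 by (auto elim!: eventually_mono simp: flat_def)
    have "((\<lambda>s. exp (- 1 / s) / s ^ k) has_real_derivative
       (exp (- 1 / t) * (1 / t\<^sup>2) * t ^ k - exp (- 1 / t) * (real k * t ^ (k - Suc 0))) / (t ^ k * t ^ k)) (at t)"
      using 1 by (auto intro!: derivative_eq_intros simp: power2_eq_square)
    also have "(exp (- 1 / t) * (1 / t\<^sup>2) * t ^ k - exp (- 1 / t) * (real k * t ^ (k - Suc 0))) / (t ^ k * t ^ k)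
      = - real k * flat (Suc k) t + flat (Suc (Suc k)) t"
      using 1 by (cases k) (simp_all add: flat_def power2_eq_square field_simps)
    finally show ?thesis using DERIV_cong_ev[OF refl ev refl] by simp
  next
    case 2
    have ev: "eventually (\<lambda>s. flat k s = 0) (nhds t)"
      using eventually_nhds_in_open[of "{..<0}" t] 2 by (auto elim!: eventually_mono simp: flat_def)
    have "(flat k has_real_derivative 0) (at t)"
      using DERIV_cong_ev[OF refl ev refl, of 0] by (simp only: DERIV_const)
    moreover have "- real k * flat (Suc k) t + flat (Suc (Suc k)) t = 0" using 2 by (simp add: flat_def)
    ultimately show ?thesis by (simp only:)
  next
    case 3
    have b: "norm (flat k s / s) \<le> fact (k + 2) * \<bar>s\<bar>" for s
    proof (cases "s = 0")
      case False
      have "\<bar>flat k s\<bar> / \<bar>s\<bar> \<le> fact (k + 2) * s\<^sup>2 / \<bar>s\<bar>" by (intro divide_right_mono flat_bound) auto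
      also have "\<dots> = fact (k + 2) * \<bar>s\<bar>"
        using False by (auto simp: power2_eq_square abs_if simp del: fact_Suc)
      finally show ?thesis by simp
    qed (simp add: flat_def)
    have "((\<lambda>s::real. fact (k + 2) * \<bar>s\<bar>) \<longlongrightarrow> fact (k + 2) * \<bar>0\<bar>) (at 0)" by (intro tendsto_intros)
    then have "((\<lambda>s::real. fact (k + 2) * \<bar>s\<bar>) \<longlongrightarrow> 0) (at 0)" by (simp del: fact_Suc)
    then have "((\<lambda>s. flat k s / s) \<longlongrightarrow> 0) (at 0)"
      by (rule Lim_null_comparison[rotated]) (use b in auto)
    then show ?thesis using 3 by (simp add: DERIV_def flat_def)
  qed
qed

lemma continuous_flat: "continuous_on UNIV (flat k)"
  by (rule DERIV_continuous_on[OF has_field_derivative_at_within[OF DERIV_flat]])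

text \<open>Smoothness asks for all iterated partial derivatives. A class of differentiable functions that contains its
  partial derivatives consists of smooth functions; closing the coordinate functions under sums, products and
  composition with \<open>flat k\<close> gives such a class, and it contains the mollifiers.\<close>

inductive_set smooth_class :: "(real^'n \<Rightarrow> real) set" where
  const: "(\<lambda>x. c) \<in> smooth_class"
| coord: "(\<lambda>x. x $ i) \<in> smooth_class"
| add: "f \<in> smooth_class \<Longrightarrow> g \<in> smooth_class \<Longrightarrow> (\<lambda>x. f x + g x) \<in> smooth_class"
| mult: "f \<in> smooth_class \<Longrightarrow> g \<in> smooth_class \<Longrightarrow> (\<lambda>x. f x * g x) \<in> smooth_class"
| flat: "f \<in> smooth_class \<Longrightarrow> (\<lambda>x. flat k (f x)) \<in> smooth_class"

lemma smooth_class_derivative: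
  assumes "f \<in> smooth_class"
  shows "\<exists>D. (\<forall>x. (f has_derivative D x) (at x)) \<and> (\<forall>i. (\<lambda>x. D x (axis i 1)) \<in> smooth_class)"
  using assms
proof induction
  case (const c)
  show ?case by (rule exI[of _ "\<lambda>x h. 0"]) (auto intro: smooth_class.const)
next
  case (coord j)
  show ?case
    by (rule exI[of _ "\<lambda>x h. h $ j"]) (auto intro: smooth_class.const bounded_linear_imp_has_derivative bounded_linear_vec_nth)
next
  case (add f g)
  then obtain D E where D: "\<And>x. (f has_derivative D x) (at x)" "\<And>i. (\<lambda>x. D x (axis i 1)) \<in> smooth_class"
    and E: "\<And>x. (g has_derivative E x) (at x)" "\<And>i. (\<lambda>x. E x (axis i 1)) \<in> smooth_class" by blast
  show ?case
    by (rule exI[of _ "\<lambda>x h. D x h + E x h"]) (auto intro!: smooth_class.add has_derivative_add D E)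
next
  case (mult f g)
  then obtain D E where D: "\<And>x. (f has_derivative D x) (at x)" "\<And>i. (\<lambda>x. D x (axis i 1)) \<in> smooth_class"
    and E: "\<And>x. (g has_derivative E x) (at x)" "\<And>i. (\<lambda>x. E x (axis i 1)) \<in> smooth_class" by blast
  show ?case
    by (rule exI[of _ "\<lambda>x h. f x * E x h + D x h * g x"])
      (auto intro!: smooth_class.add smooth_class.mult has_derivative_mult D E mult)
next
  case (flat f k)
  then obtain D where D: "\<And>x. (f has_derivative D x) (at x)" "\<And>i. (\<lambda>x. D x (axis i 1)) \<in> smooth_class" by blast
  have d: "((\<lambda>x. flat k (f x)) has_derivative (\<lambda>h. (- real k * flat (Suc k) (f x) + flat (Suc (Suc k)) (f x)) * D x h)) (at x)" for x
    by (rule has_derivative_compose[OF D(1) DERIV_flat[THEN has_field_derivative_imp_has_derivative]])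
  show ?case
  proof (rule exI, intro conjI allI, rule d)
    show "(\<lambda>x. (- real k * flat (Suc k) (f x) + flat (Suc (Suc k)) (f x)) * D x (axis i 1)) \<in> smooth_class" for i
      by (intro smooth_class.intros D flat)
  qed
qed

lemma smooth_classD:
  assumes "f \<in> smooth_class"
  shows "f differentiable (at x)" "pderiv_at i f \<in> smooth_class" "has_partial i f (pderiv_at i f)" "continuous_on UNIV f"
proof -
  obtain D where D: "\<And>x. (f has_derivative D x) (at x)" "\<And>i. (\<lambda>x. D x (axis i 1)) \<in> smooth_class"
    using smooth_class_derivative[OF assms] by blast
  show "f differentiable (at x)" using D(1) by (auto simp: differentiable_def)
  have p: "pderiv_at i f x = D x (axis i 1)" for x
    unfolding pderiv_at_def using frechet_derivative_at[OF D(1)[of x]] by simp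
  have "pderiv_at i f = (\<lambda>x. D x (axis i 1))" by (rule ext) (rule p)
  then show "pderiv_at i f \<in> smooth_class" using D(2)[of i] by simp
  show "has_partial i f (pderiv_at i f)"
    unfolding has_partial_def
  proof
    fix x :: "real^'a"
    have "((\<lambda>t::real. x + t *\<^sub>R axis i 1) has_derivative (\<lambda>t. t *\<^sub>R axis i 1)) (at 0)"
      by (auto intro!: derivative_eq_intros)
    moreover have "(f has_derivative D x) (at (x + 0 *\<^sub>R axis i 1))" using D(1)[of x] by simp
    ultimately have "((\<lambda>t. f (x + t *\<^sub>R axis i 1)) has_derivative (\<lambda>t. D x (t *\<^sub>R axis i 1))) (at 0)"
      by (rule has_derivative_compose)
    moreover have "D x (t *\<^sub>R axis i 1) = D x (axis i 1) * t" for t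
      using linear_cmul[OF has_derivative_linear[OF D(1)[of x]], of t "axis i 1"] by simp
    ultimately show "((\<lambda>t. f (x + t *\<^sub>R axis i 1)) has_real_derivative pderiv_at i f x) (at 0)"
      unfolding has_field_derivative_def p by simp
  qed
  show "continuous_on UNIV f"
    using D(1) by (auto intro!: continuous_at_imp_continuous_on has_derivative_continuous)
qed

lemma smooth_class_smooth:
  assumes "f \<in> smooth_class"
  shows "smooth f"
proof -
  have "foldr pderiv_at is f \<in> smooth_class" for "is"
    by (induction "is") (auto intro: assms smooth_classD(2))
  then show ?thesis unfolding smooth_def using smooth_classD(1) by blast
qed

lemma smooth_class_sum:
  assumes "finite S" "\<And>s. s \<in> S \<Longrightarrow> f s \<in> smooth_class"
  shows "(\<lambda>x. \<Sum>s\<in>S. f s x) \<in> smooth_class"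
  using assms by (induction S rule: finite_induct) (auto intro: smooth_class.intros)

lemma has_partial_unique:
  assumes "has_partial i f f'" "has_partial i f f''"
  shows "f' x = f'' x"
  using assms DERIV_unique unfolding has_partial_def by blast

lemma has_partial_reflect:
  assumes "has_partial i f f'"
  shows "has_partial i (\<lambda>y. f (x - y)) (\<lambda>y. - f' (x - y))"
  unfolding has_partial_def
proof
  fix y
  have "((\<lambda>t. f ((x - y) + t *\<^sub>R axis i 1)) has_real_derivative f' (x - y)) (at (- 0))"
    using assms by (simp add: has_partial_def)
  then have "((\<lambda>t. f ((x - y) + (- t) *\<^sub>R axis i 1)) has_real_derivative f' (x - y) * - 1) (at 0)"
    by (rule DERIV_chain2[where g = uminus]) (auto intro!: derivative_eq_intros)
  then show "((\<lambda>t. f (x - (y + t *\<^sub>R axis i 1))) has_real_derivative - f' (x - y)) (at 0)"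
    by (simp add: algebra_simps)
qed

text \<open>The bounds are relative to the volume of the ball of radius \<open>\<epsilon>\<close>, so that convolution with \<open>k\<close> and with
  \<open>\<epsilon> * k1\<close> is dominated by \<open>C\<close> times the mean over that ball, with \<open>C\<close> independent of \<open>\<epsilon>\<close>. The last two
  conjuncts say that \<open>k\<close> and its first derivatives, reflected and translated, can serve as test functions.\<close>

definition mollifier :: "real \<Rightarrow> real \<Rightarrow> (real^'n \<Rightarrow> real) \<Rightarrow> ('n \<Rightarrow> real^'n \<Rightarrow> real) \<Rightarrow>
     ('n \<Rightarrow> 'n \<Rightarrow> real^'n \<Rightarrow> real) \<Rightarrow> bool" where
  "mollifier C \<epsilon> k k1 k2 \<longleftrightarrow> C2 k k1 k2 \<and> (\<forall>z. k z \<ge> 0) \<and> (\<forall>z. norm z \<ge> \<epsilon> \<longrightarrow> k z = 0) \<and>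
     integral\<^sup>L lborel k = 1 \<and> (\<forall>z. k z \<le> C / measure lborel (ball (0::real^'n) \<epsilon>)) \<and>
     (\<forall>i z. \<bar>k1 i z\<bar> \<le> C / (\<epsilon> * measure lborel (ball (0::real^'n) \<epsilon>))) \<and>
     (\<forall>x. smooth (\<lambda>y. k (x - y)) \<and> (\<forall>i y. pderiv_at i (\<lambda>y. k (x - y)) y = - k1 i (x - y))) \<and>
     (\<forall>x i. smooth (\<lambda>y. k1 i (x - y)) \<and> (\<forall>j y. pderiv_at j (\<lambda>y. k1 i (x - y)) y = - k2 i j (x - y)))"

lemma mollifier_exists:
  obtains C where "C > 0" "\<And>\<epsilon>. \<epsilon> > 0 \<Longrightarrow> \<exists>k k1 k2. mollifier C \<epsilon> (k :: real^'n \<Rightarrow> real) k1 k2"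
proof -
  obtain M where M: "\<And>t. t \<le> 1 \<Longrightarrow> \<bar>flat 2 t\<bar> \<le> M" "M > 0"
  proof -
    have "\<bar>flat 2 t\<bar> \<le> fact 4" if "t \<le> 1" for t
    proof (cases "t > 0")
      case True
      have "\<bar>flat 2 t\<bar> \<le> fact 4 * t\<^sup>2" using flat_bound[of 2 t] by simp
      also have "\<dots> \<le> fact 4 * 1" using True that by (intro mult_left_mono power_le_one) auto
      finally show ?thesis by simp
    qed (simp add: flat_def)
    then show ?thesis using that[of "fact 4"] by simp
  qed
  define N where "N = CARD('n)"
  define C where "C = exp 2 * 2 ^ N * max 1 (2 * M)"
  show ?thesis
  proof (rule that[of C])
    show "C > 0" by (simp add: C_def)
    fix \<epsilon> :: real assume \<epsilon>: "\<epsilon> > 0"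
    define V where "V = measure lborel (ball (0::real^'n) \<epsilon>)"
    have V: "V > 0" unfolding V_def using \<epsilon> by (simp add: content_ball_pos)
    \<comment> \<open>the kernel is \<open>exp (- 1 / q)\<close>, where \<open>q\<close> is positive exactly on the ball of radius \<open>\<epsilon>\<close>\<close>
    define q where "q = (\<lambda>z::real^'n. 1 + (- 1 / \<epsilon>\<^sup>2) * (norm z)\<^sup>2)"
    define K where "K = (\<lambda>z. flat 0 (q z))"
    define K1 where "K1 = (\<lambda>i z. flat 2 (q z) * ((- 1 / \<epsilon>\<^sup>2) * (2 * z $ i)))"
    define K2 where "K2 = (\<lambda>i j (z::real^'n). ((- 2 * flat 3 (q z) + flat 4 (q z)) * ((- 1 / \<epsilon>\<^sup>2) * (2 * z $ j))) * ((- 1 / \<epsilon>\<^sup>2) * (2 * z $ i))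
         + flat 2 (q z) * ((- 1 / \<epsilon>\<^sup>2) * (2 * (if i = j then 1 else 0))))"
    have C2q: "C2 q (\<lambda>i z. (- 1 / \<epsilon>\<^sup>2) * (2 * z $ i)) (\<lambda>i j z. (- 1 / \<epsilon>\<^sup>2) * (2 * (if i = j then 1 else 0)))"
      unfolding q_def by (rule C2_affine[OF C2_norm2])
    have C2K: "C2 K K1 K2"
      unfolding K_def K1_def K2_def
    proof (rule C2_chain[OF C2q])
      show "(flat 0 has_real_derivative flat 2 t) (at t)" for t
        using DERIV_flat[of 0 t] by (simp add: numeral_2_eq_2)
      show "(flat 2 has_real_derivative - 2 * flat 3 t + flat 4 t) (at t)" for t
        using DERIV_flat[of 2 t] by (simp add: eval_nat_numeral)
      show "continuous_on UNIV (\<lambda>t. - 2 * flat 3 t + flat 4 t)"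
        by (intro continuous_intros continuous_flat)
    qed
    have q1: "q z \<le> 1" for z by (simp add: q_def)
    have qz: "q z \<le> 0" if "norm z \<ge> \<epsilon>" for z
    proof -
      have "\<epsilon>\<^sup>2 \<le> (norm z)\<^sup>2" using that \<epsilon> by (intro power_mono) auto
      then show ?thesis using \<epsilon> by (simp add: q_def field_simps)
    qed
    have K0: "K z \<ge> 0" for z by (simp add: K_def flat_def)
    have Kz: "K z = 0" if "norm z \<ge> \<epsilon>" for z using qz[OF that] by (simp add: K_def flat_def)
    have K1z: "K1 i z = 0" if "norm z \<ge> \<epsilon>" for z i using qz[OF that] by (simp add: K1_def flat_def)
    have Kle: "K z \<le> 1" for z by (simp add: K_def flat_def)
    have K1le: "\<bar>K1 i z\<bar> \<le> 2 * M / \<epsilon>" for i z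
    proof (cases "norm z \<ge> \<epsilon>")
      case False
      have zi: "\<bar>z $ i\<bar> \<le> \<epsilon>" using component_le_norm_cart[of z i] False by simp
      have "\<bar>K1 i z\<bar> = \<bar>flat 2 (q z)\<bar> * (2 * \<bar>z $ i\<bar> / \<epsilon>\<^sup>2)" by (simp add: K1_def abs_mult)
      also have "\<dots> \<le> M * (2 * \<epsilon> / \<epsilon>\<^sup>2)"
        using M zi \<epsilon> by (intro mult_mono M q1 divide_right_mono) auto
      also have "\<dots> = 2 * M / \<epsilon>" using \<epsilon> by (simp add: power2_eq_square)
      finally show ?thesis .
    qed (use K1z M \<epsilon> in simp)
    define c where "c = integral\<^sup>L lborel K"
    have iK: "integrable lborel K" by (rule integrable_compactly_supported[OF C2D(1)[OF C2K], of \<epsilon>]) (use Kz in auto)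
    have c: "c \<ge> V / (exp 2 * 2 ^ N)"
    proof -
      have "(1/2)^N * V = measure lborel (ball (0::real^'n) (\<epsilon>/2))"
        unfolding V_def N_def using \<epsilon> content_ball_conv_unit_ball[of \<epsilon> "0::real^'n"] content_ball_conv_unit_ball[of "\<epsilon>/2" "0::real^'n"]
        by (simp add: power_divide)
      then have "exp (-2) * ((1/2)^N * V) = (\<integral>z. exp (-2) * indicat_real (ball (0::real^'n) (\<epsilon>/2)) z \<partial>lborel)"
        by simp
      also have "\<dots> \<le> c" unfolding c_def
      proof (rule integral_mono[OF _ iK])
        show "integrable lborel (\<lambda>z. exp (-2) * indicat_real (ball (0::real^'n) (\<epsilon>/2)) z)"
          by (intro integrable_mult_right integrable_real_indicator) (auto simp: emeasure_lborel_ball_finite[unfolded infinity_ennreal_def])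
        fix z :: "real^'n"
        show "exp (-2) * indicat_real (ball 0 (\<epsilon>/2)) z \<le> K z"
        proof (cases "norm z < \<epsilon> / 2")
          case True
          then have "(norm z)\<^sup>2 \<le> (\<epsilon> / 2)\<^sup>2" by (intro power_mono) auto
          then have "2 * (norm z)\<^sup>2 \<le> \<epsilon>\<^sup>2"
            using zero_le_power2[of "norm z"] by (simp only: power_divide power2_eq_square[of 2])
          then have q: "q z \<ge> 1 / 2" using \<epsilon> by (simp add: q_def field_simps)
          then have "1 / q z \<le> 2" by (simp add: field_simps)
          then have "exp (-2) \<le> exp (- 1 / q z)" by simp
          then show ?thesis using q True by (simp add: K_def flat_def)
        qed (use K0 in simp)
      qed
      finally show ?thesis by (simp add: exp_minus field_simps power_one_over)
    qed
    have c0: "c > 0" using c V by (smt (verit) divide_pos_pos exp_gt_zero mult_pos_pos zero_less_power)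
    have ci: "1 / c \<le> exp 2 * 2 ^ N / V" using c V c0 by (simp add: field_simps)
    define k where "k = (\<lambda>z. (1 / c) * K z)"
    define k1 where "k1 = (\<lambda>i z. (1 / c) * K1 i z)"
    define k2 where "k2 = (\<lambda>i j z. (1 / c) * K2 i j z)"
    have C2k: "C2 k k1 k2" unfolding k_def k1_def k2_def using C2_affine[OF C2K, of 0 "1/c"] by simp
    have nrm: "(\<lambda>y::real^'n. (norm (x - y))\<^sup>2) \<in> smooth_class" for x
    proof -
      have "(\<lambda>y::real^'n. \<Sum>i\<in>UNIV. (x $ i + (- 1) * y $ i) * (x $ i + (- 1) * y $ i)) \<in> smooth_class"
        by (intro smooth_class_sum smooth_class.intros) auto
      moreover have "(norm (x - y))\<^sup>2 = (\<Sum>i\<in>UNIV. (x $ i + (- 1) * y $ i) * (x $ i + (- 1) * y $ i))" for y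
        by (subst norm_vec_sq) (simp add: power2_eq_square)
      ultimately show ?thesis by (simp only:)
    qed
    have qs: "(\<lambda>y. q (x - y)) \<in> smooth_class" for x
      unfolding q_def by (intro smooth_class.intros nrm)
    have ks: "(\<lambda>y. k (x - y)) \<in> smooth_class" for x
      unfolding k_def K_def by (intro smooth_class.intros qs)
    have k1s: "(\<lambda>y. k1 i (x - y)) \<in> smooth_class" for i x
    proof -
      have "(\<lambda>y::real^'n. (1/c) * (flat 2 (q (x - y)) * ((- 1 / \<epsilon>\<^sup>2) * (2 * (x $ i + (-1) * y $ i))))) \<in> smooth_class"
        by (intro smooth_class.intros qs)
      then show ?thesis by (simp add: k1_def K1_def)
    qed
    have "mollifier C \<epsilon> k k1 k2"
      unfolding mollifier_def V_def[symmetric]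
    proof (intro conjI allI impI C2k)
      fix z x y i j
      show "k z \<ge> 0" using K0 c0 by (simp add: k_def)
      show "norm z \<ge> \<epsilon> \<Longrightarrow> k z = 0" using Kz by (simp add: k_def)
      show "integral\<^sup>L lborel k = 1" using c0 by (simp add: k_def c_def)
      have "k z \<le> exp 2 * 2 ^ N / V * 1"
        unfolding k_def using ci Kle K0 c0 V by (intro mult_mono) auto
      also have "\<dots> \<le> exp 2 * 2 ^ N / V * max 1 (2 * M)" using V by (intro mult_left_mono) auto
      finally show "k z \<le> C / V" by (simp add: C_def)
      have "\<bar>k1 i z\<bar> = (1 / c) * \<bar>K1 i z\<bar>" using c0 by (simp add: k1_def abs_mult)
      also have "\<dots> \<le> exp 2 * 2 ^ N / V * (2 * M / \<epsilon>)" using V by (intro mult_mono ci K1le) auto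
      also have "\<dots> \<le> exp 2 * 2 ^ N / V * (max 1 (2 * M) / \<epsilon>)" using V \<epsilon> by (intro mult_left_mono divide_right_mono) auto
      finally show "\<bar>k1 i z\<bar> \<le> C / (\<epsilon> * V)" by (simp add: C_def mult.commute)
      show "smooth (\<lambda>y. k (x - y))" by (rule smooth_class_smooth[OF ks])
      show "smooth (\<lambda>y. k1 i (x - y))" by (rule smooth_class_smooth[OF k1s])
      show "pderiv_at i (\<lambda>y. k (x - y)) y = - k1 i (x - y)"
        by (rule has_partial_unique[OF smooth_classD(3)[OF ks] has_partial_reflect[OF C2D(4)[OF C2k]]])
      show "pderiv_at j (\<lambda>y. k1 i (x - y)) y = - k2 i j (x - y)"
        by (rule has_partial_unique[OF smooth_classD(3)[OF k1s] has_partial_reflect[OF C2D(5)[OF C2k]]])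
    qed
    then show "\<exists>k k1 k2. mollifier C \<epsilon> (k :: real^'n \<Rightarrow> real) k1 k2" by blast
  qed
qed

section \<open>Continuity of translations\<close>

lemma lborel_shift: "distr lborel borel (\<lambda>x. x - z) = (lborel :: (real^'n) measure)"
proof -
  have "(\<lambda>x. x - z) = (+) (- z)" by auto
  then show ?thesis by (simp only: lborel_distr_plus)
qed

lemma lborel_reflect: "distr lborel borel (\<lambda>z. x - z) = (lborel :: (real^'n) measure)"
proof -
  have "lborel = density (distr lborel borel (\<lambda>z::real^'n. x + (- 1) *\<^sub>R z)) (\<lambda>_. ennreal (\<bar>- 1\<bar>^DIM(real^'n)))"
    using lborel_affine[of "-1" x] by simp
  then show ?thesis by (simp add: density_1)
qed

lemma
  fixes f :: "real^'n \<Rightarrow> real"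
  shows integrable_shift: "integrable lborel f \<Longrightarrow> integrable lborel (\<lambda>x. f (x - z))"
    and integral_shift: "f \<in> borel_measurable borel \<Longrightarrow> (\<integral>x. f (x - z) \<partial>lborel) = (\<integral>x. f x \<partial>lborel)"
    and integrable_reflect: "integrable lborel f \<Longrightarrow> integrable lborel (\<lambda>y. f (z - y))"
    and integral_reflect: "f \<in> borel_measurable borel \<Longrightarrow> (\<integral>y. f (z - y) \<partial>lborel) = (\<integral>x. f x \<partial>lborel)"
proof -
  show "integrable lborel f \<Longrightarrow> integrable lborel (\<lambda>x. f (x - z))"
    using integrable_distr[of "\<lambda>x. x - z" lborel borel f] by (simp add: lborel_shift)
  show "integrable lborel f \<Longrightarrow> integrable lborel (\<lambda>y. f (z - y))"
    using integrable_distr[of "\<lambda>y. z - y" lborel borel f] by (simp add: lborel_reflect)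
  show "f \<in> borel_measurable borel \<Longrightarrow> (\<integral>x. f (x - z) \<partial>lborel) = (\<integral>x. f x \<partial>lborel)"
    using integral_distr[of "\<lambda>x. x - z" lborel borel f] by (simp add: lborel_shift)
  show "f \<in> borel_measurable borel \<Longrightarrow> (\<integral>y. f (z - y) \<partial>lborel) = (\<integral>x. f x \<partial>lborel)"
    using integral_distr[of "\<lambda>y. z - y" lborel borel f] by (simp add: lborel_reflect)
qed

definition L1_translation_continuous :: "(real^'n \<Rightarrow> real) \<Rightarrow> bool" where
  "L1_translation_continuous f \<longleftrightarrow>
    (\<forall>e>0. \<exists>d>0. \<forall>z. norm z < d \<longrightarrow> (\<integral>x. \<bar>f (x - z) - f x\<bar> \<partial>lborel) < e)"

lemma L1_translation_continuous_lim:
  fixes f :: "real^'n \<Rightarrow> real"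
  assumes s: "\<And>i. integrable lborel (s i)" "\<And>i. L1_translation_continuous (s i)"
    and f: "integrable lborel f"
    and lim: "(\<lambda>i. \<integral>x. \<bar>f x - s i x\<bar> \<partial>lborel) \<longlonglongrightarrow> 0"
  shows "L1_translation_continuous f"
  unfolding L1_translation_continuous_def
proof (intro allI impI)
  fix e :: real assume e: "e > 0"
  have "eventually (\<lambda>i. (\<integral>x. \<bar>f x - s i x\<bar> \<partial>lborel) < e / 3) sequentially"
    using order_tendstoD(2)[OF lim, of "e/3"] e by simp
  then obtain i where i: "(\<integral>x. \<bar>f x - s i x\<bar> \<partial>lborel) < e / 3" by (auto simp: eventually_sequentially)
  have e3: "e / 3 > 0" using e by simp
  obtain d where d: "d > 0" "\<And>z. norm z < d \<Longrightarrow> (\<integral>x. \<bar>s i (x - z) - s i x\<bar> \<partial>lborel) < e / 3"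
    using s(2)[of i] e3 unfolding L1_translation_continuous_def by blast
  show "\<exists>d>0. \<forall>z. norm z < d \<longrightarrow> (\<integral>x. \<bar>f (x - z) - f x\<bar> \<partial>lborel) < e"
  proof (intro exI[of _ d] conjI d allI impI)
    fix z :: "real^'n" assume z: "norm z < d"
    note i1 = integrable_shift[OF f, of z] integrable_shift[OF s(1), of i z]
    have "(\<integral>x. \<bar>f (x - z) - f x\<bar> \<partial>lborel)
       \<le> (\<integral>x. \<bar>f (x - z) - s i (x - z)\<bar> + \<bar>s i (x - z) - s i x\<bar> + \<bar>f x - s i x\<bar> \<partial>lborel)"
      by (intro integral_mono) (use i1 f s in auto)
    also have "\<dots> = (\<integral>x. \<bar>f (x - z) - s i (x - z)\<bar> \<partial>lborel) + (\<integral>x. \<bar>s i (x - z) - s i x\<bar> \<partial>lborel) + (\<integral>x. \<bar>f x - s i x\<bar> \<partial>lborel)"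
      using i1 f s by simp
    also have "(\<integral>x. \<bar>f (x - z) - s i (x - z)\<bar> \<partial>lborel) = (\<integral>x. \<bar>f x - s i x\<bar> \<partial>lborel)"
      using integral_shift[of "\<lambda>x. \<bar>f x - s i x\<bar>" z] borel_measurable_integrable[OF f] borel_measurable_integrable[OF s(1), of i] by simp
    finally show "(\<integral>x. \<bar>f (x - z) - f x\<bar> \<partial>lborel) < e" using i d(2)[OF z] by simp
  qed
qed

text \<open>The set is enclosed between a compact set \<open>T\<close> and an open set \<open>U\<close> of almost the same measure. A translation that
  is shorter than the distance from \<open>T\<close> to the complement of \<open>U\<close> changes the indicator function only on
  \<open>U - T\<close> and on its translate.\<close>

lemma L1_translation_continuous_bounded_set:
  fixes A :: "(real^'n) set"
  assumes A: "A \<in> sets borel" and bd: "bounded A"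
  shows "L1_translation_continuous (indicat_real A)"
  unfolding L1_translation_continuous_def
proof (intro allI impI)
  fix e :: real assume e: "e > 0"
  obtain U where U: "open U" "A \<subseteq> U" "emeasure lborel (U - A) < ennreal (e / 5)"
    using outer_regular_lborel[OF A, of "e/5"] e by auto
  have A': "A \<in> sets lebesgue" using A by simp
  have e5: "e / 5 > 0" using e by simp
  obtain T where T: "closed T" "T \<subseteq> A" "A - T \<in> lmeasurable" "emeasure lebesgue (A - T) < ennreal (e / 5)"
    by (rule sets_lebesgue_inner_closed[OF A' e5])
  have cT: "compact T" using T bd bounded_subset compact_eq_bounded_closed by blast
  have mT: "T \<in> sets borel" using T by simp
  have mU: "U \<in> sets borel" using U by simp
  have "emeasure lborel (A - T) < ennreal (e / 5)" using T(4) A mT by simp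
  have "emeasure lborel (U - T) \<le> emeasure lborel (U - A) + emeasure lborel (A - T)"
  proof -
    have "U - T \<subseteq> (U - A) \<union> (A - T)" by auto
    then have "emeasure lborel (U - T) \<le> emeasure lborel ((U - A) \<union> (A - T))" using A mT mU by (intro emeasure_mono) auto
    also have "\<dots> \<le> emeasure lborel (U - A) + emeasure lborel (A - T)" using A mT mU by (intro emeasure_subadditive) auto
    finally show ?thesis .
  qed
  also have "\<dots> \<le> ennreal (e / 5) + ennreal (e / 5)" by (intro add_mono less_imp_le U(3)) fact
  also have "\<dots> = ennreal (2 * e / 5)" using e by (simp add: ennreal_plus[symmetric] del: ennreal_plus)
  finally have em: "emeasure lborel (U - T) \<le> ennreal (2 * e / 5)" .
  then have fin: "emeasure lborel (U - T) < \<infinity>" by (rule le_less_trans) simp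
  have m: "measure lborel (U - T) \<le> 2 * e / 5" unfolding measure_def
    using em e by (intro enn2real_leI) auto
  obtain d where d: "d > 0" "(\<Union>x\<in>T. ball x d) \<subseteq> U"
    using compact_subset_open_imp_ball_epsilon_subset[OF cT U(1)] T U by blast
  show "\<exists>d>0. \<forall>z. norm z < d \<longrightarrow> (\<integral>x. \<bar>indicat_real A (x - z) - indicat_real A x\<bar> \<partial>lborel) < e"
  proof (intro exI[of _ d] conjI d allI impI)
    fix z :: "real^'n" assume z: "norm z < d"
    define W where "W = indicat_real (U - T)"
    have iW: "integrable lborel W" unfolding W_def using fin mU mT by (intro integrable_real_indicator) auto
    have WU: "y \<in> U" if "x \<in> T" "norm (y - x) < d" for x y
    proof -
      have "y \<in> ball x d" using that by (simp add: dist_norm norm_minus_commute)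
      then show ?thesis using d that by blast
    qed
    have iA: "integrable lborel (indicat_real A)"
      using A bd by (intro integrable_real_indicator) (auto intro: emeasure_bounded_finite[unfolded infinity_ennreal_def])
    have "(\<integral>x. \<bar>indicat_real A (x - z) - indicat_real A x\<bar> \<partial>lborel) \<le> (\<integral>x. W x + W (x - z) \<partial>lborel)"
    proof (rule integral_mono)
      show "integrable lborel (\<lambda>x. \<bar>indicat_real A (x - z) - indicat_real A x\<bar>)"
        using iA integrable_shift[OF iA] by auto
      show "integrable lborel (\<lambda>x. W x + W (x - z))" using iW integrable_shift[OF iW] by auto
      fix x
      have 1: "x - z \<in> U" if "x \<in> T" using WU[OF that, of "x - z"] z by simp
      have 2: "x \<in> U" if "x - z \<in> T" using WU[OF that, of x] z by simp
      show "\<bar>indicat_real A (x - z) - indicat_real A x\<bar> \<le> W x + W (x - z)"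
        using 1 2 T(2) U(2) unfolding W_def by (auto simp: indicator_def)
    qed
    also have "\<dots> = (\<integral>x. W x \<partial>lborel) + (\<integral>x. W (x - z) \<partial>lborel)" using iW integrable_shift[OF iW] by simp
    also have "(\<integral>x. W (x - z) \<partial>lborel) = (\<integral>x. W x \<partial>lborel)" using mU mT by (intro integral_shift) (auto simp: W_def)
    also have "(\<integral>x. W x \<partial>lborel) = measure lborel (U - T)" unfolding W_def using mU mT by simp
    finally show "(\<integral>x. \<bar>indicat_real A (x - z) - indicat_real A x\<bar> \<partial>lborel) < e" using m e by linarith
  qed
qed

lemma L1_translation_continuous:
  fixes f :: "real^'n \<Rightarrow> real"
  assumes "integrable lborel f"
  shows "L1_translation_continuous f"
  using assms
proof induction
  case (base A c)
  have iA: "integrable lborel (indicat_real A)" using base by simp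
  define s where "s n = indicat_real (A \<inter> cball 0 (real n))" for n
  have isn: "integrable lborel (s n)" for n
    unfolding s_def by (rule integrable_real_indicator)
      (use base in \<open>auto intro: le_less_trans[OF emeasure_mono[of _ A]]\<close>)
  have L: "L1_translation_continuous (indicat_real A)"
  proof (rule L1_translation_continuous_lim[OF isn _ iA])
    show "L1_translation_continuous (s n)" for n
      unfolding s_def using base by (intro L1_translation_continuous_bounded_set) auto
    have "(\<lambda>n. \<integral>x. \<bar>indicat_real A x - s n x\<bar> \<partial>lborel) \<longlonglongrightarrow> (\<integral>(x::real^'n). 0 \<partial>lborel)"
    proof (rule integral_dominated_convergence[where w = "indicat_real A"])
      show "AE x in lborel. (\<lambda>n. \<bar>indicat_real A x - s n x\<bar>) \<longlonglongrightarrow> 0"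
      proof (intro AE_I2)
        fix x :: "real^'n"
        have "eventually (\<lambda>n. \<bar>indicat_real A x - s n x\<bar> = 0) sequentially"
          using eventually_ge_at_top[of "nat \<lceil>norm x\<rceil>"]
          by eventually_elim (auto simp: s_def indicator_def ceiling_le_iff nat_le_iff)
        then show "(\<lambda>n. \<bar>indicat_real A x - s n x\<bar>) \<longlonglongrightarrow> 0" by (rule tendsto_eventually)
      qed
      show "AE x in lborel. norm \<bar>indicat_real A x - s n x\<bar> \<le> indicat_real A x" for n
        by (intro AE_I2) (auto simp: s_def indicator_def)
    qed (use iA isn in auto)
    then show "(\<lambda>n. \<integral>x. \<bar>indicat_real A x - s n x\<bar> \<partial>lborel) \<longlonglongrightarrow> 0" by simp
  qed
  show ?case unfolding L1_translation_continuous_def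
  proof (intro allI impI)
    fix e :: real assume e: "e > 0"
    then have "e / (\<bar>c\<bar> + 1) > 0" by simp
    then obtain d where d: "d > 0" "\<And>z. norm z < d \<Longrightarrow> (\<integral>x. \<bar>indicat_real A (x - z) - indicat_real A x\<bar> \<partial>lborel) < e / (\<bar>c\<bar> + 1)"
      using L unfolding L1_translation_continuous_def by blast
    show "\<exists>d>0. \<forall>z. norm z < d \<longrightarrow> (\<integral>x. \<bar>indicat_real A (x - z) *\<^sub>R c - indicat_real A x *\<^sub>R c\<bar> \<partial>lborel) < e"
    proof (intro exI[of _ d] conjI d allI impI)
      fix z :: "real^'n" assume z: "norm z < d"
      have "\<bar>indicat_real A (x - z) *\<^sub>R c - indicat_real A x *\<^sub>R c\<bar> = \<bar>c\<bar> * \<bar>indicat_real A (x - z) - indicat_real A x\<bar>" for x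
        by (simp add: abs_mult[symmetric] algebra_simps)
      then have "(\<integral>x. \<bar>indicat_real A (x - z) *\<^sub>R c - indicat_real A x *\<^sub>R c\<bar> \<partial>lborel)
        = \<bar>c\<bar> * (\<integral>x. \<bar>indicat_real A (x - z) - indicat_real A x\<bar> \<partial>lborel)" by simp
      also have "\<dots> \<le> \<bar>c\<bar> * (e / (\<bar>c\<bar> + 1))" using d(2)[OF z] by (intro mult_left_mono) auto
      also have "\<dots> < e" using e by (simp add: field_simps)
      finally show "(\<integral>x. \<bar>indicat_real A (x - z) *\<^sub>R c - indicat_real A x *\<^sub>R c\<bar> \<partial>lborel) < e" .
    qed
  qed
next
  case (add f g)
  show ?case unfolding L1_translation_continuous_def
  proof (intro allI impI)
    fix e :: real assume "e > 0"
    then have e2: "e / 2 > 0" by simp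
    obtain d1 where d1: "d1 > 0" "\<And>z. norm z < d1 \<Longrightarrow> (\<integral>x. \<bar>f (x - z) - f x\<bar> \<partial>lborel) < e / 2"
      using add(3) e2 unfolding L1_translation_continuous_def by blast
    obtain d2 where d2: "d2 > 0" "\<And>z. norm z < d2 \<Longrightarrow> (\<integral>x. \<bar>g (x - z) - g x\<bar> \<partial>lborel) < e / 2"
      using add(4) e2 unfolding L1_translation_continuous_def by blast
    show "\<exists>d>0. \<forall>z. norm z < d \<longrightarrow> (\<integral>x. \<bar>f (x - z) + g (x - z) - (f x + g x)\<bar> \<partial>lborel) < e"
    proof (intro exI[of _ "min d1 d2"] conjI allI impI)
      fix z :: "real^'n" assume z: "norm z < min d1 d2"
      note i = integrable_shift[OF add(1), of z] integrable_shift[OF add(2), of z] add(1,2)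
      have "(\<integral>x. \<bar>f (x - z) + g (x - z) - (f x + g x)\<bar> \<partial>lborel)
        \<le> (\<integral>x. \<bar>f (x - z) - f x\<bar> + \<bar>g (x - z) - g x\<bar> \<partial>lborel)"
        by (intro integral_mono) (use i in auto)
      also have "\<dots> = (\<integral>x. \<bar>f (x - z) - f x\<bar> \<partial>lborel) + (\<integral>x. \<bar>g (x - z) - g x\<bar> \<partial>lborel)" using i by simp
      finally show "(\<integral>x. \<bar>f (x - z) + g (x - z) - (f x + g x)\<bar> \<partial>lborel) < e" using d1(2)[of z] d2(2)[of z] z by simp
    qed (use d1 d2 in auto)
  qed
next
  case (lim f s)
  show ?case
  proof (rule L1_translation_continuous_lim[OF lim.hyps(1) lim.IH lim.hyps(4)])
    have "(\<lambda>n. \<integral>x. \<bar>f x - s n x\<bar> \<partial>lborel) \<longlonglongrightarrow> (\<integral>(x::real^'n). 0 \<partial>lborel)"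
    proof (rule integral_dominated_convergence[where w = "\<lambda>x. 3 * \<bar>f x\<bar>"])
      show "AE x in lborel. (\<lambda>n. \<bar>f x - s n x\<bar>) \<longlonglongrightarrow> 0"
      proof (intro AE_I2)
        fix x
        have "(\<lambda>n. \<bar>f x - s n x\<bar>) \<longlonglongrightarrow> \<bar>f x - f x\<bar>" using lim.hyps(2)[of x] by (intro tendsto_intros) auto
        then show "(\<lambda>n. \<bar>f x - s n x\<bar>) \<longlonglongrightarrow> 0" by simp
      qed
      show "AE x in lborel. norm \<bar>f x - s n x\<bar> \<le> 3 * \<bar>f x\<bar>" for n
      proof (intro AE_I2)
        fix x show "norm \<bar>f x - s n x\<bar> \<le> 3 * \<bar>f x\<bar>" using lim.hyps(3)[of x n] by (simp add: abs_if split: if_splits)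
      qed
    qed (use lim.hyps(1,4) in auto)
    then show "(\<lambda>n. \<integral>x. \<bar>f x - s n x\<bar> \<partial>lborel) \<longlonglongrightarrow> 0" by simp
  qed
qed

lemma square_integrable_diff:
  fixes f g :: "real^'n \<Rightarrow> real"
  assumes "f \<in> borel_measurable borel" "g \<in> borel_measurable borel"
    "integrable lborel (\<lambda>x. (f x)\<^sup>2)" "integrable lborel (\<lambda>x. (g x)\<^sup>2)"
  shows "integrable lborel (\<lambda>x. (f x - g x)\<^sup>2)"
proof (rule Bochner_Integration.integrable_bound[where f = "\<lambda>x. 2 * (f x)\<^sup>2 + 2 * (g x)\<^sup>2"])
  show "AE x in lborel. norm ((f x - g x)\<^sup>2) \<le> norm (2 * (f x)\<^sup>2 + 2 * (g x)\<^sup>2)"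
  proof (intro AE_I2)
    fix x
    have "(f x - g x)\<^sup>2 \<le> 2 * (f x)\<^sup>2 + 2 * (g x)\<^sup>2"
      using zero_le_power2[of "f x + g x"] by (simp add: power2_eq_square algebra_simps)
    then show "norm ((f x - g x)\<^sup>2) \<le> norm (2 * (f x)\<^sup>2 + 2 * (g x)\<^sup>2)" by simp
  qed
qed (use assms in auto)

text \<open>For nonnegative numbers \<open>(a - b)\<^sup>2 \<le> \<bar>a\<^sup>2 - b\<^sup>2\<bar>\<close>. Applied to the positive and the negative part of \<open>f\<close>, this
  reduces the claim to the continuity of translations in \<open>L\<^sup>1\<close>.\<close>

lemma L2_translation_continuous:
  fixes f :: "real^'n \<Rightarrow> real"
  assumes f: "f \<in> borel_measurable borel" "integrable lborel (\<lambda>x. (f x)\<^sup>2)" and e: "e > 0"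
  shows "\<exists>d>0. \<forall>z. norm z < d \<longrightarrow> (\<integral>x. (f (x - z) - f x)\<^sup>2 \<partial>lborel) < e"
proof -
  define p where "p x = (max 0 (f x))\<^sup>2" for x
  define q where "q x = (max 0 (- f x))\<^sup>2" for x
  have p: "integrable lborel p"
    unfolding p_def[abs_def] by (rule Bochner_Integration.integrable_bound[OF f(2)]) (use f(1) in \<open>auto simp: max_def\<close>)
  have q: "integrable lborel q"
    unfolding q_def[abs_def] by (rule Bochner_Integration.integrable_bound[OF f(2)]) (use f(1) in \<open>auto simp: max_def\<close>)
  have e4: "e / 4 > 0" using e by simp
  obtain d1 where d1: "d1 > 0" "\<And>z. norm z < d1 \<Longrightarrow> (\<integral>x. \<bar>p (x - z) - p x\<bar> \<partial>lborel) < e / 4"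
    using L1_translation_continuous[OF p] e4 unfolding L1_translation_continuous_def by blast
  obtain d2 where d2: "d2 > 0" "\<And>z. norm z < d2 \<Longrightarrow> (\<integral>x. \<bar>q (x - z) - q x\<bar> \<partial>lborel) < e / 4"
    using L1_translation_continuous[OF q] e4 unfolding L1_translation_continuous_def by blast
  have sq: "(a - b)\<^sup>2 \<le> \<bar>a\<^sup>2 - b\<^sup>2\<bar>" if "a \<ge> 0" "b \<ge> 0" for a b :: real
  proof -
    have "\<bar>a - b\<bar> * \<bar>a - b\<bar> \<le> \<bar>a - b\<bar> * \<bar>a + b\<bar>" using that by (intro mult_left_mono) auto
    then show ?thesis by (simp add: power2_eq_square abs_mult[symmetric] algebra_simps)
  qed
  have pt: "(f y - f x)\<^sup>2 \<le> 2 * \<bar>p y - p x\<bar> + 2 * \<bar>q y - q x\<bar>" for x y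
  proof -
    have "f y - f x = (max 0 (f y) - max 0 (f x)) - (max 0 (- f y) - max 0 (- f x))" by (simp add: max_def)
    then have "(f y - f x)\<^sup>2 = ((max 0 (f y) - max 0 (f x)) - (max 0 (- f y) - max 0 (- f x)))\<^sup>2" by simp
    also have "\<dots> \<le> 2 * (max 0 (f y) - max 0 (f x))\<^sup>2 + 2 * (max 0 (- f y) - max 0 (- f x))\<^sup>2"
      using zero_le_power2[of "(max 0 (f y) - max 0 (f x)) + (max 0 (- f y) - max 0 (- f x))"]
      by (simp add: power2_eq_square algebra_simps)
    also have "\<dots> \<le> 2 * \<bar>p y - p x\<bar> + 2 * \<bar>q y - q x\<bar>"
      unfolding p_def q_def by (intro add_mono mult_left_mono sq) auto
    finally show ?thesis .
  qed
  show ?thesis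
  proof (intro exI[of _ "min d1 d2"] conjI allI impI)
    fix z :: "real^'n" assume z: "norm z < min d1 d2"
    note i = integrable_shift[OF p, of z] integrable_shift[OF q, of z] p q
    have "(\<integral>x. (f (x - z) - f x)\<^sup>2 \<partial>lborel) \<le> (\<integral>x. 2 * \<bar>p (x - z) - p x\<bar> + 2 * \<bar>q (x - z) - q x\<bar> \<partial>lborel)"
    proof (rule integral_mono)
      show "integrable lborel (\<lambda>x. (f (x - z) - f x)\<^sup>2)"
        using f integrable_shift[OF f(2), of z] by (intro square_integrable_diff) auto
      show "integrable lborel (\<lambda>x. 2 * \<bar>p (x - z) - p x\<bar> + 2 * \<bar>q (x - z) - q x\<bar>)" using i by auto
    qed (rule pt)
    also have "\<dots> = 2 * (\<integral>x. \<bar>p (x - z) - p x\<bar> \<partial>lborel) + 2 * (\<integral>x. \<bar>q (x - z) - q x\<bar> \<partial>lborel)" using i by simp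
    finally show "(\<integral>x. (f (x - z) - f x)\<^sup>2 \<partial>lborel) < e" using d1(2)[of z] d2(2)[of z] z by simp
  qed (use d1 d2 in auto)
qed

section \<open>Convolutions and local oscillation\<close>

lemma bounded_compactly_supported:
  fixes f :: "real^'n \<Rightarrow> real"
  assumes "continuous_on UNIV f" "\<And>x. x \<notin> cball 0 R \<Longrightarrow> f x = 0"
  obtains B where "B > 0" "\<And>x. \<bar>f x\<bar> \<le> B"
proof -
  have "compact (f ` cball 0 R)" by (intro compact_continuous_image continuous_on_subset[OF assms(1)]) auto
  then have "bounded (f ` cball 0 R)" by (rule compact_imp_bounded)
  then obtain B where B: "\<forall>y\<in>f ` cball 0 R. norm y \<le> B" by (auto simp: bounded_iff)
  show ?thesis
  proof (rule that[of "\<bar>B\<bar> + 1"])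
    show "\<bar>f x\<bar> \<le> \<bar>B\<bar> + 1" for x
      using B assms(2)[of x] by (cases "x \<in> cball 0 R") force+
  qed simp
qed

definition conv :: "(real^'n \<Rightarrow> real) \<Rightarrow> (real^'n \<Rightarrow> real) \<Rightarrow> real^'n \<Rightarrow> real" where
  "conv U k x = (\<integral>y. U y * k (x - y) \<partial>lborel)"

lemma integrable_conv:
  fixes U k :: "real^'n \<Rightarrow> real"
  assumes U: "integrable lborel U" and k: "k \<in> borel_measurable borel" "\<And>x. \<bar>k x\<bar> \<le> B"
  shows "integrable lborel (\<lambda>y. U y * k (x - y))"
proof (rule Bochner_Integration.integrable_bound[where f = "\<lambda>y. \<bar>U y\<bar> * B"])
  show "AE y in lborel. norm (U y * k (x - y)) \<le> norm (\<bar>U y\<bar> * B)"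
    using k(2) order_trans[OF _ abs_ge_self] by (intro AE_I2) (auto simp: abs_mult intro!: mult_left_mono)
qed (use U k in auto)

lemma tendsto_integral_mult_bounded:
  fixes U :: "real^'n \<Rightarrow> real"
  assumes U: "integrable lborel U" and k: "\<And>n y. \<bar>k n y\<bar> \<le> B" "\<And>n. k n \<in> borel_measurable borel"
    and lim: "\<And>y. (\<lambda>n. k n y) \<longlonglongrightarrow> l y" "l \<in> borel_measurable borel"
  shows "(\<lambda>n. \<integral>y. U y * k n y \<partial>lborel) \<longlonglongrightarrow> (\<integral>y. U y * l y \<partial>lborel)"
proof (rule integral_dominated_convergence[where w = "\<lambda>y. \<bar>U y\<bar> * B"])
  show "AE y in lborel. (\<lambda>n. U y * k n y) \<longlonglongrightarrow> U y * l y"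
    by (intro AE_I2 tendsto_intros lim)
  show "AE y in lborel. norm (U y * k n y) \<le> \<bar>U y\<bar> * B" for n
    using k(1) by (intro AE_I2) (auto simp: abs_mult intro!: mult_left_mono)
qed (use U k lim in auto)

lemma conv_continuous:
  fixes U :: "real^'n \<Rightarrow> real"
  assumes U: "integrable lborel U" and k: "continuous_on UNIV k" "\<And>x. \<bar>k x\<bar> \<le> B"
  shows "continuous_on UNIV (conv U k)"
  unfolding continuous_on_sequentially
proof (intro ballI allI impI)
  fix X :: "nat \<Rightarrow> real^'n" and a :: "real^'n"
  assume "(\<forall>n. X n \<in> UNIV) \<and> X \<longlonglongrightarrow> a"
  then have X: "X \<longlonglongrightarrow> a" by simp
  have mk: "k \<in> borel_measurable borel" by (rule borel_measurable_continuous_onI[OF k(1)])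
  have "isCont k y" for y using k(1) by (simp add: continuous_on_eq_continuous_at)
  then have "(\<lambda>n. k (X n - y)) \<longlonglongrightarrow> k (a - y)" for y
    by (rule isCont_tendsto_compose) (intro tendsto_intros X)
  then show "(conv U k \<circ> X) \<longlonglongrightarrow> conv U k a"
    unfolding conv_def comp_def by (intro tendsto_integral_mult_bounded[OF U, where B = B] k) (use mk in auto)
qed

text \<open>The difference quotients of \<open>k\<close> are bounded by the mean value theorem, so that the limit can be taken by dominated
  convergence; \<open>U\<close> need only be integrable.\<close>

lemma conv_has_partial:
  fixes U :: "real^'n \<Rightarrow> real"
  assumes U: "integrable lborel U" and pd: "has_partial i k k'" and k: "continuous_on UNIV k" "\<And>x. \<bar>k x\<bar> \<le> B0"
    and k': "continuous_on UNIV k'" "\<And>x. \<bar>k' x\<bar> \<le> B"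
  shows "has_partial i (conv U k) (conv U k')"
  unfolding has_partial_def DERIV_def
proof (intro allI)
  fix x :: "real^'n"
  define e :: "real^'n" where "e = axis i 1"
  have mk: "k \<in> borel_measurable borel" "k' \<in> borel_measurable borel"
    by (rule borel_measurable_continuous_onI[OF k(1)], rule borel_measurable_continuous_onI[OF k'(1)])
  show "((\<lambda>h. (conv U k (x + (0 + h) *\<^sub>R axis i 1) - conv U k (x + 0 *\<^sub>R axis i 1)) / h) \<longlongrightarrow> conv U k' x) (at 0)"
    unfolding tendsto_at_iff_sequentially
  proof (intro allI impI)
    fix X :: "nat \<Rightarrow> real" assume X: "\<forall>n. X n \<in> UNIV - {0}" "X \<longlonglongrightarrow> 0"
    have Xn: "X n \<noteq> 0" for n using X by auto
    have Xlim: "filterlim X (at 0) sequentially" using X by (auto simp: filterlim_at)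
    define Q where "Q n y = (k ((x - y) + X n *\<^sub>R e) - k (x - y)) / X n" for n y
    have "(\<lambda>n. \<integral>y. U y * Q n y \<partial>lborel) \<longlonglongrightarrow> (\<integral>y. U y * k' (x - y) \<partial>lborel)"
    proof (rule tendsto_integral_mult_bounded[OF U, where B = B])
      show "(\<lambda>n. Q n y) \<longlonglongrightarrow> k' (x - y)" for y
      proof -
        have "((\<lambda>t. (k ((x - y) + t *\<^sub>R e) - k (x - y)) / t) \<longlongrightarrow> k' (x - y)) (at 0)"
          using pd[unfolded has_partial_def, rule_format, of "x - y"] by (simp add: DERIV_def e_def)
        then show ?thesis unfolding Q_def using Xlim by (rule filterlim_compose)
      qed
      show "\<bar>Q n y\<bar> \<le> B" for n y
      proof -
        define g where "g t = k ((x - y) + t *\<^sub>R e)" for t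
        have g: "(g has_real_derivative k' ((x - y) + t *\<^sub>R e)) (at t)" for t
          unfolding g_def e_def by (rule has_partial_line[OF pd])
        have "norm (g (X n) - g 0) \<le> B * norm (X n - 0)"
          by (rule field_differentiable_bound[where S = UNIV and f' = "\<lambda>t. k' ((x - y) + t *\<^sub>R e)"])
            (use g k' in \<open>auto intro: has_field_derivative_at_within\<close>)
        then show ?thesis using Xn[of n] by (simp add: Q_def g_def abs_divide divide_le_eq)
      qed
      show "Q n \<in> borel_measurable borel" for n unfolding Q_def using mk by measurable
      show "(\<lambda>y. k' (x - y)) \<in> borel_measurable borel" using mk by measurable
    qed
    moreover have "(\<integral>y. U y * Q n y \<partial>lborel) = (conv U k (x + X n *\<^sub>R e) - conv U k x) / X n" for n
    proof -
      have "(\<integral>y. U y * Q n y \<partial>lborel) = (\<integral>y. (U y * k (x + X n *\<^sub>R e - y) - U y * k (x - y)) / X n \<partial>lborel)"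
        by (simp add: Q_def algebra_simps diff_divide_distrib)
      then show ?thesis unfolding conv_def
        using integrable_conv[OF U mk(1) k(2), of x] integrable_conv[OF U mk(1) k(2), of "x + X n *\<^sub>R e"] by simp
    qed
    ultimately show "((\<lambda>h. (conv U k (x + (0 + h) *\<^sub>R axis i 1) - conv U k (x + 0 *\<^sub>R axis i 1)) / h) \<circ> X) \<longlonglongrightarrow> conv U k' x"
      unfolding conv_def[of U k'] comp_def e_def by simp
  qed
qed

lemma conv_C2:
  fixes U :: "real^'n \<Rightarrow> real"
  assumes U: "integrable lborel U" and k: "C2 k k1 k2" and z: "\<And>x. norm x \<ge> R \<Longrightarrow> k x = 0"
  shows "C2 (conv U k) (\<lambda>i. conv U (k1 i)) (\<lambda>i j. conv U (k2 i j))"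
proof -
  have oU: "open (- cball (0::real^'n) R)" by auto
  have z1: "k1 i x = 0" "k2 i j x = 0" if "x \<notin> cball 0 R" for i j x
    using C2_zero_on_open[OF k oU, of x] z that by auto
  obtain B where B: "\<And>x. \<bar>k x\<bar> \<le> B" using bounded_compactly_supported[OF C2D(1)[OF k], of R] z by (metis mem_cball_0 linorder_le_cases)
  have "\<exists>B. \<forall>x. \<bar>k1 i x\<bar> \<le> B" for i using bounded_compactly_supported[OF C2D(2)[OF k], of R] z1(1) by metis
  then obtain B1 where B1: "\<And>i x. \<bar>k1 i x\<bar> \<le> B1 i" by metis
  have "\<exists>B. \<forall>x. \<bar>k2 i j x\<bar> \<le> B" for i j using bounded_compactly_supported[OF C2D(3)[OF k], of R] z1(2) by metis
  then obtain B2 where B2: "\<And>i j x. \<bar>k2 i j x\<bar> \<le> B2 i j" by metis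
  show ?thesis
    unfolding C2_def
  proof (intro conjI allI)
    show "continuous_on UNIV (conv U k)" by (rule conv_continuous[OF U C2D(1)[OF k] B])
    fix i j
    show "continuous_on UNIV (conv U (k1 i))" by (rule conv_continuous[OF U C2D(2)[OF k] B1])
    show "continuous_on UNIV (conv U (k2 i j))" by (rule conv_continuous[OF U C2D(3)[OF k] B2])
    show "has_partial i (conv U k) (conv U (k1 i))"
      by (rule conv_has_partial[OF U C2D(4)[OF k] C2D(1)[OF k] B C2D(2)[OF k] B1])
    show "has_partial j (conv U (k1 i)) (conv U (k2 i j))"
      by (rule conv_has_partial[OF U C2D(5)[OF k] C2D(2)[OF k] B1 C2D(3)[OF k] B2])
    show "conv U (k2 i j) = conv U (k2 j i)" using C2D(6)[OF k, of i j] by simp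
  qed
qed

abbreviation uniform_kernel :: "real \<Rightarrow> real^'n \<Rightarrow> real^'n \<Rightarrow> real" where
  "uniform_kernel \<epsilon> x y \<equiv> indicat_real (ball x \<epsilon>) y / measure lborel (ball (0::real^'n) \<epsilon>)"

text \<open>The mean of \<open>\<bar>f - f x\<bar>\<close> over the ball of radius \<open>\<epsilon>\<close> around \<open>x\<close>. It measures at once how far a mollification of
  \<open>f\<close> is from \<open>f\<close> and how far a mean of \<open>\<bar>f\<bar>\<close> is from \<open>\<bar>f\<bar>\<close>.\<close>

definition osc :: "real \<Rightarrow> (real^'n \<Rightarrow> real) \<Rightarrow> real^'n \<Rightarrow> real" where
  "osc \<epsilon> f x = (\<integral>y. \<bar>f y - f x\<bar> * (uniform_kernel \<epsilon> x y) \<partial>lborel)"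

lemma measure_ball_translate:
  "\<epsilon> > 0 \<Longrightarrow> measure lborel (ball (x::real^'n) \<epsilon>) = measure lborel (ball (0::real^'n) \<epsilon>)"
  using content_ball_conv_unit_ball[of \<epsilon> x] content_ball_conv_unit_ball[of \<epsilon> "0::real^'n"] by simp

lemma integrable_indicator_ball: "integrable lborel (indicat_real (ball (x::real^'n) \<epsilon>))"
  by (rule integrable_real_indicator) (auto simp: emeasure_lborel_ball_finite[unfolded infinity_ennreal_def])

lemma integrable_of_square:
  fixes f :: "real^'n \<Rightarrow> real"
  assumes "f \<in> borel_measurable borel" "integrable lborel (\<lambda>x. (f x)\<^sup>2)"
    and "integrable lborel \<kappa>" "\<And>x. \<bar>\<kappa> x\<bar> \<le> B"
  shows "integrable lborel (\<lambda>x. f x * \<kappa> x)"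
proof (rule Bochner_Integration.integrable_bound[where f = "\<lambda>x. B * (f x)\<^sup>2 + \<bar>\<kappa> x\<bar>"])
  show "AE x in lborel. norm (f x * \<kappa> x) \<le> norm (B * (f x)\<^sup>2 + \<bar>\<kappa> x\<bar>)"
  proof (intro AE_I2)
    fix x
    have "\<bar>f x\<bar> \<le> (f x)\<^sup>2 + 1"
      using abs_mult_le_half_sq[of "f x" 1] zero_le_power2[of "f x"] by simp
    then have "\<bar>f x\<bar> * \<bar>\<kappa> x\<bar> \<le> ((f x)\<^sup>2 + 1) * \<bar>\<kappa> x\<bar>" by (intro mult_right_mono) auto
    also have "\<dots> \<le> B * (f x)\<^sup>2 + \<bar>\<kappa> x\<bar>"
      using mult_left_mono[OF assms(4)[of x], of "(f x)\<^sup>2"] by (simp add: algebra_simps)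
    finally show "norm (f x * \<kappa> x) \<le> norm (B * (f x)\<^sup>2 + \<bar>\<kappa> x\<bar>)" by (simp add: abs_mult)
  qed
qed (use assms in auto)

lemma jensen_square:
  fixes g \<kappa> :: "real^'n \<Rightarrow> real"
  assumes "integrable lborel \<kappa>" "\<And>x. \<kappa> x \<ge> 0" "(\<integral>x. \<kappa> x \<partial>lborel) = 1"
    and "integrable lborel (\<lambda>x. g x * \<kappa> x)" "integrable lborel (\<lambda>x. (g x)\<^sup>2 * \<kappa> x)"
  shows "(\<integral>x. g x * \<kappa> x \<partial>lborel)\<^sup>2 \<le> (\<integral>x. (g x)\<^sup>2 * \<kappa> x \<partial>lborel)"
proof -
  define m where "m = (\<integral>x. g x * \<kappa> x \<partial>lborel)"
  have "0 \<le> (\<integral>x. (g x - m)\<^sup>2 * \<kappa> x \<partial>lborel)" using assms(2) by (intro Bochner_Integration.integral_nonneg) auto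
  also have "\<dots> = (\<integral>x. (g x)\<^sup>2 * \<kappa> x - 2 * m * (g x * \<kappa> x) + m\<^sup>2 * \<kappa> x \<partial>lborel)"
    by (simp add: power2_eq_square algebra_simps)
  also have "\<dots> = (\<integral>x. (g x)\<^sup>2 * \<kappa> x \<partial>lborel) - 2 * m * m + m\<^sup>2 * 1"
    using assms by (simp add: m_def)
  finally show ?thesis by (simp add: m_def power2_eq_square)
qed

lemma osc_weight:
  fixes x :: "real^'n"
  assumes "\<epsilon> > 0"
  defines "\<kappa> \<equiv> (\<lambda>y. uniform_kernel \<epsilon> x y)"
  shows "integrable lborel \<kappa>" "\<And>y. \<kappa> y \<ge> 0" "(\<integral>y. \<kappa> y \<partial>lborel) = 1" "\<And>y. \<bar>\<kappa> y\<bar> \<le> 1 / measure lborel (ball (0::real^'n) \<epsilon>)"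
proof -
  have V: "measure lborel (ball (0::real^'n) \<epsilon>) > 0" using assms by (simp add: content_ball_pos)
  show "integrable lborel \<kappa>" unfolding \<kappa>_def using integrable_indicator_ball[of x \<epsilon>] by simp
  show "\<And>y. \<kappa> y \<ge> 0" unfolding \<kappa>_def by simp
  show "(\<integral>y. \<kappa> y \<partial>lborel) = 1" unfolding \<kappa>_def using V measure_ball_translate[OF assms(1), of x] by simp
  show "\<And>y. \<bar>\<kappa> y\<bar> \<le> 1 / measure lborel (ball (0::real^'n) \<epsilon>)"
    unfolding \<kappa>_def by (auto simp: indicator_def)
qed

lemma osc_integrable:
  fixes f :: "real^'n \<Rightarrow> real"
  assumes f: "f \<in> borel_measurable borel" "integrable lborel (\<lambda>x. (f x)\<^sup>2)" and \<epsilon>: "\<epsilon> > 0"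
  defines "\<kappa> \<equiv> (\<lambda>x y. uniform_kernel \<epsilon> x y)"
  shows "integrable lborel (\<lambda>y. f y * \<kappa> x y)" "integrable lborel (\<lambda>y. \<bar>f y - c\<bar> * \<kappa> x y)"
    "integrable lborel (\<lambda>y. (f y - c)\<^sup>2 * \<kappa> x y)"
proof -
  have w: "integrable lborel (\<kappa> x)" "\<And>y. \<kappa> x y \<ge> 0" "\<And>y. \<bar>\<kappa> x y\<bar> \<le> 1 / measure lborel (ball (0::real^'n) \<epsilon>)"
    unfolding \<kappa>_def using osc_weight[OF \<epsilon>, of x] by auto
  show i1: "integrable lborel (\<lambda>y. f y * \<kappa> x y)" by (rule integrable_of_square[OF f w(1,3)])
  have "integrable lborel (\<lambda>y. f y * \<kappa> x y - c * \<kappa> x y)" using i1 w(1) by auto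
  then have "integrable lborel (\<lambda>y. \<bar>f y * \<kappa> x y - c * \<kappa> x y\<bar>)" by (rule integrable_abs)
  moreover have "\<bar>f y * \<kappa> x y - c * \<kappa> x y\<bar> = \<bar>f y - c\<bar> * \<kappa> x y" for y
    using w(2)[of y] by (simp add: left_diff_distrib[symmetric] abs_mult)
  ultimately show "integrable lborel (\<lambda>y. \<bar>f y - c\<bar> * \<kappa> x y)" by simp
  have i2: "integrable lborel (\<lambda>y. (f y)\<^sup>2 * \<kappa> x y)"
    using integrable_real_mult_indicator[of "ball x \<epsilon>" lborel "\<lambda>y. (f y)\<^sup>2 / measure lborel (ball (0::real^'n) \<epsilon>)"] f(2)
    by (simp add: \<kappa>_def)
  have "integrable lborel (\<lambda>y. (f y)\<^sup>2 * \<kappa> x y - 2 * c * (f y * \<kappa> x y) + c\<^sup>2 * \<kappa> x y)" using i1 i2 w(1) by auto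
  then show "integrable lborel (\<lambda>y. (f y - c)\<^sup>2 * \<kappa> x y)" by (simp add: power2_eq_square algebra_simps)
qed

text \<open>By Jensen's inequality and Tonelli's theorem the square of the \<open>L\<^sup>2\<close> norm of the oscillation is at most a mean over
  \<open>\<bar>z\<bar> < \<epsilon>\<close> of the squared \<open>L\<^sup>2\<close> distances between \<open>f\<close> and its translate by \<open>z\<close>.\<close>

lemma osc_L2:
  fixes f :: "real^'n \<Rightarrow> real"
  assumes f: "f \<in> borel_measurable borel" "integrable lborel (\<lambda>x. (f x)\<^sup>2)" and e: "e > 0"
  shows "\<exists>\<epsilon>0>0. \<forall>\<epsilon>. 0 < \<epsilon> \<and> \<epsilon> < \<epsilon>0 \<longrightarrow> (\<integral>\<^sup>+x. ennreal ((osc \<epsilon> f x)\<^sup>2) \<partial>lborel) \<le> ennreal e"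
proof -
  obtain d where d: "d > 0" "\<And>z. norm z < d \<Longrightarrow> (\<integral>x. (f (x - z) - f x)\<^sup>2 \<partial>lborel) < e"
    using L2_translation_continuous[OF f e] by blast
  show ?thesis
  proof (intro exI[of _ d] conjI d allI impI)
    fix \<epsilon> :: real assume \<epsilon>: "0 < \<epsilon> \<and> \<epsilon> < d"
    define V where "V = measure lborel (ball (0::real^'n) \<epsilon>)"
    have V: "V > 0" unfolding V_def using \<epsilon> by (simp add: content_ball_pos)
    define \<kappa> where "\<kappa> = (\<lambda>x y. indicat_real (ball (x::real^'n) \<epsilon>) y / V)"
    have \<epsilon>0: "\<epsilon> > 0" using \<epsilon> by simp
    note oi = osc_integrable[OF f \<epsilon>0, folded V_def]
    have 1: "ennreal ((osc \<epsilon> f x)\<^sup>2) \<le> (\<integral>\<^sup>+z. ennreal ((f (x - z) - f x)\<^sup>2 * \<kappa> 0 z) \<partial>lborel)" for x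
    proof -
      have "(osc \<epsilon> f x)\<^sup>2 \<le> (\<integral>y. \<bar>f y - f x\<bar>\<^sup>2 * \<kappa> x y \<partial>lborel)"
        unfolding osc_def V_def[symmetric] \<kappa>_def
        by (rule jensen_square[OF osc_weight(1-3)[where x = x, OF \<epsilon>0, folded V_def], where g = "\<lambda>y. \<bar>f y - f x\<bar>"]) (use oi in auto)
      then have "ennreal ((osc \<epsilon> f x)\<^sup>2) \<le> ennreal (\<integral>y. (f y - f x)\<^sup>2 * \<kappa> x y \<partial>lborel)"
        by (intro ennreal_leI) simp
      also have "\<dots> = (\<integral>\<^sup>+y. ennreal ((f y - f x)\<^sup>2 * \<kappa> x y) \<partial>lborel)"
        unfolding \<kappa>_def using oi(3)[where x = x and c = "f x"] V
        by (intro nn_integral_eq_integral[symmetric] AE_I2) auto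
      also have "\<dots> = (\<integral>\<^sup>+y. ennreal ((f y - f x)\<^sup>2 * \<kappa> x y) \<partial>distr lborel borel (\<lambda>z. x - z))"
        by (simp add: lborel_reflect)
      also have "\<dots> = (\<integral>\<^sup>+z. ennreal ((f (x - z) - f x)\<^sup>2 * \<kappa> x (x - z)) \<partial>lborel)"
      proof -
        have [measurable]: "f \<in> borel_measurable borel" by (rule f)
        have [measurable]: "ball x \<epsilon> \<in> sets borel" by simp
        have "(\<lambda>y. ennreal ((f y - f x)\<^sup>2 * \<kappa> x y)) \<in> borel_measurable borel"
          unfolding \<kappa>_def by measurable
        then show ?thesis by (subst nn_integral_distr) simp_all
      qed
      also have "\<dots> = (\<integral>\<^sup>+z. ennreal ((f (x - z) - f x)\<^sup>2 * \<kappa> 0 z) \<partial>lborel)"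
        by (simp add: \<kappa>_def indicator_def dist_norm)
      finally show ?thesis .
    qed
    have "(\<integral>\<^sup>+x. ennreal ((osc \<epsilon> f x)\<^sup>2) \<partial>lborel) \<le> (\<integral>\<^sup>+x. \<integral>\<^sup>+z. ennreal ((f (x - z) - f x)\<^sup>2 * \<kappa> 0 z) \<partial>lborel \<partial>lborel)"
      by (intro nn_integral_mono 1)
    also have "\<dots> = (\<integral>\<^sup>+z. \<integral>\<^sup>+x. ennreal ((f (x - z) - f x)\<^sup>2 * \<kappa> 0 z) \<partial>lborel \<partial>lborel)"
    proof (rule lborel_pair.Fubini'[symmetric])
      have [measurable]: "f \<in> borel_measurable borel" by (rule f)
      have [measurable]: "ball (0::real^'n) \<epsilon> \<in> sets borel" by simp
      show "(\<lambda>(x, z). ennreal ((f (x - z) - f x)\<^sup>2 * \<kappa> 0 z)) \<in> borel_measurable (lborel \<Otimes>\<^sub>M lborel)"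
        unfolding \<kappa>_def by measurable
    qed
    also have "\<dots> \<le> (\<integral>\<^sup>+z. ennreal (e * \<kappa> 0 z) \<partial>lborel)"
    proof (intro nn_integral_mono)
      fix z :: "real^'n"
      show "(\<integral>\<^sup>+x. ennreal ((f (x - z) - f x)\<^sup>2 * \<kappa> 0 z) \<partial>lborel) \<le> ennreal (e * \<kappa> 0 z)"
      proof (cases "z \<in> ball 0 \<epsilon>")
        case True
        then have z: "norm z < d" using \<epsilon> by simp
        have k0: "\<kappa> 0 z \<ge> 0" using V by (simp add: \<kappa>_def)
        have i: "integrable lborel (\<lambda>x. (f (x - z) - f x)\<^sup>2)"
          using f integrable_shift[OF f(2), of z] by (intro square_integrable_diff) auto
        have "(\<integral>\<^sup>+x. ennreal ((f (x - z) - f x)\<^sup>2 * \<kappa> 0 z) \<partial>lborel) = ennreal (\<integral>x. (f (x - z) - f x)\<^sup>2 * \<kappa> 0 z \<partial>lborel)"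
          using i k0 by (intro nn_integral_eq_integral AE_I2) auto
        also have "(\<integral>x. (f (x - z) - f x)\<^sup>2 * \<kappa> 0 z \<partial>lborel) = (\<integral>x. (f (x - z) - f x)\<^sup>2 \<partial>lborel) * \<kappa> 0 z" by simp
        also have "ennreal \<dots> \<le> ennreal (e * \<kappa> 0 z)"
          using d(2)[OF z] k0 by (intro ennreal_leI mult_right_mono) auto
        finally show ?thesis .
      qed (simp add: \<kappa>_def)
    qed
    also have "\<dots> = ennreal (\<integral>z. e * \<kappa> 0 z \<partial>lborel)"
      using integrable_mult_right[OF osc_weight(1)[where x = "0::real^'n", OF \<epsilon>0, folded V_def], of e] e V
      unfolding \<kappa>_def by (intro nn_integral_eq_integral AE_I2) auto
    also have "(\<integral>z. e * \<kappa> 0 z \<partial>lborel) = e" using osc_weight(3)[where x = "0::real^'n", OF \<epsilon>0, folded V_def] \<epsilon>0 unfolding \<kappa>_def by simp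
    finally show "(\<integral>\<^sup>+x. ennreal ((osc \<epsilon> f x)\<^sup>2) \<partial>lborel) \<le> ennreal e" .
  qed
qed

section \<open>Mollified solutions\<close>

text \<open>Integration against a function dominated by \<open>B\<close> times the uniform kernel: up to the factor \<open>B\<close>, the result is the
  value of \<open>\<bar>f\<bar>\<close> at the centre plus the oscillation.\<close>

lemma weighted_integral_bound:
  fixes f h :: "real^'n \<Rightarrow> real"
  assumes f: "f \<in> borel_measurable borel" "integrable lborel (\<lambda>x. (f x)\<^sup>2)" and \<epsilon>: "\<epsilon> > 0"
    and h: "h \<in> borel_measurable borel"
      "\<And>y. \<bar>h y\<bar> \<le> B * (uniform_kernel \<epsilon> x y)"
  shows "integrable lborel (\<lambda>y. f y * h y)"
    and "(\<integral>y. \<bar>(f y - c) * h y\<bar> \<partial>lborel) \<le> B * (\<integral>y. \<bar>f y - c\<bar> * (uniform_kernel \<epsilon> x y) \<partial>lborel)"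
    and "(\<integral>y. \<bar>f y * h y\<bar> \<partial>lborel) \<le> B * (\<bar>f x\<bar> + osc \<epsilon> f x)"
    and "integrable lborel h"
proof -
  define \<kappa> where "\<kappa> = (\<lambda>y. uniform_kernel \<epsilon> x y)"
  note w = osc_weight[where x = x, OF \<epsilon>, folded \<kappa>_def]
  have oi: "integrable lborel (\<lambda>y. f y * \<kappa> y)" "\<And>c. integrable lborel (\<lambda>y. \<bar>f y - c\<bar> * \<kappa> y)"
    unfolding \<kappa>_def using osc_integrable(1,2)[OF f \<epsilon>] by auto
  have hk: "\<bar>h y\<bar> \<le> B * \<kappa> y" for y using h(2) unfolding \<kappa>_def .
  have i: "integrable lborel (\<lambda>y. (f y - c) * h y)" for c
  proof (rule Bochner_Integration.integrable_bound[where f = "\<lambda>y. B * (\<bar>f y - c\<bar> * \<kappa> y)"])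
    show "AE y in lborel. norm ((f y - c) * h y) \<le> norm (B * (\<bar>f y - c\<bar> * \<kappa> y))"
    proof (intro AE_I2)
      fix y
      have "\<bar>f y - c\<bar> * \<bar>h y\<bar> \<le> \<bar>f y - c\<bar> * (B * \<kappa> y)" by (intro mult_left_mono hk) auto
      also have "\<dots> \<le> norm (B * (\<bar>f y - c\<bar> * \<kappa> y))" by (simp add: mult_ac)
      finally show "norm ((f y - c) * h y) \<le> norm (B * (\<bar>f y - c\<bar> * \<kappa> y))" by (simp add: abs_mult)
    qed
  qed (use oi(2)[of c] f h in auto)
  show "integrable lborel (\<lambda>y. f y * h y)" using i[of 0] by simp
  show "integrable lborel h"
    by (rule Bochner_Integration.integrable_bound[where f = "\<lambda>y. B * \<kappa> y"])
      (use w h hk in \<open>auto intro!: AE_I2 order_trans[OF hk]\<close>)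
  have b: "(\<integral>y. \<bar>(f y - c) * h y\<bar> \<partial>lborel) \<le> B * (\<integral>y. \<bar>f y - c\<bar> * \<kappa> y \<partial>lborel)" for c
  proof -
    have "(\<integral>y. \<bar>(f y - c) * h y\<bar> \<partial>lborel) \<le> (\<integral>y. B * (\<bar>f y - c\<bar> * \<kappa> y) \<partial>lborel)"
    proof (rule integral_mono)
      show "integrable lborel (\<lambda>y. \<bar>(f y - c) * h y\<bar>)" using i by auto
      show "integrable lborel (\<lambda>y. B * (\<bar>f y - c\<bar> * \<kappa> y))" using oi(2) by auto
      fix y
      have "\<bar>f y - c\<bar> * \<bar>h y\<bar> \<le> \<bar>f y - c\<bar> * (B * \<kappa> y)" by (intro mult_left_mono hk) auto
      then show "\<bar>(f y - c) * h y\<bar> \<le> B * (\<bar>f y - c\<bar> * \<kappa> y)" by (simp add: abs_mult mult_ac)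
    qed
    then show ?thesis by simp
  qed
  then show "(\<integral>y. \<bar>(f y - c) * h y\<bar> \<partial>lborel) \<le> B * (\<integral>y. \<bar>f y - c\<bar> * (uniform_kernel \<epsilon> x y) \<partial>lborel)"
    unfolding \<kappa>_def .
  have B0: "B \<ge> 0"
  proof -
    have "0 \<le> B * \<kappa> x" using hk[of x] by linarith
    moreover have "\<kappa> x > 0" unfolding \<kappa>_def using \<epsilon> by (simp add: content_ball_pos)
    ultimately show ?thesis by (simp add: zero_le_mult_iff)
  qed
  have "(\<integral>y. \<bar>f y * h y\<bar> \<partial>lborel) \<le> B * (\<integral>y. \<bar>f y\<bar> * \<kappa> y \<partial>lborel)" using b[of 0] by simp
  also have "(\<integral>y. \<bar>f y\<bar> * \<kappa> y \<partial>lborel) \<le> (\<integral>y. \<bar>f y - f x\<bar> * \<kappa> y + \<bar>f x\<bar> * \<kappa> y \<partial>lborel)"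
  proof (rule integral_mono)
    show "integrable lborel (\<lambda>y. \<bar>f y\<bar> * \<kappa> y)" using oi(2)[of 0] by simp
    show "integrable lborel (\<lambda>y. \<bar>f y - f x\<bar> * \<kappa> y + \<bar>f x\<bar> * \<kappa> y)" using oi(2) w(1) by auto
    fix y show "\<bar>f y\<bar> * \<kappa> y \<le> \<bar>f y - f x\<bar> * \<kappa> y + \<bar>f x\<bar> * \<kappa> y"
      unfolding distrib_right[symmetric] by (intro mult_right_mono) (auto simp: \<kappa>_def)
  qed
  also have "\<dots> = osc \<epsilon> f x + \<bar>f x\<bar>" proof -
    have "osc \<epsilon> f x = (\<integral>y. \<bar>f y - f x\<bar> * \<kappa> y \<partial>lborel)" unfolding osc_def \<kappa>_def ..
    then show ?thesis using oi(2)[of "f x"] w(1,3) by simp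
  qed
  finally show "(\<integral>y. \<bar>f y * h y\<bar> \<partial>lborel) \<le> B * (\<bar>f x\<bar> + osc \<epsilon> f x)"
    using B0 by (simp add: mult_left_mono add.commute)
qed

lemma mollifierD:
  fixes k :: "real^'n \<Rightarrow> real"
  assumes "mollifier C \<epsilon> k k1 k2" "\<epsilon> > 0"
  shows "C2 k k1 k2" "k z \<ge> 0" "norm z \<ge> \<epsilon> \<Longrightarrow> k z = 0" "norm z > \<epsilon> \<Longrightarrow> k1 i z = 0"
    "integral\<^sup>L lborel k = 1"
    "\<bar>k (x - y)\<bar> \<le> C * (uniform_kernel \<epsilon> x y)"
    "\<bar>k1 i (x - y)\<bar> \<le> (C / \<epsilon>) * (uniform_kernel \<epsilon> x y)"
    "C > 0"
proof -
  note m = assms(1)[unfolded mollifier_def]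
  show c2: "C2 k k1 k2" and k0: "k z \<ge> 0" and kz: "norm z \<ge> \<epsilon> \<Longrightarrow> k z = 0" and i1: "integral\<^sup>L lborel k = 1" for z
    using m by auto
  have V: "measure lborel (ball (0::real^'n) \<epsilon>) > 0" using assms(2) by (simp add: content_ball_pos)
  show k1z: "norm z > \<epsilon> \<Longrightarrow> k1 i z = 0" for z i
    by (rule C2_zero_on_open(1)[OF c2, of "- cball 0 \<epsilon>"]) (use kz in auto)
  \<comment> \<open>on the sphere itself the derivative vanishes by continuity from outside\<close>
  have k1z': "k1 i z = 0" if "norm z \<ge> \<epsilon>" for z i
  proof (rule ccontr)
    assume nz: "k1 i z \<noteq> 0"
    have "isCont (\<lambda>t. k1 i ((1 + t) *\<^sub>R z)) 0"
      using continuous_on_compose2[OF C2D(2)[OF c2, of i], of UNIV "\<lambda>t. (1 + t) *\<^sub>R z"]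
      by (simp add: continuous_intros continuous_on_eq_continuous_at)
    then have "((\<lambda>t. k1 i ((1 + t) *\<^sub>R z)) \<longlongrightarrow> k1 i z) (at_right 0)"
      by (auto simp: isCont_def intro: tendsto_mono[OF at_le])
    moreover have "eventually (\<lambda>t. k1 i ((1 + t) *\<^sub>R z) = 0) (at_right (0::real))"
      using eventually_at_right_less[of "0::real"]
    proof eventually_elim
      case (elim t)
      have zpos: "norm z > 0" using that assms(2) by linarith
      have "norm ((1 + t) *\<^sub>R z) = (1 + t) * norm z" using elim by simp
      also have "\<dots> > 1 * norm z" using elim zpos by (intro mult_strict_right_mono) auto
      finally show ?case using that by (intro k1z) linarith
    qed
    ultimately have "((\<lambda>t. 0) \<longlongrightarrow> k1 i z) (at_right (0::real))" by (subst (asm) tendsto_cong) auto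
    then have "k1 i z = 0" using tendsto_unique[OF trivial_limit_at_right_real tendsto_const] by metis
    then show False using nz by simp
  qed
  show "\<bar>k (x - y)\<bar> \<le> C * (uniform_kernel \<epsilon> x y)"
  proof (cases "y \<in> ball x \<epsilon>")
    case True
    have "k (x - y) \<le> C / measure lborel (ball (0::real^'n) \<epsilon>)" using m by blast
    then show ?thesis using k0 True by simp
  next
    case False
    then have "k (x - y) = 0" by (intro kz) (simp add: dist_norm)
    then show ?thesis using False by simp
  qed
  show "\<bar>k1 i (x - y)\<bar> \<le> (C / \<epsilon>) * (uniform_kernel \<epsilon> x y)"
  proof (cases "y \<in> ball x \<epsilon>")
    case True
    have "\<bar>k1 i (x - y)\<bar> \<le> C / (\<epsilon> * measure lborel (ball (0::real^'n) \<epsilon>))" using m by blast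
    then show ?thesis using True by simp
  next
    case False
    then have "k1 i (x - y) = 0" by (intro k1z') (simp add: dist_norm)
    then show ?thesis using False by simp
  qed
  show "C > 0"
  proof (rule ccontr)
    assume "\<not> C > 0"
    have "k z = 0" for z
    proof -
      have "k z \<le> C / measure lborel (ball (0::real^'n) \<epsilon>)" using m by blast
      also have "\<dots> \<le> 0" using \<open>\<not> C > 0\<close> V by (intro divide_nonpos_pos) auto
      finally show ?thesis using k0[of z] by simp
    qed
    then have "k = (\<lambda>z. 0)" by (rule ext)
    then have "integral\<^sup>L lborel k = 0" by simp
    then show False using i1 by simp
  qed
qed

lemma mollification_osc:
  fixes f :: "real^'n \<Rightarrow> real"
  assumes f: "f \<in> borel_measurable borel" "integrable lborel (\<lambda>x. (f x)\<^sup>2)"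
    and \<epsilon>: "\<epsilon> > 0" and k: "mollifier C \<epsilon> k k1 k2"
  shows "\<bar>conv f k x - f x\<bar> \<le> C * osc \<epsilon> f x"
proof -
  note m = mollifierD[OF k \<epsilon>]
  have mk: "k \<in> borel_measurable borel" by (rule borel_measurable_continuous_onI[OF C2D(1)[OF m(1)]])
  have mk': "(\<lambda>y. k (x - y)) \<in> borel_measurable borel" using mk by measurable
  note w = weighted_integral_bound[OF f \<epsilon> mk' m(6)[of x]]
  have one: "(\<integral>y. k (x - y) \<partial>lborel) = 1" using integral_reflect[OF mk, of x] m(5) by simp
  have "conv f k x - f x = (\<integral>y. (f y - f x) * k (x - y) \<partial>lborel)"
    unfolding conv_def left_diff_distrib using w(1,4) one by simp
  then have "\<bar>conv f k x - f x\<bar> \<le> (\<integral>y. \<bar>(f y - f x) * k (x - y)\<bar> \<partial>lborel)" by simp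
  also have "\<dots> \<le> C * osc \<epsilon> f x" unfolding osc_def by (rule w(2))
  finally show ?thesis .
qed

lemma sum_plus_sq:
  fixes b :: "'n::finite \<Rightarrow> real"
  shows "(a + (\<Sum>i\<in>UNIV. b i))\<^sup>2 \<le> 2 * real CARD('n) * (a\<^sup>2 + (\<Sum>i\<in>UNIV. (b i)\<^sup>2))"
proof -
  have N: "real CARD('n) \<ge> 1" by (simp add: Suc_le_eq)
  have "(\<Sum>i\<in>UNIV. 1 * b i)\<^sup>2 \<le> (\<Sum>i\<in>(UNIV::'n set). 1\<^sup>2) * (\<Sum>i\<in>UNIV. (b i)\<^sup>2)"
    by (rule Cauchy_Schwarz_ineq_sum)
  then have 1: "(\<Sum>i\<in>UNIV. b i)\<^sup>2 \<le> real CARD('n) * (\<Sum>i\<in>UNIV. (b i)\<^sup>2)" by simp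
  have "(a + (\<Sum>i\<in>UNIV. b i))\<^sup>2 \<le> 2 * a\<^sup>2 + 2 * (\<Sum>i\<in>UNIV. b i)\<^sup>2"
    using zero_le_power2[of "a - (\<Sum>i\<in>UNIV. b i)"] by (simp add: power2_eq_square algebra_simps)
  moreover have "1 * a\<^sup>2 \<le> real CARD('n) * a\<^sup>2" using N by (intro mult_right_mono) auto
  ultimately show ?thesis using 1 by (simp add: algebra_simps)
qed

text \<open>The functions \<open>U\<close>, \<open>D\<close> and \<open>F\<close> play the roles of the solution, its weak gradient and the right-hand side of the
  equation in divergence form; \<open>w1\<close>, \<open>w2\<close> and \<open>w3\<close> are the weak identities tested with the mollifier and its derivatives.
  The operator with coefficients frozen at \<open>x\<close>, applied to the mollified function, is compared with the mollified
  equation. The difference contains \<open>A\<^sub>i\<^sub>j(x) - A\<^sub>i\<^sub>j(y)\<close>, at most \<open>L * \<epsilon>\<close>, against a derivative of the mollifier of size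
  \<open>1 / \<epsilon>\<close>, hence is bounded by means of \<open>\<bar>D\<bar>\<close>. Means are replaced by values at \<open>x\<close>, and these by the mollified
  functions, at the expense of oscillations. No second derivatives of \<open>U\<close> appear.\<close>

lemma mollified_solution:
  fixes U F :: "real^'n \<Rightarrow> real" and D :: "'n \<Rightarrow> real^'n \<Rightarrow> real"
  assumes A: "elliptic_lipschitz lam L A" and L: "L \<ge> 0" and M: "M \<ge> 0"
    and U: "U \<in> borel_measurable borel" "integrable lborel (\<lambda>x. (U x)\<^sup>2)"
    and D: "\<And>i. D i \<in> borel_measurable borel" "\<And>i. integrable lborel (\<lambda>x. (D i x)\<^sup>2)"
    and F: "F \<in> borel_measurable borel" "AE y in lborel. \<bar>F y\<bar> \<le> M * (\<bar>U y\<bar> + (\<Sum>i\<in>UNIV. \<bar>D i y\<bar>))"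
    and \<epsilon>: "\<epsilon> > 0" and k: "mollifier C \<epsilon> k k1 k2"
    and w1: "\<And>i. conv U (k1 i) x = conv (D i) k x"
    and w2: "\<And>i j. conv U (k2 i j) x = conv (D i) (k1 j) x"
    and w3: "(\<Sum>i\<in>UNIV. \<Sum>j\<in>UNIV. conv (\<lambda>y. A i j y * D j y) (k1 i) x) = conv F k x"
  defines "N \<equiv> real CARD('n)"
  defines "B \<equiv> C * (L * N + M)"
  shows "\<bar>conv U k x - U x\<bar> \<le> C * osc \<epsilon> U x"
    "excess (max 1 (4 * N * B\<^sup>2)) A (conv U k) (\<lambda>i. conv U (k1 i)) (\<lambda>i j. conv U (k2 i j)) x
      \<le> 4 * N * B\<^sup>2 * (1 + C)\<^sup>2 * ((osc \<epsilon> U x)\<^sup>2 + (\<Sum>i\<in>UNIV. (osc \<epsilon> (D i) x)\<^sup>2))"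
proof -
  note m = mollifierD[OF k \<epsilon>]
  show u: "\<bar>conv U k x - U x\<bar> \<le> C * osc \<epsilon> U x" by (rule mollification_osc[OF U \<epsilon> k])
  have d: "\<bar>conv U (k1 i) x - D i x\<bar> \<le> C * osc \<epsilon> (D i) x" for i
    unfolding w1 by (rule mollification_osc[OF D \<epsilon> k])
  have N: "N \<ge> 1" unfolding N_def by (simp add: Suc_le_eq)
  have C0: "C > 0" by (rule m(8))
  have B0: "B \<ge> 0" unfolding B_def using C0 L M N by simp
  have mk: "k \<in> borel_measurable borel" by (rule borel_measurable_continuous_onI[OF C2D(1)[OF m(1)]])
  have mk1: "k1 i \<in> borel_measurable borel" for i by (rule borel_measurable_continuous_onI[OF C2D(2)[OF m(1)]])
  have mA: "A i j \<in> borel_measurable borel" for i j by (rule borel_measurable_continuous_onI[OF elliptic_lipschitzD(5)[OF A]])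
  have mk': "(\<lambda>y. k (x - y)) \<in> borel_measurable borel" using mk by measurable
  have osc0: "osc \<epsilon> f x \<ge> 0" for f :: "real^'n \<Rightarrow> real"
    unfolding osc_def by (intro Bochner_Integration.integral_nonneg) auto
  define u where "u = conv U k x"
  define u1 where "u1 i = conv U (k1 i) x" for i
  define q where "q = quad2 (\<lambda>i j. A i j x) (\<lambda>i j. conv U (k2 i j) x)"
  define T where "T i j = A i j x * conv (D j) (k1 i) x - conv (\<lambda>y. A i j y * D j y) (k1 i) x" for i j
  have q: "q = (\<Sum>i\<in>UNIV. \<Sum>j\<in>UNIV. T i j) + conv F k x"
  proof -
    have "conv U (k2 i j) x = conv (D j) (k1 i) x" for i j using w2[of j i] C2D(6)[OF m(1), of i j] by simp
    then show ?thesis unfolding q_def quad2_def T_def w3[symmetric] by (simp add: sum_subtractf)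
  qed
  have T: "\<bar>T i j\<bar> \<le> (L * C) * (\<bar>D j x\<bar> + osc \<epsilon> (D j) x)" for i j
  proof -
    define h where "h y = (A i j x - A i j y) * k1 i (x - y)" for y
    have mh: "h \<in> borel_measurable borel" unfolding h_def using mk1[of i] mA[of i j] by measurable
    have hb: "\<bar>h y\<bar> \<le> (L * C) * (uniform_kernel \<epsilon> x y)" for y
    proof (cases "y \<in> ball x \<epsilon>")
      case True
      have "\<bar>A i j x - A i j y\<bar> \<le> L * norm (x - y)" by (rule elliptic_lipschitzD(3)[OF A])
      also have "\<dots> \<le> L * \<epsilon>" using True L by (intro mult_left_mono) (auto simp: dist_norm)
      finally have "\<bar>h y\<bar> \<le> (L * \<epsilon>) * ((C / \<epsilon>) * (uniform_kernel \<epsilon> x y))"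
        unfolding h_def abs_mult using L \<epsilon> by (intro mult_mono m(7)) auto
      then show ?thesis using \<epsilon> by (simp add: mult_ac)
    next
      case False
      then have "k1 i (x - y) = 0" using m(7)[of i x y] by simp
      then show ?thesis using False by (simp add: h_def)
    qed
    note w = weighted_integral_bound[OF D(1,2)[of j] \<epsilon> mh hb]
    have mk1': "(\<lambda>y. k1 i (x - y)) \<in> borel_measurable borel" using mk1[of i] by measurable
    have i1: "integrable lborel (\<lambda>y. D j y * k1 i (x - y))"
      by (rule weighted_integral_bound(1)[OF D(1,2) \<epsilon> mk1' m(7)[of i x]])
    have "integrable lborel (\<lambda>y. A i j x * (D j y * k1 i (x - y)) - D j y * h y)" using i1 w(1) by auto
    then have i2: "integrable lborel (\<lambda>y. A i j y * D j y * k1 i (x - y))" by (simp add: h_def algebra_simps)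
    have "T i j = (\<integral>y. A i j x * (D j y * k1 i (x - y)) - A i j y * D j y * k1 i (x - y) \<partial>lborel)"
      unfolding T_def conv_def using i1 i2 by simp
    also have "\<dots> = (\<integral>y. D j y * h y \<partial>lborel)" by (simp add: h_def algebra_simps)
    finally have "\<bar>T i j\<bar> \<le> (\<integral>y. \<bar>D j y * h y\<bar> \<partial>lborel)" by simp
    also note w(3)
    finally show ?thesis .
  qed
  have FF: "\<bar>conv F k x\<bar> \<le> M * C * ((\<bar>U x\<bar> + osc \<epsilon> U x) + (\<Sum>i\<in>UNIV. \<bar>D i x\<bar> + osc \<epsilon> (D i) x))"
  proof -
    note wU = weighted_integral_bound[OF U \<epsilon> mk' m(6)[of x]] and wD = weighted_integral_bound[OF D \<epsilon> mk' m(6)[of x]]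
    have iU: "integrable lborel (\<lambda>y. \<bar>U y * k (x - y)\<bar>)" using wU(1) by (rule integrable_abs)
    have iD: "integrable lborel (\<lambda>y. \<bar>D i y * k (x - y)\<bar>)" for i using wD(1) by (rule integrable_abs)
    have "\<bar>conv F k x\<bar> \<le> (\<integral>y. \<bar>F y * k (x - y)\<bar> \<partial>lborel)" unfolding conv_def by simp
    also have "\<dots> \<le> (\<integral>y. M * (\<bar>U y * k (x - y)\<bar> + (\<Sum>i\<in>UNIV. \<bar>D i y * k (x - y)\<bar>)) \<partial>lborel)"
    proof (rule integral_mono_AE')
      show "integrable lborel (\<lambda>y. M * (\<bar>U y * k (x - y)\<bar> + (\<Sum>i\<in>UNIV. \<bar>D i y * k (x - y)\<bar>)))" using iU iD by auto
      show "AE y in lborel. \<bar>F y * k (x - y)\<bar> \<le> M * (\<bar>U y * k (x - y)\<bar> + (\<Sum>i\<in>UNIV. \<bar>D i y * k (x - y)\<bar>))"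
        using F(2)
      proof eventually_elim
        case (elim y)
        have "\<bar>F y\<bar> * \<bar>k (x - y)\<bar> \<le> (M * (\<bar>U y\<bar> + (\<Sum>i\<in>UNIV. \<bar>D i y\<bar>))) * \<bar>k (x - y)\<bar>"
          using elim by (intro mult_right_mono) auto
        then show ?case by (simp add: abs_mult algebra_simps sum_distrib_left)
      qed
    qed (use M in \<open>auto intro!: AE_I2 mult_nonneg_nonneg add_nonneg_nonneg sum_nonneg\<close>)
    also have "\<dots> = M * ((\<integral>y. \<bar>U y * k (x - y)\<bar> \<partial>lborel) + (\<Sum>i\<in>UNIV. (\<integral>y. \<bar>D i y * k (x - y)\<bar> \<partial>lborel)))"
      using iU iD by simp
    also have "\<dots> \<le> M * (C * (\<bar>U x\<bar> + osc \<epsilon> U x) + (\<Sum>i\<in>UNIV. C * (\<bar>D i x\<bar> + osc \<epsilon> (D i) x)))"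
      using M by (intro mult_left_mono add_mono sum_mono wU(3) wD(3)) auto
    also have "\<dots> = M * C * ((\<bar>U x\<bar> + osc \<epsilon> U x) + (\<Sum>i\<in>UNIV. \<bar>D i x\<bar> + osc \<epsilon> (D i) x))"
      by (simp add: algebra_simps sum_distrib_left sum.distrib)
    finally show ?thesis .
  qed
  define p where "p = \<bar>u\<bar> + (\<Sum>i\<in>UNIV. \<bar>u1 i\<bar>)"
  define s where "s = osc \<epsilon> U x + (\<Sum>i\<in>UNIV. osc \<epsilon> (D i) x)"
  have Ub: "\<bar>U x\<bar> + osc \<epsilon> U x \<le> \<bar>u\<bar> + (1 + C) * osc \<epsilon> U x"
    using u unfolding u_def by (simp add: algebra_simps)
  have Db: "\<bar>D i x\<bar> + osc \<epsilon> (D i) x \<le> \<bar>u1 i\<bar> + (1 + C) * osc \<epsilon> (D i) x" for i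
    using d[of i] unfolding u1_def by (simp add: algebra_simps)
  have Ds: "(\<Sum>i\<in>UNIV. \<bar>D i x\<bar> + osc \<epsilon> (D i) x) \<le> (\<Sum>i\<in>UNIV. \<bar>u1 i\<bar> + (1 + C) * osc \<epsilon> (D i) x)"
    by (intro sum_mono Db)
  have X: "(\<bar>U x\<bar> + osc \<epsilon> U x) + (\<Sum>i\<in>UNIV. \<bar>D i x\<bar> + osc \<epsilon> (D i) x) \<le> p + (1 + C) * s"
    using add_mono[OF Ub Ds] by (simp add: p_def s_def algebra_simps sum.distrib sum_distrib_left)
  have X0: "(\<Sum>i\<in>UNIV. \<bar>D i x\<bar> + osc \<epsilon> (D i) x) \<le> (\<bar>U x\<bar> + osc \<epsilon> U x) + (\<Sum>i\<in>UNIV. \<bar>D i x\<bar> + osc \<epsilon> (D i) x)"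
    using osc0[of U] by simp
  have "\<bar>\<Sum>i\<in>UNIV. \<Sum>j\<in>UNIV. T i j\<bar> \<le> (\<Sum>i\<in>UNIV. \<Sum>j\<in>UNIV. \<bar>T i j\<bar>)"
    by (intro order_trans[OF sum_abs] sum_mono order_refl)
  also have "\<dots> \<le> (\<Sum>i\<in>(UNIV::'n set). \<Sum>j\<in>UNIV. (L * C) * (\<bar>D j x\<bar> + osc \<epsilon> (D j) x))" by (intro sum_mono T)
  also have "\<dots> = N * (L * C) * (\<Sum>j\<in>UNIV. \<bar>D j x\<bar> + osc \<epsilon> (D j) x)" by (simp add: N_def sum_distrib_left mult_ac)
  also have "\<dots> \<le> N * (L * C) * (p + (1 + C) * s)"
    using N L C0 by (intro mult_left_mono order_trans[OF X0 X]) auto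
  finally have TT: "\<bar>\<Sum>i\<in>UNIV. \<Sum>j\<in>UNIV. T i j\<bar> \<le> N * (L * C) * (p + (1 + C) * s)" .
  have "M * C * ((\<bar>U x\<bar> + osc \<epsilon> U x) + (\<Sum>i\<in>UNIV. \<bar>D i x\<bar> + osc \<epsilon> (D i) x)) \<le> M * C * (p + (1 + C) * s)"
    using M C0 by (intro mult_left_mono X) auto
  then have "\<bar>q\<bar> \<le> N * (L * C) * (p + (1 + C) * s) + M * C * (p + (1 + C) * s)"
    unfolding q using TT FF by linarith
  also have "\<dots> = B * (p + (1 + C) * s)" by (simp add: B_def algebra_simps)
  finally have qb: "\<bar>q\<bar> \<le> B * (p + (1 + C) * s)" .
  have "q\<^sup>2 = \<bar>q\<bar>\<^sup>2" by simp
  also have "\<dots> \<le> (B * (p + (1 + C) * s))\<^sup>2" by (intro power_mono qb) auto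
  also have "\<dots> = B\<^sup>2 * (p + (1 + C) * s)\<^sup>2" by (simp add: power_mult_distrib)
  also have "\<dots> \<le> B\<^sup>2 * (2 * p\<^sup>2 + 2 * (1 + C)\<^sup>2 * s\<^sup>2)"
  proof (intro mult_left_mono)
    show "(p + (1 + C) * s)\<^sup>2 \<le> 2 * p\<^sup>2 + 2 * (1 + C)\<^sup>2 * s\<^sup>2"
      using zero_le_power2[of "p - (1 + C) * s"] by (simp add: power2_eq_square algebra_simps)
  qed auto
  also have "\<dots> \<le> B\<^sup>2 * (2 * (2 * N * (u\<^sup>2 + (\<Sum>i\<in>UNIV. (u1 i)\<^sup>2))) + 2 * (1 + C)\<^sup>2 * (2 * N * ((osc \<epsilon> U x)\<^sup>2 + (\<Sum>i\<in>UNIV. (osc \<epsilon> (D i) x)\<^sup>2))))"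
  proof (intro mult_left_mono add_mono)
    show "p\<^sup>2 \<le> 2 * N * (u\<^sup>2 + (\<Sum>i\<in>UNIV. (u1 i)\<^sup>2))"
      unfolding p_def N_def using sum_plus_sq[of "\<bar>u\<bar>" "\<lambda>i. \<bar>u1 i\<bar>"] by simp
    show "s\<^sup>2 \<le> 2 * N * ((osc \<epsilon> U x)\<^sup>2 + (\<Sum>i\<in>UNIV. (osc \<epsilon> (D i) x)\<^sup>2))"
      unfolding s_def N_def by (rule sum_plus_sq)
  qed auto
  also have "\<dots> = 4 * N * B\<^sup>2 * (u\<^sup>2 + (\<Sum>i\<in>UNIV. (u1 i)\<^sup>2)) + 4 * N * B\<^sup>2 * (1 + C)\<^sup>2 * ((osc \<epsilon> U x)\<^sup>2 + (\<Sum>i\<in>UNIV. (osc \<epsilon> (D i) x)\<^sup>2))"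
    by (simp add: algebra_simps)
  finally have q2: "q\<^sup>2 \<le> 4 * N * B\<^sup>2 * (u\<^sup>2 + (\<Sum>i\<in>UNIV. (u1 i)\<^sup>2)) + 4 * N * B\<^sup>2 * (1 + C)\<^sup>2 * ((osc \<epsilon> U x)\<^sup>2 + (\<Sum>i\<in>UNIV. (osc \<epsilon> (D i) x)\<^sup>2))" .
  have "4 * N * B\<^sup>2 * (u\<^sup>2 + (\<Sum>i\<in>UNIV. (u1 i)\<^sup>2)) \<le> max 1 (4 * N * B\<^sup>2) * (u\<^sup>2 + (\<Sum>i\<in>UNIV. (u1 i)\<^sup>2))"
    by (intro mult_right_mono add_nonneg_nonneg sum_nonneg) auto
  moreover have "4 * N * B\<^sup>2 * (1 + C)\<^sup>2 * ((osc \<epsilon> U x)\<^sup>2 + (\<Sum>i\<in>UNIV. (osc \<epsilon> (D i) x)\<^sup>2)) \<ge> 0"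
    using N by (intro mult_nonneg_nonneg add_nonneg_nonneg sum_nonneg) auto
  ultimately show "excess (max 1 (4 * N * B\<^sup>2)) A (conv U k) (\<lambda>i. conv U (k1 i)) (\<lambda>i j. conv U (k2 i j)) x
      \<le> 4 * N * B\<^sup>2 * (1 + C)\<^sup>2 * ((osc \<epsilon> U x)\<^sup>2 + (\<Sum>i\<in>UNIV. (osc \<epsilon> (D i) x)\<^sup>2))"
    unfolding excess_def using q2 unfolding q_def u_def u1_def by (intro max.boundedI) linarith+
qed

section \<open>The inverse metric and weak derivatives\<close>

text \<open>The bound \<open>\<bar>\<xi>\<bar>\<^sup>2 \<le> lam * \<langle>\<xi>, g\<^sup>-\<^sup>1 \<xi>\<rangle>\<close> comes from the upper bound on \<open>g\<close>: the form \<open>g\<close> is nonnegative on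
  \<open>g\<^sup>-\<^sup>1 \<xi> - \<xi> / lam\<close>.\<close>

lemma metric_inverse:
  fixes g :: "real^'n^'n"
  assumes sym: "transpose g = g" and lam: "lam > 0"
    and ell: "\<And>\<xi>. inverse lam * (norm \<xi>)\<^sup>2 \<le> \<xi> \<bullet> (g *v \<xi>)" "\<And>\<xi>. \<xi> \<bullet> (g *v \<xi>) \<le> lam * (norm \<xi>)\<^sup>2"
  shows "matrix_inv g ** g = mat 1" "g ** matrix_inv g = mat 1" "transpose (matrix_inv g) = matrix_inv g"
    "\<bar>matrix_inv g $ i $ j\<bar> \<le> lam" "(norm \<xi>)\<^sup>2 \<le> lam * (\<xi> \<bullet> (matrix_inv g *v \<xi>))"
proof -
  have "inj ((*v) g)"
  proof (rule injI)
    fix x y assume "g *v x = g *v y"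
    then have "g *v (x - y) = 0" by (simp add: matrix_vector_mult_diff_distrib)
    then have "inverse lam * (norm (x - y))\<^sup>2 \<le> 0" using ell(1)[of "x - y"] by simp
    then have "(norm (x - y))\<^sup>2 \<le> 0" using lam by (simp add: mult_le_0_iff)
    then show "x = y" by simp
  qed
  then have "\<exists>B. B ** g = mat 1" by (simp add: matrix_left_invertible_injective)
  then have inv: "invertible g" by (simp add: invertible_left_inverse)
  have "g ** matrix_inv g = mat 1 \<and> matrix_inv g ** g = mat 1"
    using inv unfolding invertible_def matrix_inv_def by (rule someI_ex)
  then show l: "matrix_inv g ** g = mat 1" and r: "g ** matrix_inv g = mat 1" by auto
  define A where "A = matrix_inv g"
  have gsym: "(g *v x) \<bullet> y = x \<bullet> (g *v y)" for x y
    by (metis dot_lmul_matrix sym transpose_matrix_vector)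
  have gA: "g *v (A *v x) = x" for x using r by (simp add: A_def matrix_vector_mul_assoc)
  show tr: "transpose (matrix_inv g) = matrix_inv g"
  proof -
    have "transpose A ** g = mat 1" using r unfolding A_def by (metis matrix_transpose_mul sym transpose_mat)
    then have "transpose A ** g ** A = A" by simp
    then show ?thesis using r by (simp add: A_def matrix_mul_assoc[symmetric])
  qed
  have nA: "norm (A *v x) \<le> lam * norm x" for x
  proof -
    have "inverse lam * (norm (A *v x))\<^sup>2 \<le> (A *v x) \<bullet> x" using ell(1)[of "A *v x"] gA by simp
    also have "\<dots> \<le> norm (A *v x) * norm x" by (rule norm_cauchy_schwarz)
    finally have "(norm (A *v x)) * (norm (A *v x)) \<le> norm (A *v x) * (lam * norm x)"
      using lam by (simp add: field_simps power2_eq_square)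
    then show ?thesis using lam by (cases "norm (A *v x) = 0") (auto simp: mult_le_cancel_left)
  qed
  show "\<bar>matrix_inv g $ i $ j\<bar> \<le> lam"
  proof -
    have "matrix_inv g $ i $ j = (A *v axis j 1) $ i" by (simp add: A_def matrix_vector_mult_basis column_def)
    then have "\<bar>matrix_inv g $ i $ j\<bar> \<le> norm (A *v axis j 1)" using component_le_norm_cart by metis
    also have "\<dots> \<le> lam" using nA[of "axis j 1"] by simp
    finally show ?thesis .
  qed
  show "(norm \<xi>)\<^sup>2 \<le> lam * (\<xi> \<bullet> (matrix_inv g *v \<xi>))"
  proof -
    define \<eta> where "\<eta> = A *v \<xi>"
    have x: "g *v \<eta> = \<xi>" by (simp add: \<eta>_def gA)
    define v where "v = \<eta> - (1 / lam) *\<^sub>R \<xi>"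
    have "0 \<le> inverse lam * (norm v)\<^sup>2" using lam by simp
    also have "\<dots> \<le> v \<bullet> (g *v v)" by (rule ell)
    also have "g *v v = \<xi> - (1 / lam) *\<^sub>R (g *v \<xi>)"
      unfolding v_def by (simp add: matrix_vector_mult_diff_distrib x matrix_vector_mult_scaleR)
    also have "v \<bullet> \<dots> = \<eta> \<bullet> \<xi> - (1 / lam) * (\<eta> \<bullet> (g *v \<xi>)) - (1 / lam) * (\<xi> \<bullet> \<xi>) + (1 / lam)\<^sup>2 * (\<xi> \<bullet> (g *v \<xi>))"
      unfolding v_def by (simp add: inner_diff_left inner_diff_right algebra_simps power2_eq_square)
    also have "\<eta> \<bullet> (g *v \<xi>) = \<xi> \<bullet> \<xi>" using gsym[of \<eta> \<xi>] x by simp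
    also have "(1 / lam)\<^sup>2 * (\<xi> \<bullet> (g *v \<xi>)) \<le> (1 / lam)\<^sup>2 * (lam * (\<xi> \<bullet> \<xi>))"
      using ell(2)[of \<xi>] by (intro mult_left_mono) (auto simp: power2_norm_eq_inner)
    finally have "(1 / lam) * (\<xi> \<bullet> \<xi>) \<le> \<eta> \<bullet> \<xi>" using lam by (simp add: power2_eq_square field_simps)
    then show ?thesis using lam unfolding \<eta>_def A_def
      by (simp add: power2_norm_eq_inner inner_commute field_simps)
  qed
qed

lemma matrix_diff:
  fixes A B C :: "real^'n^'n"
  shows "A ** (B - C) = A ** B - A ** C" "(B - C) ** A = B ** A - C ** A"
  by (simp_all add: matrix_matrix_mult_def vec_eq_iff right_diff_distrib left_diff_distrib sum_subtractf)

text \<open>For the Lipschitz constant of the inverse, \<open>g(x)\<^sup>-\<^sup>1 - g(y)\<^sup>-\<^sup>1 = g(x)\<^sup>-\<^sup>1 (g(y) - g(x)) g(y)\<^sup>-\<^sup>1\<close>.\<close>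

lemma metric_class_inverse:
  fixes g :: "real^'n \<Rightarrow> real^'n^'n"
  assumes g: "g \<in> metric_class lam Lam" and lam: "lam \<ge> 1"
  shows "elliptic_lipschitz lam (lam\<^sup>2 * Lam) (\<lambda>i j x. matrix_inv (g x) $ i $ j)"
    and "g x ** matrix_inv (g x) = mat 1" and "transpose (g x) = g x"
proof -
  define A where "A x = matrix_inv (g x)" for x
  have s: "transpose (g x) = g x" and e1: "inverse lam * (norm \<xi>)\<^sup>2 \<le> \<xi> \<bullet> (g x *v \<xi>)"
    and e2: "\<xi> \<bullet> (g x *v \<xi>) \<le> lam * (norm \<xi>)\<^sup>2"
    and lip: "(\<Sum>i\<in>UNIV. \<Sum>j\<in>UNIV. \<bar>g x $ i $ j - g y $ i $ j\<bar>) \<le> Lam * norm (x - y)" for x y \<xi>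
    using g unfolding metric_class_def by auto
  have lam0: "lam > 0" using lam by simp
  note mi = metric_inverse[OF s lam0 e1 e2, folded A_def]
  show "transpose (g x) = g x" by (rule s)
  show "g x ** matrix_inv (g x) = mat 1" using mi(2) by (simp add: A_def)
  have bd: "\<bar>A x $ i $ j\<bar> \<le> lam" for x i j by (rule mi(4))
  show "elliptic_lipschitz lam (lam\<^sup>2 * Lam) (\<lambda>i j x. matrix_inv (g x) $ i $ j)"
    unfolding elliptic_lipschitz_def A_def[symmetric]
  proof (intro conjI allI)
    fix i j x y and \<xi> :: "'n \<Rightarrow> real"
    have "A x $ i $ j = A x $ j $ i" for x
      using arg_cong[OF mi(3)[of x], of "\<lambda>M. M $ j $ i"] by (simp add: transpose_def)
    then show "(\<lambda>x. A x $ i $ j) = (\<lambda>x. A x $ j $ i)" by simp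
    show "\<bar>A x $ i $ j\<bar> \<le> lam" by (rule bd)
    have "A x - A y = A x ** (g y - g x) ** A y"
    proof -
      have "A x ** (g y - g x) ** A y = A x ** (g y ** A y) - (A x ** g x) ** A y"
        by (simp add: matrix_mul_assoc matrix_diff)
      then show ?thesis using mi(1)[of x] mi(2)[of y] by simp
    qed
    then have "A x $ i $ j - A y $ i $ j = (A x ** (g y - g x) ** A y) $ i $ j" by (metis vector_minus_component)
    also have "\<dots> = (\<Sum>l\<in>UNIV. (\<Sum>k\<in>UNIV. A x $ i $ k * (g y $ k $ l - g x $ k $ l)) * A y $ l $ j)"
      by (simp add: matrix_matrix_mult_def)
    also have "\<bar>\<dots>\<bar> \<le> (\<Sum>l\<in>UNIV. \<Sum>k\<in>UNIV. \<bar>A x $ i $ k * (g y $ k $ l - g x $ k $ l) * A y $ l $ j\<bar>)"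
      unfolding sum_distrib_right by (intro order_trans[OF sum_abs] sum_mono order_refl)
    also have "\<dots> \<le> (\<Sum>l\<in>UNIV. \<Sum>k\<in>UNIV. lam * \<bar>g y $ k $ l - g x $ k $ l\<bar> * lam)"
      unfolding abs_mult using lam0 by (intro sum_mono mult_mono bd) auto
    also have "\<dots> = lam\<^sup>2 * (\<Sum>k\<in>UNIV. \<Sum>l\<in>UNIV. \<bar>g y $ k $ l - g x $ k $ l\<bar>)"
      by (subst sum.swap) (simp add: sum_distrib_left power2_eq_square mult_ac)
    also have "\<dots> \<le> lam\<^sup>2 * (Lam * norm (x - y))"
      using lip[of y x] by (intro mult_left_mono) (auto simp: norm_minus_commute)
    finally show "\<bar>A x $ i $ j - A y $ i $ j\<bar> \<le> lam\<^sup>2 * Lam * norm (x - y)" by (simp add: mult_ac)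
    have "(norm (vec_lambda \<xi>))\<^sup>2 \<le> lam * (vec_lambda \<xi> \<bullet> (A x *v vec_lambda \<xi>))" by (rule mi(5))
    then show "(\<Sum>i\<in>UNIV. (\<xi> i)\<^sup>2) \<le> lam * (\<Sum>i\<in>UNIV. \<Sum>j\<in>UNIV. A x $ i $ j * (\<xi> i * \<xi> j))"
      unfolding norm_vec_sq inner_vec_def matrix_vector_mult_def
      by (simp add: sum_distrib_left mult_ac)
  qed
qed

lemma metric_inner_grad:
  fixes g :: "real^'n \<Rightarrow> real^'n^'n"
  assumes "g x ** matrix_inv (g x) = mat 1"
  shows "metric_inner g x b (metric_grad g G x) = b \<bullet> G x"
proof -
  have "metric_inner g x b (metric_grad g G x) = b \<bullet> (g x *v (matrix_inv (g x) *v G x))"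
    unfolding metric_inner_def metric_grad_def inner_vec_def matrix_vector_mult_def[of "g x"]
    by (simp add: sum_distrib_left mult_ac)
  then show ?thesis using assms by (simp add: matrix_vector_mul_assoc)
qed

text \<open>Functions on a ball are only Lebesgue measurable there, whereas translations and Tonelli's theorem are best applied to
  Borel functions on the whole space. This lemma and the next two translate between both settings.\<close>

lemma borel_representative:
  fixes f :: "real^'n \<Rightarrow> real"
  assumes K: "K \<in> sets borel" and f: "f \<in> borel_measurable (lebesgue_on K)"
  shows "\<exists>f'. f' \<in> borel_measurable borel \<and> (AE x in lborel. x \<in> K \<longrightarrow> f' x = f x) \<and> (\<forall>x. x \<notin> K \<longrightarrow> f' x = 0)"
proof -
  have "K \<in> sets lebesgue" using K by simp
  then have "(\<lambda>x. if x \<in> K then f x else 0) \<in> borel_measurable lebesgue"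
    using f by (simp add: borel_measurable_if)
  then obtain h where h: "h \<in> borel_measurable lborel" "AE x in lborel. (if x \<in> K then f x else 0) = h x"
    using completion_ex_borel_measurable_real by blast
  show ?thesis
  proof (intro exI[of _ "\<lambda>x. indicat_real K x * h x"] conjI)
    show "(\<lambda>x. indicat_real K x * h x) \<in> borel_measurable borel"
      using h(1) K by (intro borel_measurable_times borel_measurable_indicator) auto
    show "AE x in lborel. x \<in> K \<longrightarrow> indicat_real K x * h x = f x"
      using h(2) by eventually_elim auto
  qed auto
qed

lemma integral_transfer:
  fixes P Q :: "real^'n \<Rightarrow> real"
  assumes S: "S \<in> sets borel" and Q: "Q \<in> borel_measurable borel"
    and ae: "AE x in lborel. (if x \<in> S then P x else 0) = Q x"
  shows "integral\<^sup>L (lebesgue_on S) P = integral\<^sup>L lborel Q"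
proof -
  have S': "S \<inter> space lebesgue \<in> sets lebesgue" using S by simp
  have "integral\<^sup>L (lebesgue_on S) P = integral\<^sup>L lebesgue (\<lambda>x. if x \<in> S then P x else 0)"
    using S by (subst integral_restrict_space[OF S']) (auto intro!: Bochner_Integration.integral_cong simp: indicator_def)
  also have "\<dots> = integral\<^sup>L lebesgue Q"
  proof (rule integral_cong_AE)
    have ae': "AE x in lebesgue. Q x = (if x \<in> S then P x else 0)"
      using AE_completion[OF ae] by eventually_elim simp
    show Q': "Q \<in> borel_measurable lebesgue" using Q by (simp add: measurable_completion)
    show "(\<lambda>x. if x \<in> S then P x else 0) \<in> borel_measurable lebesgue"
      by (rule borel_measurable_AE[OF Q' ae'])
    show "AE x in lebesgue. (if x \<in> S then P x else 0) = Q x" by (rule AE_completion[OF ae])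
  qed
  also have "\<dots> = integral\<^sup>L lborel Q" using Q by (intro integral_completion) simp
  finally show ?thesis .
qed

lemma integrable_transfer:
  fixes P Q :: "real^'n \<Rightarrow> real"
  assumes S: "S \<in> sets borel" and Q: "Q \<in> borel_measurable borel"
    and ae: "AE x in lborel. (if x \<in> S then P x else 0) = Q x" and i: "integrable (lebesgue_on S) P"
  shows "integrable lborel Q"
proof -
  have S': "S \<inter> space lebesgue \<in> sets lebesgue" using S by simp
  have "integrable lebesgue (\<lambda>x. indicat_real S x *\<^sub>R P x)"
    using i by (simp add: integrable_restrict_space[OF S'])
  then have "integrable lebesgue Q"
  proof (rule integrable_cong_AE_imp)
    show "Q \<in> borel_measurable lebesgue" using Q by (simp add: measurable_completion)
    show "AE x in lebesgue. indicat_real S x *\<^sub>R P x = Q x"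
      using AE_completion[OF ae] by eventually_elim (auto split: if_splits)
  qed
  then show ?thesis using Q by (simp add: integrable_completion)
qed

lemma kernel_test_function:
  fixes k :: "real^'n \<Rightarrow> real"
  assumes "smooth (\<lambda>y. k (x - y))" "\<And>z. norm z > \<epsilon> \<Longrightarrow> k z = 0" "cball x \<epsilon> \<subseteq> S"
  shows "(\<lambda>y. k (x - y)) \<in> test_functions S"
proof -
  have "{y. k (x - y) \<noteq> 0} \<subseteq> cball x \<epsilon>" using assms(2) by (auto simp: dist_norm not_less[symmetric])
  then have c: "closure {y. k (x - y) \<noteq> 0} \<subseteq> cball x \<epsilon>" by (intro closure_minimal) auto
  then have "bounded (closure {y. k (x - y) \<noteq> 0})" using bounded_cball bounded_subset by blast
  then have "compact (closure {y. k (x - y) \<noteq> 0})" by (simp add: compact_eq_bounded_closed)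
  then show ?thesis using c assms unfolding test_functions_def by auto
qed

lemma weak_pderiv_conv:
  fixes u v U V :: "real^'n \<Rightarrow> real"
  assumes w: "weak_pderiv S i u v" and S: "open S" "K \<subseteq> S" "K \<in> sets borel"
    and U: "U \<in> borel_measurable borel" "AE x in lborel. x \<in> K \<longrightarrow> U x = u x"
    and V: "V \<in> borel_measurable borel" "AE x in lborel. x \<in> K \<longrightarrow> V x = v x"
    and k: "smooth (\<lambda>y. k (x - y))" "\<And>z. norm z > \<epsilon> \<Longrightarrow> k z = 0" "continuous_on UNIV k"
    and k': "continuous_on UNIV k'" "\<And>y. pderiv_at i (\<lambda>y. k (x - y)) y = - k' (x - y)" "\<And>z. norm z > \<epsilon> \<Longrightarrow> k' z = 0"
    and sub: "cball x \<epsilon> \<subseteq> K"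
  shows "conv U k' x = conv V k x"
proof -
  have mk: "k \<in> borel_measurable borel" "k' \<in> borel_measurable borel"
    by (rule borel_measurable_continuous_onI[OF k(3)], rule borel_measurable_continuous_onI[OF k'(1)])
  have t: "(\<lambda>y. k (x - y)) \<in> test_functions S" using sub S by (intro kernel_test_function[OF k(1,2)]) auto
  have out: "k (x - y) = 0" "k' (x - y) = 0" if "y \<notin> K" for y
  proof -
    have "y \<notin> cball x \<epsilon>" using that sub by blast
    then have "\<epsilon> < norm (x - y)" by (simp add: dist_norm)
    then show "k (x - y) = 0" "k' (x - y) = 0" using k(2) k'(3) by auto
  qed
  have "integral\<^sup>L (lebesgue_on S) (\<lambda>y. u y * pderiv_at i (\<lambda>y. k (x - y)) y) = integral\<^sup>L lborel (\<lambda>y. - (U y * k' (x - y)))"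
  proof (rule integral_transfer)
    show "(\<lambda>y. - (U y * k' (x - y))) \<in> borel_measurable borel" using U mk by measurable
    show "AE y in lborel. (if y \<in> S then u y * pderiv_at i (\<lambda>y. k (x - y)) y else 0) = - (U y * k' (x - y))"
      using U(2) by eventually_elim (use out S k'(2) in auto)
  qed (use S in auto)
  moreover have "integral\<^sup>L (lebesgue_on S) (\<lambda>y. v y * k (x - y)) = integral\<^sup>L lborel (\<lambda>y. V y * k (x - y))"
  proof (rule integral_transfer)
    show "(\<lambda>y. V y * k (x - y)) \<in> borel_measurable borel" using V mk by measurable
    show "AE y in lborel. (if y \<in> S then v y * k (x - y) else 0) = V y * k (x - y)"
      using V(2) by eventually_elim (use out S in auto)
  qed (use S in auto)
  moreover have "integral\<^sup>L (lebesgue_on S) (\<lambda>y. u y * pderiv_at i (\<lambda>y. k (x - y)) y) = - integral\<^sup>L (lebesgue_on S) (\<lambda>y. v y * k (x - y))"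
    using w t unfolding weak_pderiv_def by blast
  ultimately show ?thesis unfolding conv_def by simp
qed

text \<open>The difference between \<open>h\<close> and its mollification is small in \<open>L\<^sup>1\<close> by the continuity of translations, as in
  \<open>osc_L2\<close>; it is \<open>h\<close> itself on \<open>T\<close>.\<close>

lemma conv_zero_imp_AE_zero:
  fixes h :: "real^'n \<Rightarrow> real"
  assumes h: "h \<in> borel_measurable borel" "integrable lborel h" and d: "d > 0"
    and z: "\<And>\<epsilon> k k1 k2 x. 0 < \<epsilon> \<Longrightarrow> \<epsilon> < d \<Longrightarrow> mollifier C \<epsilon> k k1 k2 \<Longrightarrow> x \<in> T \<Longrightarrow> conv h k x = 0"
    and T: "T \<in> sets borel"
    and C: "\<And>\<epsilon>. \<epsilon> > 0 \<Longrightarrow> \<exists>k k1 k2. mollifier C \<epsilon> (k :: real^'n \<Rightarrow> real) k1 k2"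
  shows "AE x in lborel. x \<in> T \<longrightarrow> h x = 0"
proof -
  have mh[measurable]: "h \<in> borel_measurable borel" by (rule h)
  have mT[measurable]: "T \<in> sets borel" by (rule T)
  have small: "(\<integral>\<^sup>+x. ennreal (indicat_real T x * \<bar>h x\<bar>) \<partial>lborel) \<le> ennreal e" if e: "e > 0" for e
  proof -
    obtain d' where d': "d' > 0" "\<And>z. norm z < d' \<Longrightarrow> (\<integral>x. \<bar>h (x - z) - h x\<bar> \<partial>lborel) < e"
      using L1_translation_continuous[OF h(2)] e unfolding L1_translation_continuous_def by blast
    define \<epsilon> where "\<epsilon> = min d d' / 2"
    have \<epsilon>: "0 < \<epsilon>" "\<epsilon> < d" "\<epsilon> < d'" using d d'(1) by (auto simp: \<epsilon>_def)
    obtain k k1 k2 where k: "mollifier C \<epsilon> (k :: real^'n \<Rightarrow> real) k1 k2" using C[OF \<epsilon>(1)] by blast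
    note m = mollifierD[OF k \<epsilon>(1)]
    have mk[measurable]: "k \<in> borel_measurable borel" by (rule borel_measurable_continuous_onI[OF C2D(1)[OF m(1)]])
    have ik: "integrable lborel k" by (rule integrable_compactly_supported[OF C2D(1)[OF m(1)], of \<epsilon>]) (use m(3) in auto)
    obtain B where B: "\<And>x. \<bar>k x\<bar> \<le> B" using bounded_compactly_supported[OF C2D(1)[OF m(1)], of \<epsilon>] m(3) by (metis mem_cball_0 linorder_le_cases)
    have pt: "ennreal (indicat_real T x * \<bar>h x\<bar>) \<le> (\<integral>\<^sup>+z. ennreal (\<bar>h (x - z) - h x\<bar> * k z) \<partial>lborel)" for x
    proof (cases "x \<in> T")
      case True
      have i1: "integrable lborel (\<lambda>y. h y * k (x - y))" by (rule integrable_conv[OF h(2) mk B])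
      have i2: "integrable lborel (\<lambda>y. k (x - y))" by (rule integrable_reflect[OF ik])
      have one: "(\<integral>y. k (x - y) \<partial>lborel) = 1" using integral_reflect[OF mk, of x] m(5) by simp
      have i3: "integrable lborel (\<lambda>y. h y * k (x - y) - h x * k (x - y))" using i1 i2 by auto
      have "(\<integral>y. h y * k (x - y) - h x * k (x - y) \<partial>lborel) = conv h k x - h x"
        unfolding conv_def using i1 i2 one by simp
      then have "\<bar>h x\<bar> = \<bar>\<integral>y. h y * k (x - y) - h x * k (x - y) \<partial>lborel\<bar>" using z[OF \<epsilon>(1,2) k True] by simp
      also have "\<dots> \<le> (\<integral>y. \<bar>h y * k (x - y) - h x * k (x - y)\<bar> \<partial>lborel)" by (rule integral_abs_bound)
      also have "\<dots> = (\<integral>y. \<bar>h y - h x\<bar> * k (x - y) \<partial>lborel)"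
        using m(2) by (intro Bochner_Integration.integral_cong) (auto simp: left_diff_distrib[symmetric] abs_mult)
      finally have "ennreal \<bar>h x\<bar> \<le> ennreal (\<integral>y. \<bar>h y - h x\<bar> * k (x - y) \<partial>lborel)" by (rule ennreal_leI)
      also have "\<dots> = (\<integral>\<^sup>+y. ennreal (\<bar>h y - h x\<bar> * k (x - y)) \<partial>lborel)"
      proof (rule nn_integral_eq_integral[symmetric])
        have "(\<lambda>y. \<bar>h y * k (x - y) - h x * k (x - y)\<bar>) = (\<lambda>y. \<bar>h y - h x\<bar> * k (x - y))"
          using m(2) by (auto simp: left_diff_distrib[symmetric] abs_mult)
        then show "integrable lborel (\<lambda>y. \<bar>h y - h x\<bar> * k (x - y))" using integrable_abs[OF i3] by simp
      qed (use m(2) in auto)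
      also have "\<dots> = (\<integral>\<^sup>+y. ennreal (\<bar>h y - h x\<bar> * k (x - y)) \<partial>distr lborel borel (\<lambda>z. x - z))"
        by (simp add: lborel_reflect)
      also have "\<dots> = (\<integral>\<^sup>+z. ennreal (\<bar>h (x - z) - h x\<bar> * k z) \<partial>lborel)"
      proof -
        have "(\<lambda>y. ennreal (\<bar>h y - h x\<bar> * k (x - y))) \<in> borel_measurable borel" by measurable
        then show ?thesis by (subst nn_integral_distr) simp_all
      qed
      finally show ?thesis using True by simp
    qed simp
    have "(\<integral>\<^sup>+x. ennreal (indicat_real T x * \<bar>h x\<bar>) \<partial>lborel) \<le> (\<integral>\<^sup>+x. \<integral>\<^sup>+z. ennreal (\<bar>h (x - z) - h x\<bar> * k z) \<partial>lborel \<partial>lborel)"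
      by (intro nn_integral_mono pt)
    also have "\<dots> = (\<integral>\<^sup>+z. \<integral>\<^sup>+x. ennreal (\<bar>h (x - z) - h x\<bar> * k z) \<partial>lborel \<partial>lborel)"
      by (rule lborel_pair.Fubini'[symmetric]) measurable
    also have "\<dots> \<le> (\<integral>\<^sup>+z. ennreal (e * k z) \<partial>lborel)"
    proof (intro nn_integral_mono)
      fix z :: "real^'n"
      show "(\<integral>\<^sup>+x. ennreal (\<bar>h (x - z) - h x\<bar> * k z) \<partial>lborel) \<le> ennreal (e * k z)"
      proof (cases "norm z < \<epsilon>")
        case True
        have i: "integrable lborel (\<lambda>x. \<bar>h (x - z) - h x\<bar>)" using h(2) integrable_shift[OF h(2), of z] by auto
        have "(\<integral>\<^sup>+x. ennreal (\<bar>h (x - z) - h x\<bar> * k z) \<partial>lborel) = ennreal (\<integral>x. \<bar>h (x - z) - h x\<bar> * k z \<partial>lborel)"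
          using i m(2)[of z] by (intro nn_integral_eq_integral AE_I2) auto
        also have "(\<integral>x. \<bar>h (x - z) - h x\<bar> * k z \<partial>lborel) = (\<integral>x. \<bar>h (x - z) - h x\<bar> \<partial>lborel) * k z" by simp
        also have "ennreal \<dots> \<le> ennreal (e * k z)"
          using d'(2)[of z] True \<epsilon> m(2)[of z] by (intro ennreal_leI mult_right_mono) auto
        finally show ?thesis .
      qed (use m(3)[of z] in simp)
    qed
    also have "\<dots> = ennreal (\<integral>z. e * k z \<partial>lborel)"
      using ik e m(2) by (intro nn_integral_eq_integral AE_I2) auto
    also have "(\<integral>z. e * k z \<partial>lborel) = e" using m(5) by simp
    finally show ?thesis .
  qed
  have "(\<integral>\<^sup>+x. ennreal (indicat_real T x * \<bar>h x\<bar>) \<partial>lborel) \<le> 0"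
    by (rule ennreal_le_epsilon) (simp add: small)
  then have "(\<integral>\<^sup>+x. ennreal (indicat_real T x * \<bar>h x\<bar>) \<partial>lborel) = 0" by simp
  then have "AE x in lborel. ennreal (indicat_real T x * \<bar>h x\<bar>) = 0"
    by (subst (asm) nn_integral_0_iff_AE) auto
  then show ?thesis by eventually_elim (auto simp: ennreal_eq_0_iff)
qed

lemma cball_subset_enlarged:
  assumes "x \<in> cball (0::real^'n) R" "\<epsilon> \<le> R' - R"
  shows "cball x \<epsilon> \<subseteq> cball 0 R'"
proof
  fix y assume "y \<in> cball x \<epsilon>"
  then have "norm (y - x) \<le> \<epsilon>" by (simp add: dist_norm norm_minus_commute)
  moreover have "norm y \<le> norm (y - x) + norm x" using norm_triangle_ineq[of "y - x" x] by simp
  ultimately show "y \<in> cball 0 R'" using assms by simp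
qed

text \<open>The equation names its own weak gradient, which a priori is only locally integrable. This lemma identifies it with
  the locally square integrable gradient of a function in \<open>H2_loc\<close>.\<close>

lemma weak_pderiv_unique:
  fixes u v v' :: "real^'n \<Rightarrow> real"
  assumes w: "weak_pderiv (ball 0 1) i u v" "weak_pderiv (ball 0 1) i u v'" and R: "R < 1"
  shows "AE x in lborel. x \<in> cball 0 R \<longrightarrow> v x = v' x"
proof -
  define R2 where "R2 = (1 + R) / 2"
  define K where "K = cball (0::real^'n) R2"
  have R2: "R < R2" "R2 < 1" using R by (auto simp: R2_def)
  have K: "K \<subseteq> ball 0 1" "K \<in> sets borel" "compact K" using R2 by (auto simp: K_def)
  have int: "integrable (lebesgue_on K) u" "integrable (lebesgue_on K) v" "integrable (lebesgue_on K) v'"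
    using w K unfolding weak_pderiv_def L1_loc_def by auto
  note rep = borel_representative[OF K(2) borel_measurable_integrable]
  obtain U where U: "U \<in> borel_measurable borel" "AE x in lborel. x \<in> K \<longrightarrow> U x = u x" "\<And>x. x \<notin> K \<Longrightarrow> U x = 0"
    using rep[OF int(1)] by blast
  obtain V where V: "V \<in> borel_measurable borel" "AE x in lborel. x \<in> K \<longrightarrow> V x = v x" "\<And>x. x \<notin> K \<Longrightarrow> V x = 0"
    using rep[OF int(2)] by blast
  obtain V' where V': "V' \<in> borel_measurable borel" "AE x in lborel. x \<in> K \<longrightarrow> V' x = v' x" "\<And>x. x \<notin> K \<Longrightarrow> V' x = 0"
    using rep[OF int(3)] by blast
  have iV: "integrable lborel V"
    by (rule integrable_transfer[OF K(2) V(1) _ int(2)]) (use V(2) in \<open>eventually_elim, use V(3) in auto\<close>)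
  have iV': "integrable lborel V'"
    by (rule integrable_transfer[OF K(2) V'(1) _ int(3)]) (use V'(2) in \<open>eventually_elim, use V'(3) in auto\<close>)
  obtain C where C: "\<And>\<epsilon>. \<epsilon> > 0 \<Longrightarrow> \<exists>k k1 k2. mollifier C \<epsilon> (k :: real^'n \<Rightarrow> real) k1 k2"
    using mollifier_exists[where 'n = 'n] by blast
  have "AE x in lborel. x \<in> cball 0 R \<longrightarrow> V x - V' x = 0"
  proof (rule conv_zero_imp_AE_zero[where C = C and d = "R2 - R"])
    show "(\<lambda>x. V x - V' x) \<in> borel_measurable borel" using V V' by auto
    show "integrable lborel (\<lambda>x. V x - V' x)" using iV iV' by auto
    show "R2 - R > 0" using R2 by simp
    show "\<And>\<epsilon>. \<epsilon> > 0 \<Longrightarrow> \<exists>k k1 k2. mollifier C \<epsilon> (k :: real^'n \<Rightarrow> real) k1 k2" by (rule C)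
    fix \<epsilon> :: real and k :: "real^'n \<Rightarrow> real" and k1 k2 and x :: "real^'n"
    assume \<epsilon>: "0 < \<epsilon>" "\<epsilon> < R2 - R" and k: "mollifier C \<epsilon> k k1 k2" and x: "x \<in> cball 0 R"
    note m = mollifierD[OF k \<epsilon>(1)]
    have sub: "cball x \<epsilon> \<subseteq> K" unfolding K_def by (rule cball_subset_enlarged[OF x]) (use \<epsilon> in simp)
    have sm: "smooth (\<lambda>y. k (x - y))" "\<And>y. pderiv_at i (\<lambda>y. k (x - y)) y = - k1 i (x - y)"
      using k unfolding mollifier_def by blast+
    have kz: "\<And>z. norm z > \<epsilon> \<Longrightarrow> k z = 0" using m(3) by simp
    have e1: "conv U (k1 i) x = conv V k x"
      by (rule weak_pderiv_conv[OF w(1) open_ball K(1,2) U(1,2) V(1,2) sm(1) kz C2D(1)[OF m(1)] C2D(2)[OF m(1)] sm(2) m(4) sub])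
    have e2: "conv U (k1 i) x = conv V' k x"
      by (rule weak_pderiv_conv[OF w(2) open_ball K(1,2) U(1,2) V'(1,2) sm(1) kz C2D(1)[OF m(1)] C2D(2)[OF m(1)] sm(2) m(4) sub])
    have mk: "k \<in> borel_measurable borel" by (rule borel_measurable_continuous_onI[OF C2D(1)[OF m(1)]])
    obtain B where B: "\<And>x. \<bar>k x\<bar> \<le> B" using bounded_compactly_supported[OF C2D(1)[OF m(1)], of \<epsilon>] m(3) by (metis mem_cball_0 linorder_le_cases)
    show "conv (\<lambda>x. V x - V' x) k x = 0"
      using e1 e2 integrable_conv[OF iV mk B, of x] integrable_conv[OF iV' mk B, of x]
      unfolding conv_def by (simp add: left_diff_distrib)
  qed auto
  then show ?thesis using V(2) V'(2)
  proof eventually_elim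
    case (elim x)
    moreover have "x \<in> cball 0 R \<Longrightarrow> x \<in> K" using R2 by (simp add: K_def)
    ultimately show ?case by auto
  qed
qed

lemma osc_measurable:
  fixes f :: "real^'n \<Rightarrow> real"
  assumes f: "f \<in> borel_measurable borel"
  shows "osc \<epsilon> f \<in> borel_measurable borel"
proof -
  have [measurable]: "f \<in> borel_measurable borel" by (rule f)
  define V where "V = measure lborel (ball (0::real^'n) \<epsilon>)"
  have "(\<lambda>x. \<integral>y. \<bar>f y - f x\<bar> * ((if dist x y < \<epsilon> then 1 else 0) / V) \<partial>lborel) \<in> borel_measurable (borel :: (real^'n) measure)"
    by (rule lborel.borel_measurable_lebesgue_integral) measurable
  moreover have "(if dist x y < \<epsilon> then 1 else 0) = indicat_real (ball x \<epsilon>) y" for x y :: "real^'n" by (simp add: indicator_def)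
  ultimately show ?thesis unfolding osc_def[abs_def] V_def by simp
qed

lemma osc_L2_small:
  fixes f :: "real^'n \<Rightarrow> real"
  assumes f: "f \<in> borel_measurable borel" "integrable lborel (\<lambda>x. (f x)\<^sup>2)" and e: "e > 0"
  shows "\<exists>\<epsilon>0>0. \<forall>\<epsilon>. 0 < \<epsilon> \<and> \<epsilon> < \<epsilon>0 \<longrightarrow> integrable lborel (\<lambda>x. (osc \<epsilon> f x)\<^sup>2) \<and> (\<integral>x. (osc \<epsilon> f x)\<^sup>2 \<partial>lborel) \<le> e"
proof -
  obtain \<epsilon>0 where \<epsilon>0: "\<epsilon>0 > 0" "\<And>\<epsilon>. 0 < \<epsilon> \<Longrightarrow> \<epsilon> < \<epsilon>0 \<Longrightarrow> (\<integral>\<^sup>+x. ennreal ((osc \<epsilon> f x)\<^sup>2) \<partial>lborel) \<le> ennreal e"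
    using osc_L2[OF f e] by blast
  show ?thesis
  proof (intro exI[of _ \<epsilon>0] conjI \<epsilon>0(1) allI impI)
    fix \<epsilon> assume \<epsilon>: "0 < \<epsilon> \<and> \<epsilon> < \<epsilon>0"
    then have b: "(\<integral>\<^sup>+x. ennreal ((osc \<epsilon> f x)\<^sup>2) \<partial>lborel) \<le> ennreal e" using \<epsilon>0(2) by blast
    have m: "(\<lambda>x. (osc \<epsilon> f x)\<^sup>2) \<in> borel_measurable lborel" using osc_measurable[OF f(1), of \<epsilon>] by simp
    show i: "integrable lborel (\<lambda>x. (osc \<epsilon> f x)\<^sup>2)"
      by (rule integrableI_nonneg[OF m]) (use b in \<open>auto intro: le_less_trans\<close>)
    have "ennreal (\<integral>x. (osc \<epsilon> f x)\<^sup>2 \<partial>lborel) \<le> ennreal e"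
      using b nn_integral_eq_integral[OF i] by simp
    then show "(\<integral>x. (osc \<epsilon> f x)\<^sup>2 \<partial>lborel) \<le> e" using e by (simp add: ennreal_le_iff)
  qed
qed

section \<open>Three balls for weak solutions\<close>

text \<open>Both terms of the hypothesis have the same size if \<open>exp (2 * \<tau> * (\<alpha> + \<beta>)) = Y / X\<close>. If this \<open>\<tau>\<close> is not admissible, then \<open>Y\<close> is at most a
  multiple of \<open>X\<close> and the trivial bound \<open>Z \<le> Y\<close> suffices; if \<open>X = 0\<close>, then \<open>\<tau>\<close> tends to infinity.\<close>

lemma exponential_interpolation:
  fixes X Y Z :: real
  assumes ab: "\<alpha> > 0" "\<beta> > 0" and C: "C > 0" and pos: "X \<ge> 0" "Y \<ge> 0" and ZY: "Z \<le> Y"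
    and est: "\<And>\<tau>. \<tau> \<ge> \<tau>1 \<Longrightarrow> Z \<le> C * (exp (2 * \<tau> * \<alpha>) * X + exp (- 2 * \<tau> * \<beta>) * Y)"
  defines "\<theta> \<equiv> \<beta> / (\<alpha> + \<beta>)"
  shows "Z \<le> max (2 * C) (exp (2 * \<tau>1 * \<beta>)) * (X powr \<theta> * Y powr (1 - \<theta>))"
proof -
  have \<theta>: "\<theta> > 0" "\<theta> < 1" "1 - \<theta> = \<alpha> / (\<alpha> + \<beta>)" using ab by (auto simp: \<theta>_def field_simps)
  have rhs0: "X powr \<theta> * Y powr (1 - \<theta>) \<ge> 0" by simp
  consider "Y = 0" | "X = 0" "Y > 0" | "X > 0" "Y > 0" using pos by linarith
  then show ?thesis
  proof cases
    case 1
    then show ?thesis using ZY by simp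
  next
    case 2
    have "Z \<le> 0 + e" if e: "e > 0" for e
    proof -
      define \<tau> where "\<tau> = max \<tau>1 (ln (C * Y / e) / (2 * \<beta>))"
      have z: "Z \<le> C * (exp (- 2 * \<tau> * \<beta>) * Y)" using est[of \<tau>] 2 by (simp add: \<tau>_def)
      have "ln (C * Y / e) / (2 * \<beta>) \<le> \<tau>" by (simp add: \<tau>_def)
      then have "ln (C * Y / e) \<le> 2 * \<tau> * \<beta>" using ab by (simp add: field_simps)
      then have "exp (- 2 * \<tau> * \<beta>) \<le> exp (- ln (C * Y / e))" by simp
      also have "\<dots> = e / (C * Y)" using C 2 e by (simp add: exp_minus)
      finally have "C * Y * exp (- 2 * \<tau> * \<beta>) \<le> C * Y * (e / (C * Y))" using C 2 by (intro mult_left_mono) auto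
      then have "C * (exp (- 2 * \<tau> * \<beta>) * Y) \<le> e" using C 2 by (simp add: mult_ac)
      then show ?thesis using z by simp
    qed
    then have "Z \<le> 0" by (rule field_le_epsilon)
    then show ?thesis using 2 by simp
  next
    case 3
    define \<tau> where "\<tau> = ln (Y / X) / (2 * (\<alpha> + \<beta>))"
    have YX: "Y / X > 0" using 3 by simp
    have prod: "X powr \<theta> * Y powr (1 - \<theta>) = X * (Y / X) powr (1 - \<theta>)"
    proof -
      have "X * (Y / X) powr (1 - \<theta>) = X powr 1 * (Y powr (1 - \<theta>) / X powr (1 - \<theta>))"
        using 3 by (simp add: powr_divide)
      also have "\<dots> = (X powr 1 / X powr (1 - \<theta>)) * Y powr (1 - \<theta>)" by simp
      also have "X powr 1 / X powr (1 - \<theta>) = X powr \<theta>" by (subst powr_diff[symmetric]) simp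
      finally show ?thesis by simp
    qed
    have prod': "X powr \<theta> * Y powr (1 - \<theta>) = Y * (Y / X) powr (- \<theta>)"
    proof -
      have "(Y / X) powr (1 - \<theta>) = (Y / X) powr 1 * (Y / X) powr (- \<theta>)" by (subst powr_add[symmetric]) simp
      then show ?thesis unfolding prod using 3 by simp
    qed
    show ?thesis
    proof (cases "\<tau> \<ge> \<tau>1")
      case True
      have e1: "exp (2 * \<tau> * \<alpha>) = (Y / X) powr (1 - \<theta>)"
        unfolding powr_def \<theta>(3) \<tau>_def using 3 ab by (simp add: field_simps)
      have e2: "exp (- 2 * \<tau> * \<beta>) = (Y / X) powr (- \<theta>)"
        unfolding powr_def \<theta>_def \<tau>_def using 3 ab by (simp add: field_simps)
      have "Z \<le> C * (exp (2 * \<tau> * \<alpha>) * X + exp (- 2 * \<tau> * \<beta>) * Y)" by (rule est[OF True])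
      also have "\<dots> = 2 * C * (X powr \<theta> * Y powr (1 - \<theta>))"
        unfolding e1 e2 using prod prod' by (simp add: algebra_simps)
      also have "\<dots> \<le> max (2 * C) (exp (2 * \<tau>1 * \<beta>)) * (X powr \<theta> * Y powr (1 - \<theta>))"
        using rhs0 by (intro mult_right_mono) auto
      finally show ?thesis .
    next
      case False
      have "Z \<le> Y * (Y / X) powr (- \<theta>) * (Y / X) powr \<theta>"
      proof -
        have "(Y / X) powr (- \<theta>) * (Y / X) powr \<theta> = 1" using 3 by (simp add: powr_add[symmetric])
        then show ?thesis using ZY by (simp add: mult.assoc)
      qed
      also have "\<dots> = (Y / X) powr \<theta> * (X powr \<theta> * Y powr (1 - \<theta>))" unfolding prod' by simp
      also have "\<dots> \<le> exp (2 * \<tau>1 * \<beta>) * (X powr \<theta> * Y powr (1 - \<theta>))"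
      proof (intro mult_right_mono rhs0)
        have "ln (Y / X) / (2 * (\<alpha> + \<beta>)) < \<tau>1" using False by (simp add: \<tau>_def)
        then have "ln (Y / X) < \<tau>1 * (2 * (\<alpha> + \<beta>))" using ab by (simp add: divide_less_eq)
        then have "\<theta> * ln (Y / X) \<le> \<theta> * (\<tau>1 * (2 * (\<alpha> + \<beta>)))" using \<theta> by (intro mult_left_mono) auto
        also have "\<dots> = \<theta> * (\<alpha> + \<beta>) * (2 * \<tau>1)" by (simp only: mult_ac)
        also have "\<dots> = 2 * \<tau>1 * \<beta>" using ab by (simp add: \<theta>_def)
        finally show "(Y / X) powr \<theta> \<le> exp (2 * \<tau>1 * \<beta>)" using YX 3 by (simp add: powr_def)
      qed
      also have "\<dots> \<le> max (2 * C) (exp (2 * \<tau>1 * \<beta>)) * (X powr \<theta> * Y powr (1 - \<theta>))"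
        using rhs0 by (intro mult_right_mono) auto
      finally show ?thesis .
    qed
  qed
qed

lemma cball_integral_perturb:
  fixes f h w :: "real^'n \<Rightarrow> real"
  assumes "integrable lborel (\<lambda>x. indicat_real (cball 0 s) x * (f x)\<^sup>2)" "integrable lborel (\<lambda>x. indicat_real (cball 0 s) x * (h x)\<^sup>2)"
    and "integrable lborel (\<lambda>x. (w x)\<^sup>2)" and "\<And>x. x \<in> cball 0 s \<Longrightarrow> \<bar>f x - h x\<bar> \<le> c * w x"
  shows "cball_integral s (\<lambda>x. (f x)\<^sup>2) \<le> 2 * cball_integral s (\<lambda>x. (h x)\<^sup>2) + 2 * c\<^sup>2 * (\<integral>x. (w x)\<^sup>2 \<partial>lborel)"
proof -
  have "cball_integral s (\<lambda>x. (f x)\<^sup>2) \<le> (\<integral>x. 2 * (indicat_real (cball 0 s) x * (h x)\<^sup>2) + 2 * c\<^sup>2 * (w x)\<^sup>2 \<partial>lborel)"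
    unfolding cball_integral_def
  proof (rule integral_mono[OF assms(1)])
    show "integrable lborel (\<lambda>x. 2 * (indicat_real (cball 0 s) x * (h x)\<^sup>2) + 2 * c\<^sup>2 * (w x)\<^sup>2)" using assms(2,3) by auto
    fix x :: "real^'n"
    show "indicat_real (cball 0 s) x * (f x)\<^sup>2 \<le> 2 * (indicat_real (cball 0 s) x * (h x)\<^sup>2) + 2 * c\<^sup>2 * (w x)\<^sup>2"
    proof (cases "x \<in> cball 0 s")
      case True
      have "\<bar>f x - h x\<bar>\<^sup>2 \<le> (c * w x)\<^sup>2" by (intro power_mono assms(4) True) auto
      then have "(f x - h x)\<^sup>2 \<le> c\<^sup>2 * (w x)\<^sup>2" by (simp add: power_mult_distrib)
      moreover have "(f x)\<^sup>2 \<le> 2 * (h x)\<^sup>2 + 2 * (f x - h x)\<^sup>2"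
        using zero_le_power2[of "f x - 2 * h x"] by (simp add: power2_eq_square algebra_simps)
      ultimately show ?thesis using True by simp
    qed simp
  qed
  also have "\<dots> = 2 * cball_integral s (\<lambda>x. (h x)\<^sup>2) + 2 * c\<^sup>2 * (\<integral>x. (w x)\<^sup>2 \<partial>lborel)"
    unfolding cball_integral_def using assms(2,3) by simp
  finally show ?thesis .
qed

lemma cball_integral_integrable:
  fixes U :: "real^'n \<Rightarrow> real"
  assumes "integrable lborel (\<lambda>x. (U x)\<^sup>2)"
  shows "integrable lborel (\<lambda>x. indicat_real (cball 0 s) x * (U x)\<^sup>2)"
  using integrable_real_mult_indicator[OF _ assms, of "cball 0 s"] by (simp add: mult.commute)

lemma weak_div_conv:
  fixes X :: "real^'n \<Rightarrow> real^'n" and f F :: "real^'n \<Rightarrow> real"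
  assumes w: "weak_div S X f" and S: "open S" "K \<subseteq> S" "K \<in> sets borel"
    and Y: "\<And>i. Y i \<in> borel_measurable borel" "AE x in lborel. x \<in> K \<longrightarrow> (\<forall>i. Y i x = X x $ i)"
      "\<And>i. integrable lborel (\<lambda>y. Y i y * k1 i (x - y))"
    and F: "F \<in> borel_measurable borel" "AE x in lborel. x \<in> K \<longrightarrow> F x = f x"
    and \<epsilon>: "\<epsilon> > 0" and k: "mollifier C \<epsilon> k k1 k2" and sub: "cball x \<epsilon> \<subseteq> K"
  shows "(\<Sum>i\<in>UNIV. conv (Y i) (k1 i) x) = conv F k x"
proof -
  note m = mollifierD[OF k \<epsilon>]
  have sm: "smooth (\<lambda>y. k (x - y))" "\<And>i y. pderiv_at i (\<lambda>y. k (x - y)) y = - k1 i (x - y)"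
    using k unfolding mollifier_def by blast+
  have mk: "k \<in> borel_measurable borel" "\<And>i. k1 i \<in> borel_measurable borel"
    by (rule borel_measurable_continuous_onI[OF C2D(1)[OF m(1)]], rule borel_measurable_continuous_onI[OF C2D(2)[OF m(1)]])
  have t: "(\<lambda>y. k (x - y)) \<in> test_functions S"
    by (rule kernel_test_function[OF sm(1)]) (use m(3) sub S in auto)
  have out: "k (x - y) = 0" "k1 i (x - y) = 0" if "y \<notin> K" for y i
  proof -
    have "y \<notin> cball x \<epsilon>" using that sub by blast
    then have "\<epsilon> < norm (x - y)" by (simp add: dist_norm)
    then show "k (x - y) = 0" "k1 i (x - y) = 0" using m(3,4) by auto
  qed
  have "integral\<^sup>L (lebesgue_on S) (\<lambda>y. X y \<bullet> grad (\<lambda>y. k (x - y)) y) = integral\<^sup>L lborel (\<lambda>y. \<Sum>i\<in>UNIV. - (Y i y * k1 i (x - y)))"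
  proof (rule integral_transfer)
    show "(\<lambda>y. \<Sum>i\<in>UNIV. - (Y i y * k1 i (x - y))) \<in> borel_measurable borel"
    proof (intro borel_measurable_sum)
      fix i show "(\<lambda>y. - (Y i y * k1 i (x - y))) \<in> borel_measurable borel" using Y(1)[of i] mk(2)[of i] by measurable
    qed
    have gr: "X y \<bullet> grad (\<lambda>y. k (x - y)) y = (\<Sum>i\<in>UNIV. - (X y $ i * k1 i (x - y)))" for y
      unfolding inner_vec_def grad_def by (simp add: sm(2))
    show "AE y in lborel. (if y \<in> S then X y \<bullet> grad (\<lambda>y. k (x - y)) y else 0) = (\<Sum>i\<in>UNIV. - (Y i y * k1 i (x - y)))"
      unfolding gr using Y(2)
    proof eventually_elim
      case (elim y)
      show ?case
      proof (cases "y \<in> K")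
        case True
        then show ?thesis using elim S by auto
      next
        case False
        then show ?thesis using out(2)[OF False] by simp
      qed
    qed
  qed (use S in auto)
  also have "\<dots> = - (\<Sum>i\<in>UNIV. conv (Y i) (k1 i) x)"
    unfolding conv_def using Y(3) by (simp add: sum_negf)
  finally have 1: "integral\<^sup>L (lebesgue_on S) (\<lambda>y. X y \<bullet> grad (\<lambda>y. k (x - y)) y) = - (\<Sum>i\<in>UNIV. conv (Y i) (k1 i) x)" .
  have 2: "integral\<^sup>L (lebesgue_on S) (\<lambda>y. f y * k (x - y)) = integral\<^sup>L lborel (\<lambda>y. F y * k (x - y))"
  proof (rule integral_transfer)
    show "(\<lambda>y. F y * k (x - y)) \<in> borel_measurable borel" using F mk by measurable
    show "AE y in lborel. (if y \<in> S then f y * k (x - y) else 0) = F y * k (x - y)"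
      using F(2) by eventually_elim (use out S in auto)
  qed (use S in auto)
  have "integral\<^sup>L (lebesgue_on S) (\<lambda>y. X y \<bullet> grad (\<lambda>y. k (x - y)) y) = - integral\<^sup>L (lebesgue_on S) (\<lambda>y. f y * k (x - y))"
    using w t unfolding weak_div_def by blast
  then show ?thesis unfolding 1 2 conv_def by simp
qed

text \<open>The estimate of \<open>three_ball_classical\<close> for Borel representatives of weak solutions. For fixed \<open>\<tau>\<close> it is applied to
  the mollified solution. Passing between \<open>U\<close> and its mollification costs factors \<open>2\<close>, which turn the constant
  \<open>C0\<close> into \<open>4 * C0\<close>, and errors that tend to \<open>0\<close> with the mollification parameter.\<close>

theorem weak_three_ball:
  fixes lam Lam r0 \<rho> :: real
  assumes lam: "lam \<ge> 1" and Lam: "Lam > 0" and r: "0 < r0" "r0 < \<rho>" "\<rho> < 1"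
  obtains \<alpha> \<beta> where "\<alpha> > 0" "\<beta> > 0"
    "\<And>M1. M1 > 0 \<Longrightarrow> \<exists>C>0. \<exists>\<tau>1. \<forall>(g :: real^'n \<Rightarrow> real^'n^'n) b a u.
       g \<in> metric_class lam Lam \<longrightarrow> Linf_bounded (ball 0 1) b M1 \<longrightarrow> Linf_bounded (ball 0 1) a M1 \<longrightarrow>
       u \<in> H2_loc (ball 0 1) \<longrightarrow> solves (ball 0 1) g b a u \<longrightarrow>
       (\<exists>U. U \<in> borel_measurable borel \<and> integrable lborel (\<lambda>x. (U x)\<^sup>2) \<and>
          (AE x in lborel. x \<in> cball 0 ((3 + \<rho>) / 4) \<longrightarrow> U x = u x) \<and>
          (\<forall>\<tau>\<ge>\<tau>1. cball_integral \<rho> (\<lambda>x. (U x)\<^sup>2)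
             \<le> C * (exp (2 * \<tau> * \<alpha>) * cball_integral (r0 / 2) (\<lambda>x. (U x)\<^sup>2) + exp (- 2 * \<tau> * \<beta>) * cball_integral ((1 + \<rho>) / 2) (\<lambda>x. (U x)\<^sup>2))))"
proof -
  define R where "R = (1 + \<rho>) / 2"
  define R' where "R' = (3 + \<rho>) / 4"
  define L where "L = lam\<^sup>2 * Lam"
  define N where "N = real CARD('n)"
  have L: "L \<ge> 0" using lam Lam by (simp add: L_def)
  have o: "0 < r0 / 2" "r0 / 2 < \<rho>" "\<rho> < R" "R < R'" "R < 1" "R' < 1" using r by (auto simp: R_def R'_def)
  obtain \<alpha> \<beta> where ab: "\<alpha> > 0" "\<beta> > 0"
    and cl: "\<And>K. K \<ge> 1 \<Longrightarrow> \<exists>C>0. \<exists>\<tau>1\<ge>1. \<forall>A (u :: real^'n \<Rightarrow> real) u1 u2 \<tau>. elliptic_lipschitz lam L A \<longrightarrow> C2 u u1 u2 \<longrightarrow> \<tau> \<ge> \<tau>1 \<longrightarrow>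
       cball_integral \<rho> (\<lambda>x. (u x)\<^sup>2) \<le> C * (exp (2 * \<tau> * \<alpha>) * cball_integral (r0 / 2) (\<lambda>x. (u x)\<^sup>2) + exp (- 2 * \<tau> * \<beta>) * cball_integral R (\<lambda>x. (u x)\<^sup>2)
          + exp (2 * \<tau>) * cball_integral R (excess K A u u1 u2))"
  proof (rule three_ball_classical[where 'n = 'n, OF lam L o(1,2,3,5)], goal_cases)
    case (1 \<alpha> \<beta>)
    from 1(2-4) show ?case by (rule 1(1))
  qed
  obtain Cm where Cm: "Cm > 0" "\<And>\<epsilon>. \<epsilon> > 0 \<Longrightarrow> \<exists>k k1 k2. mollifier Cm \<epsilon> (k :: real^'n \<Rightarrow> real) k1 k2"
    using mollifier_exists[where 'n = 'n] by blast
  show ?thesis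
  proof (rule that[OF ab])
    fix M1 :: real assume M1: "M1 > 0"
    define B where "B = Cm * (L * N + M1)"
    define Kc where "Kc = max 1 (4 * N * B\<^sup>2)"
    define K' where "K' = 4 * N * B\<^sup>2 * (1 + Cm)\<^sup>2"
    have K'0: "K' \<ge> 0" by (simp add: K'_def N_def)
    have "Kc \<ge> 1" by (simp add: Kc_def)
    then obtain C0 \<tau>1 where C0: "C0 > 0" and \<tau>1: "\<tau>1 \<ge> 1"
      and est: "\<And>A (u :: real^'n \<Rightarrow> real) u1 u2 \<tau>. elliptic_lipschitz lam L A \<Longrightarrow> C2 u u1 u2 \<Longrightarrow> \<tau> \<ge> \<tau>1 \<Longrightarrow>
       cball_integral \<rho> (\<lambda>x. (u x)\<^sup>2) \<le> C0 * (exp (2 * \<tau> * \<alpha>) * cball_integral (r0 / 2) (\<lambda>x. (u x)\<^sup>2) + exp (- 2 * \<tau> * \<beta>) * cball_integral R (\<lambda>x. (u x)\<^sup>2)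
          + exp (2 * \<tau>) * cball_integral R (excess Kc A u u1 u2))"
      using cl by blast
    have main: "\<exists>U. U \<in> borel_measurable borel \<and> integrable lborel (\<lambda>x. (U x)\<^sup>2) \<and>
          (AE x in lborel. x \<in> cball 0 R' \<longrightarrow> U x = u x) \<and>
          (\<forall>\<tau>\<ge>\<tau>1. cball_integral \<rho> (\<lambda>x. (U x)\<^sup>2)
             \<le> (4 * C0) * (exp (2 * \<tau> * \<alpha>) * cball_integral (r0 / 2) (\<lambda>x. (U x)\<^sup>2) + exp (- 2 * \<tau> * \<beta>) * cball_integral R (\<lambda>x. (U x)\<^sup>2)))"
      if g: "g \<in> metric_class lam Lam" and b: "Linf_bounded (ball 0 1) b M1" and a: "Linf_bounded (ball 0 1) a M1"
        and u: "u \<in> H2_loc (ball 0 1)" and sol: "solves (ball 0 1) g b a u"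
      for g :: "real^'n \<Rightarrow> real^'n^'n" and b a u
    proof -
      define A where "A = (\<lambda>i j x. matrix_inv (g x) $ i $ j)"
      define K where "K = cball (0::real^'n) R'"
      have K: "K \<subseteq> ball 0 1" "K \<in> sets borel" "compact K" using o by (auto simp: K_def)
      have A: "elliptic_lipschitz lam L A" unfolding A_def L_def by (rule metric_class_inverse(1)[OF g lam])
      obtain D D2 where D: "\<And>i. D i \<in> L2_loc (ball 0 1)" "\<And>i. weak_pderiv (ball 0 1) i u (D i)" and uL: "u \<in> L2_loc (ball 0 1)"
        using u unfolding H2_loc_def by blast
      obtain G where G: "weak_grad (ball 0 1) u G"
        and wd: "weak_div (ball 0 1) (metric_grad g G) (\<lambda>x. metric_inner g x (b x) (metric_grad g G x) + a x * u x)"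
        using sol unfolding solves_def by blast
      define f where "f = (\<lambda>x. metric_inner g x (b x) (metric_grad g G x) + a x * u x)"
      have GD: "AE x in lborel. x \<in> K \<longrightarrow> G x $ i = D i x" for i
        unfolding K_def by (rule weak_pderiv_unique[OF _ D(2) o(6)]) (use G in \<open>simp add: weak_grad_def\<close>)
      have GD': "AE x in lborel. \<forall>i\<in>UNIV. x \<in> K \<longrightarrow> G x $ i = D i x"
        using GD by (intro AE_finite_allI) auto
      note rep = borel_representative[OF K(2)]
      have mu: "u \<in> borel_measurable (lebesgue_on K)" "integrable (lebesgue_on K) (\<lambda>x. (u x)\<^sup>2)"
        using uL K unfolding L2_loc_def by auto
      have mD: "D i \<in> borel_measurable (lebesgue_on K)" "integrable (lebesgue_on K) (\<lambda>x. (D i x)\<^sup>2)" for i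
        using D(1)[of i] K unfolding L2_loc_def by auto
      have mf: "f \<in> borel_measurable (lebesgue_on K)"
        using wd K unfolding weak_div_def L1_loc_def f_def by (auto intro: borel_measurable_integrable)
      obtain U where U: "U \<in> borel_measurable borel" "AE x in lborel. x \<in> K \<longrightarrow> U x = u x" "\<And>x. x \<notin> K \<Longrightarrow> U x = 0"
        using rep[OF mu(1)] by blast
      have "\<forall>i. \<exists>E. E \<in> borel_measurable borel \<and> (AE x in lborel. x \<in> K \<longrightarrow> E x = D i x) \<and> (\<forall>x. x \<notin> K \<longrightarrow> E x = 0)"
        using rep[OF mD(1)] by (rule allI)
      from choice[OF this] obtain E where
        E0: "\<forall>i. E i \<in> borel_measurable borel \<and> (AE x in lborel. x \<in> K \<longrightarrow> E i x = D i x) \<and> (\<forall>x. x \<notin> K \<longrightarrow> E i x = 0)"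
        by (rule exE)
      have E: "E i \<in> borel_measurable borel" "AE x in lborel. x \<in> K \<longrightarrow> E i x = D i x" "x \<notin> K \<Longrightarrow> E i x = 0" for i x
        using spec[OF E0, of i] by auto
      obtain F where F: "F \<in> borel_measurable borel" "AE x in lborel. x \<in> K \<longrightarrow> F x = f x" "\<And>x. x \<notin> K \<Longrightarrow> F x = 0"
        using rep[OF mf] by blast
      have E': "AE x in lborel. \<forall>i\<in>UNIV. x \<in> K \<longrightarrow> E i x = D i x" using E(2) by (intro AE_finite_allI) auto
      have U2: "integrable lborel (\<lambda>x. (U x)\<^sup>2)"
      proof (rule integrable_transfer[OF K(2) _ _ mu(2)])
        show "AE x in lborel. (if x \<in> K then (u x)\<^sup>2 else 0) = (U x)\<^sup>2"
          using U(2) by eventually_elim (use U(3) in auto)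
      qed (use U in auto)
      have E2: "integrable lborel (\<lambda>x. (E i x)\<^sup>2)" for i
      proof (rule integrable_transfer[OF K(2) _ _ mD(2)])
        show "AE x in lborel. (if x \<in> K then (D i x)\<^sup>2 else 0) = (E i x)\<^sup>2"
          using E(2)[of i] by eventually_elim (use E(3) in auto)
      qed (use E in auto)
      have iU: "integrable lborel U"
      proof -
        have "integrable lborel (indicat_real (cball (0::real^'n) R'))"
          by (rule integrable_real_indicator) (auto simp: emeasure_lborel_cball_finite[unfolded infinity_ennreal_def])
        then have "integrable lborel (\<lambda>x. U x * indicat_real (cball 0 R') x)"
          by (rule integrable_of_square[OF U(1) U2, where B = 1]) simp
        moreover have "U x * indicat_real (cball 0 R') x = U x" for x using U(3)[of x] by (auto simp: K_def indicator_def)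
        ultimately show ?thesis by simp
      qed
      have ball_ae: "AE x in lborel. x \<in> ball 0 1 \<longrightarrow> Q x" if "AE x in lebesgue_on (ball (0::real^'n) 1). Q x" for Q
      proof -
        have "AE x in lebesgue. x \<in> ball 0 1 \<longrightarrow> Q x" using that by (subst (asm) AE_restrict_space_iff) auto
        then show ?thesis by (simp add: AE_completion_iff)
      qed
      have bb: "AE x in lborel. x \<in> ball 0 1 \<longrightarrow> norm (b x) \<le> M1" "AE x in lborel. x \<in> ball 0 1 \<longrightarrow> \<bar>a x\<bar> \<le> M1"
        using ball_ae b a unfolding Linf_bounded_def by auto
      have Fb: "AE y in lborel. \<bar>F y\<bar> \<le> M1 * (\<bar>U y\<bar> + (\<Sum>i\<in>UNIV. \<bar>E i y\<bar>))"
        using bb F(2) U(2) E' GD'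
      proof eventually_elim
        case (elim y)
        show ?case
        proof (cases "y \<in> K")
          case False
          then show ?thesis using F(3) M1 by (auto intro!: mult_nonneg_nonneg add_nonneg_nonneg sum_nonneg)
        next
          case True
          then have y1: "y \<in> ball 0 1" using K by auto
          have "F y = b y \<bullet> G y + a y * u y"
            using elim True metric_inner_grad[of g y "b y" G, OF metric_class_inverse(2)[OF g lam]] by (simp add: f_def)
          then have "\<bar>F y\<bar> \<le> \<bar>b y \<bullet> G y\<bar> + \<bar>a y * u y\<bar>" by linarith
          also have "\<dots> \<le> norm (b y) * norm (G y) + \<bar>a y\<bar> * \<bar>u y\<bar>"
            by (intro add_mono Cauchy_Schwarz_ineq2) (simp add: abs_mult)
          also have "\<dots> \<le> M1 * (\<Sum>i\<in>UNIV. \<bar>G y $ i\<bar>) + M1 * \<bar>u y\<bar>"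
            using elim y1 M1 by (intro add_mono mult_mono norm_le_l1_cart) auto
          also have "(\<Sum>i\<in>UNIV. \<bar>G y $ i\<bar>) = (\<Sum>i\<in>UNIV. \<bar>E i y\<bar>)" using elim True by simp
          also have "u y = U y" using elim True by simp
          finally show ?thesis by (simp add: algebra_simps)
        qed
      qed
      have est_U: "cball_integral \<rho> (\<lambda>x. (U x)\<^sup>2) \<le> (4 * C0) * (exp (2 * \<tau> * \<alpha>) * cball_integral (r0 / 2) (\<lambda>x. (U x)\<^sup>2) + exp (- 2 * \<tau> * \<beta>) * cball_integral R (\<lambda>x. (U x)\<^sup>2))"
        if \<tau>: "\<tau> \<ge> \<tau>1" for \<tau>
      proof (rule field_le_epsilon)
        fix d :: real assume d: "d > 0"
        define ea where "ea = exp (2 * \<tau> * \<alpha>)"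
        define eb where "eb = exp (- 2 * \<tau> * \<beta>)"
        define et where "et = exp (2 * \<tau>)"
        have pos: "ea > 0" "eb > 0" "et > 0" by (auto simp: ea_def eb_def et_def)
        \<comment> \<open>the total coefficient of the oscillation bound \<open>e\<close> in the computation below\<close>
        define Z where "Z = 2 * C0 * (2 * Cm\<^sup>2 * (ea + eb) + et * (K' * (N + 1))) + 2 * Cm\<^sup>2"
        have Z: "Z \<ge> 0" unfolding Z_def using C0 pos K'0 by (auto simp: N_def intro!: add_nonneg_nonneg mult_nonneg_nonneg)
        define e where "e = d / (Z + 1)"
        have e: "e > 0" "Z * e \<le> d" using d Z by (auto simp: e_def field_simps)
        obtain \<epsilon>U where \<epsilon>U: "\<epsilon>U > 0" "\<And>\<epsilon>. 0 < \<epsilon> \<Longrightarrow> \<epsilon> < \<epsilon>U \<Longrightarrow> integrable lborel (\<lambda>x. (osc \<epsilon> U x)\<^sup>2) \<and> (\<integral>x. (osc \<epsilon> U x)\<^sup>2 \<partial>lborel) \<le> e"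
          using osc_L2_small[OF U(1) U2 e(1)] by blast
        have "\<forall>i. \<exists>\<epsilon>0>0. \<forall>\<epsilon>. 0 < \<epsilon> \<and> \<epsilon> < \<epsilon>0 \<longrightarrow> integrable lborel (\<lambda>x. (osc \<epsilon> (E i) x)\<^sup>2) \<and> (\<integral>x. (osc \<epsilon> (E i) x)\<^sup>2 \<partial>lborel) \<le> e"
          using osc_L2_small[OF E(1) E2 e(1)] by blast
        then obtain \<epsilon>E where \<epsilon>E: "\<And>i. \<epsilon>E i > 0"
          "\<And>i \<epsilon>. 0 < \<epsilon> \<Longrightarrow> \<epsilon> < \<epsilon>E i \<Longrightarrow> integrable lborel (\<lambda>x. (osc \<epsilon> (E i) x)\<^sup>2) \<and> (\<integral>x. (osc \<epsilon> (E i) x)\<^sup>2 \<partial>lborel) \<le> e"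
          by metis
        define \<epsilon> where "\<epsilon> = min (min \<epsilon>U (Min (range \<epsilon>E))) (R' - R) / 2"
        have mE: "Min (range \<epsilon>E) > 0" using \<epsilon>E(1) by (simp add: Min_gr_iff)
        have mE': "Min (range \<epsilon>E) \<le> \<epsilon>E i" for i by (rule Min_le) auto
        have \<epsilon>: "0 < \<epsilon>" "\<epsilon> < \<epsilon>U" "\<epsilon> < \<epsilon>E i" "\<epsilon> \<le> R' - R" for i
        proof -
          define p where "p = min (min \<epsilon>U (Min (range \<epsilon>E))) (R' - R)"
          have "p > 0" using mE \<epsilon>U(1) o by (simp add: p_def)
          moreover have "p \<le> \<epsilon>U" "p \<le> Min (range \<epsilon>E)" "p \<le> R' - R" unfolding p_def by linarith+
          moreover have "\<epsilon> = p / 2" by (simp add: \<epsilon>_def p_def)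
          ultimately show "0 < \<epsilon>" "\<epsilon> < \<epsilon>U" "\<epsilon> < \<epsilon>E i" "\<epsilon> \<le> R' - R" using mE'[of i] by linarith+
        qed
        obtain k k1 k2 where k: "mollifier Cm \<epsilon> (k :: real^'n \<Rightarrow> real) k1 k2" using Cm(2)[OF \<epsilon>(1)] by blast
        note m = mollifierD[OF k \<epsilon>(1)]
        define v where "v = conv U k"
        define v1 where "v1 = (\<lambda>i. conv U (k1 i))"
        define v2 where "v2 = (\<lambda>i j. conv U (k2 i j))"
        have v: "C2 v v1 v2" unfolding v_def v1_def v2_def using m(3) by (intro conv_C2[OF iU m(1)])
        have k2z: "k2 i j z = 0" if "norm z > \<epsilon>" for i j z
          by (rule C2_zero_on_open(2)[OF m(1), of "- cball 0 \<epsilon>"]) (use m(3) that in auto)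
        have sm: "\<And>x. smooth (\<lambda>y. k (x - y))" "\<And>x i y. pderiv_at i (\<lambda>y. k (x - y)) y = - k1 i (x - y)"
          "\<And>x i. smooth (\<lambda>y. k1 i (x - y))" "\<And>x i j y. pderiv_at j (\<lambda>y. k1 i (x - y)) y = - k2 i j (x - y)"
          using k unfolding mollifier_def by blast+
        have kz: "\<And>z. norm z > \<epsilon> \<Longrightarrow> k z = 0" using m(3) by simp
        have appr: "\<bar>v x - U x\<bar> \<le> Cm * osc \<epsilon> U x"
          "excess Kc A v v1 v2 x \<le> K' * ((osc \<epsilon> U x)\<^sup>2 + (\<Sum>i\<in>UNIV. (osc \<epsilon> (E i) x)\<^sup>2))" if x: "x \<in> cball 0 R" for x
        proof -
          have sub: "cball x \<epsilon> \<subseteq> K" unfolding K_def by (rule cball_subset_enlarged[OF x \<epsilon>(4)])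
          have w1: "conv U (k1 i) x = conv (E i) k x" for i
            by (rule weak_pderiv_conv[OF D(2) open_ball K(1,2) U(1,2) E(1,2) sm(1) kz C2D(1)[OF m(1)] C2D(2)[OF m(1)] sm(2) m(4) sub])
          have w2: "conv U (k2 i j) x = conv (E i) (k1 j) x" for i j
          proof -
            have "conv U (k2 j i) x = conv (E i) (k1 j) x"
              by (rule weak_pderiv_conv[OF D(2) open_ball K(1,2) U(1,2) E(1,2) sm(3) m(4) C2D(2)[OF m(1)] C2D(3)[OF m(1)] sm(4) k2z sub])
            then show ?thesis using C2D(6)[OF m(1), of i j] by simp
          qed
          have mA: "A i j \<in> borel_measurable borel" for i j by (rule borel_measurable_continuous_onI[OF elliptic_lipschitzD(5)[OF A]])
          have mk1: "k1 i \<in> borel_measurable borel" for i by (rule borel_measurable_continuous_onI[OF C2D(2)[OF m(1)]])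
          define Y where "Y i y = (\<Sum>j\<in>UNIV. A i j y * E j y)" for i y
          have iAE: "integrable lborel (\<lambda>y. A i j y * E j y * k1 i (x - y))" for i j
          proof -
            have mh: "(\<lambda>y. A i j y * k1 i (x - y)) \<in> borel_measurable borel" using mA[of i j] mk1[of i] by measurable
            have hb: "\<bar>A i j y * k1 i (x - y)\<bar> \<le> (lam * (Cm / \<epsilon>)) * (uniform_kernel \<epsilon> x y)" for y
              unfolding abs_mult mult.assoc using elliptic_lipschitzD(2)[OF A, of i j y] m(7)[of i x y] lam
              by (intro mult_mono) auto
            show ?thesis using weighted_integral_bound(1)[OF E(1) E2 \<epsilon>(1) mh hb, of j] by (simp add: mult_ac)
          qed
          have cY: "conv (Y i) (k1 i) x = (\<Sum>j\<in>UNIV. conv (\<lambda>y. A i j y * E j y) (k1 i) x)" for i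
            unfolding conv_def Y_def sum_distrib_right using iAE by simp
          have w3: "(\<Sum>i\<in>UNIV. \<Sum>j\<in>UNIV. conv (\<lambda>y. A i j y * E j y) (k1 i) x) = conv F k x"
            unfolding cY[symmetric]
          proof (rule weak_div_conv[OF wd open_ball K(1,2) _ _ _ F(1) _ \<epsilon>(1) k sub])
            show "Y i \<in> borel_measurable borel" for i
              unfolding Y_def[abs_def] using mA E(1) by (intro borel_measurable_sum borel_measurable_times) auto
            show "AE x in lborel. x \<in> K \<longrightarrow> (\<forall>i. Y i x = metric_grad g G x $ i)"
              using E' GD'
              by eventually_elim (auto simp: Y_def metric_grad_def matrix_vector_mult_def A_def)
            show "integrable lborel (\<lambda>y. Y i y * k1 i (x - y))" for i
              unfolding Y_def sum_distrib_right using iAE by auto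
            show "AE x in lborel. x \<in> K \<longrightarrow> F x = metric_inner g x (b x) (metric_grad g G x) + a x * u x"
              using F(2) unfolding f_def .
          qed
          note ms = mollified_solution[OF A L less_imp_le[OF M1] U(1) U2 E(1) E2 F(1) Fb \<epsilon>(1) k w1 w2 w3]
          show "\<bar>v x - U x\<bar> \<le> Cm * osc \<epsilon> U x" unfolding v_def by (rule ms(1))
          show "excess Kc A v v1 v2 x \<le> K' * ((osc \<epsilon> U x)\<^sup>2 + (\<Sum>i\<in>UNIV. (osc \<epsilon> (E i) x)\<^sup>2))"
            unfolding v_def v1_def v2_def Kc_def K'_def B_def N_def by (rule ms(2))
        qed
        have oU: "integrable lborel (\<lambda>x. (osc \<epsilon> U x)\<^sup>2)" "(\<integral>x. (osc \<epsilon> U x)\<^sup>2 \<partial>lborel) \<le> e"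
          using \<epsilon>U(2)[OF \<epsilon>(1,2)] by auto
        have oE: "integrable lborel (\<lambda>x. (osc \<epsilon> (E i) x)\<^sup>2)" "(\<integral>x. (osc \<epsilon> (E i) x)\<^sup>2 \<partial>lborel) \<le> e" for i
          using \<epsilon>E(2)[OF \<epsilon>(1,3)] by auto
        have cv: "continuous_on UNIV (\<lambda>x. (v x)\<^sup>2)" by (intro continuous_intros C2D(1)[OF v])
        have cmp1: "cball_integral \<rho> (\<lambda>x. (U x)\<^sup>2) \<le> 2 * cball_integral \<rho> (\<lambda>x. (v x)\<^sup>2) + 2 * Cm\<^sup>2 * (\<integral>x. (osc \<epsilon> U x)\<^sup>2 \<partial>lborel)"
        proof (rule cball_integral_perturb[OF cball_integral_integrable[OF U2] integrable_cball[OF cv] oU(1)])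
          fix x :: "real^'n" assume "x \<in> cball 0 \<rho>"
          then have "x \<in> cball 0 R" using o by auto
          then show "\<bar>U x - v x\<bar> \<le> Cm * osc \<epsilon> U x" using appr(1)[of x] by (simp add: abs_minus_commute)
        qed
        have cmp2: "cball_integral s (\<lambda>x. (v x)\<^sup>2) \<le> 2 * cball_integral s (\<lambda>x. (U x)\<^sup>2) + 2 * Cm\<^sup>2 * (\<integral>x. (osc \<epsilon> U x)\<^sup>2 \<partial>lborel)" if "s \<le> R" for s
        proof (rule cball_integral_perturb[OF integrable_cball[OF cv] cball_integral_integrable[OF U2] oU(1)])
          fix x :: "real^'n" assume "x \<in> cball 0 s"
          then have "x \<in> cball 0 R" using that by auto
          then show "\<bar>v x - U x\<bar> \<le> Cm * osc \<epsilon> U x" by (rule appr(1))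
        qed
        have cmp3: "cball_integral R (excess Kc A v v1 v2) \<le> K' * (N + 1) * e"
        proof -
          have "cball_integral R (excess Kc A v v1 v2) \<le> (\<integral>x. K' * ((osc \<epsilon> U x)\<^sup>2 + (\<Sum>i\<in>UNIV. (osc \<epsilon> (E i) x)\<^sup>2)) \<partial>lborel)"
            unfolding cball_integral_def
          proof (rule integral_mono[OF integrable_cball[OF continuous_excess[OF A v]]])
            show "integrable lborel (\<lambda>x. K' * ((osc \<epsilon> U x)\<^sup>2 + (\<Sum>i\<in>UNIV. (osc \<epsilon> (E i) x)\<^sup>2)))" using oU(1) oE(1) by auto
            fix x :: "real^'n"
            show "indicat_real (cball 0 R) x * excess Kc A v v1 v2 x \<le> K' * ((osc \<epsilon> U x)\<^sup>2 + (\<Sum>i\<in>UNIV. (osc \<epsilon> (E i) x)\<^sup>2))"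
            proof (cases "x \<in> cball 0 R")
              case True
              then show ?thesis using appr(2)[OF True] by simp
            next
              case False
              then show ?thesis using K'0 by (auto intro!: mult_nonneg_nonneg add_nonneg_nonneg sum_nonneg)
            qed
          qed
          also have "\<dots> = K' * ((\<integral>x. (osc \<epsilon> U x)\<^sup>2 \<partial>lborel) + (\<Sum>i\<in>UNIV. (\<integral>x. (osc \<epsilon> (E i) x)\<^sup>2 \<partial>lborel)))"
            using oU(1) oE(1) by simp
          also have "\<dots> \<le> K' * (e + (\<Sum>i\<in>(UNIV::'n set). e))"
            using K'0 by (intro mult_left_mono add_mono sum_mono oU oE) auto
          finally show ?thesis by (simp add: N_def algebra_simps)
        qed
        define J where "J s = cball_integral s (\<lambda>x. (U x)\<^sup>2)" for s
        have cc: "2 * Cm\<^sup>2 * (\<integral>x. (osc \<epsilon> U x)\<^sup>2 \<partial>lborel) \<le> 2 * Cm\<^sup>2 * e" using oU(2) by (intro mult_left_mono) auto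
        have c1: "cball_integral (r0 / 2) (\<lambda>x. (v x)\<^sup>2) \<le> 2 * J (r0 / 2) + 2 * Cm\<^sup>2 * e" using cmp2[of "r0 / 2"] cc o unfolding J_def by linarith
        have c2: "cball_integral R (\<lambda>x. (v x)\<^sup>2) \<le> 2 * J R + 2 * Cm\<^sup>2 * e" using cmp2[of R] cc unfolding J_def by linarith
        have "cball_integral \<rho> (\<lambda>x. (v x)\<^sup>2) \<le> C0 * (ea * cball_integral (r0 / 2) (\<lambda>x. (v x)\<^sup>2) + eb * cball_integral R (\<lambda>x. (v x)\<^sup>2) + et * cball_integral R (excess Kc A v v1 v2))"
          unfolding ea_def eb_def et_def by (rule est[OF A v \<tau>])
        also have "\<dots> \<le> C0 * (ea * (2 * J (r0 / 2) + 2 * Cm\<^sup>2 * e) + eb * (2 * J R + 2 * Cm\<^sup>2 * e) + et * (K' * (N + 1) * e))"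
          using C0 pos by (intro mult_left_mono add_mono c1 c2 cmp3) auto
        finally have "J \<rho> \<le> 2 * (C0 * (ea * (2 * J (r0 / 2) + 2 * Cm\<^sup>2 * e) + eb * (2 * J R + 2 * Cm\<^sup>2 * e) + et * (K' * (N + 1) * e))) + 2 * Cm\<^sup>2 * e"
          using cmp1 cc unfolding J_def by linarith
        also have "\<dots> = (4 * C0) * (ea * J (r0 / 2) + eb * J R) + Z * e" by (simp add: Z_def algebra_simps)
        also have "\<dots> \<le> (4 * C0) * (ea * J (r0 / 2) + eb * J R) + d" using e(2) by simp
        finally show "cball_integral \<rho> (\<lambda>x. (U x)\<^sup>2) \<le> (4 * C0) * (exp (2 * \<tau> * \<alpha>) * cball_integral (r0 / 2) (\<lambda>x. (U x)\<^sup>2) + exp (- 2 * \<tau> * \<beta>) * cball_integral R (\<lambda>x. (U x)\<^sup>2)) + d"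
          unfolding J_def ea_def eb_def .
      qed
      show ?thesis using U(1,2) U2 est_U unfolding K_def by blast
    qed
    show "\<exists>C>0. \<exists>\<tau>1. \<forall>(g :: real^'n \<Rightarrow> real^'n^'n) b a u.
       g \<in> metric_class lam Lam \<longrightarrow> Linf_bounded (ball 0 1) b M1 \<longrightarrow> Linf_bounded (ball 0 1) a M1 \<longrightarrow>
       u \<in> H2_loc (ball 0 1) \<longrightarrow> solves (ball 0 1) g b a u \<longrightarrow>
       (\<exists>U. U \<in> borel_measurable borel \<and> integrable lborel (\<lambda>x. (U x)\<^sup>2) \<and>
          (AE x in lborel. x \<in> cball 0 ((3 + \<rho>) / 4) \<longrightarrow> U x = u x) \<and>
          (\<forall>\<tau>\<ge>\<tau>1. cball_integral \<rho> (\<lambda>x. (U x)\<^sup>2)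
             \<le> C * (exp (2 * \<tau> * \<alpha>) * cball_integral (r0 / 2) (\<lambda>x. (U x)\<^sup>2) + exp (- 2 * \<tau> * \<beta>) * cball_integral ((1 + \<rho>) / 2) (\<lambda>x. (U x)\<^sup>2))))"
      using main C0 unfolding R_def R'_def by (intro exI[of _ "4 * C0"] conjI exI[of _ \<tau>1] allI impI) auto
  qed
qed

section \<open>The three balls inequality in terms of norms\<close>

lemma nn_integral_representative:
  fixes u U :: "real^'n \<Rightarrow> real"
  assumes U: "U \<in> borel_measurable borel" "integrable lborel (\<lambda>x. (U x)\<^sup>2)"
    and ae: "AE x in lborel. x \<in> K \<longrightarrow> U x = u x" and S: "S \<in> sets borel" "S \<subseteq> K"
  shows "(\<integral>\<^sup>+x. ennreal ((u x)\<^sup>2) \<partial>lebesgue_on S) = ennreal (\<integral>x. indicat_real S x * (U x)\<^sup>2 \<partial>lborel)"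
proof -
  have S': "S \<inter> space lebesgue \<in> sets lebesgue" using S by simp
  have i: "integrable lborel (\<lambda>x. indicat_real S x * (U x)\<^sup>2)"
    using integrable_real_mult_indicator[OF _ U(2), of S] S(1) by (simp add: mult.commute)
  have "(\<integral>\<^sup>+x. ennreal ((u x)\<^sup>2) \<partial>lebesgue_on S) = (\<integral>\<^sup>+x. ennreal ((u x)\<^sup>2) * indicator S x \<partial>lebesgue)"
    by (rule nn_integral_restrict_space[OF S'])
  also have "\<dots> = (\<integral>\<^sup>+x. ennreal ((u x)\<^sup>2) * indicator S x \<partial>lborel)" by (rule nn_integral_completion)
  also have "\<dots> = (\<integral>\<^sup>+x. ennreal (indicat_real S x * (U x)\<^sup>2) \<partial>lborel)"
    by (rule nn_integral_cong_AE) (use ae in eventually_elim, use S(2) in \<open>auto simp: indicator_def\<close>)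
  also have "\<dots> = ennreal (\<integral>x. indicat_real S x * (U x)\<^sup>2 \<partial>lborel)"
    by (rule nn_integral_eq_integral[OF i]) auto
  finally show ?thesis .
qed

text \<open>The exponent is \<open>\<beta> / (\<alpha> + \<beta>)\<close> for the numbers given by \<open>weak_three_ball\<close>. The interpolation is done for the real integrals over
  balls of radius less than \<open>1\<close>; the norm over the unit ball enters only at the end, by monotonicity. If this norm is
  infinite, the right-hand side is infinite unless the norm over the small ball is \<open>0\<close>, and in this case the
  interpolation shows that the left-hand side is \<open>0\<close>.\<close>

theorem theorem5p1:
  fixes lam Lam m M r0 rho :: real
  assumes "CARD('n::finite) \<ge> 2"
    and "lam \<ge> 1" and "Lam > 0"
    and "0 < r0" and "r0 < rho" and "rho < 1"
  shows "\<exists>\<theta>. 0 < \<theta> \<and> \<theta> < 1 \<and> (\<forall>M1>0. \<exists>C>0.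
    \<forall>(\<mu>0::real) (g :: real^'n \<Rightarrow> real^'n^'n) (b :: real^'n \<Rightarrow> real^'n)
      (a :: real^'n \<Rightarrow> real) (u :: real^'n \<Rightarrow> real).
      g \<in> metric_class lam Lam \<and>
      \<mu>0 > 0 \<and>
      (\<exists>C1>0. \<exists>\<tau>0>0. carleman_estimate (annulus r0) g (weight \<mu>0) C1 \<tau>0) \<and>
      m = (INF x\<in>closure (annulus r0 :: (real^'n) set). norm (grad (weight \<mu>0) x)) \<and>
      M = C2_norm (closure (annulus r0 :: (real^'n) set)) (weight \<mu>0) \<and>
      Linf_bounded (ball 0 1) b M1 \<and>
      Linf_bounded (ball 0 1) a M1 \<and>
      u \<in> H2_loc (ball 0 1) \<and>
      solves (ball 0 1) g b a u
      \<longrightarrow> L2_norm (ball 0 rho) u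
            \<le> ennreal C * ennreal_powr (L2_norm (ball 0 r0) u) \<theta>
                        * ennreal_powr (L2_norm (ball 0 1) u) (1 - \<theta>))"
proof -
  define R where "R = (1 + rho) / 2"
  define R' where "R' = (3 + rho) / 4"
  have o: "0 < r0" "r0 < rho" "rho < R" "R < R'" "R' < 1" using assms by (auto simp: R_def R'_def)
  obtain \<alpha> \<beta> where ab: "\<alpha> > 0" "\<beta> > 0"
    and est: "\<And>M1. M1 > 0 \<Longrightarrow> \<exists>C>0. \<exists>\<tau>1. \<forall>(g :: real^'n \<Rightarrow> real^'n^'n) b a u.
       g \<in> metric_class lam Lam \<longrightarrow> Linf_bounded (ball 0 1) b M1 \<longrightarrow> Linf_bounded (ball 0 1) a M1 \<longrightarrow>
       u \<in> H2_loc (ball 0 1) \<longrightarrow> solves (ball 0 1) g b a u \<longrightarrow>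
       (\<exists>U. U \<in> borel_measurable borel \<and> integrable lborel (\<lambda>x. (U x)\<^sup>2) \<and>
          (AE x in lborel. x \<in> cball 0 R' \<longrightarrow> U x = u x) \<and>
          (\<forall>\<tau>\<ge>\<tau>1. cball_integral rho (\<lambda>x. (U x)\<^sup>2)
             \<le> C * (exp (2 * \<tau> * \<alpha>) * cball_integral (r0 / 2) (\<lambda>x. (U x)\<^sup>2) + exp (- 2 * \<tau> * \<beta>) * cball_integral R (\<lambda>x. (U x)\<^sup>2))))"
    unfolding R_def R'_def
  proof (rule weak_three_ball[where 'n = 'n, OF assms(2-6)], goal_cases)
    case (1 \<alpha> \<beta>)
    from 1(2-4) show ?case by (rule 1(1))
  qed
  define \<theta> where "\<theta> = \<beta> / (\<alpha> + \<beta>)"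
  have \<theta>: "0 < \<theta>" "\<theta> < 1" using ab by (auto simp: \<theta>_def field_simps)
  show ?thesis
  proof (rule exI[of _ \<theta>], intro conjI \<theta> allI impI)
    fix M1 :: real assume "M1 > 0"
    then obtain C \<tau>1 where C: "C > 0"
      and est: "\<And>(g :: real^'n \<Rightarrow> real^'n^'n) b a u.
       g \<in> metric_class lam Lam \<Longrightarrow> Linf_bounded (ball 0 1) b M1 \<Longrightarrow> Linf_bounded (ball 0 1) a M1 \<Longrightarrow>
       u \<in> H2_loc (ball 0 1) \<Longrightarrow> solves (ball 0 1) g b a u \<Longrightarrow>
       (\<exists>U. U \<in> borel_measurable borel \<and> integrable lborel (\<lambda>x. (U x)\<^sup>2) \<and>
          (AE x in lborel. x \<in> cball 0 R' \<longrightarrow> U x = u x) \<and>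
          (\<forall>\<tau>\<ge>\<tau>1. cball_integral rho (\<lambda>x. (U x)\<^sup>2)
             \<le> C * (exp (2 * \<tau> * \<alpha>) * cball_integral (r0 / 2) (\<lambda>x. (U x)\<^sup>2) + exp (- 2 * \<tau> * \<beta>) * cball_integral R (\<lambda>x. (U x)\<^sup>2))))"
      using est by blast
    define Ci where "Ci = max (2 * C) (exp (2 * \<tau>1 * \<beta>))"
    have Ci: "Ci > 0" using C by (simp add: Ci_def)
    have bound: "L2_norm (ball 0 rho) u
            \<le> ennreal (Ci powr (1/2)) * ennreal_powr (L2_norm (ball 0 r0) u) \<theta>
                        * ennreal_powr (L2_norm (ball 0 1) u) (1 - \<theta>)"
      if g: "g \<in> metric_class lam Lam" and b: "Linf_bounded (ball 0 1) b M1" and a: "Linf_bounded (ball 0 1) a M1"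
        and u: "u \<in> H2_loc (ball 0 1)" and sol: "solves (ball 0 1) g b a u"
      for g :: "real^'n \<Rightarrow> real^'n^'n" and b a u
    proof -
      obtain U where U: "U \<in> borel_measurable borel" "integrable lborel (\<lambda>x. (U x)\<^sup>2)"
          "AE x in lborel. x \<in> cball 0 R' \<longrightarrow> U x = u x"
        and e: "\<And>\<tau>. \<tau> \<ge> \<tau>1 \<Longrightarrow> cball_integral rho (\<lambda>x. (U x)\<^sup>2)
             \<le> C * (exp (2 * \<tau> * \<alpha>) * cball_integral (r0 / 2) (\<lambda>x. (U x)\<^sup>2) + exp (- 2 * \<tau> * \<beta>) * cball_integral R (\<lambda>x. (U x)\<^sup>2))"
        using est[OF g b a u sol] by blast
      define I where "I S = (\<integral>x. indicat_real S x * (U x)\<^sup>2 \<partial>lborel)" for S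
      have iI: "integrable lborel (\<lambda>x. indicat_real S x * (U x)\<^sup>2)" if "S \<in> sets borel" for S
        using integrable_real_mult_indicator[OF _ U(2), of S] that by (simp add: mult.commute)
      have I_mono: "I S \<le> I T" if "S \<subseteq> T" "S \<in> sets borel" "T \<in> sets borel" for S T
        unfolding I_def using that by (intro integral_mono iI mult_right_mono) (auto simp: indicator_def)
      have I0: "I S \<ge> 0" for S unfolding I_def by (intro Bochner_Integration.integral_nonneg) auto
      have cI: "cball_integral s (\<lambda>x. (U x)\<^sup>2) = I (cball 0 s)" for s by (simp add: cball_integral_def I_def)
      have nI: "(\<integral>\<^sup>+x. ennreal ((u x)\<^sup>2) \<partial>lebesgue_on S) = ennreal (I S)" if "S \<subseteq> cball 0 R'" "S \<in> sets borel" for S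
        unfolding I_def by (rule nn_integral_representative[OF U that(2,1)])
      define X where "X = I (ball 0 r0)"
      define Y where "Y = I (cball 0 R)"
      define Z where "Z = I (ball 0 rho)"
      have XX: "cball_integral (r0 / 2) (\<lambda>x. (U x)\<^sup>2) \<le> X" unfolding cI X_def using o by (intro I_mono) auto
      have ZZ: "Z \<le> cball_integral rho (\<lambda>x. (U x)\<^sup>2)" unfolding cI Z_def by (intro I_mono) auto
      have ZY: "Z \<le> Y" unfolding Z_def Y_def using o by (intro I_mono) auto
      have pos: "X \<ge> 0" "Y \<ge> 0" "Z \<ge> 0" unfolding X_def Y_def Z_def by (rule I0)+
      have "Z \<le> Ci * (X powr \<theta> * Y powr (1 - \<theta>))"
        unfolding Ci_def \<theta>_def
      proof (rule exponential_interpolation[OF ab C pos(1,2) ZY])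
        fix \<tau> assume "\<tau> \<ge> \<tau>1"
        have "C * (exp (2 * \<tau> * \<alpha>) * cball_integral (r0 / 2) (\<lambda>x. (U x)\<^sup>2) + exp (- 2 * \<tau> * \<beta>) * Y)
           \<le> C * (exp (2 * \<tau> * \<alpha>) * X + exp (- 2 * \<tau> * \<beta>) * Y)"
          using C XX by (intro mult_left_mono add_right_mono) auto
        then show "Z \<le> C * (exp (2 * \<tau> * \<alpha>) * X + exp (- 2 * \<tau> * \<beta>) * Y)"
          using e[OF \<open>\<tau> \<ge> \<tau>1\<close>] ZZ unfolding Y_def cI by linarith
      qed
      then have "Z powr (1/2) \<le> (Ci * (X powr \<theta> * Y powr (1 - \<theta>))) powr (1/2)" using pos by (intro powr_mono2) auto
      also have "\<dots> = Ci powr (1/2) * ((X powr (1/2)) powr \<theta> * (Y powr (1/2)) powr (1 - \<theta>))"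
        using Ci pos by (simp add: powr_mult powr_powr mult.commute)
      finally have real_est: "Z powr (1/2) \<le> Ci powr (1/2) * ((X powr (1/2)) powr \<theta> * (Y powr (1/2)) powr (1 - \<theta>))" .
      have nZ: "L2_norm (ball 0 rho) u = ennreal (Z powr (1/2))"
        unfolding L2_norm_def Z_def using o by (subst nI) (auto simp: ennreal_powr_def I0)
      have nX: "ennreal_powr (L2_norm (ball 0 r0) u) \<theta> = ennreal ((X powr (1/2)) powr \<theta>)"
        unfolding L2_norm_def X_def using o by (subst nI) (auto simp: ennreal_powr_def I0)
      define n1 where "n1 = (\<integral>\<^sup>+x. ennreal ((u x)\<^sup>2) \<partial>lebesgue_on (ball 0 1))"
      have Yn: "ennreal Y \<le> n1"
      proof -
        have "ennreal Y = (\<integral>\<^sup>+x. ennreal ((u x)\<^sup>2) \<partial>lebesgue_on (cball 0 R))"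
          unfolding Y_def using o by (subst nI) auto
        also have "\<dots> \<le> n1" unfolding n1_def
          using o by (subst (1 2) nn_integral_restrict_space) (auto intro!: nn_integral_mono simp: indicator_def)
        finally show ?thesis .
      qed
      show ?thesis
      proof (cases "n1 = top")
        case True
        then have t: "ennreal_powr (L2_norm (ball 0 1) u) (1 - \<theta>) = top"
          unfolding L2_norm_def n1_def[symmetric] by (simp add: ennreal_powr_def)
        show ?thesis
        proof (cases "X = 0")
          case True
          then have "Z powr (1/2) \<le> 0" using real_est by simp
          then show ?thesis unfolding nZ by (simp add: ennreal_neg)
        next
          case False
          then have "ennreal (Ci powr (1/2)) * ennreal ((X powr (1/2)) powr \<theta>) * top = top"
            using Ci pos by (simp add: ennreal_mult_top ennreal_mult[symmetric])
          then show ?thesis unfolding nX t by simp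
        qed
      next
        case False
        then obtain y where y: "n1 = ennreal y" "y \<ge> 0" by (cases n1) auto
        have Yy: "Y \<le> y" using Yn y by (simp add: ennreal_le_iff)
        have t: "ennreal_powr (L2_norm (ball 0 1) u) (1 - \<theta>) = ennreal ((y powr (1/2)) powr (1 - \<theta>))"
          unfolding L2_norm_def n1_def[symmetric] y(1) using y(2) by (simp add: ennreal_powr_def)
        have "(Y powr (1/2)) powr (1 - \<theta>) \<le> (y powr (1/2)) powr (1 - \<theta>)"
          using Yy pos \<theta> by (intro powr_mono2) auto
        then have "Ci powr (1/2) * ((X powr (1/2)) powr \<theta> * (Y powr (1/2)) powr (1 - \<theta>))
           \<le> Ci powr (1/2) * ((X powr (1/2)) powr \<theta> * (y powr (1/2)) powr (1 - \<theta>))"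
          by (intro mult_left_mono) auto
        then have "ennreal (Z powr (1/2)) \<le> ennreal (Ci powr (1/2) * ((X powr (1/2)) powr \<theta> * (y powr (1/2)) powr (1 - \<theta>)))"
          using real_est by (intro ennreal_leI) linarith
        then show ?thesis unfolding nZ nX t by (simp add: ennreal_mult mult.assoc)
      qed
    qed
    show "\<exists>C>0.
    \<forall>(\<mu>0::real) (g :: real^'n \<Rightarrow> real^'n^'n) (b :: real^'n \<Rightarrow> real^'n)
      (a :: real^'n \<Rightarrow> real) (u :: real^'n \<Rightarrow> real).
      g \<in> metric_class lam Lam \<and>
      \<mu>0 > 0 \<and>
      (\<exists>C1>0. \<exists>\<tau>0>0. carleman_estimate (annulus r0) g (weight \<mu>0) C1 \<tau>0) \<and>
      m = (INF x\<in>closure (annulus r0 :: (real^'n) set). norm (grad (weight \<mu>0) x)) \<and>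
      M = C2_norm (closure (annulus r0 :: (real^'n) set)) (weight \<mu>0) \<and>
      Linf_bounded (ball 0 1) b M1 \<and>
      Linf_bounded (ball 0 1) a M1 \<and>
      u \<in> H2_loc (ball 0 1) \<and>
      solves (ball 0 1) g b a u
      \<longrightarrow> L2_norm (ball 0 rho) u
            \<le> ennreal C * ennreal_powr (L2_norm (ball 0 r0) u) \<theta>
                        * ennreal_powr (L2_norm (ball 0 1) u) (1 - \<theta>)"
      by (rule exI[of _ "Ci powr (1/2)"]) (use Ci bound in auto)
  qed
qed

end
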